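(* Let $\mathcal{O}=\mathcal{F}(V)/(R)$ be a binary quadratic operad over a field $\mathbb{K}$ with $V$ finite dimensional. Let ${}^2\mathcal{O}$ be the operad encoding two totally compatible $\mathcal{O}$-algebras, let ${}^2\mathcal{C}om$ be the operad encoding two totally compatible commutative associative algebras, and let $\circ$ denote the white product of binary quadratic operads. Then $${}^2\mathcal{O}=\mathcal{O}\circ{}^2\mathcal{C}om .$$
   Context: Operads are $\mathbb{K}$-linear symmetric operads. $\mathcal{F}(V)$ is the free operad on an $\mathbb{S}$-module $V$ (spanned by rooted trees with labelled leaves and internal vertices decorated by $V$) and $\mathcal{F}_{(2)}(V)$ is the part spanned by trees with two internal vertices. A quadratic operad $\mathcal{F}(V)/(R)$ is the quotient by the operadic ideal generated by $R\subset\mathcal{F}_{(2)}(V)$ ($R$ is identified with the $\mathbb{S}$-submodule it spans); it is binary if $V(n)=0$ for $n\ne2$, and then we write $V$ for $V(2)$ and $\mathcal{F}_{(2)}(V)=\mathcal{F}(V)(3)$. If $e_1,\dots,e_s$ is a basis of $V$, then $\mathcal{F}(V)(3)$ has basis $T^1_{i,j}=e_j(e_i(1,2),3)$, $T^2_{i,j}=e_j(e_i(2,3),1)$, $T^3_{i,j}=e_j(e_i(3,1),2)$, $1\le i,j\le s$. Let $R$ be spanned by $r_k=\sum_{l=1}^{3}\sum_{i,j}\gamma^{k,l}_{i,j}T^l_{i,j}$, $1\le k\le t$. Total compatibility. Let $V_\circ,V_\bullet$ be two copies of $V$ with bases $e_i^\circ$, $e_i^\bullet$ corresponding to $e_i$.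 For $x,y\in\{\circ,\bullet\}$ let $T^{l}_{i,j}(x,y)$ be the tree $T^l_{i,j}$ with its inner vertex (carrying two leaves) decorated by $e^x_i$ and its root vertex by $e^y_j$. Let $R_\circ$, $R_\bullet$ be the copies of $R$ in $\mathcal{F}(V_\circ)$, $\mathcal{F}(V_\bullet)$, and let ${}_{\circ\bullet}R$ consist of all $T^l_{i,j}(\circ,\bullet)-T^l_{i,j}(\bullet,\circ)$ ($1\le l\le3$, $1\le i,j\le s$) together with all $\sum_{l,i,j}\gamma^{k,l}_{i,j}T^l_{i,j}(\circ,\bullet)$ ($1\le k\le t$). Then ${}^2\mathcal{O}:=\mathcal{F}(V_\circ\oplus V_\bullet)/(R_\circ\cup R_\bullet\cup{}_{\circ\bullet}R)$. ${}^2\mathcal{C}om$ is this construction applied to the operad $\mathcal{C}om$ of commutative associative algebras: it is generated by two symmetric binary operations $w,b$ with relations (all equalities of trees in arity 3): $w(w(1,2),3)=w(w(2,3),1)=w(w(3,1),2)$; $b(b(1,2),3)=b(b(2,3),1)=b(b(3,1),2)$; and the six trees $b(w(1,2),3)$, $b(w(2,3),1)$, $b(w(3,1),2)$, $w(b(1,2),3)$, $w(b(2,3),1)$, $w(b(3,1),2)$ are all equal. White product. For binary quadratic operads $\mathcal{F}(V)/(R)$ and $\mathcal{F}(W)/(S)$, let $\Phi:\mathcal{F}(V\otimes W)(3)\to\mathcal{F}(V)(3)\otimes\mathcal{F}(W)(3)$ send a tree with inner vertex decorated by $v\otimes w$ and root vertex decorated by $v'\otimes w'$ to (same labelled tree decorated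 by $v$ and $v'$) $\otimes$ (same labelled tree decorated by $w$ and $w'$). The white product is $\mathcal{F}(V)/(R)\circ\mathcal{F}(W)/(S):=\mathcal{F}(V\otimes W)/(\Phi^{-1}(R\otimes\mathcal{F}(W)(3)+\mathcal{F}(V)(3)\otimes S))$. The equality is understood under the identification of generators $e_i^\circ\leftrightarrow e_i\otimes w$, $e_i^\bullet\leftrightarrow e_i\otimes b$. *)

theory Defs
  imports "HOL-Combinatorics.Permutations" "HOL-Algebra.Module" "HOL-Algebra.AbelCoset"
begin

section \<open>Linear algebra over a ring record\<close>

text \<open>
  Vector spaces are modules, in the sense of the locale \<^locale>\<open>module\<close>, over a field.  The
  ring multiplication and unit that a record of type \<^typ>\<open>('k, 'v) module\<close> carries
  play no role and are left undefined.
\<close>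

definition mod_span :: "('k, 'm) ring_scheme \<Rightarrow> ('k, 'v) module \<Rightarrow> 'v set \<Rightarrow> 'v set" where
  "mod_span K M S = \<Inter>{H. submodule H K M \<and> S \<subseteq> H}"

definition lin_maps ::
    "('k, 'm) ring_scheme \<Rightarrow> ('k, 'v) module \<Rightarrow> ('k, 'w) module \<Rightarrow> ('v \<Rightarrow> 'w) set" where
  "lin_maps K M N = {f \<in> carrier M \<rightarrow> carrier N.
     (\<forall>x\<in>carrier M. \<forall>y\<in>carrier M. f (x \<oplus>\<^bsub>M\<^esub> y) = f x \<oplus>\<^bsub>N\<^esub> f y) \<and>
     (\<forall>a\<in>carrier K. \<forall>x\<in>carrier M. f (a \<odot>\<^bsub>M\<^esub> x) = a \<odot>\<^bsub>N\<^esub> f x)}"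

definition is_basis ::
    "('k, 'm) ring_scheme \<Rightarrow> ('k, 'v) module \<Rightarrow> nat \<Rightarrow> (nat \<Rightarrow> 'v) \<Rightarrow> bool" where
  "is_basis K M s e \<longleftrightarrow> e \<in> {1..s} \<rightarrow> carrier M \<and>
     (\<forall>v\<in>carrier M. \<exists>!c. c \<in> {1..s} \<rightarrow>\<^sub>E carrier K \<and> v = (\<Oplus>\<^bsub>M\<^esub>i\<in>{1..s}. c i \<odot>\<^bsub>M\<^esub> e i))"

definition quot_mod :: "('k, 'v) module \<Rightarrow> 'v set \<Rightarrow> ('k, 'v set) module" where
  "quot_mod M N = \<lparr>carrier = a_rcosets\<^bsub>M\<^esub> N, mult = undefined, one = undefined,
     zero = N, add = set_add M,
     smult = (\<lambda>a X. \<Union>x\<in>X. N +>\<^bsub>M\<^esub> (a \<odot>\<^bsub>M\<^esub> x))\<rparr>"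

definition dsum :: "('k, 'v) module \<Rightarrow> ('k, 'w) module \<Rightarrow> ('k, 'v \<times> 'w) module" where
  "dsum M N = \<lparr>carrier = carrier M \<times> carrier N, mult = undefined, one = undefined,
     zero = (\<zero>\<^bsub>M\<^esub>, \<zero>\<^bsub>N\<^esub>),
     add = (\<lambda>x y. (fst x \<oplus>\<^bsub>M\<^esub> fst y, snd x \<oplus>\<^bsub>N\<^esub> snd y)),
     smult = (\<lambda>a x. (a \<odot>\<^bsub>M\<^esub> fst x, a \<odot>\<^bsub>N\<^esub> snd x))\<rparr>"

definition free_mod :: "('k, 'm) ring_scheme \<Rightarrow> 'x set \<Rightarrow> ('k, 'x \<Rightarrow> 'k) module" where
  "free_mod K X = \<lparr>carrier = {f. (\<forall>p. f p \<in> carrier K) \<and> (\<forall>p. p \<notin> X \<longrightarrow> f p = \<zero>\<^bsub>K\<^esub>) \<and>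
                                 finite {p. f p \<noteq> \<zero>\<^bsub>K\<^esub>}},
     mult = undefined, one = undefined,
     zero = (\<lambda>p. \<zero>\<^bsub>K\<^esub>), add = (\<lambda>f g p. f p \<oplus>\<^bsub>K\<^esub> g p), smult = (\<lambda>a f p. a \<otimes>\<^bsub>K\<^esub> f p)\<rparr>"

definition single :: "('k, 'm) ring_scheme \<Rightarrow> 'x \<Rightarrow> 'x \<Rightarrow> 'k" where
  "single K p = (\<lambda>q. if q = p then \<one>\<^bsub>K\<^esub> else \<zero>\<^bsub>K\<^esub>)"

text \<open>\<open>lin_ext K M h\<close> is the linear map from a free module to \<open>M\<close> with values \<open>h\<close> on the basis.\<close>

definition lin_ext ::
    "('k, 'm) ring_scheme \<Rightarrow> ('k, 'v) module \<Rightarrow> ('x \<Rightarrow> 'v) \<Rightarrow> ('x \<Rightarrow> 'k) \<Rightarrow> 'v" where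
  "lin_ext K M h f = (\<Oplus>\<^bsub>M\<^esub>p\<in>{p. f p \<noteq> \<zero>\<^bsub>K\<^esub>}. f p \<odot>\<^bsub>M\<^esub> h p)"

definition tensor_pre ::
    "('k, 'm) ring_scheme \<Rightarrow> ('k, 'v) module \<Rightarrow> ('k, 'w) module \<Rightarrow> ('k, 'v \<times> 'w \<Rightarrow> 'k) module" where
  "tensor_pre K M N = free_mod K (carrier M \<times> carrier N)"

definition tensor_ker ::
    "('k, 'm) ring_scheme \<Rightarrow> ('k, 'v) module \<Rightarrow> ('k, 'w) module \<Rightarrow> ('v \<times> 'w \<Rightarrow> 'k) set" where
  "tensor_ker K M N = (let F = tensor_pre K M N; \<delta> = single K in mod_span K F (
     {\<delta> (x \<oplus>\<^bsub>M\<^esub> x', y) \<ominus>\<^bsub>F\<^esub> (\<delta> (x, y) \<oplus>\<^bsub>F\<^esub> \<delta> (x', y)) | x x' y.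
        x \<in> carrier M \<and> x' \<in> carrier M \<and> y \<in> carrier N} \<union>
     {\<delta> (x, y \<oplus>\<^bsub>N\<^esub> y') \<ominus>\<^bsub>F\<^esub> (\<delta> (x, y) \<oplus>\<^bsub>F\<^esub> \<delta> (x, y')) | x y y'.
        x \<in> carrier M \<and> y \<in> carrier N \<and> y' \<in> carrier N} \<union>
     {\<delta> (a \<odot>\<^bsub>M\<^esub> x, y) \<ominus>\<^bsub>F\<^esub> a \<odot>\<^bsub>F\<^esub> \<delta> (x, y) | a x y.
        a \<in> carrier K \<and> x \<in> carrier M \<and> y \<in> carrier N} \<union>
     {\<delta> (x, a \<odot>\<^bsub>N\<^esub> y) \<ominus>\<^bsub>F\<^esub> a \<odot>\<^bsub>F\<^esub> \<delta> (x, y) | a x y.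
        a \<in> carrier K \<and> x \<in> carrier M \<and> y \<in> carrier N}))"

definition tensor ::
    "('k, 'm) ring_scheme \<Rightarrow> ('k, 'v) module \<Rightarrow> ('k, 'w) module \<Rightarrow>
     ('k, ('v \<times> 'w \<Rightarrow> 'k) set) module" where
  "tensor K M N = quot_mod (tensor_pre K M N) (tensor_ker K M N)"

definition tens ::
    "('k, 'm) ring_scheme \<Rightarrow> ('k, 'v) module \<Rightarrow> ('k, 'w) module \<Rightarrow>
     'v \<Rightarrow> 'w \<Rightarrow> ('v \<times> 'w \<Rightarrow> 'k) set" where
  "tens K M N x y = tensor_ker K M N +>\<^bsub>tensor_pre K M N\<^esub> single K (x, y)"

section \<open>S-modules, operads, ideals and quotients\<close>

text \<open>
  \<open>sact V n v \<sigma>\<close> is the right action \<open>v \<cdot> \<sigma>\<close> of a permutation \<open>\<sigma>\<close> of \<open>{1..n}\<close> on \<open>V(n)\<close>.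
  Operads are given by partial compositions: \<open>pcomp P m n i x y\<close> is \<open>x \<circ>\<^sub>i y\<close> in
  \<open>P(m + n - 1)\<close>, for \<open>x \<in> P(m)\<close>, \<open>y \<in> P(n)\<close> and \<open>1 \<le> i \<le> m\<close>.
\<close>

record ('k, 'v) smod =
  part :: "nat \<Rightarrow> ('k, 'v) module"
  sact :: "nat \<Rightarrow> 'v \<Rightarrow> (nat \<Rightarrow> nat) \<Rightarrow> 'v"

record ('k, 'a) operad = "('k, 'a) smod" +
  pcomp :: "nat \<Rightarrow> nat \<Rightarrow> nat \<Rightarrow> 'a \<Rightarrow> 'a \<Rightarrow> 'a"
  opunit :: 'a

definition s_module :: "('k, 'm) ring_scheme \<Rightarrow> ('k, 'v, 'n) smod_scheme \<Rightarrow> bool" where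
  "s_module K V \<longleftrightarrow> (\<forall>n. module K (part V n) \<and>
     (\<forall>\<sigma>. \<sigma> permutes {1..n} \<longrightarrow>
        (\<lambda>v. sact V n v \<sigma>) \<in> lin_maps K (part V n) (part V n)) \<and>
     (\<forall>v\<in>carrier (part V n). sact V n v id = v \<and>
        (\<forall>\<sigma> \<tau>. \<sigma> permutes {1..n} \<and> \<tau> permutes {1..n} \<longrightarrow>
           sact V n v (\<sigma> \<circ> \<tau>) = sact V n (sact V n v \<sigma>) \<tau>)))"

definition binary_smod :: "('k, 'v, 'n) smod_scheme \<Rightarrow> bool" where
  "binary_smod V \<longleftrightarrow> (\<forall>n. n \<noteq> 2 \<longrightarrow> carrier (part V n) = {\<zero>\<^bsub>part V n\<^esub>})"

definition smod_span ::
    "('k, 'm) ring_scheme \<Rightarrow> ('k, 'v, 'n) smod_scheme \<Rightarrow> nat \<Rightarrow> 'v set \<Rightarrow> 'v set" where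
  "smod_span K V n S = \<Inter>{H. submodule H K (part V n) \<and>
     (\<forall>x\<in>H. \<forall>\<sigma>. \<sigma> permutes {1..n} \<longrightarrow> sact V n x \<sigma> \<in> H) \<and> S \<subseteq> H}"

definition smod_dsum :: "('k, 'v) smod \<Rightarrow> ('k, 'w) smod \<Rightarrow> ('k, 'v \<times> 'w) smod" where
  "smod_dsum V W = \<lparr>part = (\<lambda>n. dsum (part V n) (part W n)),
     sact = (\<lambda>n x \<sigma>. (sact V n (fst x) \<sigma>, sact W n (snd x) \<sigma>))\<rparr>"

definition smod_tensor ::
    "('k, 'm) ring_scheme \<Rightarrow> ('k, 'v) smod \<Rightarrow> ('k, 'w) smod \<Rightarrow>
     ('k, ('v \<times> 'w \<Rightarrow> 'k) set) smod" where
  "smod_tensor K V W = \<lparr>part = (\<lambda>n. tensor K (part V n) (part W n)),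
     sact = (\<lambda>n X \<sigma>. \<Union>x\<in>X. tensor_ker K (part V n) (part W n) +>\<^bsub>tensor_pre K (part V n) (part W n)\<^esub>
        lin_ext K (tensor_pre K (part V n) (part W n))
          (\<lambda>(v, w). single K (sact V n v \<sigma>, sact W n w \<sigma>)) x)\<rparr>"

definition operad_ideal ::
    "('k, 'm) ring_scheme \<Rightarrow> ('k, 'a) operad \<Rightarrow> (nat \<Rightarrow> 'a set) \<Rightarrow> bool" where
  "operad_ideal K P I \<longleftrightarrow>
     (\<forall>n. submodule (I n) K (part P n)) \<and>
     (\<forall>n. \<forall>x\<in>I n. \<forall>\<sigma>. \<sigma> permutes {1..n} \<longrightarrow> sact P n x \<sigma> \<in> I n) \<and>
     (\<forall>m n. \<forall>i\<in>{1..m}. \<forall>x\<in>I m. \<forall>y\<in>carrier (part P n). pcomp P m n i x y \<in> I (m + n - 1)) \<and>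
     (\<forall>m n. \<forall>i\<in>{1..m}. \<forall>x\<in>carrier (part P m). \<forall>y\<in>I n. pcomp P m n i x y \<in> I (m + n - 1))"

definition gen_ideal ::
    "('k, 'm) ring_scheme \<Rightarrow> ('k, 'a) operad \<Rightarrow> (nat \<Rightarrow> 'a set) \<Rightarrow> nat \<Rightarrow> 'a set" where
  "gen_ideal K P R n = \<Inter>{I n | I. operad_ideal K P I \<and> (\<forall>k. R k \<subseteq> I k)}"

definition quot_operad :: "('k, 'a) operad \<Rightarrow> (nat \<Rightarrow> 'a set) \<Rightarrow> ('k, 'a set) operad" where
  "quot_operad P I = \<lparr>part = (\<lambda>n. quot_mod (part P n) (I n)),
     sact = (\<lambda>n X \<sigma>. \<Union>x\<in>X. I n +>\<^bsub>part P n\<^esub> sact P n x \<sigma>),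
     pcomp = (\<lambda>m n i X Y. \<Union>x\<in>X. \<Union>y\<in>Y. I (m + n - 1) +>\<^bsub>part P (m + n - 1)\<^esub> pcomp P m n i x y),
     opunit = I 1 +>\<^bsub>part P 1\<^esub> opunit P\<rparr>"

definition operad_iso ::
    "('k, 'm) ring_scheme \<Rightarrow> ('k, 'a) operad \<Rightarrow> ('k, 'b) operad \<Rightarrow> (nat \<Rightarrow> 'a \<Rightarrow> 'b) set" where
  "operad_iso K P Q = {f.
     (\<forall>n. f n \<in> lin_maps K (part P n) (part Q n) \<and>
          bij_betw (f n) (carrier (part P n)) (carrier (part Q n))) \<and>
     (\<forall>n. \<forall>x\<in>carrier (part P n). \<forall>\<sigma>. \<sigma> permutes {1..n} \<longrightarrow>
          f n (sact P n x \<sigma>) = sact Q n (f n x) \<sigma>) \<and>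
     (\<forall>m n. \<forall>i\<in>{1..m}. \<forall>x\<in>carrier (part P m). \<forall>y\<in>carrier (part P n).
          f (m + n - 1) (pcomp P m n i x y) = pcomp Q m n i (f m x) (f n y)) \<and>
     f 1 (opunit P) = opunit Q}"

section \<open>The free operad on an S-module\<close>

text \<open>
  Planar rooted trees with labelled leaves.  The tree operad \<open>tree_operad K D\<close> is the free
  operad on the sets of operations \<open>D n\<close>, without any symmetry or linearity.  The free
  operad on an S-module \<open>V\<close> is its quotient by the relations making a vertex decoration linear
  in \<open>V\<close> and compatible with the symmetric groups; so it is spanned by non-planar trees
  decorated by \<open>V\<close>.
\<close>

datatype 'v ptree = Leaf nat | Node 'v "'v ptree list"

fun leaves :: "'v ptree \<Rightarrow> nat list" where
  "leaves (Leaf i) = [i]"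
| "leaves (Node v ts) = concat (map leaves ts)"

fun decorated :: "(nat \<Rightarrow> 'v set) \<Rightarrow> 'v ptree \<Rightarrow> bool" where
  "decorated D (Leaf i) \<longleftrightarrow> True"
| "decorated D (Node v ts) \<longleftrightarrow> v \<in> D (length ts) \<and> (\<forall>t\<in>set ts. decorated D t)"

fun leaf_subst :: "(nat \<Rightarrow> 'v ptree) \<Rightarrow> 'v ptree \<Rightarrow> 'v ptree" where
  "leaf_subst h (Leaf i) = h i"
| "leaf_subst h (Node v ts) = Node v (map (leaf_subst h) ts)"

definition relabel :: "(nat \<Rightarrow> nat) \<Rightarrow> 'v ptree \<Rightarrow> 'v ptree" where
  "relabel f = leaf_subst (\<lambda>i. Leaf (f i))"

definition graft :: "nat \<Rightarrow> nat \<Rightarrow> 'v ptree \<Rightarrow> 'v ptree \<Rightarrow> 'v ptree" where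
  "graft n i t u = leaf_subst (\<lambda>j. if j < i then Leaf j
     else if j = i then relabel (\<lambda>k. k + i - 1) u else Leaf (j + n - 1)) t"

definition ptrees :: "(nat \<Rightarrow> 'v set) \<Rightarrow> nat \<Rightarrow> 'v ptree set" where
  "ptrees D n = {t. decorated D t \<and> distinct (leaves t) \<and> set (leaves t) = {1..n}}"

text \<open>
  A tree stands for the operation whose inputs are plugged in at the leaves of the same
  label.  With \<open>\<tau> = \<sigma>\<inverse>\<close> and \<open>(\<mu> \<cdot> \<sigma>)(x 1, \<dots>, x n) = \<mu>(x (\<tau> 1), \<dots>, x (\<tau> n))\<close>, the
  permutation \<open>\<sigma>\<close> acts by relabelling the leaves by \<open>\<tau>\<close>.
\<close>

definition tree_operad ::
    "('k, 'm) ring_scheme \<Rightarrow> (nat \<Rightarrow> 'v set) \<Rightarrow> ('k, 'v ptree \<Rightarrow> 'k) operad" where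
  "tree_operad K D = \<lparr>part = (\<lambda>n. free_mod K (ptrees D n)),
     sact = (\<lambda>n x \<sigma>. lin_ext K (free_mod K (ptrees D n)) (\<lambda>t. single K (relabel (inv_into UNIV \<sigma>) t)) x),
     pcomp = (\<lambda>m n i x y. let F = free_mod K (ptrees D (m + n - 1)) in
        lin_ext K F (\<lambda>t. lin_ext K F (\<lambda>u. single K (graft n i t u)) y) x),
     opunit = single K (Leaf 1)\<rparr>"

definition corolla :: "nat \<Rightarrow> 'v \<Rightarrow> 'v ptree" where
  "corolla n v = Node v (map Leaf [1..<Suc n])"

definition smod_trees :: "('k, 'm) ring_scheme \<Rightarrow> ('k, 'v) smod \<Rightarrow> ('k, 'v ptree \<Rightarrow> 'k) operad" where
  "smod_trees K V = tree_operad K (\<lambda>n. carrier (part V n))"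

definition free_rels :: "('k, 'm) ring_scheme \<Rightarrow> ('k, 'v) smod \<Rightarrow> nat \<Rightarrow> ('v ptree \<Rightarrow> 'k) set" where
  "free_rels K V n = (let M = part V n; F = part (smod_trees K V) n; c = (\<lambda>v. single K (corolla n v)) in
     {c (u \<oplus>\<^bsub>M\<^esub> v) \<ominus>\<^bsub>F\<^esub> (c u \<oplus>\<^bsub>F\<^esub> c v) | u v. u \<in> carrier M \<and> v \<in> carrier M} \<union>
     {c (a \<odot>\<^bsub>M\<^esub> v) \<ominus>\<^bsub>F\<^esub> a \<odot>\<^bsub>F\<^esub> c v | a v. a \<in> carrier K \<and> v \<in> carrier M} \<union>
     {c (sact V n v \<sigma>) \<ominus>\<^bsub>F\<^esub> sact (smod_trees K V) n (c v) \<sigma> | v \<sigma>.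
        v \<in> carrier M \<and> \<sigma> permutes {1..n}})"

definition free_ideal :: "('k, 'm) ring_scheme \<Rightarrow> ('k, 'v) smod \<Rightarrow> nat \<Rightarrow> ('v ptree \<Rightarrow> 'k) set" where
  "free_ideal K V = gen_ideal K (smod_trees K V) (free_rels K V)"

definition free_operad ::
    "('k, 'm) ring_scheme \<Rightarrow> ('k, 'v) smod \<Rightarrow> ('k, ('v ptree \<Rightarrow> 'k) set) operad" where
  "free_operad K V = quot_operad (smod_trees K V) (free_ideal K V)"

definition free_tree ::
    "('k, 'm) ring_scheme \<Rightarrow> ('k, 'v) smod \<Rightarrow> nat \<Rightarrow> 'v ptree \<Rightarrow> ('v ptree \<Rightarrow> 'k) set" where
  "free_tree K V n t = free_ideal K V n +>\<^bsub>part (smod_trees K V) n\<^esub> single K t"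

section \<open>Binary quadratic operads\<close>

text \<open>A binary quadratic operad is presented by an S-module \<open>V\<close> and a set \<open>R\<close> of elements of \<open>F(V)(3)\<close>.\<close>

definition bq_ideal ::
    "('k, 'm) ring_scheme \<Rightarrow> ('k, 'v) smod \<Rightarrow> ('v ptree \<Rightarrow> 'k) set set \<Rightarrow>
     nat \<Rightarrow> ('v ptree \<Rightarrow> 'k) set set" where
  "bq_ideal K V R = gen_ideal K (free_operad K V) (\<lambda>n. if n = 3 then R else {})"

definition bq_operad ::
    "('k, 'm) ring_scheme \<Rightarrow> ('k, 'v) smod \<Rightarrow> ('v ptree \<Rightarrow> 'k) set set \<Rightarrow>
     ('k, ('v ptree \<Rightarrow> 'k) set set) operad" where
  "bq_operad K V R = quot_operad (free_operad K V) (bq_ideal K V R)"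

definition bq_gen ::
    "('k, 'm) ring_scheme \<Rightarrow> ('k, 'v) smod \<Rightarrow> ('v ptree \<Rightarrow> 'k) set set \<Rightarrow>
     'v \<Rightarrow> ('v ptree \<Rightarrow> 'k) set set" where
  "bq_gen K V R v = bq_ideal K V R 2 +>\<^bsub>part (free_operad K V) 2\<^esub> free_tree K V 2 (corolla 2 v)"

text \<open>
  The three trees in arity 3, with inner vertex decorated by \<open>u\<close> and root by \<open>v\<close>:
  \<open>v(u(1,2),3)\<close>, \<open>v(u(2,3),1)\<close> and \<open>v(u(3,1),2)\<close> for \<open>l = 1, 2, 3\<close>.
\<close>

definition tree3 :: "nat \<Rightarrow> 'v \<Rightarrow> 'v \<Rightarrow> 'v ptree" where
  "tree3 l u v =
     (if l = 1 then Node v [Node u [Leaf 1, Leaf 2], Leaf 3]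
      else if l = 2 then Node v [Node u [Leaf 2, Leaf 3], Leaf 1]
      else Node v [Node u [Leaf 3, Leaf 1], Leaf 2])"

definition T3 ::
    "('k, 'm) ring_scheme \<Rightarrow> ('k, 'v) smod \<Rightarrow> nat \<Rightarrow> 'v \<Rightarrow> 'v \<Rightarrow> ('v ptree \<Rightarrow> 'k) set" where
  "T3 K V l u v = free_tree K V 3 (tree3 l u v)"

text \<open>\<open>rel3 K V s a b g\<close> is the sum of the \<open>g l i j\<close>-multiples of \<open>T\<^sup>l\<close> with inner vertex \<open>a i\<close> and root \<open>b j\<close>.\<close>

definition rel3 ::
    "('k, 'm) ring_scheme \<Rightarrow> ('k, 'v) smod \<Rightarrow> nat \<Rightarrow> (nat \<Rightarrow> 'v) \<Rightarrow> (nat \<Rightarrow> 'v) \<Rightarrow>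
     (nat \<Rightarrow> nat \<Rightarrow> nat \<Rightarrow> 'k) \<Rightarrow> ('v ptree \<Rightarrow> 'k) set" where
  "rel3 K V s a b g = (let F = part (free_operad K V) 3 in
     finsum F (\<lambda>(l, i, j). g l i j \<odot>\<^bsub>F\<^esub> T3 K V l (a i) (b j)) ({1..3} \<times> {1..s} \<times> {1..s}))"

section \<open>Total compatibility\<close>

definition white_copy :: "('k, 'v) smod \<Rightarrow> 'v \<Rightarrow> 'v \<times> 'v" where
  "white_copy V v = (v, \<zero>\<^bsub>part V 2\<^esub>)"

definition black_copy :: "('k, 'v) smod \<Rightarrow> 'v \<Rightarrow> 'v \<times> 'v" where
  "black_copy V v = (\<zero>\<^bsub>part V 2\<^esub>, v)"

definition double_smod :: "('k, 'v) smod \<Rightarrow> ('k, 'v \<times> 'v) smod" where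
  "double_smod V = smod_dsum V V"

definition double_rels ::
    "('k, 'm) ring_scheme \<Rightarrow> ('k, 'v) smod \<Rightarrow> nat \<Rightarrow> (nat \<Rightarrow> 'v) \<Rightarrow>
     nat \<Rightarrow> (nat \<Rightarrow> nat \<Rightarrow> nat \<Rightarrow> nat \<Rightarrow> 'k) \<Rightarrow> (('v \<times> 'v) ptree \<Rightarrow> 'k) set set" where
  "double_rels K V s e t \<gamma> =
     (let U = double_smod V; w = (\<lambda>i. white_copy V (e i)); b = (\<lambda>i. black_copy V (e i)) in
      {rel3 K U s w w (\<gamma> k) | k. k \<in> {1..t}} \<union>
      {rel3 K U s b b (\<gamma> k) | k. k \<in> {1..t}} \<union>
      {T3 K U l (w i) (b j) \<ominus>\<^bsub>part (free_operad K U) 3\<^esub> T3 K U l (b i) (w j) | l i j.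
         l \<in> {1..3} \<and> i \<in> {1..s} \<and> j \<in> {1..s}} \<union>
      {rel3 K U s w b (\<gamma> k) | k. k \<in> {1..t}})"

definition double_operad ::
    "('k, 'm) ring_scheme \<Rightarrow> ('k, 'v) smod \<Rightarrow> nat \<Rightarrow> (nat \<Rightarrow> 'v) \<Rightarrow>
     nat \<Rightarrow> (nat \<Rightarrow> nat \<Rightarrow> nat \<Rightarrow> nat \<Rightarrow> 'k) \<Rightarrow> ('k, (('v \<times> 'v) ptree \<Rightarrow> 'k) set set) operad" where
  "double_operad K V s e t \<gamma> = bq_operad K (double_smod V) (double_rels K V s e t \<gamma>)"

section \<open>Totally compatible commutative associative algebras\<close>

definition com_smod :: "('k, 'm) ring_scheme \<Rightarrow> ('k, 'k) smod" where
  "com_smod K = \<lparr>part = (\<lambda>n. \<lparr>carrier = (if n = 2 then carrier K else {\<zero>\<^bsub>K\<^esub>}),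
       mult = undefined, one = undefined, zero = \<zero>\<^bsub>K\<^esub>,
       add = (\<lambda>x y. x \<oplus>\<^bsub>K\<^esub> y), smult = (\<lambda>a x. a \<otimes>\<^bsub>K\<^esub> x)\<rparr>),
     sact = (\<lambda>n x \<sigma>. x)\<rparr>"

text \<open>
  With the symmetric generator \<open>e\<^sub>1 = \<one>\<close>, the operad Com has the two relations
  \<open>T\<^sup>1 - T\<^sup>2\<close> and \<open>T\<^sup>2 - T\<^sup>3\<close>.
\<close>

definition com_coeff :: "('k, 'm) ring_scheme \<Rightarrow> nat \<Rightarrow> nat \<Rightarrow> nat \<Rightarrow> nat \<Rightarrow> 'k" where
  "com_coeff K k l i j =
     (if l = k then \<one>\<^bsub>K\<^esub> else if l = k + 1 then \<ominus>\<^bsub>K\<^esub> \<one>\<^bsub>K\<^esub> else \<zero>\<^bsub>K\<^esub>)"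

definition com2_smod :: "('k, 'm) ring_scheme \<Rightarrow> ('k, 'k \<times> 'k) smod" where
  "com2_smod K = double_smod (com_smod K)"

definition com2_rels :: "('k, 'm) ring_scheme \<Rightarrow> (('k \<times> 'k) ptree \<Rightarrow> 'k) set set" where
  "com2_rels K = double_rels K (com_smod K) 1 (\<lambda>i. \<one>\<^bsub>K\<^esub>) 2 (com_coeff K)"

definition com2_w :: "('k, 'm) ring_scheme \<Rightarrow> 'k \<times> 'k" where
  "com2_w K = white_copy (com_smod K) \<one>\<^bsub>K\<^esub>"

definition com2_b :: "('k, 'm) ring_scheme \<Rightarrow> 'k \<times> 'k" where
  "com2_b K = black_copy (com_smod K) \<one>\<^bsub>K\<^esub>"

section \<open>The white product\<close>

definition tensor3 ::
    "('k, 'm) ring_scheme \<Rightarrow> ('k, 'v) smod \<Rightarrow> ('k, 'w) smod \<Rightarrow>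
     ('k, (('v ptree \<Rightarrow> 'k) set \<times> ('w ptree \<Rightarrow> 'k) set \<Rightarrow> 'k) set) module" where
  "tensor3 K V W = tensor K (part (free_operad K V) 3) (part (free_operad K W) 3)"

definition tens3 ::
    "('k, 'm) ring_scheme \<Rightarrow> ('k, 'v) smod \<Rightarrow> ('k, 'w) smod \<Rightarrow>
     ('v ptree \<Rightarrow> 'k) set \<Rightarrow> ('w ptree \<Rightarrow> 'k) set \<Rightarrow>
     (('v ptree \<Rightarrow> 'k) set \<times> ('w ptree \<Rightarrow> 'k) set \<Rightarrow> 'k) set" where
  "tens3 K V W = tens K (part (free_operad K V) 3) (part (free_operad K W) 3)"

text \<open>
  \<open>\<Phi>\<close> is the linear map with the given values on decorated trees.  The trees \<open>T\<^sup>l\<close> decorated by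
  elementary tensors span \<open>F(V \<otimes> W)(3)\<close> when \<open>V\<close> and \<open>W\<close> are binary, so that its values on
  that space do not depend on the choice made by \<open>SOME\<close>.
\<close>

definition white_Phi ::
    "('k, 'm) ring_scheme \<Rightarrow> ('k, 'v) smod \<Rightarrow> ('k, 'w) smod \<Rightarrow>
     (('v \<times> 'w \<Rightarrow> 'k) set ptree \<Rightarrow> 'k) set \<Rightarrow>
     (('v ptree \<Rightarrow> 'k) set \<times> ('w ptree \<Rightarrow> 'k) set \<Rightarrow> 'k) set" where
  "white_Phi K V W = (let X = smod_tensor K V W; t = tens K (part V 2) (part W 2) in
     SOME \<Phi>. \<Phi> \<in> lin_maps K (part (free_operad K X) 3) (tensor3 K V W) \<and>
       (\<forall>l\<in>{1..3}. \<forall>v\<in>carrier (part V 2). \<forall>v'\<in>carrier (part V 2).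
          \<forall>w\<in>carrier (part W 2). \<forall>w'\<in>carrier (part W 2).
            \<Phi> (T3 K X l (t v w) (t v' w')) = tens3 K V W (T3 K V l v v') (T3 K W l w w')))"

definition white_rels ::
    "('k, 'm) ring_scheme \<Rightarrow> ('k, 'v) smod \<Rightarrow> ('v ptree \<Rightarrow> 'k) set set \<Rightarrow>
     ('k, 'w) smod \<Rightarrow> ('w ptree \<Rightarrow> 'k) set set \<Rightarrow>
     (('v \<times> 'w \<Rightarrow> 'k) set ptree \<Rightarrow> 'k) set set" where
  "white_rels K V R W S =
     {x \<in> carrier (part (free_operad K (smod_tensor K V W)) 3). white_Phi K V W x \<in> set_add (tensor3 K V W)
        (mod_span K (tensor3 K V W) {tens3 K V W r y | r y.
          r \<in> smod_span K (free_operad K V) 3 R \<and> y \<in> carrier (part (free_operad K W) 3)})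
        (mod_span K (tensor3 K V W) {tens3 K V W x s | x s.
          x \<in> carrier (part (free_operad K V) 3) \<and> s \<in> smod_span K (free_operad K W) 3 S})}"

definition white_product ::
    "('k, 'm) ring_scheme \<Rightarrow> ('k, 'v) smod \<Rightarrow> ('v ptree \<Rightarrow> 'k) set set \<Rightarrow>
     ('k, 'w) smod \<Rightarrow> ('w ptree \<Rightarrow> 'k) set set \<Rightarrow>
     ('k, (('v \<times> 'w \<Rightarrow> 'k) set ptree \<Rightarrow> 'k) set set) operad" where
  "white_product K V R W S = bq_operad K (smod_tensor K V W) (white_rels K V R W S)"

definition white_gen ::
    "('k, 'm) ring_scheme \<Rightarrow> ('k, 'v) smod \<Rightarrow> ('v ptree \<Rightarrow> 'k) set set \<Rightarrow>
     ('k, 'w) smod \<Rightarrow> ('w ptree \<Rightarrow> 'k) set set \<Rightarrow> 'v \<Rightarrow> 'w \<Rightarrow>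
     (('v \<times> 'w \<Rightarrow> 'k) set ptree \<Rightarrow> 'k) set set" where
  "white_gen K V R W S v w =
     bq_gen K (smod_tensor K V W) (white_rels K V R W S) (tens K (part V 2) (part W 2) v w)"

end

theory Submission
  imports Defs
begin

text \<open>
  The trees \<open>T\<^sup>l\<^bsub>i,j\<^esub>\<close> form a basis of \<open>F(V)(3)\<close>.  They span because every tree is an iterated
  composite of corollas.  They are independent because a functional on trees that is linear and
  equivariant at every vertex descends to the free operad: the trees killed by all such functionals
  form an operadic ideal.

  The S-modules \<open>V \<oplus> V\<close> and \<open>V \<otimes> \<langle>w, b\<rangle>\<close> are isomorphic, hence so are their free operads, and it
  remains to compare the two spaces of relations in arity 3.  The space \<open>\<^sup>2Com(3)\<close> has the three
  coordinates \<open>ww\<close>, \<open>bb\<close> and \<open>wb = bw\<close>.  Applying one of them to the second factor of \<open>\<Phi>(x)\<close> sends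
  the white relations into \<open>R\<close>; recolouring the result puts it into \<open>R\<^sub>\<circ>\<close>, \<open>R\<^sub>\<bullet>\<close> or the mixed copy of
  \<open>R\<close>, and \<open>x\<close> is the sum of its three recoloured parts modulo the
  \<open>T\<^sup>l\<^bsub>i,j\<^esub>(w, b) - T\<^sup>l\<^bsub>i,j\<^esub>(b, w)\<close>.
\<close>

section \<open>Linear algebra\<close>

text \<open>Independence of the trees is what makes maps available at all.
  \<open>free_operad\<close> is a quotient by a generated ideal and its elements have no normal
  form, so values on trees define a linear map only once the ideal is known not to identify those
  trees. The recolourings, the coordinates on 2Com(3) and \<Phi> itself all arise from such
  prescribed values; in particular the \<open>SOME\<close> in \<open>white_Phi\<close> says nothing
  until a candidate for \<Phi> has been built.

  A second obstacle is that relations generate under the symmetric group, so a linear computation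
  with the given relations is not enough: recolourings have to commute with the action, and
  coordinates have to be invariant. Invariance comes from the symmetry of w and b, whose trees are
  merely permuted among the three shapes. Moreover the action leaves the chosen basis, as it may
  replace an inner e_i by its image under the transposition; maps prescribed on basis trees must
  therefore be known on all decorations, which is where bilinearity of the trees in their two
  decorations is used.\<close>

definition scal :: "('k, 'm) ring_scheme \<Rightarrow> ('k, 'k) module" where
  "scal K = part (com_smod K) 2"

text \<open>K as a module over itself is borrowed from \<open>com_smod\<close>, so that linear
  functionals and the generator of Com live in one and the same module.\<close>

lemma scal_simps [simp]:
  "carrier (scal K) = carrier K" "zero (scal K) = zero K"
  "add (scal K) = add K" "smult (scal K) = mult K"
  by (auto simp: scal_def com_smod_def)

lemma abelian_group_scal: assumes "cring K" shows "abelian_group (scal K)"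
proof -
  interpret cring K by fact
  show ?thesis
    by (rule abelian_groupI) (auto simp: a_ac intro: add.inv_closed l_neg)
qed

lemma module_scal: assumes "cring K" shows "module K (scal K)"
proof -
  interpret cring K by fact
  show ?thesis
    by (rule moduleI) (auto simp: abelian_group_scal assms l_distr r_distr m_assoc)
qed

lemma module_cring: "module K M \<Longrightarrow> cring K"
  by (simp add: module_def)

lemma diff_zero_imp_eq:
  assumes "abelian_group G" "x \<in> carrier G" "y \<in> carrier G" "x \<ominus>\<^bsub>G\<^esub> y = \<zero>\<^bsub>G\<^esub>"
  shows "x = y"
proof -
  interpret abelian_group G by fact
  show ?thesis using assms(2-4) by (metis a_minus_def add.inv_closed minus_equality minus_minus)
qed

section \<open>Linear maps and their closure properties\<close>

lemma lin_mapsI: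
  assumes "\<And>x. x \<in> carrier M \<Longrightarrow> f x \<in> carrier N"
    and "\<And>x y. x \<in> carrier M \<Longrightarrow> y \<in> carrier M \<Longrightarrow> f (x \<oplus>\<^bsub>M\<^esub> y) = f x \<oplus>\<^bsub>N\<^esub> f y"
    and "\<And>a x. a \<in> carrier K \<Longrightarrow> x \<in> carrier M \<Longrightarrow> f (a \<odot>\<^bsub>M\<^esub> x) = a \<odot>\<^bsub>N\<^esub> f x"
  shows "f \<in> lin_maps K M N"
  using assms by (auto simp: lin_maps_def)

lemma lin_mapsD:
  assumes "f \<in> lin_maps K M N"
  shows "x \<in> carrier M \<Longrightarrow> f x \<in> carrier N"
    and "x \<in> carrier M \<Longrightarrow> y \<in> carrier M \<Longrightarrow> f (x \<oplus>\<^bsub>M\<^esub> y) = f x \<oplus>\<^bsub>N\<^esub> f y"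
    and "a \<in> carrier K \<Longrightarrow> x \<in> carrier M \<Longrightarrow> f (a \<odot>\<^bsub>M\<^esub> x) = a \<odot>\<^bsub>N\<^esub> f x"
  using assms by (auto simp: lin_maps_def)

text \<open>\<open>lin_maps\<close> sees only values on the carrier. Operations on quotients agree
  with a composite of linear maps there and nowhere else.\<close>

lemma lin_maps_cong:
  assumes "f \<in> lin_maps K M N" "module K M" "\<And>x. x \<in> carrier M \<Longrightarrow> g x = f x"
  shows "g \<in> lin_maps K M N"
proof -
  interpret M: module K M by fact
  show ?thesis by (rule lin_mapsI) (auto simp: assms(3) lin_mapsD[OF assms(1)])
qed

lemma lin_maps_zero:
  assumes "f \<in> lin_maps K M N" "module K M" "module K N"
  shows "f \<zero>\<^bsub>M\<^esub> = \<zero>\<^bsub>N\<^esub>"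
proof -
  interpret M: module K M by fact
  interpret N: module K N by fact
  have "f (\<zero>\<^bsub>K\<^esub> \<odot>\<^bsub>M\<^esub> \<zero>\<^bsub>M\<^esub>) = \<zero>\<^bsub>K\<^esub> \<odot>\<^bsub>N\<^esub> f \<zero>\<^bsub>M\<^esub>"
    by (rule lin_mapsD[OF assms(1)]) auto
  then show ?thesis using lin_mapsD(1)[OF assms(1)] by simp
qed

lemma lin_maps_neg:
  assumes "f \<in> lin_maps K M N" "module K M" "module K N" "x \<in> carrier M"
  shows "f (\<ominus>\<^bsub>M\<^esub> x) = \<ominus>\<^bsub>N\<^esub> f x"
proof -
  interpret M: module K M by fact
  interpret N: module K N by fact
  have x: "f x \<in> carrier N" "f (\<ominus>\<^bsub>M\<^esub> x) \<in> carrier N" using assms lin_mapsD(1)[OF assms(1)] by auto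
  have "f (\<ominus>\<^bsub>M\<^esub> x \<oplus>\<^bsub>M\<^esub> x) = f (\<ominus>\<^bsub>M\<^esub> x) \<oplus>\<^bsub>N\<^esub> f x"
    by (rule lin_mapsD[OF assms(1)]) (use assms in auto)
  then have "f (\<ominus>\<^bsub>M\<^esub> x) \<oplus>\<^bsub>N\<^esub> f x = \<zero>\<^bsub>N\<^esub>"
    using lin_maps_zero[OF assms(1-3)] assms(4) by (simp add: M.l_neg)
  then show ?thesis using x N.minus_equality by metis
qed

lemma lin_maps_minus:
  assumes "f \<in> lin_maps K M N" "module K M" "module K N" "x \<in> carrier M" "y \<in> carrier M"
  shows "f (x \<ominus>\<^bsub>M\<^esub> y) = f x \<ominus>\<^bsub>N\<^esub> f y"
proof -
  interpret M: module K M by fact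
  show ?thesis using assms
    by (simp add: a_minus_def lin_mapsD(2)[OF assms(1)] lin_maps_neg[OF assms(1-3)])
qed

text \<open>For infinite A both sums are zero by convention, so finiteness need not be carried
  along.\<close>

lemma lin_maps_finsum:
  assumes "f \<in> lin_maps K M N" "module K M" "module K N" "x \<in> A \<rightarrow> carrier M"
  shows "f (finsum M x A) = finsum N (\<lambda>i. f (x i)) A"
proof -
  interpret M: module K M by fact
  interpret N: module K N by fact
  show ?thesis using assms(4)
  proof (induction A rule: infinite_finite_induct)
    case (insert i A)
    have "(\<lambda>i. f (x i)) \<in> A \<rightarrow> carrier N" "f (x i) \<in> carrier N" "x i \<in> carrier M" "x \<in> A \<rightarrow> carrier M"
      using insert.prems lin_mapsD(1)[OF assms(1)] by auto
    then show ?case using insert lin_mapsD(2)[OF assms(1)] by simp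
  qed (auto simp: lin_maps_zero[OF assms(1-3)])
qed

lemma lin_maps_compose:
  assumes "f \<in> lin_maps K M N" "g \<in> lin_maps K N L"
  shows "(\<lambda>x. g (f x)) \<in> lin_maps K M L"
  by (rule lin_mapsI) (use assms lin_mapsD[OF assms(1)] lin_mapsD[OF assms(2)] in auto)

lemma lin_maps_id: "(\<lambda>x. x) \<in> lin_maps K M M"
  by (rule lin_mapsI) auto

lemma lin_maps_const_zero:
  assumes "module K N" shows "(\<lambda>x. \<zero>\<^bsub>N\<^esub>) \<in> lin_maps K M N"
proof -
  interpret N: module K N by fact
  show ?thesis by (rule lin_mapsI) auto
qed

lemma lin_maps_add:
  assumes "f \<in> lin_maps K M N" "g \<in> lin_maps K M N" "module K N"
  shows "(\<lambda>x. f x \<oplus>\<^bsub>N\<^esub> g x) \<in> lin_maps K M N"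
proof -
  interpret N: module K N by fact
  show ?thesis
    by (rule lin_mapsI)
      (use lin_mapsD[OF assms(1)] lin_mapsD[OF assms(2)] in \<open>auto simp: N.smult_r_distr N.a_ac\<close>)
qed

lemma lin_maps_diff:
  assumes "f \<in> lin_maps K M N" "g \<in> lin_maps K M N" "module K N"
  shows "(\<lambda>x. f x \<ominus>\<^bsub>N\<^esub> g x) \<in> lin_maps K M N"
proof -
  interpret N: module K N by fact
  have m: "\<And>x y. x \<in> carrier N \<Longrightarrow> y \<in> carrier N \<Longrightarrow> \<ominus>\<^bsub>N\<^esub> (x \<oplus>\<^bsub>N\<^esub> y) = \<ominus>\<^bsub>N\<^esub> x \<oplus>\<^bsub>N\<^esub> \<ominus>\<^bsub>N\<^esub> y"
    by (rule N.minus_add)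
  show ?thesis
    by (rule lin_mapsI)
      (use lin_mapsD[OF assms(1)] lin_mapsD[OF assms(2)] in
        \<open>auto simp: a_minus_def N.smult_r_distr m N.a_ac N.smult_r_minus\<close>)
qed

lemma lin_maps_scale:
  assumes "f \<in> lin_maps K M (scal K)" "module K N" "y \<in> carrier N"
  shows "(\<lambda>x. f x \<odot>\<^bsub>N\<^esub> y) \<in> lin_maps K M N"
proof -
  interpret N: module K N by fact
  show ?thesis
    by (rule lin_mapsI)
      (use lin_mapsD[OF assms(1)] assms(3) in \<open>auto simp: N.smult_l_distr N.smult_assoc1\<close>)
qed

lemma lin_maps_smult:
  assumes "f \<in> lin_maps K M N" "module K N" "a \<in> carrier K"
  shows "(\<lambda>x. a \<odot>\<^bsub>N\<^esub> f x) \<in> lin_maps K M N"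
proof -
  interpret N: module K N by fact
  show ?thesis
    by (rule lin_mapsI)
      (use lin_mapsD[OF assms(1)] assms(3) in
        \<open>auto simp: N.smult_r_distr N.smult_assoc1[symmetric] N.R.m_comm\<close>)
qed

lemma lin_maps_sum:
  assumes "\<And>i. i \<in> A \<Longrightarrow> f i \<in> lin_maps K M N" "module K N"
  shows "(\<lambda>x. \<Oplus>\<^bsub>N\<^esub>i\<in>A. f i x) \<in> lin_maps K M N"
proof -
  interpret N: module K N by fact
  show ?thesis using assms(1)
  proof (induction A rule: infinite_finite_induct)
    case (insert i A)
    have *: "(\<lambda>x. f i x \<oplus>\<^bsub>N\<^esub> (\<Oplus>\<^bsub>N\<^esub>i\<in>A. f i x)) \<in> lin_maps K M N"
      by (intro lin_maps_add insert assms) (use insert in auto)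
    have ins: "(\<Oplus>\<^bsub>N\<^esub>i\<in>insert i A. f i x) = f i x \<oplus>\<^bsub>N\<^esub> (\<Oplus>\<^bsub>N\<^esub>i\<in>A. f i x)" 
      if "x \<in> carrier M" for x
      using insert that lin_mapsD(1)[OF insert.prems] by (subst N.finsum_insert) auto
    show ?case
      by (rule lin_mapsI)
       (use lin_mapsD[OF *] lin_mapsD[OF insert.prems] insert in \<open>auto simp: lin_maps_def ins Pi_def 
         N.finsum_closed N.finsum_addf N.finsum_smult_ldistr N.a_ac N.smult_r_distr\<close>)
  qed (auto intro: lin_maps_const_zero assms)
qed

section \<open>Submodules, preimages, equalisers and spans\<close>

lemma mod_submoduleI:
  assumes "module K M" "H \<subseteq> carrier M" "\<zero>\<^bsub>M\<^esub> \<in> H"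
    and "\<And>a b. a \<in> H \<Longrightarrow> b \<in> H \<Longrightarrow> a \<oplus>\<^bsub>M\<^esub> b \<in> H"
    and "\<And>a x. a \<in> carrier K \<Longrightarrow> x \<in> H \<Longrightarrow> a \<odot>\<^bsub>M\<^esub> x \<in> H"
  shows "submodule H K M"
proof -
  interpret M: module K M by fact
  have "\<ominus>\<^bsub>M\<^esub> x \<in> H" if "x \<in> H" for x
    using assms(5)[of "\<ominus>\<^bsub>K\<^esub> \<one>\<^bsub>K\<^esub>" x] that assms(2) by (auto simp: M.smult_l_minus)
  then show ?thesis using assms by (intro M.submoduleI) auto
qed

lemma submoduleD:
  assumes "submodule H K M"
  shows "x \<in> H \<Longrightarrow> x \<in> carrier M" "\<zero>\<^bsub>M\<^esub> \<in> H" "a \<in> H \<Longrightarrow> b \<in> H \<Longrightarrow> a \<oplus>\<^bsub>M\<^esub> b \<in> H"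
    "c \<in> carrier K \<Longrightarrow> a \<in> H \<Longrightarrow> c \<odot>\<^bsub>M\<^esub> a \<in> H"
  using assms subgroup.subset[of H "add_monoid M"] subgroup.one_closed[of H "add_monoid M"]
    subgroup.m_closed[of H "add_monoid M"] submodule.smult_closed[of H K M]
  by (auto simp: submodule_def)

lemma submodule_minus:
  assumes "submodule H K M" "module K M" "a \<in> H" "b \<in> H" shows "a \<ominus>\<^bsub>M\<^esub> b \<in> H"
  using assms submoduleD[OF assms(1)] module.submoduleE(3)[OF assms(2,1)] by (simp add: a_minus_def)

lemma submodule_finsum:
  assumes "submodule H K M" "module K M" "x \<in> A \<rightarrow> H"
  shows "finsum M x A \<in> H"
proof -
  interpret M: module K M by fact
  show ?thesis using assms(3)
  proof (induction A rule: infinite_finite_induct)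
    case (insert i A)
    have "x \<in> A \<rightarrow> carrier M" "x i \<in> carrier M"
      using insert.prems submoduleD(1)[OF assms(1)] by auto
    then show ?case using insert submoduleD[OF assms(1)] by (subst M.finsum_insert) auto
  qed (auto simp: submoduleD[OF assms(1)])
qed

lemma submodule_carrier: "module K M \<Longrightarrow> submodule (carrier M) K M"
  by (rule module.carrier_is_submodule)

lemma submodule_preimage:
  assumes "f \<in> lin_maps K M N" "module K M" "module K N" "submodule H K N"
  shows "submodule {x \<in> carrier M. f x \<in> H} K M"
proof -
  interpret M: module K M by fact
  show ?thesis
    by (rule mod_submoduleI[OF assms(2)])
      (auto simp: lin_mapsD[OF assms(1)] lin_maps_zero[OF assms(1-3)] submoduleD[OF assms(4)])
qed

lemma submodule_zero: assumes "module K M" shows "submodule {\<zero>\<^bsub>M\<^esub>} K M"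
proof -
  interpret M: module K M by fact
  show ?thesis by (rule mod_submoduleI[OF assms]) auto
qed

lemma submodule_eq:
  assumes "f \<in> lin_maps K M N" "g \<in> lin_maps K M N" "module K M" "module K N"
  shows "submodule {x \<in> carrier M. f x = g x} K M"
proof -
  interpret M: module K M by fact
  show ?thesis
    by (rule mod_submoduleI[OF assms(3)])
      (auto simp: lin_mapsD[OF assms(1)] lin_mapsD[OF assms(2)] lin_maps_zero[OF assms(1,3,4)]
        lin_maps_zero[OF assms(2,3,4)])
qed

lemma submodule_Int:
  assumes "module K M" "\<And>H. H \<in> \<H> \<Longrightarrow> submodule H K M" "\<H> \<noteq> {}"
  shows "submodule (\<Inter>\<H>) K M"
  by (rule mod_submoduleI[OF assms(1)])
    (use assms(3) submoduleD[OF assms(2)] in \<open>blast+\<close>)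

lemma mod_span_submodule:
  assumes "module K M" "S \<subseteq> carrier M" shows "submodule (mod_span K M S) K M"
  unfolding mod_span_def
  by (rule submodule_Int) (use assms submodule_carrier[OF assms(1)] in auto)

lemma mod_span_incl: "x \<in> S \<Longrightarrow> x \<in> mod_span K M S"
  by (auto simp: mod_span_def)

lemma mod_span_least: "submodule H K M \<Longrightarrow> S \<subseteq> H \<Longrightarrow> mod_span K M S \<subseteq> H"
  by (auto simp: mod_span_def)

lemma mod_span_carrier: "module K M \<Longrightarrow> S \<subseteq> carrier M \<Longrightarrow> mod_span K M S \<subseteq> carrier M"
  by (rule mod_span_least) (auto intro: submodule_carrier)

lemma lin_maps_mod_span:
  assumes "f \<in> lin_maps K M N" "module K M" "module K N" "submodule H K N" "S \<subseteq> carrier M"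
    "\<And>x. x \<in> S \<Longrightarrow> f x \<in> H" "x \<in> mod_span K M S"
  shows "f x \<in> H"
  using mod_span_least[OF submodule_preimage[OF assms(1-4)], of S] assms(5-7) by auto

text \<open>The equaliser of two linear maps is a submodule, so it contains the span as soon as it
  contains the generators.\<close>

lemma lin_maps_eq_on_span:
  assumes "f \<in> lin_maps K M N" "g \<in> lin_maps K M N" "module K M" "module K N"
    "S \<subseteq> carrier M" "\<And>x. x \<in> S \<Longrightarrow> f x = g x" "x \<in> mod_span K M S"
  shows "f x = g x"
  using mod_span_least[OF submodule_eq[OF assms(1-4)], of S] assms(5-7) by auto

section \<open>Bilinear maps\<close>

definition bilinear_on where
  "bilinear_on K M N L f \<longleftrightarrow> (\<forall>x\<in>carrier M. f x \<in> lin_maps K N L) \<and>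
     (\<forall>y\<in>carrier N. (\<lambda>x. f x y) \<in> lin_maps K M L)"

lemma bilinear_onD:
  assumes "bilinear_on K M N L f"
  shows "x \<in> carrier M \<Longrightarrow> f x \<in> lin_maps K N L"
    "y \<in> carrier N \<Longrightarrow> (\<lambda>x. f x y) \<in> lin_maps K M L"
  using assms by (auto simp: bilinear_on_def)

text \<open>Extend in the second variable while the first is still a generator, then in the first
  variable with the second one arbitrary.\<close>

lemma bilinear_on_span:
  assumes "bilinear_on K M N L f" "module K M" "module K N" "module K L" "submodule H K L"
    "S \<subseteq> carrier M" "T \<subseteq> carrier N" "\<And>x y. x \<in> S \<Longrightarrow> y \<in> T \<Longrightarrow> f x y \<in> H"
    "x \<in> mod_span K M S" "y \<in> mod_span K N T"
  shows "f x y \<in> H"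
proof -
  have "f x' y \<in> H" if "x' \<in> S" for x'
    by (rule lin_maps_mod_span[OF bilinear_onD(1)[OF assms(1)] assms(3-5,7) _ assms(10)])
      (use that assms in auto)
  then show ?thesis
    using lin_maps_mod_span[OF bilinear_onD(2)[OF assms(1)] assms(2,4,5,6) _ assms(9)]
      mod_span_carrier[OF assms(3,7)] assms(10) by blast
qed

lemma bilinear_on_eq_on_span:
  assumes "bilinear_on K M N L f" "bilinear_on K M N L g" "module K M" "module K N" "module K L"
    "S \<subseteq> carrier M" "T \<subseteq> carrier N" "\<And>x y. x \<in> S \<Longrightarrow> y \<in> T \<Longrightarrow> f x y = g x y"
    "x \<in> mod_span K M S" "y \<in> mod_span K N T"
  shows "f x y = g x y"
proof -
  have "f x' y = g x' y" if "x' \<in> S" for x'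
    by (rule lin_maps_eq_on_span[OF bilinear_onD(1)[OF assms(1)] bilinear_onD(1)[OF assms(2)]
          assms(4,5,7) _ assms(10)])
      (use that assms in auto)
  then show ?thesis
    using lin_maps_eq_on_span[OF bilinear_onD(2)[OF assms(1)] bilinear_onD(2)[OF assms(2)]
        assms(3,5,6) _ assms(9)]
      mod_span_carrier[OF assms(4,7)] assms(10) by blast
qed

subsection \<open>Free modules\<close>

lemma abelian_group_free_mod: assumes "cring K" shows "abelian_group (free_mod K X)"
proof -
  interpret cring K by fact
  show ?thesis
  proof (rule abelian_groupI)
    fix f g assume "f \<in> carrier (free_mod K X)" "g \<in> carrier (free_mod K X)"
    moreover have "{p. f p \<oplus>\<^bsub>K\<^esub> g p \<noteq> \<zero>\<^bsub>K\<^esub>} \<subseteq> {p. f p \<noteq> \<zero>\<^bsub>K\<^esub>} \<union> {p. g p \<noteq> \<zero>\<^bsub>K\<^esub>}" by auto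
    ultimately show "f \<oplus>\<^bsub>free_mod K X\<^esub> g \<in> carrier (free_mod K X)"
      by (auto simp: free_mod_def intro: finite_subset)
  next
    fix f assume f: "f \<in> carrier (free_mod K X)"
    have "{p. \<ominus>\<^bsub>K\<^esub> f p \<noteq> \<zero>\<^bsub>K\<^esub>} \<subseteq> {p. f p \<noteq> \<zero>\<^bsub>K\<^esub>}" by auto
    then have "(\<lambda>p. \<ominus>\<^bsub>K\<^esub> f p) \<in> carrier (free_mod K X)"
      using f by (auto simp: free_mod_def intro: finite_subset)
    then show "\<exists>g\<in>carrier (free_mod K X). g \<oplus>\<^bsub>free_mod K X\<^esub> f = \<zero>\<^bsub>free_mod K X\<^esub>"
      using f by (intro bexI[of _ "\<lambda>p. \<ominus>\<^bsub>K\<^esub> f p"]) (auto simp: free_mod_def l_neg)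
  qed (auto simp: free_mod_def a_ac fun_eq_iff)
qed

lemma module_free_mod: assumes "cring K" shows "module K (free_mod K X)"
proof -
  interpret cring K by fact
  show ?thesis
  proof (rule moduleI)
    fix a f assume a: "a \<in> carrier K" and "f \<in> carrier (free_mod K X)"
    moreover have "{p. a \<otimes>\<^bsub>K\<^esub> f p \<noteq> \<zero>\<^bsub>K\<^esub>} \<subseteq> {p. f p \<noteq> \<zero>\<^bsub>K\<^esub>}" using a by auto
    ultimately show "a \<odot>\<^bsub>free_mod K X\<^esub> f \<in> carrier (free_mod K X)"
      by (auto simp: free_mod_def intro: finite_subset)
  qed (auto simp: abelian_group_free_mod assms, auto simp: free_mod_def l_distr r_distr m_assoc)
qed

lemma single_closed: assumes "cring K" "p \<in> X" shows "single K p \<in> carrier (free_mod K X)"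
proof -
  interpret cring K by fact
  have "finite {q. single K p q \<noteq> \<zero>\<^bsub>K\<^esub>}"
    by (rule finite_subset[of _ "{p}"]) (auto simp: single_def)
  then show ?thesis using assms(2) by (auto simp: free_mod_def single_def)
qed

lemma free_mod_span:
  assumes "cring K" shows "mod_span K (free_mod K X) (single K ` X) = carrier (free_mod K X)"
proof
  interpret cring K by fact
  let ?F = "free_mod K X"
  interpret F: module K ?F using module_free_mod[OF assms] .
  have S: "single K ` X \<subseteq> carrier ?F" using single_closed[OF assms] by auto
  show "mod_span K ?F (single K ` X) \<subseteq> carrier ?F"
    by (rule mod_span_carrier[OF F.module_axioms S])
  have sub: "submodule (mod_span K ?F (single K ` X)) K ?F"
    by (rule mod_span_submodule[OF F.module_axioms S])
  \<comment> \<open>The induction runs over a finite superset of the support, because f may already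
    vanish at the point that is removed.\<close>
  have "f \<in> mod_span K ?F (single K ` X)"
    if "finite A" "f \<in> carrier ?F" "{p. f p \<noteq> \<zero>\<^bsub>K\<^esub>} \<subseteq> A" for f A
    using that
  proof (induction A arbitrary: f)
    case empty
    then have "f = \<zero>\<^bsub>?F\<^esub>" by (auto simp: free_mod_def fun_eq_iff)
    then show ?case using submoduleD(2)[OF sub] by simp
  next
    case (insert p A)
    show ?case
    proof (cases "f p = \<zero>\<^bsub>K\<^esub>")
      case True
      then show ?thesis using insert by auto
    next
      case False
      have fp: "f p \<in> carrier K" "p \<in> X" and fc: "\<And>q. f q \<in> carrier K" 
        using insert.prems False by (auto simp: free_mod_def)
      define g where "g = (\<lambda>q. if q = p then \<zero>\<^bsub>K\<^esub> else f q)"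
      have "finite {q. g q \<noteq> \<zero>\<^bsub>K\<^esub>}"
        by (rule finite_subset[of _ "{q. f q \<noteq> \<zero>\<^bsub>K\<^esub>}"]) 
          (use insert.prems in \<open>auto simp: g_def free_mod_def split: if_splits\<close>)
      then have g: "g \<in> carrier ?F" using insert.prems by (auto simp: g_def free_mod_def)
      have "g \<in> mod_span K ?F (single K ` X)"
        by (rule insert.IH[OF g]) (use insert.prems in \<open>auto simp: g_def\<close>)
      moreover have "f = (f p \<odot>\<^bsub>?F\<^esub> single K p) \<oplus>\<^bsub>?F\<^esub> g"
        using fp fc by (auto simp: fun_eq_iff g_def free_mod_def single_def)
      moreover have "f p \<odot>\<^bsub>?F\<^esub> single K p \<in> mod_span K ?F (single K ` X)"
        using fp by (intro submoduleD(4)[OF sub] mod_span_incl) auto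
      ultimately show ?thesis using submoduleD(3)[OF sub] by metis
    qed
  qed
  then show "carrier ?F \<subseteq> mod_span K ?F (single K ` X)"
    by (auto simp: free_mod_def)
qed

text \<open>\<open>lin_ext\<close> sums over the support, which changes under addition and scaling.
  Enlarging the index set lets all sums in the proof of linearity run over one common set.\<close>

lemma lin_ext_superset:
  assumes "module K M" "finite A" "{p. f p \<noteq> \<zero>\<^bsub>K\<^esub>} \<subseteq> A" "f \<in> carrier (free_mod K X)"
    "\<And>p. p \<in> X \<Longrightarrow> h p \<in> carrier M"
  shows "lin_ext K M h f = (\<Oplus>\<^bsub>M\<^esub>p\<in>A \<inter> X. f p \<odot>\<^bsub>M\<^esub> h p)"
proof -
  interpret M: module K M by fact
  show ?thesis unfolding lin_ext_def
    by (rule M.add.finprod_mono_neutral_cong_left)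
      (use assms in \<open>auto simp: free_mod_def\<close>)
qed

lemma lin_ext_linear:
  assumes "module K M" "\<And>p. p \<in> X \<Longrightarrow> h p \<in> carrier M"
  shows "lin_ext K M h \<in> lin_maps K (free_mod K X) M"
proof (rule lin_mapsI)
  interpret M: module K M by fact
  let ?F = "free_mod K X"
  interpret F: module K ?F using module_free_mod[OF module_cring[OF assms(1)]] .
  note sup = lin_ext_superset[OF assms(1) _ _ _ assms(2)]
  have fin: "finite {p. f p \<noteq> \<zero>\<^bsub>K\<^esub>}" and cl: "\<And>p. f p \<in> carrier K" if "f \<in> carrier ?F" for f
    using that by (auto simp: free_mod_def)
  fix f assume f: "f \<in> carrier ?F"
  show "lin_ext K M h f \<in> carrier M"
    using sup[OF fin[OF f] subset_refl f] cl[OF f] assms(2) by simp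
  { fix g assume g: "g \<in> carrier ?F"
    let ?A = "{p. f p \<noteq> \<zero>\<^bsub>K\<^esub>} \<union> {p. g p \<noteq> \<zero>\<^bsub>K\<^esub>}"
    have "lin_ext K M h (f \<oplus>\<^bsub>?F\<^esub> g) = (\<Oplus>\<^bsub>M\<^esub>p\<in>?A \<inter> X. (f \<oplus>\<^bsub>?F\<^esub> g) p \<odot>\<^bsub>M\<^esub> h p)"
    proof (rule sup)
      show "{p. (f \<oplus>\<^bsub>?F\<^esub> g) p \<noteq> \<zero>\<^bsub>K\<^esub>} \<subseteq> ?A" using f by (auto simp: free_mod_def)
    qed (use fin f g in auto)
    also have "\<dots> = (\<Oplus>\<^bsub>M\<^esub>p\<in>?A \<inter> X. f p \<odot>\<^bsub>M\<^esub> h p \<oplus>\<^bsub>M\<^esub> g p \<odot>\<^bsub>M\<^esub> h p)"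
      by (rule M.finsum_cong') (use cl f g assms(2) in \<open>auto simp: free_mod_def M.smult_l_distr\<close>)
    also have "\<dots> = (\<Oplus>\<^bsub>M\<^esub>p\<in>?A \<inter> X. f p \<odot>\<^bsub>M\<^esub> h p) \<oplus>\<^bsub>M\<^esub> (\<Oplus>\<^bsub>M\<^esub>p\<in>?A \<inter> X. g p \<odot>\<^bsub>M\<^esub> h p)"
      by (rule M.finsum_addf) (use cl f g assms(2) in auto)
    also have "(\<Oplus>\<^bsub>M\<^esub>p\<in>?A \<inter> X. f p \<odot>\<^bsub>M\<^esub> h p) = lin_ext K M h f"
      by (rule sup[symmetric]) (use fin f g in auto)
    also have "(\<Oplus>\<^bsub>M\<^esub>p\<in>?A \<inter> X. g p \<odot>\<^bsub>M\<^esub> h p) = lin_ext K M h g"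
      by (rule sup[symmetric]) (use fin f g in auto)
    finally show "lin_ext K M h (f \<oplus>\<^bsub>?F\<^esub> g) = lin_ext K M h f \<oplus>\<^bsub>M\<^esub> lin_ext K M h g" . }
  { fix a assume a: "a \<in> carrier K"
    let ?A = "{p. f p \<noteq> \<zero>\<^bsub>K\<^esub>}"
    have "lin_ext K M h (a \<odot>\<^bsub>?F\<^esub> f) = (\<Oplus>\<^bsub>M\<^esub>p\<in>?A \<inter> X. (a \<odot>\<^bsub>?F\<^esub> f) p \<odot>\<^bsub>M\<^esub> h p)"
    proof (rule sup)
      show "{p. (a \<odot>\<^bsub>?F\<^esub> f) p \<noteq> \<zero>\<^bsub>K\<^esub>} \<subseteq> ?A" using a by (auto simp: free_mod_def)
    qed (use fin f a in auto)
    also have "\<dots> = (\<Oplus>\<^bsub>M\<^esub>p\<in>?A \<inter> X. a \<odot>\<^bsub>M\<^esub> (f p \<odot>\<^bsub>M\<^esub> h p))"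
      by (rule M.finsum_cong') (use cl f a assms(2) in \<open>auto simp: free_mod_def M.smult_assoc1\<close>)
    also have "\<dots> = a \<odot>\<^bsub>M\<^esub> (\<Oplus>\<^bsub>M\<^esub>p\<in>?A \<inter> X. f p \<odot>\<^bsub>M\<^esub> h p)"
      by (rule M.finsum_smult_ldistr[symmetric]) (use fin cl f a assms(2) in auto)
    also have "(\<Oplus>\<^bsub>M\<^esub>p\<in>?A \<inter> X. f p \<odot>\<^bsub>M\<^esub> h p) = lin_ext K M h f"
      by (rule sup[symmetric]) (use fin f in auto)
    finally show "lin_ext K M h (a \<odot>\<^bsub>?F\<^esub> f) = a \<odot>\<^bsub>M\<^esub> lin_ext K M h f" . }
qed

text \<open>The previous lemma is taken with X = {p}, so that h has to be controlled at p
  alone.\<close>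

lemma lin_ext_single:
  assumes "module K M" "h p \<in> carrier M"
  shows "lin_ext K M h (single K p) = h p"
proof -
  interpret M: module K M by fact
  have "lin_ext K M h (single K p) = (\<Oplus>\<^bsub>M\<^esub>q\<in>{p} \<inter> {p}. single K p q \<odot>\<^bsub>M\<^esub> h q)"
    by (rule lin_ext_superset[OF assms(1)])
      (use assms single_closed[OF module_cring[OF assms(1)], of p "{p}"] in \<open>auto simp: single_def\<close>)
  also have "\<dots> = h p"
    using assms(2) by (simp add: single_def M.finsum_insert)
  finally show ?thesis .
qed

lemma free_mod_lin_maps_eq:
  assumes "f \<in> lin_maps K (free_mod K X) N" "g \<in> lin_maps K (free_mod K X) N" "module K N"
    "\<And>p. p \<in> X \<Longrightarrow> f (single K p) = g (single K p)" "x \<in> carrier (free_mod K X)"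
  shows "f x = g x"
proof -
  note cr = module_cring[OF assms(3)]
  show ?thesis
    by (rule lin_maps_eq_on_span[OF assms(1,2) module_free_mod[OF cr] assms(3), of "single K ` X"])
      (use assms free_mod_span[OF cr] single_closed[OF cr] in auto)
qed

subsection \<open>Quotient modules\<close>

text \<open>The axioms of a quotient module are inherited along the projection. The zero of N is
  prescribed because additivity cannot determine it before N is known to be a group.\<close>

lemma module_surjective_image:
  assumes "module K M" and f: "f \<in> lin_maps K M N" and surj: "f ` carrier M = carrier N"
    and z: "\<zero>\<^bsub>N\<^esub> = f \<zero>\<^bsub>M\<^esub>"
  shows "module K N"
proof -
  interpret M: module K M by fact
  note D = lin_mapsD[OF f]
  have ex: "\<exists>x\<in>carrier M. y = f x" if "y \<in> carrier N" for y using that surj by auto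
  have fc: "x \<in> carrier M \<Longrightarrow> f x \<in> carrier N" for x using surj by auto
  have ag: "abelian_group N"
  proof (rule abelian_groupI)
    fix x y assume "x \<in> carrier N" "y \<in> carrier N"
    then obtain x' y' where "x' \<in> carrier M" "y' \<in> carrier M" "x = f x'" "y = f y'" by (meson ex)
    then show "x \<oplus>\<^bsub>N\<^esub> y \<in> carrier N" "x \<oplus>\<^bsub>N\<^esub> y = y \<oplus>\<^bsub>N\<^esub> x"
      using D(2)[symmetric] fc by (auto simp: M.a_comm)
  next
    fix x y z assume "x \<in> carrier N" "y \<in> carrier N" "z \<in> carrier N"
    then obtain x' y' z' where "x' \<in> carrier M" "y' \<in> carrier M" "x = f x'" "y = f y'" 
      "z' \<in> carrier M" "z = f z'" by (meson ex)
    then show "x \<oplus>\<^bsub>N\<^esub> y \<oplus>\<^bsub>N\<^esub> z = x \<oplus>\<^bsub>N\<^esub> (y \<oplus>\<^bsub>N\<^esub> z)"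
      using D(2)[symmetric] fc by (auto simp: M.a_assoc)
  next
    show "\<zero>\<^bsub>N\<^esub> \<in> carrier N" using z fc by auto
  next
    fix x assume "x \<in> carrier N"
    then obtain x' where x: "x' \<in> carrier M" "x = f x'" by (meson ex)
    then show "\<zero>\<^bsub>N\<^esub> \<oplus>\<^bsub>N\<^esub> x = x" using D(2)[of "\<zero>\<^bsub>M\<^esub>" x'] z by simp
    have "f (\<ominus>\<^bsub>M\<^esub> x') \<oplus>\<^bsub>N\<^esub> x = \<zero>\<^bsub>N\<^esub>"
      using D(2)[of "\<ominus>\<^bsub>M\<^esub> x'" x'] x z by (simp add: M.l_neg)
    then show "\<exists>y\<in>carrier N. y \<oplus>\<^bsub>N\<^esub> x = \<zero>\<^bsub>N\<^esub>" using x fc by blast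
  qed
  show ?thesis
  proof (rule moduleI[OF module_cring[OF assms(1)] ag])
    fix a x assume a: "a \<in> carrier K" and "x \<in> carrier N"
    then obtain x' where x: "x' \<in> carrier M" "x = f x'" by (meson ex)
    then show "a \<odot>\<^bsub>N\<^esub> x \<in> carrier N" using D(3)[symmetric] a fc by auto
    fix b assume b: "b \<in> carrier K"
    show "(a \<oplus>\<^bsub>K\<^esub> b) \<odot>\<^bsub>N\<^esub> x = a \<odot>\<^bsub>N\<^esub> x \<oplus>\<^bsub>N\<^esub> b \<odot>\<^bsub>N\<^esub> x"
      using a b x D(2)[symmetric] D(3)[symmetric] by (auto simp: M.smult_l_distr)
    show "a \<otimes>\<^bsub>K\<^esub> b \<odot>\<^bsub>N\<^esub> x = a \<odot>\<^bsub>N\<^esub> (b \<odot>\<^bsub>N\<^esub> x)"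
      using a b x D(3)[symmetric] by (auto simp: M.smult_assoc1)
  next
    fix x assume "x \<in> carrier N"
    then obtain x' where "x' \<in> carrier M" "x = f x'" by (meson ex)
    then show "\<one>\<^bsub>K\<^esub> \<odot>\<^bsub>N\<^esub> x = x" using D(3)[symmetric] by auto
  next
    fix a x y assume a: "a \<in> carrier K" "x \<in> carrier N" "y \<in> carrier N"
    then obtain x' y' where "x' \<in> carrier M" "y' \<in> carrier M" "x = f x'" "y = f y'" by (meson ex)
    then show "a \<odot>\<^bsub>N\<^esub> (x \<oplus>\<^bsub>N\<^esub> y) = a \<odot>\<^bsub>N\<^esub> x \<oplus>\<^bsub>N\<^esub> a \<odot>\<^bsub>N\<^esub> y"
      using a D(2)[symmetric] D(3)[symmetric] by (auto simp: M.smult_r_distr)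
  qed
qed

lemma coset_eq_iff:
  assumes "module K M" "submodule N K M" "x \<in> carrier M" "y \<in> carrier M"
  shows "N +>\<^bsub>M\<^esub> x = N +>\<^bsub>M\<^esub> y \<longleftrightarrow> x \<ominus>\<^bsub>M\<^esub> y \<in> N"
proof -
  interpret M: module K M by fact
  have sg: "subgroup N (add_monoid M)" using assms(2) by (simp add: submodule_def)
  have sub: "N \<subseteq> carrier M" using submoduleD[OF assms(2)] by auto
  show ?thesis
  proof
    assume "N +>\<^bsub>M\<^esub> x = N +>\<^bsub>M\<^esub> y"
    then have "N +>\<^bsub>M\<^esub> (x \<oplus>\<^bsub>M\<^esub> (\<ominus>\<^bsub>M\<^esub> y)) = N"
      by (rule M.a_coset_add_inv2) (use assms sub in auto)
    then show "x \<ominus>\<^bsub>M\<^esub> y \<in> N"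
      using M.a_coset_join1[OF _ _ sg] assms by (auto simp: a_minus_def)
  next
    assume "x \<ominus>\<^bsub>M\<^esub> y \<in> N"
    then have "N +>\<^bsub>M\<^esub> (x \<oplus>\<^bsub>M\<^esub> (\<ominus>\<^bsub>M\<^esub> y)) = N"
      using M.a_coset_join2[OF _ sg] assms by (auto simp: a_minus_def)
    then show "N +>\<^bsub>M\<^esub> x = N +>\<^bsub>M\<^esub> y"
      by (rule M.a_coset_add_inv1) (use assms sub in auto)
  qed
qed

lemma coset_self:
  assumes "module K M" "submodule N K M" "x \<in> carrier M" shows "x \<in> N +>\<^bsub>M\<^esub> x"
proof -
  interpret M: module K M by fact
  have "\<zero>\<^bsub>M\<^esub> \<oplus>\<^bsub>M\<^esub> x = x" using assms by simp
  then show ?thesis using submoduleD(2)[OF assms(2)] by (force simp: a_r_coset_def')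
qed

lemma coset_mem:
  assumes "module K M" "submodule N K M" "x \<in> carrier M" "y \<in> N +>\<^bsub>M\<^esub> x"
  shows "y \<in> carrier M" "N +>\<^bsub>M\<^esub> y = N +>\<^bsub>M\<^esub> x"
proof -
  interpret M: module K M by fact
  have sg: "subgroup N (add_monoid M)" using assms(2) by (simp add: submodule_def)
  show "y \<in> carrier M" using assms(3,4) submoduleD(1)[OF assms(2)] by (auto simp: a_r_coset_def')
  show "N +>\<^bsub>M\<^esub> y = N +>\<^bsub>M\<^esub> x" using M.a_repr_independence[OF assms(4,3) sg] by simp
qed

text \<open>Operations on quotients are defined as unions over all representatives. If each
  representative yields the same coset, the union is that coset.\<close>

lemma UN_coset:
  assumes "module K M" "submodule N K M" "x \<in> carrier M"
    "\<And>y. y \<in> carrier M \<Longrightarrow> N +>\<^bsub>M\<^esub> y = N +>\<^bsub>M\<^esub> x \<Longrightarrow> G y = G x"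
  shows "(\<Union>y\<in>N +>\<^bsub>M\<^esub> x. G y) = G x"
  using coset_self[OF assms(1-3)] coset_mem[OF assms(1-3)] assms(4) by blast

lemma quot_mod_simps:
  "carrier (quot_mod M N) = (\<lambda>x. N +>\<^bsub>M\<^esub> x) ` carrier M" "zero (quot_mod M N) = N"
  by (auto simp: quot_mod_def A_RCOSETS_def')

lemma proj_linear:
  assumes "module K M" "submodule N K M"
  shows "(\<lambda>x. N +>\<^bsub>M\<^esub> x) \<in> lin_maps K M (quot_mod M N)"
proof (rule lin_mapsI)
  interpret M: module K M by fact
  have sub: "N \<subseteq> carrier M" using submoduleD[OF assms(2)] by auto
  fix x assume x: "x \<in> carrier M"
  then show "N +>\<^bsub>M\<^esub> x \<in> carrier (quot_mod M N)" by (auto simp: quot_mod_simps)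
  { fix y assume y: "y \<in> carrier M"
    have as: "abelian_subgroup N M"
      by (rule abelian_subgroupI3)
        (use assms(2) in \<open>auto simp: additive_subgroup_def submodule_def intro: M.abelian_group_axioms\<close>)
    show "N +>\<^bsub>M\<^esub> (x \<oplus>\<^bsub>M\<^esub> y) = (N +>\<^bsub>M\<^esub> x) \<oplus>\<^bsub>quot_mod M N\<^esub> (N +>\<^bsub>M\<^esub> y)"
      using abelian_subgroup.a_rcos_sum[OF as x y] by (simp add: quot_mod_def) }
  { fix a assume a: "a \<in> carrier K"
    have "(\<Union>y\<in>N +>\<^bsub>M\<^esub> x. N +>\<^bsub>M\<^esub> (a \<odot>\<^bsub>M\<^esub> y)) = N +>\<^bsub>M\<^esub> (a \<odot>\<^bsub>M\<^esub> x)"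
    proof (rule UN_coset[OF assms x])
      fix y assume y: "y \<in> carrier M" "N +>\<^bsub>M\<^esub> y = N +>\<^bsub>M\<^esub> x"
      then have "y \<ominus>\<^bsub>M\<^esub> x \<in> N" using coset_eq_iff[OF assms] x by auto
      then have "a \<odot>\<^bsub>M\<^esub> (y \<ominus>\<^bsub>M\<^esub> x) \<in> N" using submoduleD(4)[OF assms(2)] a by auto
      then have "(a \<odot>\<^bsub>M\<^esub> y) \<ominus>\<^bsub>M\<^esub> (a \<odot>\<^bsub>M\<^esub> x) \<in> N"
        using a x y by (simp add: a_minus_def M.smult_r_distr M.smult_r_minus)
      then show "N +>\<^bsub>M\<^esub> (a \<odot>\<^bsub>M\<^esub> y) = N +>\<^bsub>M\<^esub> (a \<odot>\<^bsub>M\<^esub> x)"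
        using coset_eq_iff[OF assms] a x y by auto
    qed
    then show "N +>\<^bsub>M\<^esub> (a \<odot>\<^bsub>M\<^esub> x) = a \<odot>\<^bsub>quot_mod M N\<^esub> (N +>\<^bsub>M\<^esub> x)"
      by (simp add: quot_mod_def) }
qed

lemma module_quot_mod:
  assumes "module K M" "submodule N K M" shows "module K (quot_mod M N)"
proof (rule module_surjective_image[OF assms(1) proj_linear[OF assms]])
  interpret M: module K M by fact
  have sub: "N \<subseteq> carrier M" using submoduleD[OF assms(2)] by auto
  show "\<zero>\<^bsub>quot_mod M N\<^esub> = N +>\<^bsub>M\<^esub> \<zero>\<^bsub>M\<^esub>" using sub by (simp add: quot_mod_simps)
qed (simp add: quot_mod_simps)

lemma proj_zero_iff:
  assumes "module K M" "submodule N K M" "x \<in> carrier M"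
  shows "N +>\<^bsub>M\<^esub> x = \<zero>\<^bsub>quot_mod M N\<^esub> \<longleftrightarrow> x \<in> N"
proof -
  interpret M: module K M by fact
  have sub: "N \<subseteq> carrier M" using submoduleD[OF assms(2)] by auto
  have "\<zero>\<^bsub>quot_mod M N\<^esub> = N +>\<^bsub>M\<^esub> \<zero>\<^bsub>M\<^esub>" using sub by (simp add: quot_mod_simps)
  moreover have "x \<ominus>\<^bsub>M\<^esub> \<zero>\<^bsub>M\<^esub> = x" using assms(3) M.minus_equality[of "\<zero>\<^bsub>M\<^esub>" "\<zero>\<^bsub>M\<^esub>"]
    by (simp add: a_minus_def)
  ultimately show ?thesis using coset_eq_iff[OF assms M.zero_closed] by simp
qed


lemma quot_mod_lift:
  assumes "module K M" "submodule N K M" "module K L" "f \<in> lin_maps K M L"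
    "\<And>x. x \<in> N \<Longrightarrow> f x = \<zero>\<^bsub>L\<^esub>"
  obtains g where "g \<in> lin_maps K (quot_mod M N) L" "\<And>x. x \<in> carrier M \<Longrightarrow> g (N +>\<^bsub>M\<^esub> x) = f x"
proof -
  interpret M: module K M by fact
  interpret L: module K L by fact
  note p = lin_mapsD[OF proj_linear[OF assms(1,2)]]
  \<comment> \<open>Any representative will do, since f vanishes on N; the choice makes g a function
    of the coset.\<close>
  define g where "g X = f (SOME x. x \<in> X)" for X
  have g: "g (N +>\<^bsub>M\<^esub> x) = f x" if x: "x \<in> carrier M" for x
  proof -
    define y where "y = (SOME y. y \<in> N +>\<^bsub>M\<^esub> x)"
    have y: "y \<in> N +>\<^bsub>M\<^esub> x" unfolding y_def using coset_self[OF assms(1,2) x] by (rule someI)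
    have yc: "y \<in> carrier M" "N +>\<^bsub>M\<^esub> y = N +>\<^bsub>M\<^esub> x" using coset_mem[OF assms(1,2) x y] by auto
    then have "y \<ominus>\<^bsub>M\<^esub> x \<in> N" using coset_eq_iff[OF assms(1,2)] x by auto
    then have "f y \<ominus>\<^bsub>L\<^esub> f x = \<zero>\<^bsub>L\<^esub>"
      using assms(5) lin_maps_minus[OF assms(4,1,3)] x yc by metis
    then have "f y = f x" using lin_mapsD(1)[OF assms(4)] x yc diff_zero_imp_eq[OF L.abelian_group_axioms] by blast
    then show ?thesis by (simp add: g_def y_def)
  qed
  have "g \<in> lin_maps K (quot_mod M N) L"
  proof (rule lin_mapsI)
    fix X assume "X \<in> carrier (quot_mod M N)"
    then obtain x where x: "x \<in> carrier M" "X = N +>\<^bsub>M\<^esub> x" by (auto simp: quot_mod_simps)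
    show "g X \<in> carrier L" using x g lin_mapsD[OF assms(4)] by auto
    show "g (a \<odot>\<^bsub>quot_mod M N\<^esub> X) = a \<odot>\<^bsub>L\<^esub> g X" if "a \<in> carrier K" for a
      using x g lin_mapsD[OF assms(4)] p(3)[symmetric] that by auto
    fix Y assume "Y \<in> carrier (quot_mod M N)"
    then obtain y where y: "y \<in> carrier M" "Y = N +>\<^bsub>M\<^esub> y" by (auto simp: quot_mod_simps)
    show "g (X \<oplus>\<^bsub>quot_mod M N\<^esub> Y) = g X \<oplus>\<^bsub>L\<^esub> g Y"
      using x y g lin_mapsD[OF assms(4)] p(2)[symmetric] by auto
  qed
  then show ?thesis using that g by blast
qed

subsection \<open>Tensor products\<close>

lemma module_tensor_pre: "cring K \<Longrightarrow> module K (tensor_pre K M N)"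
  by (simp add: tensor_pre_def module_free_mod)

lemma tensor_pre_single:
  "cring K \<Longrightarrow> x \<in> carrier M \<Longrightarrow> y \<in> carrier N \<Longrightarrow> single K (x, y) \<in> carrier (tensor_pre K M N)"
  by (simp add: tensor_pre_def single_closed)

lemma submodule_tensor_ker:
  assumes "module K M" "module K N"
  shows "submodule (tensor_ker K M N) K (tensor_pre K M N)"
proof -
  note cr = module_cring[OF assms(1)]
  interpret M: module K M by fact
  interpret N: module K N by fact
  interpret F: module K "tensor_pre K M N" by (rule module_tensor_pre[OF cr])
  show ?thesis
    unfolding tensor_ker_def Let_def
    by (rule mod_span_submodule[OF F.module_axioms])
      (use tensor_pre_single[OF cr, where M = M and N = N] in auto)
qed

lemma module_tensor: "module K M \<Longrightarrow> module K N \<Longrightarrow> module K (tensor K M N)"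
  unfolding tensor_def
  by (rule module_quot_mod[OF module_tensor_pre submodule_tensor_ker]) (auto intro: module_cring)

lemma tens_closed:
  assumes "module K M" "module K N" "x \<in> carrier M" "y \<in> carrier N"
  shows "tens K M N x y \<in> carrier (tensor K M N)"
  using tensor_pre_single[OF module_cring[OF assms(1)] assms(3,4)]
  by (auto simp: tens_def tensor_def quot_mod_simps)

text \<open>Each law is one of the four families of generators of \<open>tensor_ker\<close>, seen in
  the quotient.\<close>

lemma tens_bilinear:
  assumes "module K M" "module K N"
  shows "bilinear_on K M N (tensor K M N) (tens K M N)"
proof -
  note cr = module_cring[OF assms(1)]
  interpret M: module K M by fact
  interpret N: module K N by fact
  let ?F = "tensor_pre K M N" and ?I = "tensor_ker K M N"
  interpret F: module K ?F by (rule module_tensor_pre[OF cr])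
  note sub = submodule_tensor_ker[OF assms]
  note p = lin_mapsD[OF proj_linear[OF F.module_axioms sub], folded tensor_def]
  note s = tensor_pre_single[OF cr, where M = M and N = N]
  note eqI = coset_eq_iff[OF F.module_axioms sub, THEN iffD2]
  have 1: "tens K M N (x \<oplus>\<^bsub>M\<^esub> x') y = tens K M N x y \<oplus>\<^bsub>tensor K M N\<^esub> tens K M N x' y"
    if "x \<in> carrier M" "x' \<in> carrier M" "y \<in> carrier N" for x x' y
    using that s unfolding tens_def
    by (subst p(2)[symmetric], simp_all, intro eqI)
      (auto simp: tensor_ker_def Let_def intro!: mod_span_incl)
  have 2: "tens K M N x (y \<oplus>\<^bsub>N\<^esub> y') = tens K M N x y \<oplus>\<^bsub>tensor K M N\<^esub> tens K M N x y'"
    if "x \<in> carrier M" "y \<in> carrier N" "y' \<in> carrier N" for x y y'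
    using that s unfolding tens_def
    by (subst p(2)[symmetric], simp_all, intro eqI)
      (auto simp: tensor_ker_def Let_def intro!: mod_span_incl)
  have 3: "tens K M N (a \<odot>\<^bsub>M\<^esub> x) y = a \<odot>\<^bsub>tensor K M N\<^esub> tens K M N x y"
    if "x \<in> carrier M" "a \<in> carrier K" "y \<in> carrier N" for x a y
    using that s unfolding tens_def
    by (subst p(3)[symmetric], simp_all, intro eqI)
      (auto simp: tensor_ker_def Let_def intro!: mod_span_incl)
  have 4: "tens K M N x (a \<odot>\<^bsub>N\<^esub> y) = a \<odot>\<^bsub>tensor K M N\<^esub> tens K M N x y"
    if "x \<in> carrier M" "a \<in> carrier K" "y \<in> carrier N" for x a y
    using that s unfolding tens_def
    by (subst p(3)[symmetric], simp_all, intro eqI)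
      (auto simp: tensor_ker_def Let_def intro!: mod_span_incl)
  show ?thesis unfolding bilinear_on_def
    by (auto intro!: lin_mapsI simp: 1 2 3 4 tens_closed[OF assms])
qed

lemma tensor_span:
  assumes "module K M" "module K N"
  shows "mod_span K (tensor K M N) {tens K M N x y | x y. x \<in> carrier M \<and> y \<in> carrier N}
    = carrier (tensor K M N)" (is "mod_span K ?T ?S = _")
proof
  note cr = module_cring[OF assms(1)]
  let ?F = "tensor_pre K M N" and ?I = "tensor_ker K M N"
  note T = module_tensor[OF assms]
  note Fm = module_tensor_pre[OF cr, of M N]
  have S: "?S \<subseteq> carrier ?T" using tens_closed[OF assms] by auto
  show "mod_span K ?T ?S \<subseteq> carrier ?T" by (rule mod_span_carrier[OF T S])
  note p = proj_linear[OF Fm submodule_tensor_ker[OF assms], folded tensor_def]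
  have "?I +>\<^bsub>?F\<^esub> f \<in> mod_span K ?T ?S" if "f \<in> carrier ?F" for f
  proof (rule lin_maps_mod_span[OF p Fm T mod_span_submodule[OF T S]])
    show "f \<in> mod_span K ?F (single K ` (carrier M \<times> carrier N))"
      using that free_mod_span[OF cr, of "carrier M \<times> carrier N"] by (simp add: tensor_pre_def)
    show "single K ` (carrier M \<times> carrier N) \<subseteq> carrier ?F" using tensor_pre_single[OF cr] by auto
  qed (auto simp: tens_def intro!: mod_span_incl)
  then show "carrier ?T \<subseteq> mod_span K ?T ?S" by (auto simp: tensor_def quot_mod_simps)
qed

text \<open>The universal property. Maps out of a tensor product are obtained from it below, which
  avoids bases of tensor products.\<close>

lemma tensor_lift:
  assumes "module K M" "module K N" "module K L" "bilinear_on K M N L f"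
  obtains g where "g \<in> lin_maps K (tensor K M N) L"
    "\<And>x y. x \<in> carrier M \<Longrightarrow> y \<in> carrier N \<Longrightarrow> g (tens K M N x y) = f x y"
proof -
  note cr = module_cring[OF assms(1)]
  interpret M: module K M by fact
  interpret N: module K N by fact
  interpret L: module K L by fact
  let ?F = "tensor_pre K M N" and ?I = "tensor_ker K M N"
  interpret F: module K ?F by (rule module_tensor_pre[OF cr])
  note b1 = lin_mapsD[OF bilinear_onD(1)[OF assms(4)]]
  note b2 = lin_mapsD[OF bilinear_onD(2)[OF assms(4)]]
  define h where "h = lin_ext K L (\<lambda>(x, y). f x y)"
  have h: "h \<in> lin_maps K ?F L"
    unfolding h_def tensor_pre_def by (rule lin_ext_linear[OF assms(3)]) (auto simp: b1)
  have hs: "h (single K (x, y)) = f x y" if "x \<in> carrier M" "y \<in> carrier N" for x y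
    unfolding h_def by (subst lin_ext_single[OF assms(3)]) (use that b1 in auto)
  note s = tensor_pre_single[OF cr, where M = M and N = N]
  note hm = lin_maps_neg[OF h F.module_axioms assms(3)] lin_mapsD[OF h]
  have "tensor_ker K M N \<subseteq> {x \<in> carrier ?F. h x \<in> {\<zero>\<^bsub>L\<^esub>}}"
    unfolding tensor_ker_def Let_def
    by (rule mod_span_least[OF submodule_preimage[OF h F.module_axioms assms(3) submodule_zero[OF assms(3)]]])
      (auto simp: s hm hs b1 b2 a_minus_def L.r_neg)
  then obtain g where "g \<in> lin_maps K (quot_mod ?F ?I) L" "\<And>x. x \<in> carrier ?F \<Longrightarrow> g (?I +>\<^bsub>?F\<^esub> x) = h x"
    using quot_mod_lift[OF F.module_axioms submodule_tensor_ker[OF assms(1,2)] assms(3) h] by blast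
  then show ?thesis using that s hs by (auto simp: tensor_def tens_def)
qed

section \<open>Quotients of linear operads\<close>

text \<open>Associativity, unitality and equivariance play no role for quotients and their isomorphisms.\<close>

definition lin_operad :: "('k, 'm) ring_scheme \<Rightarrow> ('k, 'a) operad \<Rightarrow> bool" where
  "lin_operad K P \<longleftrightarrow> (\<forall>n. module K (part P n)) \<and>
     (\<forall>n \<sigma>. \<sigma> permutes {1..n} \<longrightarrow> (\<lambda>x. sact P n x \<sigma>) \<in> lin_maps K (part P n) (part P n)) \<and>
     (\<forall>m n. \<forall>i\<in>{1..m}. bilinear_on K (part P m) (part P n) (part P (m + n - 1)) (pcomp P m n i)) \<and>
     opunit P \<in> carrier (part P 1)"

lemma lin_operadD:
  assumes "lin_operad K P"
  shows "module K (part P n)"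
    "\<sigma> permutes {1..n} \<Longrightarrow> (\<lambda>x. sact P n x \<sigma>) \<in> lin_maps K (part P n) (part P n)"
    "i \<in> {1..m} \<Longrightarrow> bilinear_on K (part P m) (part P n) (part P (m + n - 1)) (pcomp P m n i)"
    "opunit P \<in> carrier (part P 1)"
  using assms by (auto simp: lin_operad_def)

lemma operad_idealI:
  assumes "\<And>n. submodule (I n) K (part P n)"
    and "\<And>n x \<sigma>. x \<in> I n \<Longrightarrow> \<sigma> permutes {1..n} \<Longrightarrow> sact P n x \<sigma> \<in> I n"
    and "\<And>m n i x y. i \<in> {1..m} \<Longrightarrow> x \<in> I m \<Longrightarrow> y \<in> carrier (part P n) \<Longrightarrow> pcomp P m n i x y \<in> I (m + n - 1)"
    and "\<And>m n i x y. i \<in> {1..m} \<Longrightarrow> x \<in> carrier (part P m) \<Longrightarrow> y \<in> I n \<Longrightarrow> pcomp P m n i x y \<in> I (m + n - 1)"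
  shows "operad_ideal K P I"
  using assms by (auto simp: operad_ideal_def)

lemma operad_idealD:
  assumes "operad_ideal K P I"
  shows "submodule (I n) K (part P n)"
    and "x \<in> I n \<Longrightarrow> \<sigma> permutes {1..n} \<Longrightarrow> sact P n x \<sigma> \<in> I n"
    and "i \<in> {1..m} \<Longrightarrow> x \<in> I m \<Longrightarrow> y \<in> carrier (part P n) \<Longrightarrow> pcomp P m n i x y \<in> I (m + n - 1)"
    and "i \<in> {1..m} \<Longrightarrow> x \<in> carrier (part P m) \<Longrightarrow> y \<in> I n \<Longrightarrow> pcomp P m n i x y \<in> I (m + n - 1)"
  using assms by (auto simp: operad_ideal_def)

lemma operad_ideal_carrier:
  assumes "lin_operad K P" shows "operad_ideal K P (\<lambda>n. carrier (part P n))"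
proof (rule operad_idealI)
  show "submodule (carrier (part P n)) K (part P n)" for n
    by (rule submodule_carrier[OF lin_operadD(1)[OF assms]])
  show "sact P n x \<sigma> \<in> carrier (part P n)"
    if "x \<in> carrier (part P n)" "\<sigma> permutes {1..n}" for n x \<sigma>
    using lin_mapsD(1)[OF lin_operadD(2)[OF assms that(2)] that(1)] .
  show "pcomp P m n i x y \<in> carrier (part P (m + n - 1))"
    if "i \<in> {1..m}" "x \<in> carrier (part P m)" "y \<in> carrier (part P n)" for m n i x y
    using lin_mapsD(1)[OF bilinear_onD(1)[OF lin_operadD(3)[OF assms that(1)] that(2)] that(3)] .
  then show "pcomp P m n i x y \<in> carrier (part P (m + n - 1))"
    if "i \<in> {1..m}" "x \<in> carrier (part P m)" "y \<in> carrier (part P n)" for m n i x y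
    using that .
qed

lemma operad_closed:
  assumes "lin_operad K P"
  shows "x \<in> carrier (part P n) \<Longrightarrow> \<sigma> permutes {1..n} \<Longrightarrow> sact P n x \<sigma> \<in> carrier (part P n)"
    and "i \<in> {1..m} \<Longrightarrow> x \<in> carrier (part P m) \<Longrightarrow> y \<in> carrier (part P n) \<Longrightarrow>
      pcomp P m n i x y \<in> carrier (part P (m + n - 1))"
  using operad_idealD[OF operad_ideal_carrier[OF assms]] by blast+

lemma gen_ideal_incl: "x \<in> R n \<Longrightarrow> x \<in> gen_ideal K P R n"
  by (auto simp: gen_ideal_def)

lemma gen_ideal_least:
  assumes "operad_ideal K P I" "\<And>k. R k \<subseteq> I k" shows "gen_ideal K P R n \<subseteq> I n"
  using assms unfolding gen_ideal_def by blast

lemma gen_ideal_ideal: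
  assumes P: "lin_operad K P" and R: "\<And>n. R n \<subseteq> carrier (part P n)"
  shows "operad_ideal K P (gen_ideal K P R)"
proof (rule operad_idealI)
  note L = gen_ideal_def
  \<comment> \<open>Without an ideal above R the intersection would be over the empty family and
    give the whole type. The family of all carriers is such an ideal.\<close>
  have ne: "{I n | I. operad_ideal K P I \<and> (\<forall>k. R k \<subseteq> I k)} \<noteq> {}" for n
    using operad_ideal_carrier[OF P] R by blast
  show "submodule (gen_ideal K P R n) K (part P n)" for n
    unfolding L
  proof (rule submodule_Int[OF lin_operadD(1)[OF P] _ ne])
    fix H assume "H \<in> {I n | I. operad_ideal K P I \<and> (\<forall>k. R k \<subseteq> I k)}"
    then obtain I where "H = I n" "operad_ideal K P I" by blast
    then show "submodule H K (part P n)" using operad_idealD(1) by metis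
  qed
  show "sact P n x \<sigma> \<in> gen_ideal K P R n"
    if "x \<in> gen_ideal K P R n" "\<sigma> permutes {1..n}" for n x \<sigma>
    unfolding L
  proof (rule InterI, clarify)
    fix I assume I: "operad_ideal K P I" "\<forall>k. R k \<subseteq> I k"
    then have "x \<in> I n" using that(1) unfolding L by blast
    then show "sact P n x \<sigma> \<in> I n" by (rule operad_idealD(2)[OF I(1) _ that(2)])
  qed
  show "pcomp P m n i x y \<in> gen_ideal K P R (m + n - 1)"
    if "i \<in> {1..m}" "x \<in> gen_ideal K P R m" "y \<in> carrier (part P n)" for m n i x y
    unfolding L
  proof (rule InterI, clarify)
    fix I assume I: "operad_ideal K P I" "\<forall>k. R k \<subseteq> I k"
    then have "x \<in> I m" using that(2) unfolding L by blast
    then show "pcomp P m n i x y \<in> I (m + n - 1)" by (rule operad_idealD(3)[OF I(1) that(1) _ that(3)])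
  qed
  show "pcomp P m n i x y \<in> gen_ideal K P R (m + n - 1)"
    if "i \<in> {1..m}" "x \<in> carrier (part P m)" "y \<in> gen_ideal K P R n" for m n i x y
    unfolding L
  proof (rule InterI, clarify)
    fix I assume I: "operad_ideal K P I" "\<forall>k. R k \<subseteq> I k"
    then have "y \<in> I n" using that(3) unfolding L by blast
    then show "pcomp P m n i x y \<in> I (m + n - 1)" by (rule operad_idealD(4)[OF I(1) that(1,2)])
  qed
qed

definition oproj :: "('k, 'a) operad \<Rightarrow> (nat \<Rightarrow> 'a set) \<Rightarrow> nat \<Rightarrow> 'a \<Rightarrow> 'a set" where
  "oproj P I n x = I n +>\<^bsub>part P n\<^esub> x"

lemma oproj_linear:
  assumes "lin_operad K P" "operad_ideal K P I"
  shows "oproj P I n \<in> lin_maps K (part P n) (part (quot_operad P I) n)"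
  unfolding oproj_def[abs_def] quot_operad_def
  using proj_linear[OF lin_operadD(1)[OF assms(1)] operad_idealD(1)[OF assms(2)]] by simp

lemma oproj_surj: "carrier (part (quot_operad P I) n) = oproj P I n ` carrier (part P n)"
  by (simp add: quot_operad_def quot_mod_simps oproj_def[abs_def])

lemma oproj_zero_iff:
  assumes "lin_operad K P" "operad_ideal K P I" "x \<in> carrier (part P n)"
  shows "oproj P I n x = \<zero>\<^bsub>part (quot_operad P I) n\<^esub> \<longleftrightarrow> x \<in> I n"
  using proj_zero_iff[OF lin_operadD(1)[OF assms(1)] operad_idealD(1)[OF assms(2)] assms(3)]
  by (simp add: oproj_def quot_operad_def)

lemma oproj_eq_iff:
  assumes "lin_operad K P" "operad_ideal K P I" "x \<in> carrier (part P n)" "y \<in> carrier (part P n)"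
  shows "oproj P I n x = oproj P I n y \<longleftrightarrow> x \<ominus>\<^bsub>part P n\<^esub> y \<in> I n"
  using coset_eq_iff[OF lin_operadD(1)[OF assms(1)] operad_idealD(1)[OF assms(2)] assms(3,4)]
  by (simp add: oproj_def)

lemma oproj_sact:
  assumes P: "lin_operad K P" and I: "operad_ideal K P I" and x: "x \<in> carrier (part P n)"
    and \<sigma>: "\<sigma> permutes {1..n}"
  shows "sact (quot_operad P I) n (oproj P I n x) \<sigma> = oproj P I n (sact P n x \<sigma>)"
proof -
  note M = lin_operadD(1)[OF P, of n]
  have "(\<Union>y\<in>oproj P I n x. oproj P I n (sact P n y \<sigma>)) = oproj P I n (sact P n x \<sigma>)"
    unfolding oproj_def[of P I n x]
  proof (rule UN_coset[OF M operad_idealD(1)[OF I] x])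
    fix y assume y: "y \<in> carrier (part P n)" "I n +>\<^bsub>part P n\<^esub> y = I n +>\<^bsub>part P n\<^esub> x"
    then have "y \<ominus>\<^bsub>part P n\<^esub> x \<in> I n"
      using oproj_eq_iff[OF P I y(1) x] by (simp add: oproj_def)
    then have "sact P n (y \<ominus>\<^bsub>part P n\<^esub> x) \<sigma> \<in> I n" by (rule operad_idealD(2)[OF I _ \<sigma>])
    then show "oproj P I n (sact P n y \<sigma>) = oproj P I n (sact P n x \<sigma>)"
      using lin_maps_minus[OF lin_operadD(2)[OF P \<sigma>] M M y(1) x] oproj_eq_iff[OF P I]
        operad_closed(1)[OF P _ \<sigma>] x y by simp
  qed
  then show ?thesis by (simp add: quot_operad_def oproj_def)
qed

text \<open>Independence of representatives in two moves: a change of y is absorbed by the ideal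
  condition on the second argument, a change of x by the one on the first.\<close>

lemma oproj_pcomp:
  assumes P: "lin_operad K P" and I: "operad_ideal K P I" and i: "i \<in> {1..m}"
    and x: "x \<in> carrier (part P m)" and y: "y \<in> carrier (part P n)"
  shows "pcomp (quot_operad P I) m n i (oproj P I m x) (oproj P I n y) =
    oproj P I (m + n - 1) (pcomp P m n i x y)"
proof -
  note M = lin_operadD(1)[OF P]
  let ?q = "oproj P I (m + n - 1)"
  note B = lin_operadD(3)[OF P i]
  note cl = operad_closed(2)[OF P i]
  have 1: "?q (pcomp P m n i x' y') = ?q (pcomp P m n i x' y)"
    if x': "x' \<in> carrier (part P m)" and y': "y' \<in> carrier (part P n)" "oproj P I n y' = oproj P I n y" for x' y'
  proof -
    have "y' \<ominus>\<^bsub>part P n\<^esub> y \<in> I n" using oproj_eq_iff[OF P I y'(1) y] y' by simp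
    then have "pcomp P m n i x' (y' \<ominus>\<^bsub>part P n\<^esub> y) \<in> I (m + n - 1)"
      by (rule operad_idealD(4)[OF I i x'])
    then show ?thesis
      using lin_maps_minus[OF bilinear_onD(1)[OF B x'] M M y'(1) y] oproj_eq_iff[OF P I] cl x' y y' by simp
  qed
  have 2: "?q (pcomp P m n i x' y) = ?q (pcomp P m n i x y)"
    if x': "x' \<in> carrier (part P m)" "oproj P I m x' = oproj P I m x" for x'
  proof -
    have "x' \<ominus>\<^bsub>part P m\<^esub> x \<in> I m" using oproj_eq_iff[OF P I x'(1) x] x' by simp
    then have "pcomp P m n i (x' \<ominus>\<^bsub>part P m\<^esub> x) y \<in> I (m + n - 1)"
      by (rule operad_idealD(3)[OF I i _ y])
    then show ?thesis
      using lin_maps_minus[OF bilinear_onD(2)[OF B y] M M x'(1) x] oproj_eq_iff[OF P I] cl x y x' by simp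
  qed
  have 3: "(\<Union>y'\<in>oproj P I n y. ?q (pcomp P m n i x' y')) = ?q (pcomp P m n i x' y)"
    if "x' \<in> carrier (part P m)" for x'
    unfolding oproj_def[of P I n y]
    by (rule UN_coset[OF M operad_idealD(1)[OF I] y], rule 1[OF that]) (auto simp: oproj_def)
  have "(\<Union>x'\<in>oproj P I m x. \<Union>y'\<in>oproj P I n y. ?q (pcomp P m n i x' y'))
      = (\<Union>x'\<in>oproj P I m x. ?q (pcomp P m n i x' y))"
    using coset_mem(1)[OF M operad_idealD(1)[OF I] x] 3 by (auto simp: oproj_def[of P I m x])
  also have "\<dots> = ?q (pcomp P m n i x y)"
    unfolding oproj_def[of P I m x]
    by (rule UN_coset[OF M operad_idealD(1)[OF I] x], rule 2) (auto simp: oproj_def)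
  finally show ?thesis by (simp add: quot_operad_def oproj_def)
qed

text \<open>Linearity can be tested after composing with a surjection, i.e. on representatives. This
  serves the quotient operations and also inverses of linear bijections.\<close>

lemma lin_maps_quotientI:
  assumes q: "q \<in> lin_maps K M N" "q ` carrier M = carrier N"
    and f: "(\<lambda>x. f (q x)) \<in> lin_maps K M L" and M: "module K M"
  shows "f \<in> lin_maps K N L"
proof (rule lin_mapsI)
  interpret M: module K M by fact
  have ex: "\<exists>x\<in>carrier M. y = q x" if "y \<in> carrier N" for y using that q(2) by auto
  fix x assume "x \<in> carrier N"
  then obtain x' where x: "x' \<in> carrier M" "x = q x'" by (meson ex)
  show "f x \<in> carrier L" using lin_mapsD(1)[OF f] x by simp
  show "f (a \<odot>\<^bsub>N\<^esub> x) = a \<odot>\<^bsub>L\<^esub> f x" if "a \<in> carrier K" for a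
    using lin_mapsD(3)[OF f that x(1)] lin_mapsD(3)[OF q(1) that x(1)] x by simp
  fix y assume "y \<in> carrier N"
  then obtain y' where y: "y' \<in> carrier M" "y = q y'" by (meson ex)
  show "f (x \<oplus>\<^bsub>N\<^esub> y) = f x \<oplus>\<^bsub>L\<^esub> f y"
    using lin_mapsD(2)[OF f x(1) y(1)] lin_mapsD(2)[OF q(1) x(1) y(1)] x y by simp
qed

lemma lin_operad_quot:
  assumes P: "lin_operad K P" and I: "operad_ideal K P I"
  shows "lin_operad K (quot_operad P I)" (is "lin_operad K ?Q")
proof -
  note M = lin_operadD(1)[OF P]
  note q = oproj_linear[OF P I]
  have 1: "module K (part ?Q n)" for n
    using module_quot_mod[OF M operad_idealD(1)[OF I]] by (simp add: quot_operad_def)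
  have 2: "(\<lambda>x. sact ?Q n x \<sigma>) \<in> lin_maps K (part ?Q n) (part ?Q n)"
    if \<sigma>: "\<sigma> permutes {1..n}" for n \<sigma>
  proof (rule lin_maps_quotientI[OF q oproj_surj[symmetric] _ M])
    show "(\<lambda>x. sact ?Q n (oproj P I n x) \<sigma>) \<in> lin_maps K (part P n) (part ?Q n)"
      by (rule lin_maps_cong[OF lin_maps_compose[OF lin_operadD(2)[OF P \<sigma>] q] M])
        (simp add: oproj_sact[OF P I _ \<sigma>])
  qed
  have 3: "bilinear_on K (part ?Q m) (part ?Q n) (part ?Q (m + n - 1)) (pcomp ?Q m n i)"
    if i: "i \<in> {1..m}" for m n i
    unfolding bilinear_on_def oproj_surj
  proof safe
    fix x assume x: "x \<in> carrier (part P m)"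
    show "pcomp ?Q m n i (oproj P I m x) \<in> lin_maps K (part ?Q n) (part ?Q (m + n - 1))"
      by (rule lin_maps_quotientI[OF q oproj_surj[symmetric] _ M],
          rule lin_maps_cong[OF lin_maps_compose[OF bilinear_onD(1)[OF lin_operadD(3)[OF P i] x] q] M])
        (simp add: oproj_pcomp[OF P I i x])
  next
    fix y assume y: "y \<in> carrier (part P n)"
    show "(\<lambda>x. pcomp ?Q m n i x (oproj P I n y)) \<in> lin_maps K (part ?Q m) (part ?Q (m + n - 1))"
      by (rule lin_maps_quotientI[OF q oproj_surj[symmetric] _ M],
          rule lin_maps_cong[OF lin_maps_compose[OF bilinear_onD(2)[OF lin_operadD(3)[OF P i] y] q] M])
        (simp add: oproj_pcomp[OF P I i _ y])
  qed
  have 4: "opunit ?Q = oproj P I 1 (opunit P)" by (simp add: quot_operad_def oproj_def)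
  then have "opunit ?Q \<in> carrier (part ?Q 1)" using lin_operadD(4)[OF P] oproj_surj by fastforce
  then show ?thesis using 1 2 3 by (auto simp: lin_operad_def)
qed

subsection \<open>Isomorphisms\<close>

lemma operad_isoD:
  assumes "f \<in> operad_iso K P Q"
  shows "f n \<in> lin_maps K (part P n) (part Q n)"
    "bij_betw (f n) (carrier (part P n)) (carrier (part Q n))"
    "x \<in> carrier (part P n) \<Longrightarrow> \<sigma> permutes {1..n} \<Longrightarrow> f n (sact P n x \<sigma>) = sact Q n (f n x) \<sigma>"
    "i \<in> {1..m} \<Longrightarrow> x \<in> carrier (part P m) \<Longrightarrow> y \<in> carrier (part P n) \<Longrightarrow>
      f (m + n - 1) (pcomp P m n i x y) = pcomp Q m n i (f m x) (f n y)"
    "f 1 (opunit P) = opunit Q"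
  using assms by (auto simp: operad_iso_def)

lemma operad_iso_ideal_image:
  assumes P: "lin_operad K P" and Q: "lin_operad K Q" and f: "f \<in> operad_iso K P Q" and I: "operad_ideal K P I"
  shows "operad_ideal K Q (\<lambda>n. f n ` I n)"
proof (rule operad_idealI)
  note D = operad_isoD[OF f]
  note Ic = submoduleD(1)[OF operad_idealD(1)[OF I]]
  note L = lin_mapsD[OF D(1)]
  show "submodule (f n ` I n) K (part Q n)" for n
  proof (rule mod_submoduleI[OF lin_operadD(1)[OF Q]])
    show "f n ` I n \<subseteq> carrier (part Q n)" using Ic L(1) by blast
    show "\<zero>\<^bsub>part Q n\<^esub> \<in> f n ` I n"
      using lin_maps_zero[OF D(1) lin_operadD(1)[OF P] lin_operadD(1)[OF Q]]
        submoduleD(2)[OF operad_idealD(1)[OF I]] by (metis imageI)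
    show "a \<oplus>\<^bsub>part Q n\<^esub> b \<in> f n ` I n" if "a \<in> f n ` I n" "b \<in> f n ` I n" for a b
      
    proof -
      obtain a' b' where ab: "a' \<in> I n" "a = f n a'" "b' \<in> I n" "b = f n b'" using \<open>a \<in> f n ` I n\<close> \<open>b \<in> f n ` I n\<close> by blast
      then show ?thesis
        using L(2)[OF Ic[OF ab(1)] Ic[OF ab(3)]] submoduleD(3)[OF operad_idealD(1)[OF I] ab(1,3)] by (metis imageI)
    qed
    show "c \<odot>\<^bsub>part Q n\<^esub> b \<in> f n ` I n" if "c \<in> carrier K" "b \<in> f n ` I n" for c b
      
    proof -
      obtain b' where b: "b' \<in> I n" "b = f n b'" using \<open>b \<in> f n ` I n\<close> by blast
      then show ?thesis
        using L(3)[OF that(1) Ic[OF b(1)]] submoduleD(4)[OF operad_idealD(1)[OF I] that(1) b(1)] by (metis imageI)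
    qed
  qed
  show "sact Q n x \<sigma> \<in> f n ` I n" if "x \<in> f n ` I n" "\<sigma> permutes {1..n}" for n x \<sigma>

  proof -
    obtain x' where x: "x' \<in> I n" "x = f n x'" using \<open>x \<in> f n ` I n\<close> by blast
    then show ?thesis
      using D(3)[OF Ic[OF x(1)] that(2)] operad_idealD(2)[OF I x(1) that(2)] by (metis imageI)
  qed
  \<comment> \<open>Surjectivity is what makes the image an ideal: the other factor of a composite
    in Q has to come from P as well.\<close>
  have ex: "\<exists>x\<in>carrier (part P n). y = f n x" if "y \<in> carrier (part Q n)" for y n
    using that D(2)[of n] by (auto simp: bij_betw_def)
  show "pcomp Q m n i x y \<in> f (m + n - 1) ` I (m + n - 1)"
    if "i \<in> {1..m}" "x \<in> f m ` I m" "y \<in> carrier (part Q n)" for m n i x y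
  proof -
    note t = that
    obtain x' y' where xy: "x' \<in> I m" "x = f m x'" "y' \<in> carrier (part P n)" "y = f n y'"
      using t(2) ex[OF t(3)] by blast
    then show ?thesis
      using D(4)[OF that(1) Ic[OF xy(1)] xy(3)] operad_idealD(3)[OF I that(1) xy(1,3)] by (metis imageI)
  qed
  show "pcomp Q m n i x y \<in> f (m + n - 1) ` I (m + n - 1)"
    if "i \<in> {1..m}" "x \<in> carrier (part Q m)" "y \<in> f n ` I n" for m n i x y
  proof -
    note t = that
    obtain x' y' where xy: "x' \<in> carrier (part P m)" "x = f m x'" "y' \<in> I n" "y = f n y'"
      using t(3) ex[OF t(2)] by blast
    then show ?thesis
      using D(4)[OF that(1) xy(1) Ic[OF xy(3)]] operad_idealD(4)[OF I that(1) xy(1,3)] by (metis imageI)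
  qed
qed

lemma operad_iso_ideal_preimage:
  assumes P: "lin_operad K P" and Q: "lin_operad K Q" and f: "f \<in> operad_iso K P Q" and I: "operad_ideal K Q I"
  shows "operad_ideal K P (\<lambda>n. {x \<in> carrier (part P n). f n x \<in> I n})"
proof (rule operad_idealI)
  note D = operad_isoD[OF f]
  note L = lin_mapsD[OF D(1)]
  show "submodule {x \<in> carrier (part P n). f n x \<in> I n} K (part P n)" for n
    by (rule submodule_preimage[OF D(1) lin_operadD(1)[OF P] lin_operadD(1)[OF Q] operad_idealD(1)[OF I]])
  show "sact P n x \<sigma> \<in> {x \<in> carrier (part P n). f n x \<in> I n}"
    if "x \<in> {x \<in> carrier (part P n). f n x \<in> I n}" "\<sigma> permutes {1..n}" for n x \<sigma>
    using that operad_closed(1)[OF P _ that(2)] operad_idealD(2)[OF I _ that(2)] by (simp add: D(3))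
  show "pcomp P m n i x y \<in> {x \<in> carrier (part P (m + n - 1)). f (m + n - 1) x \<in> I (m + n - 1)}"
    if "i \<in> {1..m}" "x \<in> {x \<in> carrier (part P m). f m x \<in> I m}" "y \<in> carrier (part P n)" for m n i x y
  proof -
    have x: "x \<in> carrier (part P m)" "f m x \<in> I m" using that(2) by auto
    show ?thesis
      using operad_closed(2)[OF P that(1) x(1) that(3)] D(4)[OF that(1) x(1) that(3)]
        operad_idealD(3)[OF I that(1) x(2) L(1)[OF that(3)]] by simp
  qed
  show "pcomp P m n i x y \<in> {x \<in> carrier (part P (m + n - 1)). f (m + n - 1) x \<in> I (m + n - 1)}"
    if "i \<in> {1..m}" "x \<in> carrier (part P m)" "y \<in> {x \<in> carrier (part P n). f n x \<in> I n}" for m n i x y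
  proof -
    have y: "y \<in> carrier (part P n)" "f n y \<in> I n" using that(3) by auto
    show ?thesis
      using operad_closed(2)[OF P that(1,2) y(1)] D(4)[OF that(1,2) y(1)]
        operad_idealD(4)[OF I that(1) L(1)[OF that(2)] y(2)] by simp
  qed
qed

text \<open>Minimality of a generated ideal is used twice, once for the preimage of the ideal of S
  and once for the image of the ideal of R. Generators therefore have to match only up to the
  generated ideals.\<close>

lemma operad_iso_gen_ideal:
  assumes P: "lin_operad K P" and Q: "lin_operad K Q" and f: "f \<in> operad_iso K P Q"
    and R: "\<And>n. R n \<subseteq> carrier (part P n)" and S: "\<And>n. S n \<subseteq> carrier (part Q n)"
    and RS: "\<And>n x. x \<in> R n \<Longrightarrow> f n x \<in> gen_ideal K Q S n"
    and SR: "\<And>n y. y \<in> S n \<Longrightarrow> \<exists>x\<in>gen_ideal K P R n. y = f n x"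
  shows "f n ` gen_ideal K P R n = gen_ideal K Q S n"
proof
  have "gen_ideal K P R n \<subseteq> {x \<in> carrier (part P n). f n x \<in> gen_ideal K Q S n}"
    by (rule gen_ideal_least[OF operad_iso_ideal_preimage[OF P Q f gen_ideal_ideal[where R = S, OF Q S]]])
      (use R RS in auto)
  then show "f n ` gen_ideal K P R n \<subseteq> gen_ideal K Q S n" by auto
  show "gen_ideal K Q S n \<subseteq> f n ` gen_ideal K P R n"
    by (rule gen_ideal_least[OF operad_iso_ideal_image[OF P Q f gen_ideal_ideal[where R = R, OF P R]]])
      (use SR in auto)
qed

lemma operad_iso_quot:
  assumes P: "lin_operad K P" and Q: "lin_operad K Q" and f: "f \<in> operad_iso K P Q"
    and I: "operad_ideal K P I" and J: "operad_ideal K Q J" and fI: "\<And>n. f n ` I n = J n"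
  obtains g where "g \<in> operad_iso K (quot_operad P I) (quot_operad Q J)"
    "\<And>n x. x \<in> carrier (part P n) \<Longrightarrow> g n (oproj P I n x) = oproj Q J n (f n x)"
proof -
  note D = operad_isoD[OF f]
  note L = lin_mapsD[OF D(1)]
  let ?P = "quot_operad P I" and ?Q = "quot_operad Q J"
  note mP = lin_operadD(1)[OF P] and mQ = lin_operadD(1)[OF Q]
  note lQ = lin_operad_quot[OF Q J] and lP = lin_operad_quot[OF P I]
  have "\<exists>g. g \<in> lin_maps K (part ?P n) (part ?Q n) \<and>
      (\<forall>x\<in>carrier (part P n). g (oproj P I n x) = oproj Q J n (f n x))" for n
  proof -
    have z: "oproj Q J n (f n x) = \<zero>\<^bsub>part ?Q n\<^esub>" if "x \<in> I n" for x
      using that fI[of n] oproj_zero_iff[OF Q J] submoduleD(1)[OF operad_idealD(1)[OF I]] L(1) by auto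
    obtain g where "g \<in> lin_maps K (quot_mod (part P n) (I n)) (part ?Q n)"
      "\<And>x. x \<in> carrier (part P n) \<Longrightarrow> g (I n +>\<^bsub>part P n\<^esub> x) = oproj Q J n (f n x)"
      using quot_mod_lift[OF mP operad_idealD(1)[OF I] lin_operadD(1)[OF lQ]
          lin_maps_compose[OF D(1) oproj_linear[OF Q J]] z] by blast
    then show ?thesis by (auto simp: quot_operad_def oproj_def)
  qed
  then obtain g where g: "\<And>n. g n \<in> lin_maps K (part ?P n) (part ?Q n)"
    and gx: "\<And>n x. x \<in> carrier (part P n) \<Longrightarrow> g n (oproj P I n x) = oproj Q J n (f n x)"
    by metis
  have "g \<in> operad_iso K ?P ?Q"
    unfolding operad_iso_def
  proof (intro CollectI conjI allI ballI impI)
    fix n show "g n \<in> lin_maps K (part ?P n) (part ?Q n)" by (rule g)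
    show "bij_betw (g n) (carrier (part ?P n)) (carrier (part ?Q n))"
      unfolding bij_betw_def
    proof
      show "inj_on (g n) (carrier (part ?P n))"
      proof (rule inj_onI)
        fix X Y assume "X \<in> carrier (part ?P n)" "Y \<in> carrier (part ?P n)" "g n X = g n Y"
        then obtain x y where x: "x \<in> carrier (part P n)" and y: "y \<in> carrier (part P n)"
          and XY: "X = oproj P I n x" "Y = oproj P I n y"
          and "g n (oproj P I n x) = g n (oproj P I n y)" by (auto simp: oproj_surj)
        then have "f n x \<ominus>\<^bsub>part Q n\<^esub> f n y \<in> J n"
          using gx oproj_eq_iff[OF Q J] L(1) by metis
        then have "f n (x \<ominus>\<^bsub>part P n\<^esub> y) \<in> f n ` I n"
          using lin_maps_minus[OF D(1) mP mQ x y] fI by simp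
        moreover have "x \<ominus>\<^bsub>part P n\<^esub> y \<in> carrier (part P n)"
          using submodule_minus[OF submodule_carrier[OF mP] mP x y] .
        \<comment> \<open>Injectivity of f pulls membership in the image of I back to membership in
          I.\<close>
        ultimately have "x \<ominus>\<^bsub>part P n\<^esub> y \<in> I n"
          using D(2)[of n] submoduleD(1)[OF operad_idealD(1)[OF I]] by (auto simp: bij_betw_def dest: inj_onD)
        then show "X = Y" using oproj_eq_iff[OF P I x y] XY by simp
      qed
      show "g n ` carrier (part ?P n) = carrier (part ?Q n)"
      proof -
        have "g n ` carrier (part ?P n) = (\<lambda>x. oproj Q J n (f n x)) ` carrier (part P n)"
          unfolding oproj_surj image_image by (rule image_cong[OF refl gx])
        also have "\<dots> = oproj Q J n ` (f n ` carrier (part P n))" by (simp add: image_image)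
        also have "f n ` carrier (part P n) = carrier (part Q n)" using D(2)[of n] by (simp add: bij_betw_def)
        finally show ?thesis by (simp add: oproj_surj)
      qed
    qed
  next
    fix n x \<sigma> assume x: "x \<in> carrier (part ?P n)" and s: "\<sigma> permutes {1..n}"
    then obtain y where y: "y \<in> carrier (part P n)" "x = oproj P I n y" by (auto simp: oproj_surj)
    then show "g n (sact ?P n x \<sigma>) = sact ?Q n (g n x) \<sigma>"
      using s by (simp add: oproj_sact[OF P I] oproj_sact[OF Q J] gx operad_closed[OF P] D L)
  next
    fix m n i x y assume i: "i \<in> {1..m}" and "x \<in> carrier (part ?P m)" "y \<in> carrier (part ?P n)"
    then obtain x' y' where "x' \<in> carrier (part P m)" "x = oproj P I m x'"
      "y' \<in> carrier (part P n)" "y = oproj P I n y'" by (auto simp: oproj_surj)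
    then show "g (m + n - 1) (pcomp ?P m n i x y) = pcomp ?Q m n i (g m x) (g n y)"
      by (simp add: oproj_pcomp[OF P I i] oproj_pcomp[OF Q J i] gx operad_closed(2)[OF P i] D(4)[OF i] L del: One_nat_def)
  next
    have "opunit ?P = oproj P I 1 (opunit P)" "opunit ?Q = oproj Q J 1 (opunit Q)"
      by (simp_all add: quot_operad_def oproj_def)
    then show "g 1 (opunit ?P) = opunit ?Q" using gx lin_operadD(4)[OF P] D(5) by simp
  qed
  then show ?thesis using that gx by blast
qed

text \<open>From here on 1 occurs as an arity and as a leaf label; rewriting it to
  \<open>Suc 0\<close> would spoil the matching of such terms.\<close>

declare One_nat_def [simp del]

section \<open>The tree operad\<close>

lemma leaves_leaf_subst: "leaves (leaf_subst h t) = concat (map (\<lambda>i. leaves (h i)) (leaves t))"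
proof (induction t)
  case (Node v ts)
  then have "concat (map (\<lambda>t. leaves (leaf_subst h t)) ts) =
      concat (map (\<lambda>t. concat (map (\<lambda>i. leaves (h i)) (leaves t))) ts)"
    by (auto cong: map_cong)
  also have "\<dots> = concat (map (\<lambda>i. leaves (h i)) (concat (map leaves ts)))"
    by (induction ts) auto
  finally show ?case by (simp add: o_def)
qed auto

lemma leaf_subst_compose: "leaf_subst g (leaf_subst h t) = leaf_subst (\<lambda>i. leaf_subst g (h i)) t"
  by (induction t) auto

lemma leaf_subst_cong: "(\<And>i. i \<in> set (leaves t) \<Longrightarrow> h i = g i) \<Longrightarrow> leaf_subst h t = leaf_subst g t"
  by (induction t) auto

lemma leaf_subst_Leaf: "leaf_subst Leaf t = t"
  by (induction t) (auto simp: map_idI)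

lemma decorated_leaf_subst:
  "decorated D t \<Longrightarrow> (\<And>i. i \<in> set (leaves t) \<Longrightarrow> decorated D (h i)) \<Longrightarrow> decorated D (leaf_subst h t)"
  by (induction t) auto

lemma relabel_simps [simp]:
  "relabel f (Leaf i) = Leaf (f i)" "relabel f (Node v ts) = Node v (map (relabel f) ts)"
  by (auto simp: relabel_def)

lemma leaves_relabel [simp]: "leaves (relabel f t) = map f (leaves t)"
  by (simp add: relabel_def leaves_leaf_subst)

lemma relabel_cong: "(\<And>i. i \<in> set (leaves t) \<Longrightarrow> f i = g i) \<Longrightarrow> relabel f t = relabel g t"
  unfolding relabel_def by (rule leaf_subst_cong) auto

lemma relabel_relabel: "relabel f (relabel g t) = relabel (\<lambda>i. f (g i)) t"
  by (simp add: relabel_def leaf_subst_compose)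

lemma relabel_leaf_subst: "relabel f (leaf_subst h t) = leaf_subst (\<lambda>i. relabel f (h i)) t"
  by (simp add: relabel_def leaf_subst_compose)

lemma leaf_subst_relabel: "leaf_subst h (relabel f t) = leaf_subst (\<lambda>i. h (f i)) t"
  by (simp add: relabel_def leaf_subst_compose)

lemma relabel_id: "(\<And>i. i \<in> set (leaves t) \<Longrightarrow> f i = i) \<Longrightarrow> relabel f t = t"
  using leaf_subst_cong[of t "\<lambda>i. Leaf (f i)" Leaf] leaf_subst_Leaf[of t] by (simp add: relabel_def)

lemma decorated_relabel [simp]: "decorated D (relabel f t) = decorated D t"
  by (induction t) auto

lemma ptrees_relabel:
  assumes "decorated D t" "distinct (leaves t)" "bij_betw f (set (leaves t)) {1..n}"
  shows "relabel f t \<in> ptrees D n"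
  using assms by (auto simp: ptrees_def distinct_map bij_betw_def)

lemma ptrees_permute:
  assumes "t \<in> ptrees D n" "\<sigma> permutes {1..n}" shows "relabel \<sigma> t \<in> ptrees D n"
  using assms ptrees_relabel[of D t \<sigma> n] permutes_imp_bij[OF assms(2)] by (auto simp: ptrees_def)

lemma distinct_concat_map:
  "distinct xs \<Longrightarrow> (\<And>x. x \<in> set xs \<Longrightarrow> distinct (F x)) \<Longrightarrow>
    (\<And>x y. x \<in> set xs \<Longrightarrow> y \<in> set xs \<Longrightarrow> x \<noteq> y \<Longrightarrow> set (F x) \<inter> set (F y) = {}) \<Longrightarrow>
    distinct (concat (map F xs))"
proof (induction xs)
  case (Cons x xs)
  have "set (F x) \<inter> set (F y) = {}" if "y \<in> set xs" for y
    using Cons.prems(1) that by (intro Cons.prems(3)) auto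
  moreover have "distinct (concat (map F xs))" 
    using Cons.prems by (intro Cons.IH) auto
  ultimately show ?case using Cons.prems(2) by auto
qed auto

lemma leaves_graft:
  "leaves (graft n i t u) = concat (map (\<lambda>j. if j < i then [j] else if j = i then
     map (\<lambda>k. k + i - 1) (leaves u) else [j + n - 1]) (leaves t))"
  unfolding graft_def leaves_leaf_subst by (rule arg_cong[of _ _ concat]) auto

lemma graft_ptrees:
  assumes t: "t \<in> ptrees D m" and u: "u \<in> ptrees D n" and i: "i \<in> {1..m}"
  shows "graft n i t u \<in> ptrees D (m + n - 1)"
proof -
  have t': "decorated D t" "distinct (leaves t)" "set (leaves t) = {1..m}"
    and u': "decorated D u" "distinct (leaves u)" "set (leaves u) = {1..n}"
    using t u by (auto simp: ptrees_def)
  have "decorated D (graft n i t u)"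
    unfolding graft_def by (rule decorated_leaf_subst) (use t' u' in auto)
  moreover have "distinct (leaves (graft n i t u))"
    unfolding leaves_graft
  proof (rule distinct_concat_map[OF t'(2)])
    show "distinct (if j < i then [j] else if j = i then map (\<lambda>k. k + i - 1) (leaves u) else [j + n - 1])" for j
      using u' i by (auto simp: distinct_map intro!: inj_onI)
  qed (use t' u' i in \<open>auto split: if_splits\<close>)
  moreover have "set (leaves (graft n i t u)) = {1..m + n - 1}"
  proof
    show "set (leaves (graft n i t u)) \<subseteq> {1..m + n - 1}"
      unfolding leaves_graft using t' u' i by (auto split: if_splits)
    show "{1..m + n - 1} \<subseteq> set (leaves (graft n i t u))"
    proof
      fix x assume x: "x \<in> {1..m + n - 1}"
      \<comment> \<open>The leaf of t from which the label x arises: labels below i stay, the n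
        labels from i on come from u, and \<open>x + 1 - n\<close> inverts the shift of the
        remaining ones.\<close>
      define j where "j = (if x < i then x else if x < i + n then i else x + 1 - n)"
      have "j \<in> {1..m}" using x i by (auto simp: j_def)
      moreover have "x \<in> set (if j < i then [j] else if j = i then map (\<lambda>k. k + i - 1) (leaves u) else [j + n - 1])"
        (is "_ \<in> set (?F j)")
      proof (cases "i \<le> x \<and> x < i + n")
        case True
        then have "j = i" "x = (x + 1 - i) + i - 1" "x + 1 - i \<in> {1..n}" using i by (auto simp: j_def)
        then show ?thesis using u'(3) by auto
      next
        case False
        then show ?thesis using x i by (auto simp: j_def)
      qed
      ultimately have "x \<in> (\<Union>j\<in>{1..m}. set (?F j))" by blast
      then show "x \<in> set (leaves (graft n i t u))"
        by (simp only: leaves_graft set_concat set_map t'(3) image_image)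
    qed
  qed
  ultimately show ?thesis by (simp add: ptrees_def)
qed

lemma tree_part: "part (tree_operad K D) n = free_mod K (ptrees D n)"
  by (simp add: tree_operad_def)

lemma tree_single_closed: "cring K \<Longrightarrow> t \<in> ptrees D n \<Longrightarrow> single K t \<in> carrier (part (tree_operad K D) n)"
  by (simp add: tree_part single_closed)

lemma ptrees_inv_permute:
  assumes "t \<in> ptrees D n" "\<sigma> permutes {1..n}" shows "relabel (inv_into UNIV \<sigma>) t \<in> ptrees D n"
  using ptrees_permute[OF assms(1) permutes_inv[OF assms(2)]] .

lemma tree_sact_single:
  assumes "cring K" "t \<in> ptrees D n" "\<sigma> permutes {1..n}"
  shows "sact (tree_operad K D) n (single K t) \<sigma> = single K (relabel (inv_into UNIV \<sigma>) t)"
  unfolding tree_operad_def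
  using lin_ext_single[OF module_free_mod[OF assms(1)], of "\<lambda>t. single K (relabel (inv_into UNIV \<sigma>) t)" t "ptrees D n"]
    single_closed[OF assms(1) ptrees_inv_permute[OF assms(2,3)]] by simp

lemma Leaf_ptrees: "Leaf 1 \<in> ptrees D 1"
  by (auto simp: ptrees_def)

lemma corolla_ptrees: "v \<in> D n \<Longrightarrow> corolla n v \<in> ptrees D n"
proof -
  have "leaves (corolla n v) = [1..<Suc n]" by (simp add: corolla_def o_def del: upt_Suc)
  then show "v \<in> D n \<Longrightarrow> corolla n v \<in> ptrees D n"
    by (auto simp: ptrees_def corolla_def simp del: upt_Suc)
qed

context
  fixes K :: "('k, 'm) ring_scheme" and D :: "nat \<Rightarrow> 'v set"
  assumes K: "cring K"
begin

lemma tree_inner_linear: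
  assumes "t \<in> ptrees D m" "i \<in> {1..m}"
  shows "lin_ext K (free_mod K (ptrees D (m + n - 1))) (\<lambda>u. single K (graft n i t u))
    \<in> lin_maps K (free_mod K (ptrees D n)) (free_mod K (ptrees D (m + n - 1)))"
  by (rule lin_ext_linear[OF module_free_mod[OF K]]) (use assms in \<open>auto intro!: single_closed[OF K] graft_ptrees\<close>)

lemma tree_pcomp_linear:
  assumes "y \<in> carrier (free_mod K (ptrees D n))" "i \<in> {1..m}"
  shows "(\<lambda>x. pcomp (tree_operad K D) m n i x y)
    \<in> lin_maps K (free_mod K (ptrees D m)) (free_mod K (ptrees D (m + n - 1)))"
proof -
  have "lin_ext K (free_mod K (ptrees D (m + n - 1)))
       (\<lambda>t. lin_ext K (free_mod K (ptrees D (m + n - 1))) (\<lambda>u. single K (graft n i t u)) y)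
    \<in> lin_maps K (free_mod K (ptrees D m)) (free_mod K (ptrees D (m + n - 1)))"
    by (rule lin_ext_linear[OF module_free_mod[OF K]])
      (use lin_mapsD(1)[OF tree_inner_linear[OF _ assms(2)] assms(1)] in auto)
  then show ?thesis by (simp add: tree_operad_def Let_def)
qed

lemma tree_pcomp_single_left:
  assumes "t \<in> ptrees D m" "y \<in> carrier (free_mod K (ptrees D n))" "i \<in> {1..m}"
  shows "pcomp (tree_operad K D) m n i (single K t) y =
     lin_ext K (free_mod K (ptrees D (m + n - 1))) (\<lambda>u. single K (graft n i t u)) y"
  using lin_ext_single[OF module_free_mod[OF K], of _ t] lin_mapsD(1)[OF tree_inner_linear[OF assms(1,3)] assms(2)]
  by (simp add: tree_operad_def Let_def)

lemma tree_pcomp_single: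
  assumes "t \<in> ptrees D m" "u \<in> ptrees D n" "i \<in> {1..m}"
  shows "pcomp (tree_operad K D) m n i (single K t) (single K u) = single K (graft n i t u)"
  using tree_pcomp_single_left[OF assms(1) single_closed[OF K assms(2)] assms(3)]
    lin_ext_single[OF module_free_mod[OF K], of "\<lambda>u. single K (graft n i t u)" u]
    single_closed[OF K graft_ptrees[OF assms]] by simp

text \<open>In \<open>pcomp\<close> the argument y is hidden below the extension in x. Both sides of
  each law are linear in x, so they may be compared at single trees x, where y stands under one
  \<open>lin_ext\<close> only.\<close>

lemma tree_pcomp_linear_right:
  assumes x: "x \<in> carrier (free_mod K (ptrees D m))" and i: "i \<in> {1..m}"
  shows "pcomp (tree_operad K D) m n i x
    \<in> lin_maps K (free_mod K (ptrees D n)) (free_mod K (ptrees D (m + n - 1)))"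
proof (rule lin_mapsI)
  let ?M = "free_mod K (ptrees D m)" and ?N = "free_mod K (ptrees D n)"
  let ?F = "free_mod K (ptrees D (m + n - 1))"
  note mM = module_free_mod[OF K, of "ptrees D m"] and mN = module_free_mod[OF K, of "ptrees D n"]
    and mF = module_free_mod[OF K, of "ptrees D (m + n - 1)"]
  note lin = tree_pcomp_linear[OF _ i, where n = n]
  note inner = lin_mapsD[OF tree_inner_linear[OF _ i, where n = n]]
  interpret N: module K ?N by (rule mN)
  fix y assume y: "y \<in> carrier ?N"
  show "pcomp (tree_operad K D) m n i x y \<in> carrier ?F" by (rule lin_mapsD(1)[OF lin[OF y] x])
  fix z assume z: "z \<in> carrier ?N"
  have yz: "y \<oplus>\<^bsub>?N\<^esub> z \<in> carrier ?N" using y z by simp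
  show "pcomp (tree_operad K D) m n i x (y \<oplus>\<^bsub>?N\<^esub> z) =
      pcomp (tree_operad K D) m n i x y \<oplus>\<^bsub>?F\<^esub> pcomp (tree_operad K D) m n i x z"
    by (rule free_mod_lin_maps_eq[OF lin[OF yz] lin_maps_add[OF lin[OF y] lin[OF z] mF] mF _ x])
      (simp only: tree_pcomp_single_left[OF _ y i] tree_pcomp_single_left[OF _ z i]
          tree_pcomp_single_left[OF _ yz i] inner(2)[OF _ y z])
next
  let ?M = "free_mod K (ptrees D m)" and ?N = "free_mod K (ptrees D n)"
  let ?F = "free_mod K (ptrees D (m + n - 1))"
  note mF = module_free_mod[OF K, of "ptrees D (m + n - 1)"]
  note lin = tree_pcomp_linear[OF _ i, where n = n]
  note inner = lin_mapsD[OF tree_inner_linear[OF _ i, where n = n]]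
  interpret N: module K ?N by (rule module_free_mod[OF K])
  fix a y assume a: "a \<in> carrier K" and y: "y \<in> carrier ?N"
  have ay: "a \<odot>\<^bsub>?N\<^esub> y \<in> carrier ?N" using a y by simp
  show "pcomp (tree_operad K D) m n i x (a \<odot>\<^bsub>?N\<^esub> y) = a \<odot>\<^bsub>?F\<^esub> pcomp (tree_operad K D) m n i x y"
    by (rule free_mod_lin_maps_eq[OF lin[OF ay] lin_maps_smult[OF lin[OF y] mF a] mF _ x])
      (simp only: tree_pcomp_single_left[OF _ y i] tree_pcomp_single_left[OF _ ay i] inner(3)[OF _ a y])
qed

lemma lin_operad_tree: "lin_operad K (tree_operad K D)"
proof -
  have "(\<lambda>x. sact (tree_operad K D) n x \<sigma>) \<in> lin_maps K (free_mod K (ptrees D n)) (free_mod K (ptrees D n))"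
    if "\<sigma> permutes {1..n}" for n \<sigma>
  proof -
    have "lin_ext K (free_mod K (ptrees D n)) (\<lambda>t. single K (relabel (inv_into UNIV \<sigma>) t))
      \<in> lin_maps K (free_mod K (ptrees D n)) (free_mod K (ptrees D n))"
      by (rule lin_ext_linear[OF module_free_mod[OF K]])
        (use that in \<open>auto intro!: single_closed[OF K] ptrees_inv_permute\<close>)
    then show ?thesis by (simp add: tree_operad_def)
  qed
  moreover have "opunit (tree_operad K D) \<in> carrier (part (tree_operad K D) 1)"
    using single_closed[OF K Leaf_ptrees[of D]] by (simp add: tree_operad_def)
  ultimately show ?thesis
    using tree_pcomp_linear tree_pcomp_linear_right module_free_mod[OF K]
    unfolding lin_operad_def tree_part bilinear_on_def by blast
qed

lemma tree_span: "mod_span K (part (tree_operad K D) n) (single K ` ptrees D n) = carrier (part (tree_operad K D) n)"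
  by (simp add: tree_part free_mod_span[OF K])

end

subsection \<open>Changing the decorations\<close>

fun tmap :: "(nat \<Rightarrow> 'v \<Rightarrow> 'w) \<Rightarrow> 'v ptree \<Rightarrow> 'w ptree" where
  "tmap \<phi> (Leaf i) = Leaf i"
| "tmap \<phi> (Node v ts) = Node (\<phi> (length ts) v) (map (tmap \<phi>) ts)"

lemma leaves_tmap [simp]: "leaves (tmap \<phi> t) = leaves t"
proof (induction t)
  case (Node v ts)
  then have "map leaves (map (tmap \<phi>) ts) = map leaves ts" by auto
  then show ?case by (simp only: leaves.simps tmap.simps)
qed simp

lemma decorated_tmap:
  "(\<And>n v. v \<in> D n \<Longrightarrow> \<phi> n v \<in> E n) \<Longrightarrow> decorated D t \<Longrightarrow> decorated E (tmap \<phi> t)"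
  by (induction t) auto

lemma tmap_ptrees:
  "(\<And>n v. v \<in> D n \<Longrightarrow> \<phi> n v \<in> E n) \<Longrightarrow> t \<in> ptrees D n \<Longrightarrow> tmap \<phi> t \<in> ptrees E n"
  by (auto simp: ptrees_def decorated_tmap[of D \<phi> E])

lemma tmap_inverse:
  "(\<And>n v. v \<in> D n \<Longrightarrow> \<psi> n (\<phi> n v) = v) \<Longrightarrow> decorated D t \<Longrightarrow> tmap \<psi> (tmap \<phi> t) = t"
  by (induction t) (auto simp: map_idI)

lemma tmap_leaf_subst: "tmap \<phi> (leaf_subst h t) = leaf_subst (\<lambda>i. tmap \<phi> (h i)) (tmap \<phi> t)"
  by (induction t) auto

lemma tmap_relabel: "tmap \<phi> (relabel f t) = relabel f (tmap \<phi> t)"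
  by (simp add: relabel_def tmap_leaf_subst)

lemma tmap_graft: "tmap \<phi> (graft n i t u) = graft n i (tmap \<phi> t) (tmap \<phi> u)"
proof -
  have "(\<lambda>j. tmap \<phi> (if j < i then Leaf j else if j = i then relabel (\<lambda>k. k + i - 1) u else Leaf (j + n - 1)))
    = (\<lambda>j. if j < i then Leaf j else if j = i then relabel (\<lambda>k. k + i - 1) (tmap \<phi> u) else Leaf (j + n - 1))"
    by (auto simp: tmap_relabel)
  then show ?thesis by (simp add: graft_def tmap_leaf_subst)
qed

lemma tmap_corolla: "tmap \<phi> (corolla n v) = corolla n (\<phi> n v)"
  by (simp add: corolla_def del: upt_Suc)

text \<open>Functoriality of the tree operad, the inverse being induced by the inverse bijections.
  Decorations are mere labels at this stage; linearity and equivariance enter with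
  \<open>free_rels\<close>.\<close>

lemma tree_operad_iso:
  assumes K: "cring K" and \<phi>: "\<And>n. bij_betw (\<phi> n) (D n) (E n)"
  obtains f where "f \<in> operad_iso K (tree_operad K D) (tree_operad K E)"
    "\<And>n t. t \<in> ptrees D n \<Longrightarrow> f n (single K t) = single K (tmap \<phi> t)"
proof -
  let ?P = "tree_operad K D" and ?Q = "tree_operad K E"
  define \<psi> where "\<psi> n = inv_into (D n) (\<phi> n)" for n
  have \<phi>1: "v \<in> D n \<Longrightarrow> \<phi> n v \<in> E n" for n v using \<phi> by (auto simp: bij_betw_def)
  have \<psi>1: "v \<in> E n \<Longrightarrow> \<psi> n v \<in> D n" for n v 
    using \<phi>[of n] bij_betw_inv_into[OF \<phi>[of n]] by (auto simp: bij_betw_def \<psi>_def)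
  have \<psi>\<phi>: "v \<in> D n \<Longrightarrow> \<psi> n (\<phi> n v) = v" for n v
    using \<phi>[of n] by (auto simp: bij_betw_def \<psi>_def)
  have \<phi>\<psi>: "v \<in> E n \<Longrightarrow> \<phi> n (\<psi> n v) = v" for n v
    using \<phi>[of n] by (auto simp: bij_betw_def \<psi>_def f_inv_into_f)
  have tD: "t \<in> ptrees D n \<Longrightarrow> tmap \<phi> t \<in> ptrees E n" for t n by (rule tmap_ptrees) (rule \<phi>1)
  have tE: "t \<in> ptrees E n \<Longrightarrow> tmap \<psi> t \<in> ptrees D n" for t n by (rule tmap_ptrees) (rule \<psi>1)
  have \<psi>\<phi>': "tmap \<psi> (tmap \<phi> t) = t" if "t \<in> ptrees D n" for t n
    by (rule tmap_inverse[of D]) (use that \<psi>\<phi> in \<open>auto simp: ptrees_def\<close>)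
  have \<phi>\<psi>': "tmap \<phi> (tmap \<psi> t) = t" if "t \<in> ptrees E n" for t n
    by (rule tmap_inverse[of E]) (use that \<phi>\<psi> in \<open>auto simp: ptrees_def\<close>)
  define f where "f n = lin_ext K (free_mod K (ptrees E n)) (\<lambda>t. single K (tmap \<phi> t))" for n
  define g where "g n = lin_ext K (free_mod K (ptrees D n)) (\<lambda>t. single K (tmap \<psi> t))" for n
  note m = module_free_mod[OF K]
  have f: "f n \<in> lin_maps K (part ?P n) (part ?Q n)" for n
    unfolding f_def tree_part by (rule lin_ext_linear[OF m]) (auto intro!: single_closed[OF K] tD)
  have g: "g n \<in> lin_maps K (part ?Q n) (part ?P n)" for n
    unfolding g_def tree_part by (rule lin_ext_linear[OF m]) (auto intro!: single_closed[OF K] tE)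
  have fs: "f n (single K t) = single K (tmap \<phi> t)" if "t \<in> ptrees D n" for n t
    using lin_ext_single[OF m, of "\<lambda>t. single K (tmap \<phi> t)" t] single_closed[OF K tD[OF that]]
    unfolding f_def by blast
  have gs: "g n (single K t) = single K (tmap \<psi> t)" if "t \<in> ptrees E n" for n t
    using lin_ext_single[OF m, of "\<lambda>t. single K (tmap \<psi> t)" t] single_closed[OF K tE[OF that]]
    unfolding g_def by blast
  have gf: "g n (f n x) = x" if x: "x \<in> carrier (part ?P n)" for n x
    by (rule free_mod_lin_maps_eq[OF lin_maps_compose[OF f g, unfolded tree_part] lin_maps_id m _ x[unfolded tree_part]])
      (simp add: fs gs tD \<psi>\<phi>')
  have fg: "f n (g n x) = x" if x: "x \<in> carrier (part ?Q n)" for n x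
    by (rule free_mod_lin_maps_eq[OF lin_maps_compose[OF g f, unfolded tree_part] lin_maps_id m _ x[unfolded tree_part]])
      (simp add: fs gs tE \<phi>\<psi>')
  note P = lin_operad_tree[OF K, of D] and Q = lin_operad_tree[OF K, of E]
  note sc = tree_single_closed[OF K]
  have "f \<in> operad_iso K ?P ?Q"
    unfolding operad_iso_def
  proof (intro CollectI conjI allI ballI impI)
    fix n show "f n \<in> lin_maps K (part ?P n) (part ?Q n)" by (rule f)
    show "bij_betw (f n) (carrier (part ?P n)) (carrier (part ?Q n))"
      by (rule bij_betw_byWitness[where f' = "g n"]) (use lin_mapsD(1)[OF f] lin_mapsD(1)[OF g] gf fg in auto)
  next
    fix n x \<sigma> assume x: "x \<in> carrier (part ?P n)" and s: "\<sigma> permutes {1..n}"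
    show "f n (sact ?P n x \<sigma>) = sact ?Q n (f n x) \<sigma>"
    proof (rule lin_maps_eq_on_span[OF lin_maps_compose[OF lin_operadD(2)[OF P s] f]
          lin_maps_compose[OF f lin_operadD(2)[OF Q s]] lin_operadD(1)[OF P] lin_operadD(1)[OF Q]])
      show "x \<in> mod_span K (part ?P n) (single K ` ptrees D n)" using x tree_span[OF K] by blast
    qed (use s in \<open>auto simp: sc tree_sact_single[OF K] fs tD ptrees_inv_permute tmap_relabel\<close>)
  next
    fix m n i x y assume i: "i \<in> {1..m}" and x: "x \<in> carrier (part ?P m)" and y: "y \<in> carrier (part ?P n)"
    note cl = operad_closed(2)[OF P i]
    have bP: "bilinear_on K (part ?P m) (part ?P n) (part ?Q (m + n - 1))
        (\<lambda>x y. f (m + n - 1) (pcomp ?P m n i x y))"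
      unfolding bilinear_on_def
      using lin_maps_compose[OF bilinear_onD(1)[OF lin_operadD(3)[OF P i]] f]
        lin_maps_compose[OF bilinear_onD(2)[OF lin_operadD(3)[OF P i]] f] by blast
    have bQ: "bilinear_on K (part ?P m) (part ?P n) (part ?Q (m + n - 1))
        (\<lambda>x y. pcomp ?Q m n i (f m x) (f n y))"
      unfolding bilinear_on_def
      using lin_maps_compose[OF f bilinear_onD(1)[OF lin_operadD(3)[OF Q i]]]
        lin_maps_compose[OF f bilinear_onD(2)[OF lin_operadD(3)[OF Q i]]] lin_mapsD(1)[OF f] by blast
    show "f (m + n - 1) (pcomp ?P m n i x y) = pcomp ?Q m n i (f m x) (f n y)"
    proof (rule bilinear_on_eq_on_span[OF bP bQ lin_operadD(1)[OF P] lin_operadD(1)[OF P] lin_operadD(1)[OF Q]])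
      show "x \<in> mod_span K (part ?P m) (single K ` ptrees D m)" using x tree_span[OF K] by blast
      show "y \<in> mod_span K (part ?P n) (single K ` ptrees D n)" using y tree_span[OF K] by blast
      fix x y assume "x \<in> single K ` ptrees D m" "y \<in> single K ` ptrees D n"
      then obtain t u where tu: "x = single K t" "t \<in> ptrees D m" "y = single K u" "u \<in> ptrees D n" by auto
      show "f (m + n - 1) (pcomp ?P m n i x y) = pcomp ?Q m n i (f m x) (f n y)"
        unfolding tu using tree_pcomp_single[OF K tu(2,4) i] tree_pcomp_single[OF K tD[OF tu(2)] tD[OF tu(4)] i]
          fs[OF graft_ptrees[OF tu(2,4) i]] fs[OF tu(2)] fs[OF tu(4)] by (simp add: tmap_graft)
    qed (auto simp: sc)
  next
    show "f 1 (opunit ?P) = opunit ?Q" using fs[OF Leaf_ptrees] by (simp add: tree_operad_def)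
  qed
  then show ?thesis using that fs by blast
qed

section \<open>The free operad\<close>

text \<open>What is needed to form the free operad and to compute with its trees, and what is
  checked for the tensor product of S-modules. The axioms of the action are called for by
  \<open>good_fork\<close>.\<close>

definition pre_smod :: "('k, 'm) ring_scheme \<Rightarrow> ('k, 'v) smod \<Rightarrow> bool" where
  "pre_smod K V \<longleftrightarrow> (\<forall>n. module K (part V n) \<and>
     (\<forall>v\<in>carrier (part V n). \<forall>\<sigma>. \<sigma> permutes {1..n} \<longrightarrow> sact V n v \<sigma> \<in> carrier (part V n)))"

lemma pre_smodD:
  assumes "pre_smod K V"
  shows "module K (part V n)" "cring K"
    "v \<in> carrier (part V n) \<Longrightarrow> \<sigma> permutes {1..n} \<Longrightarrow> sact V n v \<sigma> \<in> carrier (part V n)"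
proof -
  show *: "module K (part V n)" for n using assms by (simp add: pre_smod_def)
  show "cring K" by (rule module_cring[OF *[of 0]])
  show "v \<in> carrier (part V n) \<Longrightarrow> \<sigma> permutes {1..n} \<Longrightarrow> sact V n v \<sigma> \<in> carrier (part V n)"
    using assms by (simp add: pre_smod_def)
qed

lemma s_module_pre_smod: "s_module K V \<Longrightarrow> pre_smod K V"
  unfolding s_module_def pre_smod_def using lin_mapsD(1) by fast

lemma s_module_module:
  fixes V :: "('k, 'v) smod" shows "s_module K V \<Longrightarrow> module K (part V n)"
  by (rule pre_smodD(1)[OF s_module_pre_smod])

lemma s_module_cring:
  fixes V :: "('k, 'v) smod" assumes "s_module K V" shows "cring K"
  by (rule pre_smodD(2)[OF s_module_pre_smod[OF assms]])

abbreviation vtrees :: "('k, 'v) smod \<Rightarrow> nat \<Rightarrow> 'v ptree set" where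
  "vtrees V \<equiv> ptrees (\<lambda>n. carrier (part V n))"

lemma lin_operad_smod_trees: "cring K \<Longrightarrow> lin_operad K (smod_trees K V)"
  by (simp add: smod_trees_def lin_operad_tree)

lemma free_relsI:
  "u \<in> carrier (part V n) \<Longrightarrow> v \<in> carrier (part V n) \<Longrightarrow>
    single K (corolla n (u \<oplus>\<^bsub>part V n\<^esub> v)) \<ominus>\<^bsub>part (smod_trees K V) n\<^esub>
      (single K (corolla n u) \<oplus>\<^bsub>part (smod_trees K V) n\<^esub> single K (corolla n v)) \<in> free_rels K V n"
  "a \<in> carrier K \<Longrightarrow> v \<in> carrier (part V n) \<Longrightarrow>
    single K (corolla n (a \<odot>\<^bsub>part V n\<^esub> v)) \<ominus>\<^bsub>part (smod_trees K V) n\<^esub>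
      (a \<odot>\<^bsub>part (smod_trees K V) n\<^esub> single K (corolla n v)) \<in> free_rels K V n"
  "v \<in> carrier (part V n) \<Longrightarrow> \<sigma> permutes {1..n} \<Longrightarrow>
    single K (corolla n (sact V n v \<sigma>)) \<ominus>\<^bsub>part (smod_trees K V) n\<^esub>
      sact (smod_trees K V) n (single K (corolla n v)) \<sigma> \<in> free_rels K V n"
  unfolding free_rels_def Let_def by blast+

lemma free_relsE:
  assumes "x \<in> free_rels K V n"
  obtains u v where "u \<in> carrier (part V n)" "v \<in> carrier (part V n)"
      "x = single K (corolla n (u \<oplus>\<^bsub>part V n\<^esub> v)) \<ominus>\<^bsub>part (smod_trees K V) n\<^esub>
      (single K (corolla n u) \<oplus>\<^bsub>part (smod_trees K V) n\<^esub> single K (corolla n v))"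
  | a v where "a \<in> carrier K" "v \<in> carrier (part V n)"
    "x = single K (corolla n (a \<odot>\<^bsub>part V n\<^esub> v)) \<ominus>\<^bsub>part (smod_trees K V) n\<^esub>
      (a \<odot>\<^bsub>part (smod_trees K V) n\<^esub> single K (corolla n v))"
  | v \<sigma> where "v \<in> carrier (part V n)" "\<sigma> permutes {1..n}"
    "x = single K (corolla n (sact V n v \<sigma>)) \<ominus>\<^bsub>part (smod_trees K V) n\<^esub>
      sact (smod_trees K V) n (single K (corolla n v)) \<sigma>"
  using assms unfolding free_rels_def Let_def by blast

lemma free_rels_carrier:
  assumes V: "pre_smod K V" shows "free_rels K V n \<subseteq> carrier (part (smod_trees K V) n)"
proof -
  note cr = pre_smodD(2)[OF V]
  interpret M: module K "part V n" by (rule pre_smodD(1)[OF V])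
  interpret F: module K "part (smod_trees K V) n" by (rule lin_operadD(1)[OF lin_operad_smod_trees[OF cr]])
  have c: "single K (corolla n v) \<in> carrier (part (smod_trees K V) n)" if "v \<in> carrier (part V n)" for v
    unfolding smod_trees_def using that by (intro tree_single_closed[OF cr] corolla_ptrees)
  note s = operad_closed(1)[OF lin_operad_smod_trees[OF cr]]
  show ?thesis
  proof
    fix x assume "x \<in> free_rels K V n"
    then show "x \<in> carrier (part (smod_trees K V) n)"
    proof (cases rule: free_relsE)
      case (3 v \<sigma>)
      then show ?thesis using s[OF c 3(2)] c[OF pre_smodD(3)[OF V 3(1,2)]] by simp
    qed (simp_all add: c)
  qed
qed

lemma free_ideal_ideal: "pre_smod K V \<Longrightarrow> operad_ideal K (smod_trees K V) (free_ideal K V)"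
  unfolding free_ideal_def
  by (rule gen_ideal_ideal[OF lin_operad_smod_trees[OF pre_smodD(2)] free_rels_carrier])

lemma lin_operad_free: "pre_smod K V \<Longrightarrow> lin_operad K (free_operad K V)"
  unfolding free_operad_def
  by (rule lin_operad_quot[OF lin_operad_smod_trees[OF pre_smodD(2)] free_ideal_ideal])

lemma module_free_operad: "pre_smod K V \<Longrightarrow> module K (part (free_operad K V) n)"
  by (rule lin_operadD(1)[OF lin_operad_free])

lemma free_tree_oproj: "free_tree K V n t = oproj (smod_trees K V) (free_ideal K V) n (single K t)"
  by (simp add: free_tree_def oproj_def)

context
  fixes K :: "('k, 'm) ring_scheme" and V :: "('k, 'v) smod"
  assumes V: "pre_smod K V"
begin

private lemmas tree_facts = lin_operad_smod_trees[OF pre_smodD(2)[OF V], of V] free_ideal_ideal[OF V]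

lemma smod_single_closed: "t \<in> vtrees V n \<Longrightarrow> single K t \<in> carrier (part (smod_trees K V) n)"
  unfolding smod_trees_def by (rule tree_single_closed[OF pre_smodD(2)[OF V]])

lemma free_tree_closed: "t \<in> vtrees V n \<Longrightarrow> free_tree K V n t \<in> carrier (part (free_operad K V) n)"
  unfolding free_tree_oproj free_operad_def oproj_surj by (blast intro: smod_single_closed)

lemma free_tree_sact:
  assumes "t \<in> vtrees V n" "\<sigma> permutes {1..n}"
  shows "sact (free_operad K V) n (free_tree K V n t) \<sigma> = free_tree K V n (relabel (inv_into UNIV \<sigma>) t)"
  unfolding free_tree_oproj free_operad_def
  using oproj_sact[OF tree_facts smod_single_closed[OF assms(1)] assms(2)] tree_sact_single[OF pre_smodD(2)[OF V] assms]
  by (simp add: smod_trees_def)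

lemma free_tree_relabel:
  assumes "t \<in> vtrees V n" "\<sigma> permutes {1..n}"
  shows "free_tree K V n (relabel \<sigma> t) = sact (free_operad K V) n (free_tree K V n t) (inv_into UNIV \<sigma>)"
  using free_tree_sact[OF assms(1) permutes_inv[OF assms(2)]] permutes_inv_inv[OF assms(2)] by simp

lemma free_tree_pcomp:
  assumes "t \<in> vtrees V m" "u \<in> vtrees V n" "i \<in> {1..m}"
  shows "pcomp (free_operad K V) m n i (free_tree K V m t) (free_tree K V n u) =
    free_tree K V (m + n - 1) (graft n i t u)"
  unfolding free_tree_oproj free_operad_def
  using oproj_pcomp[OF tree_facts assms(3) smod_single_closed[OF assms(1)] smod_single_closed[OF assms(2)]] tree_pcomp_single[OF pre_smodD(2)[OF V] assms]
  by (simp add: smod_trees_def)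

lemma free_tree_span:
  "mod_span K (part (free_operad K V) n) (free_tree K V n ` vtrees V n) = carrier (part (free_operad K V) n)"
proof
  note m = module_free_operad[OF V, of n]
  have S: "free_tree K V n ` vtrees V n \<subseteq> carrier (part (free_operad K V) n)" using free_tree_closed by auto
  show "mod_span K (part (free_operad K V) n) (free_tree K V n ` vtrees V n) \<subseteq> carrier (part (free_operad K V) n)"
    by (rule mod_span_carrier[OF m S])
  show "carrier (part (free_operad K V) n) \<subseteq> mod_span K (part (free_operad K V) n) (free_tree K V n ` vtrees V n)"
  proof
    fix X assume "X \<in> carrier (part (free_operad K V) n)"
    then obtain x where x: "x \<in> carrier (part (smod_trees K V) n)" "X = oproj (smod_trees K V) (free_ideal K V) n x"
      by (auto simp: free_operad_def oproj_surj)
    show "X \<in> mod_span K (part (free_operad K V) n) (free_tree K V n ` vtrees V n)"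
      unfolding x(2)
    proof (rule lin_maps_mod_span[OF oproj_linear[OF tree_facts, folded free_operad_def] lin_operadD(1)[OF tree_facts(1)] m
          mod_span_submodule[OF m S]])
      show "x \<in> mod_span K (part (smod_trees K V) n) (single K ` vtrees V n)"
        using x(1) tree_span[OF pre_smodD(2)[OF V], of "\<lambda>n. carrier (part V n)" n] by (simp add: smod_trees_def)
    qed (auto simp: smod_single_closed free_tree_oproj[symmetric] intro!: mod_span_incl)
  qed
qed

lemma corolla_vtrees: "v \<in> carrier (part V n) \<Longrightarrow> corolla n v \<in> vtrees V n"
  by (rule corolla_ptrees)

private lemma free_rel_eq:
  assumes "x \<ominus>\<^bsub>part (smod_trees K V) n\<^esub> y \<in> free_rels K V n"
    "x \<in> carrier (part (smod_trees K V) n)" "y \<in> carrier (part (smod_trees K V) n)"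
  shows "oproj (smod_trees K V) (free_ideal K V) n x = oproj (smod_trees K V) (free_ideal K V) n y"
  using oproj_eq_iff[OF tree_facts assms(2,3)] gen_ideal_incl[of _ "free_rels K V" n K "smod_trees K V", OF assms(1)]
  by (simp add: free_ideal_def)

lemma free_corolla_linear: 
  "(\<lambda>v. free_tree K V n (corolla n v)) \<in> lin_maps K (part V n) (part (free_operad K V) n)"
proof (rule lin_mapsI)
  interpret M: module K "part V n" by (rule pre_smodD(1)[OF V])
  interpret F: module K "part (smod_trees K V) n" by (rule lin_operadD(1)[OF tree_facts(1)])
  note q = lin_mapsD[OF oproj_linear[OF tree_facts, folded free_operad_def]]
  note c = smod_single_closed[OF corolla_vtrees]
  fix u assume u: "u \<in> carrier (part V n)"
  show "free_tree K V n (corolla n u) \<in> carrier (part (free_operad K V) n)"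
    by (rule free_tree_closed[OF corolla_vtrees[OF u]])
  show "free_tree K V n (corolla n (a \<odot>\<^bsub>part V n\<^esub> u)) =
      a \<odot>\<^bsub>part (free_operad K V) n\<^esub> free_tree K V n (corolla n u)" if a: "a \<in> carrier K" for a
    unfolding free_tree_oproj q(3)[OF a c[OF u], symmetric]
    by (rule free_rel_eq[OF free_relsI(2)[OF a u]]) (use a u c in auto)
  fix v assume v: "v \<in> carrier (part V n)"
  show "free_tree K V n (corolla n (u \<oplus>\<^bsub>part V n\<^esub> v)) =
      free_tree K V n (corolla n u) \<oplus>\<^bsub>part (free_operad K V) n\<^esub> free_tree K V n (corolla n v)"
    unfolding free_tree_oproj q(2)[OF c[OF u] c[OF v], symmetric]
    by (rule free_rel_eq[OF free_relsI(1)[OF u v]]) (use u v c in auto)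
qed

text \<open>The third family of \<open>free_rels\<close>; the inverse appears because a permutation
  acts on a tree by relabelling with its inverse.\<close>

lemma free_corolla_sact:
  assumes v: "v \<in> carrier (part V n)" and \<sigma>: "\<sigma> permutes {1..n}"
  shows "free_tree K V n (corolla n (sact V n v \<sigma>)) = free_tree K V n (relabel (inv_into UNIV \<sigma>) (corolla n v))"
proof -
  note c = smod_single_closed[OF corolla_vtrees]
  have "free_tree K V n (corolla n (sact V n v \<sigma>)) =
      oproj (smod_trees K V) (free_ideal K V) n (sact (smod_trees K V) n (single K (corolla n v)) \<sigma>)"
    unfolding free_tree_oproj
    by (rule free_rel_eq[OF free_relsI(3)[OF v \<sigma>] c[OF pre_smodD(3)[OF V v \<sigma>]] operad_closed(1)[OF tree_facts(1) c[OF v] \<sigma>]])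
  also have "\<dots> = sact (free_operad K V) n (free_tree K V n (corolla n v)) \<sigma>"
    unfolding free_tree_oproj free_operad_def by (rule oproj_sact[OF tree_facts c[OF v] \<sigma>, symmetric])
  finally show ?thesis using free_tree_sact[OF corolla_vtrees[OF v] \<sigma>] by simp
qed

end

text \<open>An isomorphism of S-modules carries each of the three families of
  \<open>free_rels\<close> to the same family, and surjectivity makes it reach all of them; so the
  isomorphism of tree operads descends.\<close>

lemma free_operad_iso:
  assumes V: "pre_smod K V" and X: "pre_smod K X"
    and \<phi>: "\<And>n. \<phi> n \<in> lin_maps K (part V n) (part X n)"
    and b: "\<And>n. bij_betw (\<phi> n) (carrier (part V n)) (carrier (part X n))"
    and eq: "\<And>n v \<sigma>. v \<in> carrier (part V n) \<Longrightarrow> \<sigma> permutes {1..n} \<Longrightarrow> \<phi> n (sact V n v \<sigma>) = sact X n (\<phi> n v) \<sigma>"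
  obtains f where "f \<in> operad_iso K (free_operad K V) (free_operad K X)"
    "\<And>n t. t \<in> vtrees V n \<Longrightarrow> f n (free_tree K V n t) = free_tree K X n (tmap \<phi> t)"
proof -
  note cr = pre_smodD(2)[OF V]
  note P = lin_operad_smod_trees[OF cr, of V] and Q = lin_operad_smod_trees[OF cr, of X]
  let ?P = "smod_trees K V" and ?Q = "smod_trees K X"
  obtain f where f: "f \<in> operad_iso K ?P ?Q"
    and fs: "\<And>n t. t \<in> vtrees V n \<Longrightarrow> f n (single K t) = single K (tmap \<phi> t)"
    unfolding smod_trees_def
    by (rule tree_operad_iso[where \<phi> = \<phi> and D = "\<lambda>n. carrier (part V n)" and E = "\<lambda>n. carrier (part X n)",
          OF cr b]) blast
  note D = operad_isoD[OF f]
  note L = lin_mapsD[OF D(1)] and LP = lin_mapsD[OF \<phi>]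
  have sc: "single K (corolla n v) \<in> carrier (part ?P n)" if "v \<in> carrier (part V n)" for v n
    unfolding smod_trees_def using that by (intro tree_single_closed[OF cr] corolla_ptrees)
  have fc: "f n (single K (corolla n v)) = single K (corolla n (\<phi> n v))" if "v \<in> carrier (part V n)" for n v
    using fs[OF corolla_ptrees[of v "\<lambda>n. carrier (part V n)", OF that]] by (simp add: tmap_corolla)
  note fm = lin_maps_minus[OF D(1) lin_operadD(1)[OF P] lin_operadD(1)[OF Q]]
  have f1: "f n (single K (corolla n (u \<oplus>\<^bsub>part V n\<^esub> v)) \<ominus>\<^bsub>part ?P n\<^esub>
        (single K (corolla n u) \<oplus>\<^bsub>part ?P n\<^esub> single K (corolla n v))) =
      single K (corolla n (\<phi> n u \<oplus>\<^bsub>part X n\<^esub> \<phi> n v)) \<ominus>\<^bsub>part ?Q n\<^esub>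
        (single K (corolla n (\<phi> n u)) \<oplus>\<^bsub>part ?Q n\<^esub> single K (corolla n (\<phi> n v)))"
    if uv: "u \<in> carrier (part V n)" "v \<in> carrier (part V n)" for u v n
  proof -
    interpret M: module K "part V n" by (rule pre_smodD(1)[OF V])
    interpret F: module K "part ?P n" by (rule lin_operadD(1)[OF P])
    show ?thesis using uv by (simp add: fm sc L LP fc)
  qed
  have f2: "f n (single K (corolla n (a \<odot>\<^bsub>part V n\<^esub> v)) \<ominus>\<^bsub>part ?P n\<^esub> a \<odot>\<^bsub>part ?P n\<^esub> single K (corolla n v)) =
      single K (corolla n (a \<odot>\<^bsub>part X n\<^esub> \<phi> n v)) \<ominus>\<^bsub>part ?Q n\<^esub> a \<odot>\<^bsub>part ?Q n\<^esub> single K (corolla n (\<phi> n v))"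
    if uv: "a \<in> carrier K" "v \<in> carrier (part V n)" for a v n
  proof -
    interpret M: module K "part V n" by (rule pre_smodD(1)[OF V])
    interpret F: module K "part ?P n" by (rule lin_operadD(1)[OF P])
    show ?thesis using uv by (simp add: fm sc L LP fc)
  qed
  have f3: "f n (single K (corolla n (sact V n v \<sigma>)) \<ominus>\<^bsub>part ?P n\<^esub> sact ?P n (single K (corolla n v)) \<sigma>) =
      single K (corolla n (sact X n (\<phi> n v) \<sigma>)) \<ominus>\<^bsub>part ?Q n\<^esub> sact ?Q n (single K (corolla n (\<phi> n v))) \<sigma>"
    if uv: "v \<in> carrier (part V n)" "\<sigma> permutes {1..n}" for v \<sigma> n
    using uv pre_smodD(3)[OF V uv] by (simp add: fm sc operad_closed(1)[OF P] D(3) fc eq)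
  have ex: "\<exists>u\<in>carrier (part V n). v = \<phi> n u" if "v \<in> carrier (part X n)" for v n
    using that b[of n] by (auto simp: bij_betw_def)
  have im: "f n ` free_ideal K V n = free_ideal K X n" for n
    unfolding free_ideal_def
  proof (rule operad_iso_gen_ideal[OF P Q f free_rels_carrier[OF V] free_rels_carrier[OF X]])
    fix n x assume "x \<in> free_rels K V n"
    then have "f n x \<in> free_rels K X n"
    proof (cases rule: free_relsE)
      case (1 u v)
      then show ?thesis using f1[OF 1(1,2)] free_relsI(1)[OF LP(1)[OF 1(1)] LP(1)[OF 1(2)], of K] by simp
    next
      case (2 a v)
      then show ?thesis using f2[OF 2(1,2)] free_relsI(2)[OF 2(1) LP(1)[OF 2(2)]] by simp
    next
      case (3 v \<sigma>)
      then show ?thesis using f3[OF 3(1,2)] free_relsI(3)[OF LP(1)[OF 3(1)] 3(2), of K] by simp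
    qed
    then show "f n x \<in> gen_ideal K ?Q (free_rels K X) n" by (rule gen_ideal_incl)
  next
    fix n y assume "y \<in> free_rels K X n"
    then have "\<exists>x\<in>free_rels K V n. y = f n x"
    proof (cases rule: free_relsE)
      case (1 u v)
      then obtain u' v' where "u' \<in> carrier (part V n)" "u = \<phi> n u'" "v' \<in> carrier (part V n)" "v = \<phi> n v'"
        using ex by meson
      then show ?thesis using 1(3) f1 free_relsI(1) by metis
    next
      case (2 a v)
      then obtain v' where "v' \<in> carrier (part V n)" "v = \<phi> n v'" using ex by meson
      then show ?thesis using 2(1,3) f2 free_relsI(2) by metis
    next
      case (3 v \<sigma>)
      then obtain v' where "v' \<in> carrier (part V n)" "v = \<phi> n v'" using ex by meson
      then show ?thesis using 3(2,3) f3 free_relsI(3) by metis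
    qed
    then show "\<exists>x\<in>gen_ideal K ?P (free_rels K V) n. y = f n x" using gen_ideal_incl by metis
  qed
  obtain g where g: "g \<in> operad_iso K (free_operad K V) (free_operad K X)"
    and gx: "\<And>n x. x \<in> carrier (part ?P n) \<Longrightarrow>
      g n (oproj ?P (free_ideal K V) n x) = oproj ?Q (free_ideal K X) n (f n x)"
    unfolding free_operad_def
    by (rule operad_iso_quot[OF P Q f free_ideal_ideal[OF V] free_ideal_ideal[OF X] im]) blast
  have "g n (free_tree K V n t) = free_tree K X n (tmap \<phi> t)" if t: "t \<in> vtrees V n" for n t
  proof -
    have "single K t \<in> carrier (part ?P n)"
      unfolding smod_trees_def by (rule tree_single_closed[OF cr t])
    then show ?thesis using gx fs[OF t] by (simp add: free_tree_oproj)
  qed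
  with g show ?thesis by (rule that)
qed

subsection \<open>Trees are generated by corollas\<close>

text \<open>An induction principle: trees arise from corollas by grafting and relabelling. Grafting
  at the last input is enough, as every other insertion differs from it by a permutation of the
  labels.\<close>

lemma ptree_generation:
  fixes Q :: "nat \<Rightarrow> 'v ptree \<Rightarrow> bool"
  assumes leaf: "Q 1 (Leaf 1)" and cor: "\<And>n v. v \<in> D n \<Longrightarrow> Q n (corolla n v)"
    and perm: "\<And>n t \<sigma>. t \<in> ptrees D n \<Longrightarrow> Q n t \<Longrightarrow> \<sigma> permutes {1..n} \<Longrightarrow> Q n (relabel \<sigma> t)"
    and graft: "\<And>m n t u. t \<in> ptrees D m \<Longrightarrow> u \<in> ptrees D n \<Longrightarrow> Q m t \<Longrightarrow> Q n u \<Longrightarrow> 1 \<le> m \<Longrightarrow>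
      Q (m + n - 1) (graft n m t u)"
    and t: "t \<in> ptrees D n"
  shows "Q n t"
proof -
  \<comment> \<open>Subtrees have arbitrary leaf sets, not {1..n}. Quantifying over all numberings
    of the leaves makes the property inherit to subtrees.\<close>
  define P where "P t \<longleftrightarrow> (\<forall>f n. bij_betw f (set (leaves t)) {1..n} \<longrightarrow> Q n (relabel f t))" for t
  have leafP: "P (Leaf z)" for z
    unfolding P_def
  proof (intro allI impI)
    fix f :: "nat \<Rightarrow> nat" and n assume b: "bij_betw f (set (leaves (Leaf z))) {1..n}"
    then have "n = 1" using bij_betw_same_card[OF b] by simp
    then show "Q n (relabel f (Leaf z))" using b leaf by (auto simp: bij_betw_def)
  qed
  \<comment> \<open>The heart of the argument: substituting s for the leaf z of t is, up to a
    renumbering, a graft at the last input.\<close>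
  have subst: "P (leaf_subst (\<lambda>j. if j = z then s else Leaf j) t)"
    if t: "decorated D t" "distinct (leaves t)" "z \<in> set (leaves t)"
      and s: "decorated D s" "distinct (leaves s)" "set (leaves s) \<inter> (set (leaves t) - {z}) = {}"
      and PP: "P t" "P s" for t s z
    unfolding P_def
  proof (intro allI impI)
    let ?r = "leaf_subst (\<lambda>j. if j = z then s else Leaf j) t"
    define A where "A = set (leaves t) - {z}"
    define B where "B = set (leaves s)"
    have AB: "A \<inter> B = {}" "finite A" "finite B" "z \<notin> A" using s(3) by (auto simp: A_def B_def)
    have lt: "set (leaves t) = insert z A" using t(3) by (auto simp: A_def)
    have lr: "set (leaves ?r) = A \<union> B"
      unfolding leaves_leaf_subst using lt AB(4) by (auto simp: B_def split: if_splits)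
    fix f :: "nat \<Rightarrow> nat" and N assume f: "bij_betw f (set (leaves ?r)) {1..N}"
    define m where "m = card A + 1"
    define n where "n = card B"
    have N: "N = m + n - 1"
      using bij_betw_same_card[OF f] card_Un_disjoint[OF AB(2,3,1)] unfolding lr m_def n_def by simp
    obtain g0 where g0: "bij_betw g0 A {1..card A}"
      using ex_bij_betw_finite_nat[of A] AB(2) bij_betw_iff_card[of A "{1..card A}"] by auto
    obtain g' where g': "bij_betw g' B {1..n}"
      using AB(3) bij_betw_iff_card[of B "{1..card B}"] by (auto simp: n_def)
    \<comment> \<open>The leaves of t are numbered so that z comes last, at the input m where
      grafting is allowed.\<close>
    define g where "g = g0(z := m)"
    have g0': "g0 j \<in> {1..card A}" if "j \<in> A" for j using bij_betwE[OF g0] that by blast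
    have gA: "g j = g0 j" if "j \<in> A" for j using that AB(4) by (auto simp: g_def)
    have g: "bij_betw g (set (leaves t)) {1..m}"
    proof -
      have "bij_betw g A {1..card A}" using g0 bij_betw_cong[of A g g0] gA by blast
      moreover have "bij_betw g {z} {m}" by (auto simp: g_def bij_betw_def)
      ultimately have "bij_betw g (A \<union> {z}) ({1..card A} \<union> {m})"
        by (rule bij_betw_combine) (auto simp: m_def)
      moreover have "{1..card A} \<union> {m} = {1..m}" by (auto simp: m_def)
      ultimately show ?thesis unfolding lt by simp
    qed
    let ?t = "relabel g t" and ?s = "relabel g' s"
    have tp: "?t \<in> ptrees D m" and sp: "?s \<in> ptrees D n"
      using t s g g' by (auto intro!: ptrees_relabel simp: B_def)
    have "Q m ?t" "Q n ?s" using PP g g' by (auto simp: P_def B_def)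
    then have Qg: "Q N (graft n m ?t ?s)" unfolding N using tp sp by (intro graft) (auto simp: m_def)
    \<comment> \<open>The numbering produced by the graft: leaves of t other than z keep 1, ..., m -
      1, and those of s are shifted by m - 1.\<close>
    define c where "c j = (if j \<in> A then g j else g' j + m - 1)" for j
    have gr: "graft n m ?t ?s = relabel c ?r"
      unfolding graft_def leaf_subst_relabel relabel_leaf_subst
    proof (rule leaf_subst_cong)
      fix j assume j: "j \<in> set (leaves t)"
      show "(if g j < m then Leaf (g j) else if g j = m then relabel (\<lambda>k. k + m - 1) ?s else Leaf (g j + n - 1))
        = relabel c (if j = z then s else Leaf j)"
      proof (cases "j = z")
        case True
        have "relabel (\<lambda>k. k + m - 1) ?s = relabel c s"
          unfolding relabel_relabel by (rule relabel_cong) (use AB(1) in \<open>auto simp: c_def B_def\<close>)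
        then show ?thesis using True by (simp add: g_def)
      next
        case False
        then have jA: "j \<in> A" using j by (simp add: A_def)
        then have "g j < m" using g0'[OF jA] by (auto simp: gA m_def)
        then show ?thesis using False jA by (simp add: c_def)
      qed
    qed
    have c: "bij_betw c (A \<union> B) {1..N}"
    proof -
      have "bij_betw c A {1..card A}" using g0 bij_betw_cong[of A c g0] gA by (simp add: c_def)
      moreover have "bij_betw c B {m..N}"
      proof -
        have "bij_betw (\<lambda>k. k + card A) {1..n} {m..N}"
          by (rule bij_betw_byWitness[where f' = "\<lambda>k. k - card A"]) (auto simp: m_def N)
        then have "bij_betw ((\<lambda>k. k + card A) \<circ> g') B {m..N}" by (rule bij_betw_trans[OF g'])
        moreover have "((\<lambda>k. k + card A) \<circ> g') j = c j" if "j \<in> B" for j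
          using that AB(1) by (auto simp: c_def m_def)
        ultimately show ?thesis using bij_betw_cong[of B] by blast
      qed
      ultimately have "bij_betw c (A \<union> B) ({1..card A} \<union> {m..N})"
        by (rule bij_betw_combine) (auto simp: m_def)
      moreover have "{1..card A} \<union> {m..N} = {1..N}" by (auto simp: m_def N)
      ultimately show ?thesis by simp
    qed
    \<comment> \<open>The graft carries the numbering c and the goal the numbering f; this
      permutation is f after the inverse of c, so closure under relabelling finishes.\<close>
    define \<pi> where "\<pi> x = (if x \<in> {1..N} then f (inv_into (A \<union> B) c x) else x)" for x
    have "bij_betw (f \<circ> inv_into (A \<union> B) c) {1..N} {1..N}"
      by (rule bij_betw_trans[OF bij_betw_inv_into[OF c] f[unfolded lr]])
    then have "bij_betw \<pi> {1..N} {1..N}" using bij_betw_cong[of "{1..N}" \<pi>] by (simp add: \<pi>_def o_def)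
    then have \<pi>: "\<pi> permutes {1..N}" by (rule bij_imp_permutes) (auto simp: \<pi>_def)
    have grp: "graft n m ?t ?s \<in> ptrees D N"
      unfolding N using tp sp by (intro graft_ptrees) (auto simp: m_def)
    have "relabel \<pi> (graft n m ?t ?s) = relabel f ?r"
      unfolding gr relabel_relabel
    proof (rule relabel_cong)
      fix j assume "j \<in> set (leaves ?r)"
      then have j: "j \<in> A \<union> B" by (simp add: lr)
      then have "c j \<in> {1..N}" using c bij_betwE by blast
      moreover have "inv_into (A \<union> B) c (c j) = j" using c j by (simp add: bij_betw_def)
      ultimately show "\<pi> (c j) = f j" by (simp add: \<pi>_def)
    qed
    then show "Q N (relabel f ?r)" using perm[OF grp Qg \<pi>] by simp
  qed
  \<comment> \<open>A corolla with arbitrary distinct labels is a permuted standard corolla.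
    Positions count from 1 and list entries from 0, whence the \<open>i - 1\<close>.\<close>
  have corP: "P (Node v (map Leaf xs))" if "v \<in> D (length xs)" "distinct xs" for v xs
    unfolding P_def
  proof (intro allI impI)
    fix f :: "nat \<Rightarrow> nat" and n assume "bij_betw f (set (leaves (Node v (map Leaf xs)))) {1..n}"
    then have b: "bij_betw f (set xs) {1..n}" by (simp add: o_def)
    then have n: "n = length xs" using bij_betw_same_card[OF b] distinct_card[OF that(2)] by simp
    define \<sigma> where "\<sigma> i = (if i \<in> {1..n} then f (xs ! (i - 1)) else i)" for i
    have "bij_betw (\<lambda>i. xs ! (i - 1)) {1..n} (set xs)"
    proof -
      have "bij_betw (\<lambda>i. i - 1) {1..n} {..<length xs}"
        by (rule bij_betw_byWitness[where f' = "\<lambda>k. k + 1"]) (auto simp: n)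
      then show ?thesis
        using bij_betw_trans[OF _ bij_betw_nth[OF that(2) refl refl]] by (auto simp: o_def)
    qed
    then have "bij_betw (f \<circ> (\<lambda>i. xs ! (i - 1))) {1..n} {1..n}" by (rule bij_betw_trans[OF _ b])
    then have "bij_betw \<sigma> {1..n} {1..n}" using bij_betw_cong[of "{1..n}" \<sigma>] by (simp add: \<sigma>_def o_def)
    then have \<sigma>: "\<sigma> permutes {1..n}" by (rule bij_imp_permutes) (auto simp: \<sigma>_def)
    have "relabel \<sigma> (corolla n v) = relabel f (Node v (map Leaf xs))"
      unfolding corolla_def
      by (auto intro!: nth_equalityI simp: n \<sigma>_def simp del: upt_Suc)
    then show "Q n (relabel f (Node v (map Leaf xs)))"
      using perm[OF corolla_ptrees[of v D n] cor \<sigma>] that(1) n by metis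
  qed
  \<comment> \<open>The subtrees are planted one at a time, from the right: a node with leaves only
    is the base case, and each step turns one more leaf into a subtree.\<close>
  have nodeP: "P (Node v (us @ map Leaf xs))"
    if "decorated D (Node v (us @ map Leaf xs))" "distinct (leaves (Node v (us @ map Leaf xs)))"
      "\<And>u. u \<in> set us \<Longrightarrow> P u" for v us xs
    using that
  proof (induction us arbitrary: xs rule: rev_induct)
    case Nil
    then show ?case using corP[of v xs] by (simp add: o_def)
  next
    case (snoc u us)
    \<comment> \<open>A fresh leaf z holds the place of u, so that the induction hypothesis applies
      to a node with one proper subtree less; \<open>subst\<close> then plants u at z.\<close>
    obtain z where z: "z \<notin> set (leaves (Node v ((us @ [u]) @ map Leaf xs)))"
      using infinite_UNIV_nat ex_new_if_finite[OF infinite_UNIV_nat finite_set] by metis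
    let ?t = "Node v (us @ map Leaf (z # xs))"
    have Pt: "P ?t"
      by (rule snoc.IH) (use snoc.prems z in \<open>auto simp: o_def\<close>)
    have id: "leaf_subst (\<lambda>j. if j = z then u else Leaf j) w = w" if "z \<notin> set (leaves w)" for w
      using leaf_subst_cong[of w "\<lambda>j. if j = z then u else Leaf j" Leaf] that leaf_subst_Leaf by fastforce
    have "leaf_subst (\<lambda>j. if j = z then u else Leaf j) ?t = Node v ((us @ [u]) @ map Leaf xs)"
      using z by (auto simp: id o_def intro!: map_idI)
    moreover have "P (leaf_subst (\<lambda>j. if j = z then u else Leaf j) ?t)"
      by (rule subst) (use snoc.prems z Pt in \<open>auto simp: o_def\<close>)
    ultimately show ?case by (simp only:)
  qed
  have "P t" if "decorated D t" "distinct (leaves t)" for t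
    using that
  proof (induction t)
    case (Leaf z)
    then show ?case using leafP by simp
  next
    case (Node v ts)
    have "distinct (leaves u)" if "u \<in> set ts" for u
      using Node.prems(2) that by (auto simp: distinct_concat_iff)
    then show ?case using nodeP[of v ts "[]"] Node by auto
  qed
  then have "P t" using t by (simp add: ptrees_def)
  moreover have "bij_betw id (set (leaves t)) {1..n}" using t by (auto simp: ptrees_def)
  ultimately show ?thesis unfolding P_def using relabel_id[of t id] by fastforce
qed

subsection \<open>Arity three\<close>

abbreviation flip :: "nat \<Rightarrow> nat" where
  "flip \<equiv> Transposition.transpose 1 2"

lemma flip_permutes: "flip permutes {1..2}"
  by (rule permutes_swap_id) auto

lemma permutes_two: "\<sigma> permutes {1..2::nat} \<Longrightarrow> \<sigma> = id \<or> \<sigma> = flip"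
proof -
  assume p: "\<sigma> permutes {1..2::nat}"
  have 1: "\<sigma> 1 \<in> {1..2}" "\<sigma> 2 \<in> {1..2}" using permutes_in_image[OF p] by auto
  have inj: "\<sigma> 1 \<noteq> \<sigma> 2" using permutes_inj[OF p] by (metis inj_eq one_eq_numeral_iff num.distinct(1))
  have o: "\<sigma> x = x" if "x \<noteq> 1" "x \<noteq> 2" for x
    using permutes_not_in[OF p, of x] that by auto
  have "\<sigma> 1 = 1 \<and> \<sigma> 2 = 2 \<or> \<sigma> 1 = 2 \<and> \<sigma> 2 = 1" using 1 inj by auto
  then show ?thesis
  proof
    assume "\<sigma> 1 = 1 \<and> \<sigma> 2 = 2"
    then show ?thesis using o by (metis eq_id_iff)
  next
    assume a: "\<sigma> 1 = 2 \<and> \<sigma> 2 = 1"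
    have "\<sigma> x = flip x" for x using a o[of x] by (cases "x = 1"; cases "x = 2") (auto simp: transpose_def)
    then show ?thesis by auto
  qed
qed

lemma inv_flip: "inv_into UNIV flip = flip"
  by simp

lemma corolla_two: "corolla 2 v = Node v [Leaf 1, Leaf 2]"
  by (simp add: corolla_def numeral_2_eq_2 One_nat_def)

text \<open>For \<open>l \<in> {1..3}\<close>, \<open>T\<^sup>l\<close> is the tree \<open>v(u(first l, second l), third l)\<close>, and \<open>index\<close> inverts \<open>third\<close>.\<close>

definition second :: "nat \<Rightarrow> nat" where "second l = (if l = 3 then 1 else l + 1)"
definition third :: "nat \<Rightarrow> nat" where "third l = (if l = 1 then 3 else l - 1)"
definition index :: "nat \<Rightarrow> nat" where "index c = (if c = 3 then 1 else c + 1)"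

text \<open>Whether b follows a in the cyclic order of 1, 2, 3, the order in which
  \<open>tree3\<close> lists the two inner leaves.\<close>

definition ccl :: "nat \<Rightarrow> nat \<Rightarrow> bool" where
  "ccl a b \<longleftrightarrow> b = second a"

lemma tree3_alt: "l \<in> {1..3} \<Longrightarrow> tree3 l u v = Node v [Node u [Leaf l, Leaf (second l)], Leaf (third l)]"
  by (auto simp: tree3_def second_def third_def)

lemma three_cases: "l \<in> {1..3::nat} \<Longrightarrow> l = 1 \<or> l = 2 \<or> l = 3"
  by auto

lemma tree3_range:
  "l \<in> {1..3} \<Longrightarrow> second l \<in> {1..3}" "l \<in> {1..3} \<Longrightarrow> third l \<in> {1..3}"
  "l \<in> {1..3} \<Longrightarrow> l \<noteq> second l \<and> l \<noteq> third l \<and> second l \<noteq> third l"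
  by (auto simp: second_def third_def dest!: three_cases)

definition perm3 :: "nat \<Rightarrow> nat \<Rightarrow> nat \<Rightarrow> nat \<Rightarrow> nat" where
  "perm3 a b c x = (if x = 1 then a else if x = 2 then b else if x = 3 then c else x)"

definition tri :: "nat \<Rightarrow> nat \<Rightarrow> nat \<Rightarrow> bool" where
  "tri a b c \<longleftrightarrow> a \<in> {1..3} \<and> b \<in> {1..3} \<and> c \<in> {1..3} \<and> a \<noteq> b \<and> a \<noteq> c \<and> b \<noteq> c"

lemma tri_set: "tri a b c \<Longrightarrow> {a, b, c} = {1..3}"
  by (auto simp: tri_def dest!: three_cases)

lemma perm3_permutes: assumes "tri a b c" shows "perm3 a b c permutes {1..3}"
proof (rule bij_imp_permutes)
  have e: "{1..3::nat} = {1, 2, 3}" by auto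
  have "perm3 a b c ` {1..3} = {a, b, c}" unfolding e by (auto simp: perm3_def)
  also have "\<dots> = {1..3}" by (rule tri_set[OF assms])
  finally have "perm3 a b c ` {1..3} = {1..3}" .
  moreover have "inj_on (perm3 a b c) {1..3}" 
    using assms by (auto simp: e inj_on_def perm3_def tri_def)
  ultimately show "bij_betw (perm3 a b c) {1..3} {1..3}" by (simp add: bij_betw_def)
qed (auto simp: perm3_def)

lemma three_minus: "2 + 2 - 1 = (3::nat)" by simp

context
  fixes K :: "('k, 'm) ring_scheme" and V :: "('k, 'v) smod"
  assumes V: "pre_smod K V"
begin

lemma two_closed: "u \<in> carrier (part V 2) \<Longrightarrow> sact V 2 u flip \<in> carrier (part V 2)"
  by (rule pre_smodD(3)[OF V _ flip_permutes])

lemma comb_vtrees: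
  assumes "u \<in> carrier (part V 2)" "v \<in> carrier (part V 2)" "tri a b c"
  shows "Node v [Node u [Leaf a, Leaf b], Leaf c] \<in> vtrees V 3"
    "Node v [Leaf c, Node u [Leaf a, Leaf b]] \<in> vtrees V 3"
proof -
  have "tri c a b" using assms(3) by (auto simp: tri_def)
  then show "Node v [Node u [Leaf a, Leaf b], Leaf c] \<in> vtrees V 3"
    "Node v [Leaf c, Node u [Leaf a, Leaf b]] \<in> vtrees V 3"
    using assms tri_set[OF assms(3)] tri_set[of c a b] unfolding ptrees_def tri_def
    by (simp_all add: eval_nat_numeral(2) [symmetric] numeral_2_eq_2[symmetric])
qed

lemma vtrees_two:
  assumes "v \<in> carrier (part V 2)"
  shows "Node v [Leaf 1, Leaf 2] \<in> vtrees V 2" "Node v [Leaf 2, Leaf 1] \<in> vtrees V 2"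
  using assms by (auto simp: ptrees_def numeral_2_eq_2)

lemma free_swap_two:
  assumes "v \<in> carrier (part V 2)"
  shows "free_tree K V 2 (Node v [Leaf 2, Leaf 1]) = free_tree K V 2 (Node (sact V 2 v flip) [Leaf 1, Leaf 2])"
  using free_corolla_sact[OF V assms flip_permutes] by (simp add: inv_flip corolla_two)

text \<open>Equalities in arity two, at the root or at the inner vertex, pass to arity three because
  composition and action are well defined on the quotient. The vertex relations of the free operad
  are moved this way.\<close>

lemma free_comb_eq:
  assumes a: "tri a b c"
    and t: "t \<in> vtrees V 2" "t' \<in> vtrees V 2" "free_tree K V 2 t = free_tree K V 2 t'"
    and s: "s \<in> vtrees V 2" "s' \<in> vtrees V 2" "free_tree K V 2 s = free_tree K V 2 s'"
  shows "free_tree K V 3 (relabel (perm3 a b c) (graft 2 1 t s)) =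
    free_tree K V 3 (relabel (perm3 a b c) (graft 2 1 t' s'))"
proof -
  have i: "1 \<in> {1..2::nat}" by simp
  have "free_tree K V 3 (graft 2 1 t s) = free_tree K V 3 (graft 2 1 t' s')"
    using free_tree_pcomp[OF V t(1) s(1) i] free_tree_pcomp[OF V t(2) s(2) i] t(3) s(3)
    by (simp only: three_minus)
  then show ?thesis
    using free_tree_relabel[OF V graft_ptrees[OF t(1) s(1) i, unfolded three_minus] perm3_permutes[OF a]]
      free_tree_relabel[OF V graft_ptrees[OF t(2) s(2) i, unfolded three_minus] perm3_permutes[OF a]] by simp
qed

lemma graft_comb:
  "relabel (perm3 a b c) (graft 2 1 (Node v [Leaf 1, Leaf 2]) (Node u [Leaf 1, Leaf 2])) =
     Node v [Node u [Leaf a, Leaf b], Leaf c]"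
  "relabel (perm3 a b c) (graft 2 1 (Node v [Leaf 1, Leaf 2]) (Node u [Leaf 2, Leaf 1])) =
     Node v [Node u [Leaf b, Leaf a], Leaf c]"
  "relabel (perm3 a b c) (graft 2 1 (Node v [Leaf 2, Leaf 1]) (Node u [Leaf 1, Leaf 2])) =
     Node v [Leaf c, Node u [Leaf a, Leaf b]]"
  by (auto simp: graft_def perm3_def)

lemma free_swap_inner:
  assumes "u \<in> carrier (part V 2)" "v \<in> carrier (part V 2)" "tri a b c"
  shows "free_tree K V 3 (Node v [Node u [Leaf b, Leaf a], Leaf c]) =
    free_tree K V 3 (Node v [Node (sact V 2 u flip) [Leaf a, Leaf b], Leaf c])"
  using free_comb_eq[OF assms(3) vtrees_two(1)[OF assms(2)] vtrees_two(1)[OF assms(2)] refl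
      vtrees_two(2)[OF assms(1)] vtrees_two(1)[OF two_closed[OF assms(1)]] free_swap_two[OF assms(1)]]
  by (simp only: graft_comb)

lemma free_swap_root:
  assumes "u \<in> carrier (part V 2)" "v \<in> carrier (part V 2)" "tri a b c"
  shows "free_tree K V 3 (Node v [Leaf c, Node u [Leaf a, Leaf b]]) =
    free_tree K V 3 (Node (sact V 2 v flip) [Node u [Leaf a, Leaf b], Leaf c])"
  using free_comb_eq[OF assms(3) vtrees_two(2)[OF assms(2)] vtrees_two(1)[OF two_closed[OF assms(2)]] 
      free_swap_two[OF assms(2)] vtrees_two(1)[OF assms(1)] vtrees_two(1)[OF assms(1)] refl]
  by (simp only: graft_comb)

lemma tri_alt: "tri a b c \<Longrightarrow> index c \<in> {1..3} \<and> (if ccl a b then a = index c \<and> b = second (index c) \<and> c = third (index c)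
   else b = index c \<and> a = second (index c) \<and> c = third (index c))"
  by (auto simp: tri_def index_def ccl_def second_def third_def dest!: three_cases)

text \<open>The leaf at the root decides the shape. If the two inner leaves stand against the cyclic
  order, exchanging them costs a transposition on the inner decoration.\<close>

lemma free_comb:
  assumes "u \<in> carrier (part V 2)" "v \<in> carrier (part V 2)" "tri a b c"
  shows "free_tree K V 3 (Node v [Node u [Leaf a, Leaf b], Leaf c]) =
    T3 K V (index c) (if ccl a b then u else sact V 2 u flip) v"
proof (cases "ccl a b")
  case True
  then show ?thesis using tri_alt[OF assms(3)] by (simp add: T3_def tree3_alt del: atLeastAtMost_iff)
next
  case False
  have "tri b a c" using assms(3) by (auto simp: tri_def)
  then show ?thesis using free_swap_inner[OF assms(1,2), of b a c] tri_alt[OF assms(3)] False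
    by (simp add: T3_def tree3_alt del: atLeastAtMost_iff)
qed

lemma tree3_vtrees:
  assumes "u \<in> carrier (part V 2)" "v \<in> carrier (part V 2)" "l \<in> {1..3}"
  shows "tree3 l u v \<in> vtrees V 3"
  unfolding tree3_alt[OF assms(3)]
  by (rule comb_vtrees[OF assms(1,2)]) (use tree3_range assms(3) in \<open>auto simp: tri_def\<close>)

lemma T3_closed:
  "u \<in> carrier (part V 2) \<Longrightarrow> v \<in> carrier (part V 2) \<Longrightarrow> l \<in> {1..3} \<Longrightarrow>
    T3 K V l u v \<in> carrier (part (free_operad K V) 3)"
  unfolding T3_def by (rule free_tree_closed[OF V tree3_vtrees])

text \<open>A permutation permutes the three shapes and at most flips the inner decoration. The root
  decoration stays, since the inner vertex keeps its place as first input of the root.\<close>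

lemma T3_sact:
  assumes "u \<in> carrier (part V 2)" "v \<in> carrier (part V 2)" "l \<in> {1..3}" "\<sigma> permutes {1..3}"
  shows "sact (free_operad K V) 3 (T3 K V l u v) \<sigma> =
    T3 K V (index (inv_into UNIV \<sigma> (third l)))
      (if ccl (inv_into UNIV \<sigma> l) (inv_into UNIV \<sigma> (second l)) then u else sact V 2 u flip) v"
    "index (inv_into UNIV \<sigma> (third l)) \<in> {1..3}"
proof -
  let ?\<rho> = "inv_into UNIV \<sigma>"
  have p: "?\<rho> permutes {1..3}" by (rule permutes_inv[OF assms(4)])
  have t: "tri (?\<rho> l) (?\<rho> (second l)) (?\<rho> (third l))"
    unfolding tri_def permutes_in_image[OF p] using tree3_range assms(3) permutes_inj[OF p]
    by (simp add: inj_eq del: atLeastAtMost_iff)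
  show "sact (free_operad K V) 3 (T3 K V l u v) \<sigma> =
    T3 K V (index (?\<rho> (third l))) (if ccl (?\<rho> l) (?\<rho> (second l)) then u else sact V 2 u flip) v"
    unfolding T3_def[of _ _ l] free_tree_sact[OF V tree3_vtrees[OF assms(1-3)] assms(4)]
    using free_comb[OF assms(1,2) t] by (simp add: tree3_alt[OF assms(3)])
  show "index (?\<rho> (third l)) \<in> {1..3}" using tri_alt[OF t] by simp
qed

text \<open>The tree is a permuted composite of two corollas, and corollas are linear in their
  decorations, composition is bilinear, and the action is linear.\<close>

lemma T3_bilinear:
  assumes l: "l \<in> {1..3}"
  shows "bilinear_on K (part V 2) (part V 2) (part (free_operad K V) 3) (T3 K V l)"
proof -
  define \<pi> where "\<pi> = perm3 l (second l) (third l)"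
  have t: "tri l (second l) (third l)" using tree3_range l by (auto simp: tri_def)
  have p: "\<pi> permutes {1..3}" unfolding \<pi>_def by (rule perm3_permutes[OF t])
  have i: "1 \<in> {1..2::nat}" by simp
  let ?F = "free_operad K V" and ?c = "\<lambda>v. free_tree K V 2 (corolla 2 v)"
  note L = lin_operad_free[OF V]
  have eq: "T3 K V l u v = sact ?F 3 (pcomp ?F 2 2 1 (?c v) (?c u)) (inv_into UNIV \<pi>)"
    if "u \<in> carrier (part V 2)" "v \<in> carrier (part V 2)" for u v
  proof -
    note cv = corolla_vtrees[OF V that(2)] and cu = corolla_vtrees[OF V that(1)]
    have "pcomp ?F 2 2 1 (?c v) (?c u) = free_tree K V 3 (graft 2 1 (corolla 2 v) (corolla 2 u))"
      using free_tree_pcomp[OF V cv cu i] by (simp only: three_minus)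
    moreover have "free_tree K V 3 (relabel \<pi> (graft 2 1 (corolla 2 v) (corolla 2 u))) =
       sact ?F 3 (free_tree K V 3 (graft 2 1 (corolla 2 v) (corolla 2 u))) (inv_into UNIV \<pi>)"
      by (rule free_tree_relabel[OF V graft_ptrees[OF cv cu i, unfolded three_minus] p])
    moreover have "relabel \<pi> (graft 2 1 (corolla 2 v) (corolla 2 u)) = tree3 l u v"
      unfolding corolla_two \<pi>_def graft_comb tree3_alt[OF l] ..
    ultimately show ?thesis by (simp add: T3_def)
  qed
  note c = free_corolla_linear[OF V, of 2]
  note B = lin_operadD(3)[OF L i, of 2, unfolded three_minus]
  note S = lin_operadD(2)[OF L permutes_inv[OF p]]
  show ?thesis unfolding bilinear_on_def
  proof (intro conjI ballI)
    fix u assume u: "u \<in> carrier (part V 2)"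
    show "T3 K V l u \<in> lin_maps K (part V 2) (part ?F 3)"
      by (rule lin_maps_cong[OF lin_maps_compose[OF lin_maps_compose[OF c bilinear_onD(2)[OF B lin_mapsD(1)[OF c u]]] S]
          pre_smodD(1)[OF V]]) (simp add: eq u)
    show "(\<lambda>x. T3 K V l x u) \<in> lin_maps K (part V 2) (part ?F 3)"
      by (rule lin_maps_cong[OF lin_maps_compose[OF lin_maps_compose[OF c bilinear_onD(1)[OF B lin_mapsD(1)[OF c u]]] S]
          pre_smodD(1)[OF V]]) (simp add: eq u)
  qed
qed

text \<open>The spans of these trees are closed under composition because all trees of arity at least 4 are admitted.\<close>

definition low_trees :: "nat \<Rightarrow> 'v ptree set" where
  "low_trees n = (if n = 0 then {} else if n = 1 then {Leaf 1}
     else if n = 2 then corolla 2 ` carrier (part V 2)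
     else if n = 3 then {tree3 l u v | l u v. l \<in> {1..3} \<and> u \<in> carrier (part V 2) \<and> v \<in> carrier (part V 2)}
     else vtrees V n)"

lemma tree3_low:
  assumes "u \<in> carrier (part V 2)" "v \<in> carrier (part V 2)" "l \<in> {1..3}"
  shows "tree3 l u v \<in> low_trees 3"
proof -
  have "tree3 l u v \<in> {tree3 l u v | l u v. l \<in> {1..3} \<and> u \<in> carrier (part V 2) \<and> v \<in> carrier (part V 2)}"
    using assms by blast
  then show ?thesis by (simp add: low_trees_def)
qed

lemma low_trees_vtrees: "low_trees n \<subseteq> vtrees V n"
  using Leaf_ptrees[of "\<lambda>n. carrier (part V n)"] corolla_vtrees[OF V] tree3_vtrees
  by (auto simp: low_trees_def)

text \<open>\<open>ptree_generation\<close>, applied to membership in the span. Binarity kills the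
  corollas of arity 0, 1 and 3, so in arity three only composites of two binary corollas
  survive.\<close>

lemma free_tree_low:
  assumes bin: "binary_smod V" and t: "t \<in> vtrees V n"
  shows "free_tree K V n t \<in> mod_span K (part (free_operad K V) n) (free_tree K V n ` low_trees n)"
    (is "_ \<in> ?H n")
proof -
  let ?F = "free_operad K V"
  note L = lin_operad_free[OF V] and m = module_free_operad[OF V]
  have S: "free_tree K V n ` low_trees n \<subseteq> carrier (part ?F n)" for n
    using low_trees_vtrees free_tree_closed[OF V] by fast
  note sub = mod_span_submodule[OF m S]
  have incl: "t \<in> low_trees n \<Longrightarrow> free_tree K V n t \<in> ?H n" for t n by (intro mod_span_incl imageI)
  show ?thesis
    using _ _ _ _ t
  proof (rule ptree_generation[of "\<lambda>n t. free_tree K V n t \<in> ?H n" "\<lambda>n. carrier (part V n)"])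
    show "free_tree K V 1 (Leaf 1) \<in> ?H 1" by (rule incl) (simp add: low_trees_def)
  next
    fix n v assume v: "v \<in> carrier (part V n)"
    show "free_tree K V n (corolla n v) \<in> ?H n"
    proof (cases "n = 2 \<or> n \<ge> 4")
      case True
      then show ?thesis using v corolla_vtrees[OF V v] by (intro incl) (auto simp: low_trees_def)
    next
      case False
      then have "v = \<zero>\<^bsub>part V n\<^esub>" using bin v unfolding binary_smod_def by auto
      then have "free_tree K V n (corolla n v) = \<zero>\<^bsub>part ?F n\<^esub>"
        using lin_maps_zero[OF free_corolla_linear[OF V] pre_smodD(1)[OF V] m] by simp
      then show ?thesis using submoduleD(2)[OF sub] by simp
    qed
  next
    fix n t \<sigma> assume t: "t \<in> vtrees V n" "free_tree K V n t \<in> ?H n" and \<sigma>: "\<sigma> permutes {1..n}"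
    let ?\<rho> = "inv_into UNIV \<sigma>"
    have \<rho>: "?\<rho> permutes {1..n}" by (rule permutes_inv[OF \<sigma>])
    have *: "sact ?F n (free_tree K V n s) ?\<rho> \<in> ?H n" if s: "s \<in> low_trees n" for s
    proof -
      have rel: "sact ?F n (free_tree K V n s) ?\<rho> = free_tree K V n (relabel \<sigma> s)"
        using free_tree_relabel[OF V _ \<sigma>] low_trees_vtrees s by auto
      consider "n = 0" | "n = 1" | "n = 2" | "n = 3" | "n \<ge> 4" by linarith
      then show ?thesis
      proof cases
        case 1 then show ?thesis using s by (simp add: low_trees_def)
      next
        case 2
        then have "s = Leaf 1" "\<sigma> 1 = 1" using s \<sigma> permutes_in_image[OF \<sigma>, of 1] by (auto simp: low_trees_def)
        then show ?thesis using 2 s unfolding rel by (intro incl) simp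
      next
        case 3
        then obtain v where v: "v \<in> carrier (part V 2)" "s = corolla 2 v" using s by (auto simp: low_trees_def)
        have \<rho>2: "?\<rho> permutes {1..2}" using \<rho> 3 by simp
        have "sact ?F 2 (free_tree K V 2 s) ?\<rho> = free_tree K V 2 (corolla 2 (sact V 2 v ?\<rho>))"
          unfolding v(2) using free_corolla_sact[OF V v(1) \<rho>2] free_tree_sact[OF V corolla_vtrees[OF V v(1)] \<rho>2] by simp
        moreover have "corolla 2 (sact V 2 v ?\<rho>) \<in> low_trees 2"
          using pre_smodD(3)[OF V v(1) \<rho>2] by (auto simp: low_trees_def)
        ultimately show ?thesis using 3 incl by simp
      next
        case 4
        then obtain l u v where s': "s = tree3 l u v" "l \<in> {1..3}" "u \<in> carrier (part V 2)" "v \<in> carrier (part V 2)"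
          using s by (auto simp: low_trees_def)
        define u' where "u' = (if ccl (inv_into UNIV ?\<rho> l) (inv_into UNIV ?\<rho> (second l)) then u else sact V 2 u flip)"
        have u': "u' \<in> carrier (part V 2)" using s'(3) two_closed by (simp add: u'_def)
        note T = T3_sact[OF s'(3,4,2) \<rho>[unfolded 4], folded u'_def]
        have "tree3 (index (inv_into UNIV ?\<rho> (third l))) u' v \<in> low_trees 3"
          by (rule tree3_low[OF u' s'(4) T(2)])
        then show ?thesis using incl T(1) unfolding 4 s'(1) T3_def by metis
      next
        case 5
        then have "relabel \<sigma> s \<in> low_trees n"
          using s ptrees_permute[OF _ \<sigma>] by (auto simp: low_trees_def)
        then show ?thesis unfolding rel by (rule incl)
      qed
    qed
    have "sact ?F n (free_tree K V n t) ?\<rho> \<in> ?H n"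
      by (rule lin_maps_mod_span[OF lin_operadD(2)[OF L \<rho>] m m sub S _ t(2)]) (use * in auto)
    then show "free_tree K V n (relabel \<sigma> t) \<in> ?H n" using free_tree_relabel[OF V t(1) \<sigma>] by simp
  next
    fix m' n t u assume t: "t \<in> vtrees V m'" "free_tree K V m' t \<in> ?H m'"
      and u: "u \<in> vtrees V n" "free_tree K V n u \<in> ?H n" and m': "1 \<le> m'"
    have i: "m' \<in> {1..m'}" using m' by simp
    have *: "free_tree K V (m' + n - 1) (graft n m' s r) \<in> ?H (m' + n - 1)"
      if s: "s \<in> low_trees m'" and r: "r \<in> low_trees n" for s r
    proof -
      have sr: "s \<in> vtrees V m'" "r \<in> vtrees V n" using s r low_trees_vtrees by auto
      \<comment> \<open>There are no low trees of arity 0, and composing with the unit changes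
        nothing. If both arities are at least 2 and not both equal to 2, the composite has arity at
        least 4; the product of two corollas is the one real case.\<close>
      consider "m' = 1" | "n = 1" | "n = 0" | "m' = 2" "n = 2" | "m' + n - 1 \<ge> 4" using m' by linarith
      then show ?thesis
      proof cases
        case 1
        then have "graft n m' s r = r" using s by (simp add: low_trees_def graft_def relabel_id)
        then show ?thesis using r 1 incl by simp
      next
        case 2
        have "r = Leaf 1" using r 2 by (simp add: low_trees_def)
        then have "graft n m' s r = leaf_subst Leaf s"
          unfolding graft_def using 2 m' by (intro leaf_subst_cong) auto
        then show ?thesis using s 2 incl by (simp add: leaf_subst_Leaf)
      next
        case 3
        then show ?thesis using r by (simp add: low_trees_def)
      next
        case 4
        obtain v where v: "v \<in> carrier (part V 2)" "s = corolla 2 v" using s 4 by (auto simp: low_trees_def)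
        obtain w where w: "w \<in> carrier (part V 2)" "r = corolla 2 w" using r 4 by (auto simp: low_trees_def)
        \<comment> \<open>Grafting at the last input hangs the inner vertex on the right; a
          transposition at the root brings it to the left, which gives the second shape.\<close>
        have "graft n m' s r = Node v [Leaf 1, Node w [Leaf 2, Leaf 3]]"
          unfolding v w corolla_two 4 by (simp add: graft_def)
        moreover have "tri 2 3 1" by (simp add: tri_def)
        ultimately have "free_tree K V 3 (graft n m' s r) = free_tree K V 3 (tree3 2 w (sact V 2 v flip))"
          using free_swap_root[OF w(1) v(1), of 2 3 1] by (simp add: tree3_def)
        moreover have "tree3 2 w (sact V 2 v flip) \<in> low_trees 3"
          by (rule tree3_low[OF w(1) two_closed[OF v(1)]]) simp
        ultimately show ?thesis using incl 4 by (simp add: three_minus)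
      next
        case 5
        then have "graft n m' s r \<in> low_trees (m' + n - 1)"
          using graft_ptrees[OF sr i] by (simp add: low_trees_def)
        then show ?thesis by (rule incl)
      qed
    qed
    have "pcomp ?F m' n m' (free_tree K V m' t) (free_tree K V n u) \<in> ?H (m' + n - 1)"
    proof (rule bilinear_on_span[OF lin_operadD(3)[OF L i] m m m sub S S _ t(2) u(2)])
      fix x y assume "x \<in> free_tree K V m' ` low_trees m'" "y \<in> free_tree K V n ` low_trees n"
      then obtain s r where sr: "s \<in> low_trees m'" "x = free_tree K V m' s" "r \<in> low_trees n" "y = free_tree K V n r"
        by blast
      have "s \<in> vtrees V m'" "r \<in> vtrees V n" using sr low_trees_vtrees by auto
      then show "pcomp ?F m' n m' x y \<in> ?H (m' + n - 1)"
        using *[OF sr(1,3)] free_tree_pcomp[OF V _ _ i] sr by simp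
    qed
    then show "free_tree K V (m' + n - 1) (graft n m' t u) \<in> ?H (m' + n - 1)"
      using free_tree_pcomp[OF V t(1) u(1) i] by simp
  qed
qed

lemma T3_span:
  assumes bin: "binary_smod V"
  shows "mod_span K (part (free_operad K V) 3)
    {T3 K V l u v | l u v. l \<in> {1..3} \<and> u \<in> carrier (part V 2) \<and> v \<in> carrier (part V 2)} = carrier (part (free_operad K V) 3)"
    (is "mod_span K ?F ?S = _")
proof
  note m = module_free_operad[OF V, of 3]
  have S: "?S \<subseteq> carrier ?F" using T3_closed by blast
  show "mod_span K ?F ?S \<subseteq> carrier ?F" by (rule mod_span_carrier[OF m S])
  have "free_tree K V 3 ` low_trees 3 = ?S" by (auto simp: low_trees_def T3_def image_def)
  then have "free_tree K V 3 ` vtrees V 3 \<subseteq> mod_span K ?F ?S" using free_tree_low[OF bin, of _ 3] by auto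
  then have "mod_span K ?F (free_tree K V 3 ` vtrees V 3) \<subseteq> mod_span K ?F ?S"
    by (rule mod_span_least[OF mod_span_submodule[OF m S]])
  then show "carrier ?F \<subseteq> mod_span K ?F ?S" unfolding free_tree_span[OF V] .
qed

end

section \<open>Functionals on the free operad\<close>

text \<open>One-hole contexts, as functions on trees. A vertex of a tree is a context filled with a
  \<open>Node\<close>, which allows conditions to be imposed at every vertex at once.\<close>

inductive tctx :: "('v ptree \<Rightarrow> 'v ptree) \<Rightarrow> bool" where
  hole: "tctx (\<lambda>t. t)"
| node: "tctx C \<Longrightarrow> tctx (\<lambda>t. Node w (xs @ C t # ys))"

lemma tctx_compose: "tctx C \<Longrightarrow> tctx C' \<Longrightarrow> tctx (\<lambda>t. C (C' t))"
  by (induction rule: tctx.induct) (auto intro: tctx.intros)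

lemma tctx_leaf_subst:
  "tctx C \<Longrightarrow> \<exists>C'. tctx C' \<and> (\<forall>t. leaf_subst g (C t) = C' (leaf_subst g t))"
proof (induction rule: tctx.induct)
  case hole
  then show ?case by (intro exI[of _ "\<lambda>t. t"]) (auto intro: tctx.hole)
next
  case (node C w xs ys)
  then obtain C' where C': "tctx C'" "\<And>t. leaf_subst g (C t) = C' (leaf_subst g t)" by blast
  show ?case
    by (rule exI[of _ "\<lambda>t. Node w (map (leaf_subst g) xs @ C' t # map (leaf_subst g) ys)"])
      (auto intro: tctx.node C'(1) simp: C'(2))
qed

text \<open>Since the labels are distinct, i occurs once; the substituted tree as a function of the
  value at i is therefore a context with a single hole.\<close>

lemma leaf_subst_tctx:
  "distinct (leaves t) \<Longrightarrow> i \<in> set (leaves t) \<Longrightarrow> \<exists>C. tctx C \<and> (\<forall>s. leaf_subst (f(i := s)) t = C s)"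
proof (induction t)
  case (Leaf x)
  then show ?case by (intro exI[of _ "\<lambda>t. t"]) (auto intro: tctx.hole)
next
  case (Node v ts)
  then obtain t where "t \<in> set ts" "i \<in> set (leaves t)" by auto
  then obtain xs ys where ts: "ts = xs @ t # ys" by (meson split_list)
  have d: "distinct (leaves t)" and n: "i \<notin> set (leaves x)" if "x \<in> set xs \<union> set ys" for x
    using Node.prems \<open>i \<in> set (leaves t)\<close> that unfolding ts by auto
  have "distinct (leaves t)" using Node.prems unfolding ts by auto
  then obtain C where C: "tctx C" "\<And>s. leaf_subst (f(i := s)) t = C s"
    using Node.IH[OF \<open>t \<in> set ts\<close>] \<open>i \<in> set (leaves t)\<close> by blast
  have eq: "leaf_subst (f(i := s)) x = leaf_subst f x" if "x \<in> set xs \<union> set ys" for x s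
    using n[OF that] by (intro leaf_subst_cong) auto
  show ?case
    by (rule exI[of _ "\<lambda>s. Node v (map (leaf_subst f) xs @ C s # map (leaf_subst f) ys)"])
      (auto intro: tctx.node C(1) simp: ts C(2) eq simp del: fun_upd_apply)
qed

text \<open>The effect of a relabelled corolla on the trees plugged into it: input i now receives
  entry number \<rho> i, counted from 1 while list positions count from 0.\<close>

definition shuffle_list :: "(nat \<Rightarrow> nat) \<Rightarrow> 'a list \<Rightarrow> 'a list" where
  "shuffle_list \<rho> ts = map (\<lambda>i. ts ! (\<rho> i - 1)) [1..<Suc (length ts)]"

lemma shuffle_list_map:
  assumes "\<rho> permutes {1..length ts}" shows "shuffle_list \<rho> (map f ts) = map f (shuffle_list \<rho> ts)"
proof -
  have "\<rho> i - 1 < length ts" if "i \<in> {1..length ts}" for i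
    using permutes_in_image[OF assms, of i] that by auto
  then show ?thesis by (auto simp: shuffle_list_def simp del: upt_Suc)
qed

abbreviation vdec :: "('k, 'v) smod \<Rightarrow> 'v ptree \<Rightarrow> bool" where
  "vdec V \<equiv> decorated (\<lambda>n. carrier (part V n))"

text \<open>A functional on trees is good if it respects the relations of the free operad at every vertex.\<close>

definition good :: "('k, 'm) ring_scheme \<Rightarrow> ('k, 'v) smod \<Rightarrow> ('v ptree \<Rightarrow> 'k) \<Rightarrow> bool" where
  "good K V h \<longleftrightarrow> (\<forall>i. h (Leaf i) \<in> carrier K) \<and>
     (\<forall>C ts. tctx C \<longrightarrow> (\<forall>v\<in>carrier (part V (length ts)). vdec V (C (Node v ts))) \<longrightarrow>
        (\<lambda>v. h (C (Node v ts))) \<in> lin_maps K (part V (length ts)) (scal K) \<and>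
        (\<forall>v\<in>carrier (part V (length ts)). \<forall>\<sigma>. \<sigma> permutes {1..length ts} \<longrightarrow>
           h (C (Node (sact V (length ts) v \<sigma>) ts)) = h (C (Node v (shuffle_list (inv_into UNIV \<sigma>) ts)))))"

lemma goodI:
  assumes "\<And>i. h (Leaf i) \<in> carrier K"
    and "\<And>C ts. tctx C \<Longrightarrow> (\<And>v. v \<in> carrier (part V (length ts)) \<Longrightarrow> vdec V (C (Node v ts))) \<Longrightarrow>
      (\<lambda>v. h (C (Node v ts))) \<in> lin_maps K (part V (length ts)) (scal K)"
    and "\<And>C ts v \<sigma>. tctx C \<Longrightarrow> (\<And>v. v \<in> carrier (part V (length ts)) \<Longrightarrow> vdec V (C (Node v ts))) \<Longrightarrow>
      v \<in> carrier (part V (length ts)) \<Longrightarrow> \<sigma> permutes {1..length ts} \<Longrightarrow>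
      h (C (Node (sact V (length ts) v \<sigma>) ts)) = h (C (Node v (shuffle_list (inv_into UNIV \<sigma>) ts)))"
  shows "good K V h"
  using assms unfolding good_def by blast

lemma goodD:
  assumes "good K V h"
  shows "h (Leaf i) \<in> carrier K"
    and "tctx C \<Longrightarrow> (\<And>v. v \<in> carrier (part V (length ts)) \<Longrightarrow> vdec V (C (Node v ts))) \<Longrightarrow>
      (\<lambda>v. h (C (Node v ts))) \<in> lin_maps K (part V (length ts)) (scal K)"
    and "tctx C \<Longrightarrow> (\<And>v. v \<in> carrier (part V (length ts)) \<Longrightarrow> vdec V (C (Node v ts))) \<Longrightarrow>
      v \<in> carrier (part V (length ts)) \<Longrightarrow> \<sigma> permutes {1..length ts} \<Longrightarrow>
      h (C (Node (sact V (length ts) v \<sigma>) ts)) = h (C (Node v (shuffle_list (inv_into UNIV \<sigma>) ts)))"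
  using assms unfolding good_def by blast+

lemma good_closed:
  assumes "good K V h" "vdec V t" shows "h t \<in> carrier K"
proof (cases t)
  case (Leaf i)
  then show ?thesis using goodD(1)[OF assms(1)] by simp
next
  case (Node v ts)
  have "(\<lambda>v. h (Node v ts)) \<in> lin_maps K (part V (length ts)) (scal K)"
    using goodD(2)[OF assms(1) tctx.hole] assms(2) Node by simp
  from lin_mapsD(1)[OF this, of v] show ?thesis using assms(2) Node by simp
qed

text \<open>Goodness survives precomposition with contexts and with substitutions, hence with
  relabelling and with grafting in either argument. These stability properties make the common
  kernel of all good functionals an ideal.\<close>

lemma good_tctx:
  assumes h: "good K V h" and C: "tctx C" and dec: "\<And>t. vdec V t \<Longrightarrow> vdec V (C t)"
  shows "good K V (\<lambda>t. h (C t))"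
proof (rule goodI)
  show "h (C (Leaf i)) \<in> carrier K" for i by (rule good_closed[OF h dec]) simp
next
  fix C' ts assume C': "tctx C'" "\<And>v. v \<in> carrier (part V (length ts)) \<Longrightarrow> vdec V (C' (Node v ts))"
  have dd: "vdec V (C (C' (Node v ts)))" if "v \<in> carrier (part V (length ts))" for v
    by (rule dec[OF C'(2)[OF that]])
  show "(\<lambda>v. h (C (C' (Node v ts)))) \<in> lin_maps K (part V (length ts)) (scal K)"
    by (rule goodD(2)[OF h tctx_compose[OF C C'(1)], of ts, OF dd])
  fix v \<sigma> assume v: "v \<in> carrier (part V (length ts))" and s: "\<sigma> permutes {1..length ts}"
  show "h (C (C' (Node (sact V (length ts) v \<sigma>) ts))) =
      h (C (C' (Node v (shuffle_list (inv_into UNIV \<sigma>) ts))))"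
    by (rule goodD(3)[OF h tctx_compose[OF C C'(1)], of ts v \<sigma>, OF dd v s])
qed

lemma good_leaf_subst:
  assumes h: "good K V h" and g: "\<And>i. vdec V (g i)"
  shows "good K V (\<lambda>t. h (leaf_subst g t))"
proof (rule goodI)
  show "h (leaf_subst g (Leaf i)) \<in> carrier K" for i using good_closed[OF h g] by simp
next
  fix C ts assume C: "tctx C" "\<And>v. v \<in> carrier (part V (length ts)) \<Longrightarrow> vdec V (C (Node v ts))"
  let ?ts = "map (leaf_subst g) ts"
  obtain C' where C': "tctx C'" "\<And>t. leaf_subst g (C t) = C' (leaf_subst g t)"
    using tctx_leaf_subst[OF C(1)] by blast
  have d: "vdec V (C' (Node v ?ts))" if "v \<in> carrier (part V (length ?ts))" for v
    using decorated_leaf_subst[OF C(2)[of v], of g] g that by (simp add: C'(2))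
  show "(\<lambda>v. h (leaf_subst g (C (Node v ts)))) \<in> lin_maps K (part V (length ts)) (scal K)"
    using goodD(2)[OF h C'(1), of ?ts, OF d] by (simp add: C'(2))
  fix v \<sigma> assume v: "v \<in> carrier (part V (length ts))" and s: "\<sigma> permutes {1..length ts}"
  show "h (leaf_subst g (C (Node (sact V (length ts) v \<sigma>) ts))) =
      h (leaf_subst g (C (Node v (shuffle_list (inv_into UNIV \<sigma>) ts))))"
    using goodD(3)[OF h C'(1), of ?ts v \<sigma>, OF d] v s by (simp add: C'(2) shuffle_list_map permutes_inv)
qed

lemma good_relabel: "good K V h \<Longrightarrow> good K V (\<lambda>t. h (relabel f t))"
  unfolding relabel_def by (rule good_leaf_subst) auto

lemma good_graft_left:
  assumes "good K V h" "u \<in> vtrees V n" shows "good K V (\<lambda>t. h (graft n i t u))"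
  unfolding graft_def
  by (rule good_leaf_subst[OF assms(1)]) (use assms(2) in \<open>auto simp: ptrees_def\<close>)

lemma good_graft_right:
  fixes V :: "('k, 'v) smod"
  assumes h: "good K V h" and t: "t \<in> vtrees V m" and i: "i \<in> {1..m}"
  shows "good K V (\<lambda>u. h (graft n i t u))"
proof -
  \<comment> \<open>The substitution performed by \<open>graft\<close> away from the leaf i; at i
    itself f is overwritten by the grafted tree.\<close>
  define f where "f = (\<lambda>j. if j < i then Leaf j else Leaf (j + n - 1) :: 'v ptree)"
  obtain C where C: "tctx C" "\<And>s. leaf_subst (f(i := s)) t = C s"
    using leaf_subst_tctx[of t i f] t i by (auto simp: ptrees_def)
  have "vdec V (C s)" if "vdec V s" for s
    unfolding C(2)[symmetric] by (rule decorated_leaf_subst) (use t that in \<open>auto simp: ptrees_def f_def\<close>)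
  from good_relabel[OF good_tctx[OF h C(1) this], of "\<lambda>k. k + i - 1"]
  have "good K V (\<lambda>u. h (C (relabel (\<lambda>k. k + i - 1) u)))" .
  moreover have "graft n i t u = C (relabel (\<lambda>k. k + i - 1) u)" for u
    unfolding graft_def C(2)[symmetric] by (rule leaf_subst_cong) (auto simp: f_def)
  ultimately show ?thesis by simp
qed

context
  fixes K :: "('k, 'm) ring_scheme" and V :: "('k, 'v) smod"
  assumes V: "pre_smod K V"
begin

definition pairing :: "('v ptree \<Rightarrow> 'k) \<Rightarrow> ('v ptree \<Rightarrow> 'k) \<Rightarrow> 'k" where
  "pairing h = lin_ext K (scal K) h"

definition good_kernel :: "nat \<Rightarrow> ('v ptree \<Rightarrow> 'k) set" where
  "good_kernel n = {x \<in> carrier (part (smod_trees K V) n). \<forall>h. good K V h \<longrightarrow> pairing h x = \<zero>\<^bsub>K\<^esub>}"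

lemma pairing_linear: "good K V h \<Longrightarrow> pairing h \<in> lin_maps K (part (smod_trees K V) n) (scal K)"
  unfolding pairing_def smod_trees_def tree_part
  by (rule lin_ext_linear[OF module_scal[OF pre_smodD(2)[OF V]]]) (auto simp: ptrees_def intro: good_closed)

lemma pairing_single: "good K V h \<Longrightarrow> t \<in> vtrees V n \<Longrightarrow> pairing h (single K t) = h t"
  unfolding pairing_def
  by (rule lin_ext_single[OF module_scal[OF pre_smodD(2)[OF V]]]) (auto simp: ptrees_def intro: good_closed)

lemma smod_trees_span: "mod_span K (part (smod_trees K V) n) (single K ` vtrees V n) = carrier (part (smod_trees K V) n)"
  unfolding smod_trees_def by (rule tree_span[OF pre_smodD(2)[OF V]])

text \<open>The operation is transposed to the functional. After reduction of the other factor to a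
  single tree, h of a composite is again a good functional of the factor in the kernel, so it
  vanishes there; the action is treated alike.\<close>

lemma good_kernel_ideal: "operad_ideal K (smod_trees K V) good_kernel"
proof (rule operad_idealI)
  let ?T = "smod_trees K V"
  note L = lin_operad_smod_trees[OF pre_smodD(2)[OF V], of V]
  note m = lin_operadD(1)[OF L] and ms = module_scal[OF pre_smodD(2)[OF V]]
  show "submodule (good_kernel n) K (part ?T n)" for n
  proof -
    have "good_kernel n = carrier (part ?T n) \<inter> \<Inter>{{x \<in> carrier (part ?T n). pairing h x \<in> {\<zero>\<^bsub>scal K\<^esub>}} | h. good K V h}"
      by (auto simp: good_kernel_def)
    \<comment> \<open>Inserting the carrier makes the family nonempty regardless of which good
      functionals exist.\<close>
    also have "\<dots> = \<Inter>(insert (carrier (part ?T n)) {{x \<in> carrier (part ?T n). pairing h x \<in> {\<zero>\<^bsub>scal K\<^esub>}} | h. good K V h})"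
      by auto
    also have "submodule \<dots> K (part ?T n)"
      by (rule submodule_Int[OF m])
        (use submodule_carrier[OF m] submodule_preimage[OF pairing_linear m ms submodule_zero[OF ms]] in blast)+
    finally show ?thesis .
  qed
  show "sact ?T n x \<sigma> \<in> good_kernel n" if x: "x \<in> good_kernel n" and \<sigma>: "\<sigma> permutes {1..n}" for n x \<sigma>
  proof -
    have xc: "x \<in> carrier (part ?T n)" using x by (simp add: good_kernel_def)
    have "pairing h (sact ?T n x \<sigma>) = \<zero>\<^bsub>K\<^esub>" if h: "good K V h" for h
    proof -
      note gr = good_relabel[OF h, of "inv_into UNIV \<sigma>"]
      have "pairing h (sact ?T n x \<sigma>) = pairing (\<lambda>t. h (relabel (inv_into UNIV \<sigma>) t)) x"
      proof (rule lin_maps_eq_on_span[OF lin_maps_compose[OF lin_operadD(2)[OF L \<sigma>] pairing_linear[OF h]]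
            pairing_linear[OF gr] m ms])
        show "x \<in> mod_span K (part ?T n) (single K ` vtrees V n)" using xc smod_trees_span by simp
        show "single K ` vtrees V n \<subseteq> carrier (part ?T n)" using smod_single_closed[OF V] by auto
        fix y assume "y \<in> single K ` vtrees V n"
        then obtain t where t: "t \<in> vtrees V n" "y = single K t" by auto
        have "sact ?T n y \<sigma> = single K (relabel (inv_into UNIV \<sigma>) t)"
          unfolding t(2) smod_trees_def by (rule tree_sact_single[OF pre_smodD(2)[OF V] t(1) \<sigma>])
        then show "pairing h (sact ?T n y \<sigma>) = pairing (\<lambda>t. h (relabel (inv_into UNIV \<sigma>) t)) y"
          using pairing_single[OF h ptrees_inv_permute[OF t(1) \<sigma>]] pairing_single[OF gr t(1)] t(2) by simp
      qed
      then show ?thesis using x gr by (simp add: good_kernel_def)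
    qed
    then show ?thesis using operad_closed(1)[OF L xc \<sigma>] by (simp add: good_kernel_def)
  qed
  have ts: "pcomp ?T m n i (single K t) (single K u) = single K (graft n i t u)"
    if "t \<in> vtrees V m" "u \<in> vtrees V n" "i \<in> {1..m}" for m n i t u
    unfolding smod_trees_def by (rule tree_pcomp_single[OF pre_smodD(2)[OF V] that])
  show "pcomp ?T m n i x y \<in> good_kernel (m + n - 1)"
    if i: "i \<in> {1..m}" and x: "x \<in> good_kernel m" and y: "y \<in> carrier (part ?T n)" for m n i x y
  proof -
    have xc: "x \<in> carrier (part ?T m)" using x by (simp add: good_kernel_def)
    note B = bilinear_onD[OF lin_operadD(3)[OF L i, of n]]
    have "pairing h (pcomp ?T m n i x y) = \<zero>\<^bsub>K\<^esub>" if h: "good K V h" for h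
    proof -
      have "pairing h (pcomp ?T m n i x y) \<in> {\<zero>\<^bsub>scal K\<^esub>}"
      proof (rule lin_maps_mod_span[OF lin_maps_compose[OF B(1)[OF xc] pairing_linear[OF h]] m ms submodule_zero[OF ms]])
        show "y \<in> mod_span K (part ?T n) (single K ` vtrees V n)" using y smod_trees_span by simp
        show "single K ` vtrees V n \<subseteq> carrier (part ?T n)" using smod_single_closed[OF V] by auto
        fix z assume "z \<in> single K ` vtrees V n"
        then obtain u where u: "u \<in> vtrees V n" "z = single K u" by auto
        note zc = smod_single_closed[OF V, OF u(1), folded u(2)]
        note gg = good_graft_left[OF h u(1), of i]
        have "pairing h (pcomp ?T m n i x z) = pairing (\<lambda>t. h (graft n i t u)) x"
        proof (rule lin_maps_eq_on_span[OF lin_maps_compose[OF B(2)[OF zc] pairing_linear[OF h]] pairing_linear[OF gg] m ms])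
          show "x \<in> mod_span K (part ?T m) (single K ` vtrees V m)" using xc smod_trees_span by simp
          show "single K ` vtrees V m \<subseteq> carrier (part ?T m)" using smod_single_closed[OF V] by auto
          fix w assume "w \<in> single K ` vtrees V m"
          then obtain t where t: "t \<in> vtrees V m" "w = single K t" by auto
          show "pairing h (pcomp ?T m n i w z) = pairing (\<lambda>t. h (graft n i t u)) w"
            unfolding t(2) u(2) ts[OF t(1) u(1) i] pairing_single[OF gg t(1)]
            by (rule pairing_single[OF h graft_ptrees[OF t(1) u(1) i]])
        qed
        then show "pairing h (pcomp ?T m n i x z) \<in> {\<zero>\<^bsub>scal K\<^esub>}" using x gg by (simp add: good_kernel_def)
      qed
      then show ?thesis by simp
    qed
    then show ?thesis using operad_closed(2)[OF L i xc y] by (simp add: good_kernel_def)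
  qed
  show "pcomp ?T m n i x y \<in> good_kernel (m + n - 1)"
    if i: "i \<in> {1..m}" and x: "x \<in> carrier (part ?T m)" and y: "y \<in> good_kernel n" for m n i x y
  proof -
    have yc: "y \<in> carrier (part ?T n)" using y by (simp add: good_kernel_def)
    note B = bilinear_onD[OF lin_operadD(3)[OF L i, of n]]
    have "pairing h (pcomp ?T m n i x y) = \<zero>\<^bsub>K\<^esub>" if h: "good K V h" for h
    proof -
      have "pairing h (pcomp ?T m n i x y) \<in> {\<zero>\<^bsub>scal K\<^esub>}"
      proof (rule lin_maps_mod_span[OF lin_maps_compose[OF B(2)[OF yc] pairing_linear[OF h]] m ms submodule_zero[OF ms]])
        show "x \<in> mod_span K (part ?T m) (single K ` vtrees V m)" using x smod_trees_span by simp
        show "single K ` vtrees V m \<subseteq> carrier (part ?T m)" using smod_single_closed[OF V] by auto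
        fix w assume "w \<in> single K ` vtrees V m"
        then obtain t where t: "t \<in> vtrees V m" "w = single K t" by auto
        note wc = smod_single_closed[OF V, OF t(1), folded t(2)]
        note gg = good_graft_right[OF h t(1) i, of n]
        have "pairing h (pcomp ?T m n i w y) = pairing (\<lambda>u. h (graft n i t u)) y"
        proof (rule lin_maps_eq_on_span[OF lin_maps_compose[OF B(1)[OF wc] pairing_linear[OF h]] pairing_linear[OF gg] m ms])
          show "y \<in> mod_span K (part ?T n) (single K ` vtrees V n)" using yc smod_trees_span by simp
          show "single K ` vtrees V n \<subseteq> carrier (part ?T n)" using smod_single_closed[OF V] by auto
          fix z assume "z \<in> single K ` vtrees V n"
          then obtain u where u: "u \<in> vtrees V n" "z = single K u" by auto
          show "pairing h (pcomp ?T m n i w z) = pairing (\<lambda>u. h (graft n i t u)) z"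
            unfolding t(2) u(2) ts[OF t(1) u(1) i] pairing_single[OF gg u(1)]
            by (rule pairing_single[OF h graft_ptrees[OF t(1) u(1) i]])
        qed
        then show "pairing h (pcomp ?T m n i w y) \<in> {\<zero>\<^bsub>scal K\<^esub>}" using y gg by (simp add: good_kernel_def)
      qed
      then show ?thesis by simp
    qed
    then show ?thesis using operad_closed(2)[OF L i x yc] by (simp add: good_kernel_def)
  qed
qed

text \<open>The relations are imposed at corollas, where the trivial context suffices. Their
  validity at an arbitrary vertex is a consequence of the ideal property.\<close>

lemma free_rels_good_kernel: "free_rels K V n \<subseteq> good_kernel n"
proof
  let ?T = "smod_trees K V"
  note L = lin_operad_smod_trees[OF pre_smodD(2)[OF V], of V]
  note m = lin_operadD(1)[OF L, of n] and ms = module_scal[OF pre_smodD(2)[OF V]]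
  interpret F: module K "part ?T n" by (rule m)
  interpret N: module K "scal K" by (rule ms)
  interpret M: module K "part V n" by (rule pre_smodD(1)[OF V])
  have cN: "corolla n v = Node v (map Leaf [1..<Suc n])" for v :: 'v by (simp add: corolla_def)
  note c = corolla_vtrees[OF V] and scc = smod_single_closed[OF V, OF corolla_vtrees[OF V]]
  fix x assume x: "x \<in> free_rels K V n"
  have "pairing h x = \<zero>\<^bsub>K\<^esub>" if h: "good K V h" for h
  proof -
    let ?ts = "map Leaf [1..<Suc n] :: 'v ptree list"
    have len: "length ?ts = n" by (simp del: upt_Suc)
    have dec: "vdec V (Node v ?ts)" if "v \<in> carrier (part V (length ?ts))" for v
      using that by (simp del: upt_Suc)
    have lin: "(\<lambda>v. h (corolla n v)) \<in> lin_maps K (part V n) (scal K)"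
      using goodD(2)[OF h tctx.hole, of ?ts, OF dec] unfolding cN len by blast
    note l = lin_mapsD[OF lin]
    note p = lin_maps_minus[OF pairing_linear[OF h] m ms] lin_mapsD[OF pairing_linear[OF h, of n]]
    note ps = pairing_single[OF h c]
    have z0: "y \<ominus>\<^bsub>scal K\<^esub> y = \<zero>\<^bsub>K\<^esub>" if "y \<in> carrier K" for y
      using that N.r_neg[of y] by (simp add: a_minus_def)
    from x show ?thesis
    proof (cases rule: free_relsE)
      case (1 u v)
      then show ?thesis using l(1)[OF 1(1)] l(1)[OF 1(2)]
          N.a_closed[of "h (corolla n u)" "h (corolla n v)"]
        by (simp add: p scc ps l(2)[OF 1(1,2)] z0)
    next
      case (2 a v)
      then show ?thesis using l(1)[OF 2(2)]
        by (simp add: p scc ps l(3)[OF 2(1,2)] z0)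
    next
      case (3 v \<sigma>)
      have "?T = tree_operad K (\<lambda>n. carrier (part V n))" by (simp add: smod_trees_def)
      then have s: "sact ?T n (single K (corolla n v)) \<sigma> = single K (relabel (inv_into UNIV \<sigma>) (corolla n v))"
        using tree_sact_single[OF pre_smodD(2)[OF V] c[OF 3(1)] 3(2)] by simp
      have pl: "shuffle_list (inv_into UNIV \<sigma>) ?ts = map (relabel (inv_into UNIV \<sigma>)) ?ts"
      proof (rule nth_equalityI)
        fix i assume "i < length (shuffle_list (inv_into UNIV \<sigma>) ?ts)"
        then have i: "i < n" by (simp add: shuffle_list_def del: upt_Suc)
        then have "inv_into UNIV \<sigma> (1 + i) \<in> {1..n}"
          using permutes_in_image[OF permutes_inv[OF 3(2)], of "1 + i"] by auto
        then show "shuffle_list (inv_into UNIV \<sigma>) ?ts ! i = map (relabel (inv_into UNIV \<sigma>)) ?ts ! i"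
          using i by (auto simp: shuffle_list_def simp del: upt_Suc)
      qed (simp add: shuffle_list_def del: upt_Suc)
      have "h (corolla n (sact V n v \<sigma>)) = h (relabel (inv_into UNIV \<sigma>) (corolla n v))"
        using goodD(3)[OF h tctx.hole, of ?ts v \<sigma>, OF dec] 3(1,2) pl unfolding cN len by simp
      moreover have "sact V n v \<sigma> \<in> carrier (part V n)" by (rule pre_smodD(3)[OF V 3(1,2)])
      moreover note rt = ptrees_inv_permute[OF c[OF 3(1)] 3(2)]
      ultimately show ?thesis using 3(3) smod_single_closed[OF V, OF rt] pairing_single[OF h rt] l(1)[of "sact V n v \<sigma>"]
        by (simp add: s p scc ps z0)
    qed
  qed
  then show "x \<in> good_kernel n" using x free_rels_carrier[OF V] by (auto simp: good_kernel_def)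
qed

text \<open>By minimality \<open>free_ideal\<close> lies inside the common kernel, so the pairing
  with h factors through the quotient.\<close>

lemma good_functional:
  assumes h: "good K V h"
  obtains f where "f \<in> lin_maps K (part (free_operad K V) n) (scal K)"
    "\<And>t. t \<in> vtrees V n \<Longrightarrow> f (free_tree K V n t) = h t"
proof -
  note L = lin_operad_smod_trees[OF pre_smodD(2)[OF V], of V]
  have "free_ideal K V n \<subseteq> good_kernel n"
    unfolding free_ideal_def by (rule gen_ideal_least[OF good_kernel_ideal free_rels_good_kernel])
  then have z: "pairing h x = \<zero>\<^bsub>scal K\<^esub>" if "x \<in> free_ideal K V n" for x
    using that h by (auto simp: good_kernel_def)
  obtain f where f: "f \<in> lin_maps K (quot_mod (part (smod_trees K V) n) (free_ideal K V n)) (scal K)"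
    "\<And>x. x \<in> carrier (part (smod_trees K V) n) \<Longrightarrow> f (free_ideal K V n +>\<^bsub>part (smod_trees K V) n\<^esub> x) = pairing h x"
    using quot_mod_lift[OF lin_operadD(1)[OF L] operad_idealD(1)[OF free_ideal_ideal[OF V]] module_scal[OF pre_smodD(2)[OF V]]
      pairing_linear[OF h] z] by blast
  show ?thesis
  proof (rule that[of f])
    show "f \<in> lin_maps K (part (free_operad K V) n) (scal K)" using f(1) by (simp add: free_operad_def quot_operad_def)
    show "f (free_tree K V n t) = h t" if "t \<in> vtrees V n" for t
      using f(2)[OF smod_single_closed[OF V, OF that]] pairing_single[OF h that] by (simp add: free_tree_def)
  qed
qed

end

section \<open>Functionals that detect a binary tree\<close>

lemma lin_scal:
  assumes "cring K"
  shows "f \<in> lin_maps K M (scal K) \<Longrightarrow> a \<in> carrier K \<Longrightarrow> (\<lambda>x. f x \<otimes>\<^bsub>K\<^esub> a) \<in> lin_maps K M (scal K)"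
    and "f \<in> lin_maps K M (scal K) \<Longrightarrow> a \<in> carrier K \<Longrightarrow> (\<lambda>x. a \<otimes>\<^bsub>K\<^esub> f x) \<in> lin_maps K M (scal K)"
    and "f \<in> lin_maps K M (scal K) \<Longrightarrow> g \<in> lin_maps K M (scal K) \<Longrightarrow> (\<lambda>x. f x \<oplus>\<^bsub>K\<^esub> g x) \<in> lin_maps K M (scal K)"
    and "(\<lambda>x. \<zero>\<^bsub>K\<^esub>) \<in> lin_maps K M (scal K)"
  using lin_maps_scale[OF _ module_scal[OF assms], of f M a] lin_maps_smult[OF _ module_scal[OF assms], of f M a]
    lin_maps_add[OF _ _ module_scal[OF assms], of f M g] lin_maps_const_zero[OF module_scal[OF assms], of M] by simp_all

definition leaf_ind :: "('k, 'm) ring_scheme \<Rightarrow> nat \<Rightarrow> 'v ptree \<Rightarrow> 'k" where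
  "leaf_ind K c t = (case t of Leaf a \<Rightarrow> (if a = c then \<one>\<^bsub>K\<^esub> else \<zero>\<^bsub>K\<^esub>) | Node v ts \<Rightarrow> \<zero>\<^bsub>K\<^esub>)"

text \<open>The functional dual to a binary root: \<phi> and \<psi> read the two inputs and d reads
  the decoration. The second summand, with inputs exchanged and the decoration flipped, is what
  makes it respect the symmetric action at the root.\<close>

definition fork :: "('k, 'm) ring_scheme \<Rightarrow> ('k, 'v) smod \<Rightarrow> ('v ptree \<Rightarrow> 'k) \<Rightarrow> ('v ptree \<Rightarrow> 'k) \<Rightarrow>
    ('v \<Rightarrow> 'k) \<Rightarrow> 'v ptree \<Rightarrow> 'k" where
  "fork K V \<phi> \<psi> d t = (case t of Leaf a \<Rightarrow> \<zero>\<^bsub>K\<^esub> | Node v ts \<Rightarrow>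
     if length ts = 2 then (\<phi> (ts ! 0) \<otimes>\<^bsub>K\<^esub> \<psi> (ts ! 1)) \<otimes>\<^bsub>K\<^esub> d v \<oplus>\<^bsub>K\<^esub>
       (\<psi> (ts ! 0) \<otimes>\<^bsub>K\<^esub> \<phi> (ts ! 1)) \<otimes>\<^bsub>K\<^esub> d (sact V 2 v flip) else \<zero>\<^bsub>K\<^esub>)"

lemma fork_simps:
  "fork K V \<phi> \<psi> d (Leaf a) = \<zero>\<^bsub>K\<^esub>"
  "fork K V \<phi> \<psi> d (Node v [s, r]) = (\<phi> s \<otimes>\<^bsub>K\<^esub> \<psi> r) \<otimes>\<^bsub>K\<^esub> d v \<oplus>\<^bsub>K\<^esub> (\<psi> s \<otimes>\<^bsub>K\<^esub> \<phi> r) \<otimes>\<^bsub>K\<^esub> d (sact V 2 v flip)"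
  "length ts \<noteq> 2 \<Longrightarrow> fork K V \<phi> \<psi> d (Node v ts) = \<zero>\<^bsub>K\<^esub>"
  by (auto simp: fork_def One_nat_def)

lemma leaf_ind_simps:
  "leaf_ind K c (Leaf a) = (if a = c then \<one>\<^bsub>K\<^esub> else \<zero>\<^bsub>K\<^esub>)" "leaf_ind K c (Node v ts) = \<zero>\<^bsub>K\<^esub>"
  by (simp_all add: leaf_ind_def)

lemma good_leaf_ind:
  assumes "cring K" shows "good K V (leaf_ind K c)"
proof -
  interpret cring K by fact
  have z: "leaf_ind K c (C (Node v ts)) = \<zero>\<^bsub>K\<^esub>" if "tctx C" for C v ts
    using that by (cases rule: tctx.cases) (auto simp: leaf_ind_def)
  show ?thesis by (rule goodI) (auto simp: z lin_scal(4)[OF assms], simp add: leaf_ind_def)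
qed

lemma list_two: "length ts = 2 \<Longrightarrow> \<exists>s r. ts = [s, r]"
  by (auto simp: numeral_2_eq_2 length_Suc_conv)

lemma shuffle_two: "shuffle_list flip [s, r] = [r, s]" "length (shuffle_list \<rho> ts) = length ts"
  by (simp_all add: shuffle_list_def numeral_2_eq_2 One_nat_def del: upt_Suc, simp)

lemma shuffle_id: "shuffle_list id ts = ts"
  by (rule nth_equalityI) (auto simp: shuffle_list_def simp del: upt_Suc)

lemma s_moduleD:
  assumes "s_module K V" "v \<in> carrier (part V n)"
  shows "sact V n v id = v"
    "\<sigma> permutes {1..n} \<Longrightarrow> \<tau> permutes {1..n} \<Longrightarrow> sact V n v (\<sigma> \<circ> \<tau>) = sact V n (sact V n v \<sigma>) \<tau>"
  using assms unfolding s_module_def by blast+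

lemma s_module_sact_linear:
  assumes "s_module K V" "\<sigma> permutes {1..n}"
  shows "(\<lambda>v. sact V n v \<sigma>) \<in> lin_maps K (part V n) (part V n)"
  using assms unfolding s_module_def by blast

lemma s_module_flip:
  assumes "s_module K V" "v \<in> carrier (part V 2)"
  shows "sact V 2 (sact V 2 v flip) flip = v"
  using s_moduleD[OF assms] flip_permutes by (metis transpose_comp_involutory)

text \<open>At the root, linearity is that of d and of d after the flip, and equivariance comes from
  the symmetrisation. Any other vertex lies inside one input, where goodness of \<phi> and \<psi>
  applies in each summand.\<close>

lemma good_fork:
  assumes V: "s_module K V" and \<phi>: "good K V \<phi>" and \<psi>: "good K V \<psi>" and d: "d \<in> lin_maps K (part V 2) (scal K)"
  shows "good K V (fork K V \<phi> \<psi> d)"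
proof -
  note pV = s_module_pre_smod[OF V]
  note cr = pre_smodD(2)[OF pV]
  interpret K: cring K by (rule cr)
  note ls = lin_scal[OF cr]
  note dc = lin_mapsD(1)[OF d, unfolded scal_simps]
  have df: "(\<lambda>v. d (sact V 2 v flip)) \<in> lin_maps K (part V 2) (scal K)"
    by (rule lin_maps_compose[OF s_module_sact_linear[OF V flip_permutes] d])
  note gc\<phi> = good_closed[OF \<phi>] and gc\<psi> = good_closed[OF \<psi>]
  have ne: "\<exists>v. v \<in> carrier (part V n)" for n
  proof -
    interpret M: module K "part V n" by (rule pre_smodD(1)[OF pV])
    show ?thesis using M.zero_closed by blast
  qed
  show ?thesis
  proof (rule goodI)
    show "fork K V \<phi> \<psi> d (Leaf i) \<in> carrier K" for i by (simp add: fork_simps)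
  next
    fix C ts assume C: "tctx C" and dec: "\<And>v. v \<in> carrier (part V (length ts)) \<Longrightarrow> vdec V (C (Node v ts))"
    show "(\<lambda>v. fork K V \<phi> \<psi> d (C (Node v ts))) \<in> lin_maps K (part V (length ts)) (scal K)"
      using C
    proof (cases rule: tctx.cases)
      case hole
      show ?thesis
      proof (cases "length ts = 2")
        case True
        then obtain s r where sr: "ts = [s, r]" using list_two by blast
        obtain v where "v \<in> carrier (part V (length ts))" using ne by blast
        from dec[OF this] have "vdec V s" "vdec V r" by (simp_all add: hole sr)
        then have "(\<lambda>v. fork K V \<phi> \<psi> d (Node v [s, r])) \<in> lin_maps K (part V 2) (scal K)"
          unfolding fork_simps by (intro ls d df K.m_closed gc\<phi> gc\<psi>)
        then show ?thesis unfolding hole True unfolding sr .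
      next
        case False
        then show ?thesis by (simp add: hole fork_simps ls)
      qed
    next
      case (node C' w xs ys)
      show ?thesis
      \<comment> \<open>Only the number of inputs is inspected; \<open>undefined\<close> holds the
        place of the input that contains the vertex.\<close>
      proof (cases "length (xs @ undefined # ys) = 2")
        case True
        have w: "w \<in> carrier (part V 2)" and xy: "\<And>x. x \<in> set xs \<union> set ys \<Longrightarrow> vdec V x"
          using ne[of "length ts"] dec True unfolding node by auto
        have dec': "vdec V (C' (Node v ts))" if "v \<in> carrier (part V (length ts))" for v
          using dec[OF that] unfolding node by simp
        note l\<phi> = goodD(2)[OF \<phi> node(2), of ts, OF dec'] and l\<psi> = goodD(2)[OF \<psi> node(2), of ts, OF dec']
        note wf = dc[OF w] dc[OF two_closed[OF pV w]]
        from True consider r where "xs = []" "ys = [r]" | s where "xs = [s]" "ys = []"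
          by (cases xs; cases ys) auto
        then show ?thesis
        proof cases
          case 1
          then have "vdec V r" using xy by simp
          then show ?thesis unfolding node 1 append_Nil fork_simps
            by (intro ls l\<phi> l\<psi> gc\<phi> gc\<psi> wf)
        next
          case 2
          then have "vdec V s" using xy by simp
          then show ?thesis unfolding node 2 append_Nil append_Cons fork_simps
            by (intro ls l\<phi> l\<psi> gc\<phi> gc\<psi> wf)
        qed
      next
        case False
        then show ?thesis by (simp add: node fork_simps ls)
      qed
    qed
    fix v \<sigma> assume v: "v \<in> carrier (part V (length ts))" and \<sigma>: "\<sigma> permutes {1..length ts}"
    show "fork K V \<phi> \<psi> d (C (Node (sact V (length ts) v \<sigma>) ts)) =
        fork K V \<phi> \<psi> d (C (Node v (shuffle_list (inv_into UNIV \<sigma>) ts)))"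
      using C
    proof (cases rule: tctx.cases)
      case hole
      show ?thesis
      proof (cases "length ts = 2")
        case True
        then obtain s r where sr: "ts = [s, r]" using list_two by blast
        have c: "vdec V s" "vdec V r" using dec[OF v] by (simp_all add: hole sr)
        have v2: "v \<in> carrier (part V 2)" using v unfolding True .
        note cl = gc\<phi>[OF c(1)] gc\<phi>[OF c(2)] gc\<psi>[OF c(1)] gc\<psi>[OF c(2)] dc[OF v2] dc[OF two_closed[OF pV v2]]
        have "\<sigma> = id \<or> \<sigma> = flip" using permutes_two \<sigma> unfolding True by blast
        then show ?thesis
        proof
          assume "\<sigma> = id"
          then show ?thesis using s_moduleD(1)[OF V v] shuffle_id[of ts] by (simp add: hole)
        next
          assume "\<sigma> = flip"
          \<comment> \<open>The flip exchanges the two summands of \<open>fork\<close>, because the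
            transposition acts as an involution on decorations.\<close>
          then show ?thesis unfolding hole True unfolding sr
            by (simp add: fork_simps shuffle_two s_module_flip[OF V v2] cl K.m_ac K.a_comm)
        qed
      next
        case False
        then show ?thesis by (simp add: hole fork_simps shuffle_two)
      qed
    next
      case (node C' w xs ys)
      have dec': "vdec V (C' (Node v ts))" if "v \<in> carrier (part V (length ts))" for v
        using dec[OF that] unfolding node by simp
      note e\<phi> = goodD(3)[OF \<phi> node(2), of ts v \<sigma>, OF dec' v \<sigma>] and e\<psi> = goodD(3)[OF \<psi> node(2), of ts v \<sigma>, OF dec' v \<sigma>]
      show ?thesis
      proof (cases "length (xs @ undefined # ys) = 2")
        case True
        then consider r where "xs = []" "ys = [r]" | s where "xs = [s]" "ys = []"
          by (cases xs; cases ys) auto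
        then show ?thesis by cases (simp_all add: node fork_simps e\<phi> e\<psi>)
      next
        case False
        then show ?thesis by (simp add: node fork_simps)
      qed
    qed
  qed
qed

section \<open>Bases\<close>

text \<open>A basis together with its coordinate functionals, over any finite index set: the doubled
  basis is indexed by pairs and the basis in arity three by triples, unlike the enumeration in
  \<open>is_basis\<close>.\<close>

definition dual_basis :: "('k, 'm) ring_scheme \<Rightarrow> ('k, 'v) module \<Rightarrow> 'i set \<Rightarrow> ('i \<Rightarrow> 'v) \<Rightarrow> ('i \<Rightarrow> 'v \<Rightarrow> 'k) \<Rightarrow> bool" where
  "dual_basis K M I e c \<longleftrightarrow> finite I \<and> e ` I \<subseteq> carrier M \<and> (\<forall>i\<in>I. c i \<in> lin_maps K M (scal K)) \<and>
     (\<forall>i\<in>I. \<forall>j\<in>I. c i (e j) = (if i = j then \<one>\<^bsub>K\<^esub> else \<zero>\<^bsub>K\<^esub>)) \<and> mod_span K M (e ` I) = carrier M"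

lemma dual_basis_extend:
  assumes b: "dual_basis K M I e c" and N: "module K N" and g: "\<And>i. i \<in> I \<Longrightarrow> g i \<in> carrier N"
  shows "\<exists>f\<in>lin_maps K M N. \<forall>i\<in>I. f (e i) = g i"
proof -
  interpret N: module K N by fact
  have fin: "finite I" and c: "\<And>i. i \<in> I \<Longrightarrow> c i \<in> lin_maps K M (scal K)"
    and ce: "\<And>i j. i \<in> I \<Longrightarrow> j \<in> I \<Longrightarrow> c i (e j) = (if i = j then \<one>\<^bsub>K\<^esub> else \<zero>\<^bsub>K\<^esub>)"
    using b by (auto simp: dual_basis_def)
  let ?f = "\<lambda>x. \<Oplus>\<^bsub>N\<^esub>i\<in>I. c i x \<odot>\<^bsub>N\<^esub> g i"
  have "?f \<in> lin_maps K M N" by (intro lin_maps_sum lin_maps_scale c N g)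
  moreover have "?f (e j) = g j" if j: "j \<in> I" for j
  proof -
    have "?f (e j) = (\<Oplus>\<^bsub>N\<^esub>i\<in>I. if j = i then g i else \<zero>\<^bsub>N\<^esub>)"
      by (rule N.finsum_cong') (use g j in \<open>auto simp: ce\<close>)
    also have "\<dots> = g j" by (rule N.finsum_singleton[OF j fin]) (use g in auto)
    finally show ?thesis .
  qed
  ultimately show ?thesis by (intro bexI[of _ ?f] ballI)
qed

lemma dual_basis_memI:
  assumes b: "dual_basis K M I e c" and M: "module K M" and N: "module K N" and H: "submodule H K N"
    and "f \<in> lin_maps K M N" "\<And>i. i \<in> I \<Longrightarrow> f (e i) \<in> H" "x \<in> carrier M"
  shows "f x \<in> H"
proof (rule lin_maps_mod_span[OF assms(5) M N H])
  show "e ` I \<subseteq> carrier M" "x \<in> mod_span K M (e ` I)" using b assms(7) by (auto simp: dual_basis_def)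
  show "f y \<in> H" if "y \<in> e ` I" for y 
  proof -
    from that obtain i where "i \<in> I" "y = e i" by blast
    then show ?thesis using assms(6) by simp
  qed
qed

lemma is_basis_dual:
  assumes "is_basis K M s e" and M: "module K M"
  obtains c where "dual_basis K M {1..s} e c"
proof -
  interpret M: module K M by fact
  let ?sum = "\<lambda>c. \<Oplus>\<^bsub>M\<^esub>i\<in>{1..s}. c i \<odot>\<^bsub>M\<^esub> e i"
  let ?E = "{1..s} \<rightarrow>\<^sub>E carrier K"
  have e: "e i \<in> carrier M" if "i \<in> {1..s}" for i using assms(1) that by (auto simp: is_basis_def)
  have uniq: "\<exists>!c. c \<in> ?E \<and> v = ?sum c" if "v \<in> carrier M" for v using assms(1) that by (simp add: is_basis_def)
  define co where "co v = (THE c. c \<in> ?E \<and> v = ?sum c)" for v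
  have co: "co v \<in> ?E" "v = ?sum (co v)" if "v \<in> carrier M" for v
    using theI'[OF uniq[OF that]] unfolding co_def[symmetric] by blast+
  have cc: "co v i \<in> carrier K" if "v \<in> carrier M" "i \<in> {1..s}" for v i using co(1)[OF that(1)] that(2) by auto
  have coI: "co v i = c i" if "v \<in> carrier M" "v = ?sum c" "\<And>i. i \<in> {1..s} \<Longrightarrow> c i \<in> carrier K" "i \<in> {1..s}" for v c i
  proof -
    \<comment> \<open>\<open>is_basis\<close> asserts uniqueness among extensional coefficient
      families, so an arbitrary family is restricted before uniqueness is invoked.\<close>
    have "?sum c = ?sum (restrict c {1..s})"
      by (rule M.finsum_cong') (use that(3) e in auto)
    moreover have "restrict c {1..s} \<in> ?E" using that(3) by (simp add: restrict_PiE_iff)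
    ultimately have "restrict c {1..s} \<in> ?E \<and> v = ?sum (restrict c {1..s})" using that(2) by (simp only:)
    then have "co v = restrict c {1..s}" unfolding co_def by (rule the1_equality[OF uniq[OF that(1)]])
    then show ?thesis using that(4) by simp
  qed
  have "dual_basis K M {1..s} e (\<lambda>i v. co v i)"
    unfolding dual_basis_def
  proof (intro conjI ballI)
    show S: "e ` {1..s} \<subseteq> carrier M" using e by auto
    fix i assume i: "i \<in> {1..s}"
    show "(\<lambda>v. co v i) \<in> lin_maps K M (scal K)"
    proof (rule lin_mapsI)
      fix u assume u: "u \<in> carrier M"
      show "co u i \<in> carrier (scal K)" using cc[OF u i] by simp
      { fix v assume v: "v \<in> carrier M"
        have "?sum (\<lambda>i. co u i \<oplus>\<^bsub>K\<^esub> co v i) = (\<Oplus>\<^bsub>M\<^esub>i\<in>{1..s}. co u i \<odot>\<^bsub>M\<^esub> e i \<oplus>\<^bsub>M\<^esub> co v i \<odot>\<^bsub>M\<^esub> e i)"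
          by (rule M.finsum_cong') (use cc u v e in \<open>auto simp: M.smult_l_distr\<close>)
        also have "\<dots> = ?sum (co u) \<oplus>\<^bsub>M\<^esub> ?sum (co v)" by (rule M.finsum_addf) (use cc u v e in auto)
        also have "\<dots> = u \<oplus>\<^bsub>M\<^esub> v" by (simp only: co(2)[OF u, symmetric] co(2)[OF v, symmetric])
        finally have *: "?sum (\<lambda>i. co u i \<oplus>\<^bsub>K\<^esub> co v i) = u \<oplus>\<^bsub>M\<^esub> v" .
        show "co (u \<oplus>\<^bsub>M\<^esub> v) i = co u i \<oplus>\<^bsub>scal K\<^esub> co v i"
          unfolding scal_simps by (rule coI[OF _ *[symmetric] _ i]) (use u v cc in auto) }
      { fix a assume a: "a \<in> carrier K"
        have "?sum (\<lambda>i. a \<otimes>\<^bsub>K\<^esub> co u i) = (\<Oplus>\<^bsub>M\<^esub>i\<in>{1..s}. a \<odot>\<^bsub>M\<^esub> (co u i \<odot>\<^bsub>M\<^esub> e i))"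
          by (rule M.finsum_cong') (use cc u a e in \<open>auto simp: M.smult_assoc1\<close>)
        also have "\<dots> = a \<odot>\<^bsub>M\<^esub> ?sum (co u)" by (rule M.finsum_smult_ldistr[symmetric]) (use cc u a e in auto)
        also have "\<dots> = a \<odot>\<^bsub>M\<^esub> u" by (simp only: co(2)[OF u, symmetric])
        finally have *: "?sum (\<lambda>i. a \<otimes>\<^bsub>K\<^esub> co u i) = a \<odot>\<^bsub>M\<^esub> u" .
        show "co (a \<odot>\<^bsub>M\<^esub> u) i = a \<odot>\<^bsub>scal K\<^esub> co u i"
          unfolding scal_simps by (rule coI[OF _ *[symmetric] _ i]) (use u a cc in auto) }
    qed
    fix j assume j: "j \<in> {1..s}"
    have "?sum (\<lambda>k. if j = k then \<one>\<^bsub>K\<^esub> else \<zero>\<^bsub>K\<^esub>) = (\<Oplus>\<^bsub>M\<^esub>k\<in>{1..s}. if j = k then e k else \<zero>\<^bsub>M\<^esub>)"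
      by (rule M.finsum_cong') (use e in auto)
    also have "\<dots> = e j" by (rule M.finsum_singleton[OF j]) (use e in auto)
    finally have *: "?sum (\<lambda>k. if j = k then \<one>\<^bsub>K\<^esub> else \<zero>\<^bsub>K\<^esub>) = e j" .
    have "co (e j) i = (if j = i then \<one>\<^bsub>K\<^esub> else \<zero>\<^bsub>K\<^esub>)"
      by (rule coI[OF e[OF j] *[symmetric] _ i]) auto
    then show "co (e j) i = (if i = j then \<one>\<^bsub>K\<^esub> else \<zero>\<^bsub>K\<^esub>)" by (simp only: eq_commute)
  next
    have S: "e ` {1..s} \<subseteq> carrier M" using e by auto
    note sub = mod_span_submodule[OF M S]
    show "mod_span K M (e ` {1..s}) = carrier M"
    proof
      show "mod_span K M (e ` {1..s}) \<subseteq> carrier M" by (rule mod_span_carrier[OF M S])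
      show "carrier M \<subseteq> mod_span K M (e ` {1..s})"
      proof
        fix v assume v: "v \<in> carrier M"
        have "?sum (co v) \<in> mod_span K M (e ` {1..s})"
        proof (rule submodule_finsum[OF sub M], rule funcsetI)
          fix i assume "i \<in> {1..s}"
          then show "co v i \<odot>\<^bsub>M\<^esub> e i \<in> mod_span K M (e ` {1..s})"
            by (intro submoduleD(4)[OF sub cc[OF v]] mod_span_incl imageI)
        qed
        then show "v \<in> mod_span K M (e ` {1..s})" by (simp only: co(2)[OF v, symmetric])
      qed
    qed
  qed simp
  then show ?thesis using that by blast
qed

section \<open>Direct sums and the doubled basis\<close>

lemma module_dsum: assumes M: "module K M" and N: "module K N" shows "module K (dsum M N)"
proof -
  interpret M: module K M by fact
  interpret N: module K N by fact
  have "abelian_group (dsum M N)"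
  proof (rule abelian_groupI)
    fix x assume "x \<in> carrier (dsum M N)"
    then show "\<exists>y\<in>carrier (dsum M N). y \<oplus>\<^bsub>dsum M N\<^esub> x = \<zero>\<^bsub>dsum M N\<^esub>"
      by (intro bexI[of _ "(\<ominus>\<^bsub>M\<^esub> fst x, \<ominus>\<^bsub>N\<^esub> snd x)"]) (auto simp: dsum_def M.l_neg N.l_neg)
  qed (auto simp: dsum_def M.a_ac N.a_ac)
  then show ?thesis
    by (rule moduleI[OF module_cring[OF M]])
      (auto simp: dsum_def M.smult_l_distr N.smult_l_distr M.smult_r_distr N.smult_r_distr
        M.smult_assoc1 N.smult_assoc1)
qed

lemma dsum_fst: "fst \<in> lin_maps K (dsum M N) M" and dsum_snd: "snd \<in> lin_maps K (dsum M N) N"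
  by (auto intro!: lin_mapsI simp: dsum_def)

lemma dsum_inl:
  assumes "module K N" shows "(\<lambda>v. (v, \<zero>\<^bsub>N\<^esub>)) \<in> lin_maps K M (dsum M N)"
proof -
  interpret N: module K N by fact
  show ?thesis by (auto intro!: lin_mapsI simp: dsum_def)
qed

lemma dsum_inr:
  assumes "module K M" shows "(\<lambda>v. (\<zero>\<^bsub>M\<^esub>, v)) \<in> lin_maps K N (dsum M N)"
proof -
  interpret M: module K M by fact
  show ?thesis by (auto intro!: lin_mapsI simp: dsum_def)
qed

text \<open>A Boolean colour selects the black copy.\<close>

definition copy :: "('k, 'v) smod \<Rightarrow> bool \<Rightarrow> 'v \<Rightarrow> 'v \<times> 'v" where
  "copy V x = (if x then black_copy V else white_copy V)"

lemma double_part: "part (double_smod V) n = dsum (part V n) (part V n)"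
  by (simp add: double_smod_def smod_dsum_def)

lemma copy_linear:
  assumes "module K (part V 2)" shows "copy V x \<in> lin_maps K (part V 2) (part (double_smod V) 2)"
  using dsum_inl[OF assms, of "part V 2"] dsum_inr[OF assms, of "part V 2"]
  by (auto simp: copy_def white_copy_def[abs_def] black_copy_def[abs_def] double_part)

lemma dual_basis_double:
  assumes b: "dual_basis K (part V 2) I e c" and M: "module K (part V 2)"
  shows "dual_basis K (part (double_smod V) 2) (I \<times> UNIV) (\<lambda>(i, x). copy V x (e i))
    (\<lambda>(i, x) u. c i (if x then snd u else fst u))"
proof -
  let ?M = "part V 2" and ?U = "part (double_smod V) 2"
  have fin: "finite I" and c: "\<And>i. i \<in> I \<Longrightarrow> c i \<in> lin_maps K ?M (scal K)"
    and ce: "\<And>i j. i \<in> I \<Longrightarrow> j \<in> I \<Longrightarrow> c i (e j) = (if i = j then \<one>\<^bsub>K\<^esub> else \<zero>\<^bsub>K\<^esub>)"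
    and e: "\<And>i. i \<in> I \<Longrightarrow> e i \<in> carrier ?M" and sp: "mod_span K ?M (e ` I) = carrier ?M"
    using b by (auto simp: dual_basis_def)
  have U: "module K ?U" unfolding double_part by (rule module_dsum[OF M M])
  let ?b = "\<lambda>(i, x). copy V x (e i)"
  note cl = lin_mapsD[OF copy_linear[OF M]]
  have cz: "c i \<zero>\<^bsub>?M\<^esub> = \<zero>\<^bsub>K\<^esub>" if "i \<in> I" for i
    using lin_maps_zero[OF c[OF that] M module_scal[OF module_cring[OF M]]] by simp
  have S: "?b ` (I \<times> UNIV) \<subseteq> carrier ?U" using cl(1) e by auto
  note sub = mod_span_submodule[OF U S]
  show ?thesis
    unfolding dual_basis_def
  proof (intro conjI)
    show "finite (I \<times> (UNIV :: bool set))" using fin by simp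
    show "?b ` (I \<times> UNIV) \<subseteq> carrier ?U" by (rule S)
    have "(\<lambda>u. c i (fst u)) \<in> lin_maps K ?U (scal K)" "(\<lambda>u. c i (snd u)) \<in> lin_maps K ?U (scal K)"
      if "i \<in> I" for i
      unfolding double_part by (rule lin_maps_compose[OF dsum_fst c[OF that]], rule lin_maps_compose[OF dsum_snd c[OF that]])
    then have "(\<lambda>u. c i (if x then snd u else fst u)) \<in> lin_maps K ?U (scal K)" if "i \<in> I" for i x
      using that by (cases x) simp_all
    then show "\<forall>p\<in>I \<times> UNIV. (case p of (i, x) \<Rightarrow> \<lambda>u. c i (if x then snd u else fst u)) \<in> lin_maps K ?U (scal K)"
      by auto
    show "\<forall>p\<in>I \<times> UNIV. \<forall>q\<in>I \<times> UNIV. (case p of (i, x) \<Rightarrow> \<lambda>u. c i (if x then snd u else fst u)) (?b q)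
        = (if p = q then \<one>\<^bsub>K\<^esub> else \<zero>\<^bsub>K\<^esub>)"
      by (auto simp: copy_def white_copy_def black_copy_def ce cz)
    show "mod_span K ?U (?b ` (I \<times> UNIV)) = carrier ?U"
    proof
      show "mod_span K ?U (?b ` (I \<times> UNIV)) \<subseteq> carrier ?U" by (rule mod_span_carrier[OF U S])
      have "copy V x v \<in> mod_span K ?U (?b ` (I \<times> UNIV))" if "v \<in> carrier ?M" for x v
        by (rule dual_basis_memI[OF b M U sub copy_linear[OF M] _ that]) (auto intro!: mod_span_incl)
      moreover have "u = copy V False (fst u) \<oplus>\<^bsub>?U\<^esub> copy V True (snd u)" if "u \<in> carrier ?U" for u
      proof -
        interpret M: module K ?M by (rule M)
        show ?thesis using that by (auto simp: double_part dsum_def copy_def white_copy_def black_copy_def)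
      qed
      ultimately show "carrier ?U \<subseteq> mod_span K ?U (?b ` (I \<times> UNIV))"
      proof -
        assume 1: "\<And>v x. v \<in> carrier ?M \<Longrightarrow> copy V x v \<in> mod_span K ?U (?b ` (I \<times> UNIV))"
          and 2: "\<And>u. u \<in> carrier ?U \<Longrightarrow> u = copy V False (fst u) \<oplus>\<^bsub>?U\<^esub> copy V True (snd u)"
        show ?thesis
        proof
          fix u assume u: "u \<in> carrier ?U"
          then have "fst u \<in> carrier ?M" "snd u \<in> carrier ?M" by (auto simp: double_part dsum_def)
          then show "u \<in> mod_span K ?U (?b ` (I \<times> UNIV))"
            using submoduleD(3)[OF sub 1 1, of "fst u" "snd u" False True] 2[OF u] by simp
        qed
      qed
    qed
  qed
qed

lemma dual_basis_T3:
  assumes V: "s_module K V" and bin: "binary_smod V" and b: "dual_basis K (part V 2) I e c"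
  obtains d where "dual_basis K (part (free_operad K V) 3) ({1..3} \<times> I \<times> I)
    (\<lambda>(l, i, j). T3 K V l (e i) (e j)) d"
proof -
  let ?M = "part V 2" and ?F = "part (free_operad K V) 3"
  note pV = s_module_pre_smod[OF V]
  note cr = pre_smodD(2)[OF pV]
  interpret K: cring K by (rule cr)
  note mM = pre_smodD(1)[OF pV, of 2] and mF = module_free_operad[OF pV, of 3]
  have fin: "finite I" and c: "\<And>i. i \<in> I \<Longrightarrow> c i \<in> lin_maps K ?M (scal K)"
    and ce: "\<And>i j. i \<in> I \<Longrightarrow> j \<in> I \<Longrightarrow> c i (e j) = (if i = j then \<one>\<^bsub>K\<^esub> else \<zero>\<^bsub>K\<^esub>)"
    and e: "\<And>i. i \<in> I \<Longrightarrow> e i \<in> carrier ?M" and sp: "mod_span K ?M (e ` I) = carrier ?M"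
    using b by (auto simp: dual_basis_def)
  \<comment> \<open>Nested forks: the inner one looks for the leaves l and \<open>second l\<close>
    under a vertex with coordinate i, the outer one for that subtree beside the leaf
    \<open>third l\<close> under a root with coordinate j. On \<open>tree3\<close> the exchanged
    summands vanish.\<close>
  let ?h = "\<lambda>l i j. fork K V (fork K V (leaf_ind K l) (leaf_ind K (second l)) (c i)) (leaf_ind K (third l)) (c j)"
  have g: "good K V (?h l i j)" if "i \<in> I" "j \<in> I" for l i j
    by (intro good_fork[OF V] good_leaf_ind cr c that)
  have hv: "?h l i j (tree3 m u v) = (if l = m then c i u \<otimes>\<^bsub>K\<^esub> c j v else \<zero>\<^bsub>K\<^esub>)"
    if "l \<in> {1..3}" "m \<in> {1..3}" "i \<in> I" "j \<in> I" "u \<in> carrier ?M" "v \<in> carrier ?M" for l m i j u v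
  proof -
    have cl: "c i u \<in> carrier K" "c j v \<in> carrier K" "c i (sact V 2 u flip) \<in> carrier K" "c j (sact V 2 v flip) \<in> carrier K"
      using lin_mapsD(1)[OF c] that two_closed[OF pV] by auto
    show ?thesis
    proof (cases "l = m")
      case True
      have m: "m \<noteq> second m" using tree3_range(3)[OF that(2)] by blast
      show ?thesis unfolding tree3_alt[OF that(2)] True fork_simps(1,2) leaf_ind_simps
        using cl m m[symmetric] by simp
    next
      case False
      \<comment> \<open>The leaf attached to the root already separates the three shapes.\<close>
      then have m: "third m \<noteq> third l" using that(1,2) by (auto simp: third_def dest!: three_cases)
      show ?thesis unfolding tree3_alt[OF that(2)] fork_simps(1,2) leaf_ind_simps
        using cl m False by simp
    qed
  qed
  have "\<exists>f. f \<in> lin_maps K ?F (scal K) \<and> (\<forall>m\<in>{1..3}. \<forall>u\<in>carrier ?M. \<forall>v\<in>carrier ?M.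
      f (T3 K V m u v) = (if l = m then c i u \<otimes>\<^bsub>K\<^esub> c j v else \<zero>\<^bsub>K\<^esub>))"
    if lij: "l \<in> {1..3}" "i \<in> I" "j \<in> I" for l i j
  proof -
    obtain f where "f \<in> lin_maps K ?F (scal K)" and ft: "\<And>t. t \<in> vtrees V 3 \<Longrightarrow> f (free_tree K V 3 t) = ?h l i j t"
      using good_functional[OF pV g[OF lij(2,3)]] by blast
    moreover have "f (T3 K V m u v) = (if l = m then c i u \<otimes>\<^bsub>K\<^esub> c j v else \<zero>\<^bsub>K\<^esub>)"
      if "m \<in> {1..3}" "u \<in> carrier ?M" "v \<in> carrier ?M" for m u v
      unfolding T3_def ft[OF tree3_vtrees[OF pV that(2,3,1)]] by (rule hv[OF lij(1) that(1) lij(2,3) that(2,3)])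
    ultimately show ?thesis by blast
  qed
  note ex = this
  define d where "d l i j = (SOME f. f \<in> lin_maps K ?F (scal K) \<and> (\<forall>m\<in>{1..3}. \<forall>u\<in>carrier ?M. \<forall>v\<in>carrier ?M.
      f (T3 K V m u v) = (if l = m then c i u \<otimes>\<^bsub>K\<^esub> c j v else \<zero>\<^bsub>K\<^esub>)))" for l i j
  have d: "d l i j \<in> lin_maps K ?F (scal K)"
    and dT: "\<forall>m\<in>{1..3}. \<forall>u\<in>carrier ?M. \<forall>v\<in>carrier ?M.
      d l i j (T3 K V m u v) = (if l = m then c i u \<otimes>\<^bsub>K\<^esub> c j v else \<zero>\<^bsub>K\<^esub>)"
    if "l \<in> {1..3}" "i \<in> I" "j \<in> I" for l i j
    using someI_ex[OF ex[OF that]] unfolding d_def[symmetric] by blast+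
  let ?X = "{1..3::nat} \<times> I \<times> I" and ?T = "\<lambda>(l, i, j). T3 K V l (e i) (e j)"
  have "dual_basis K ?F ?X ?T (\<lambda>(l, i, j). d l i j)"
    unfolding dual_basis_def
  proof (intro conjI)
    show "finite ?X" using fin by simp
    show S: "?T ` ?X \<subseteq> carrier ?F"
    proof (rule image_subsetI, clarify)
      fix l :: nat and i j assume l: "l \<in> {1..3}" and ij: "i \<in> I" "j \<in> I"
      show "T3 K V l (e i) (e j) \<in> carrier ?F" by (rule T3_closed[OF pV e[OF ij(1)] e[OF ij(2)] l])
    qed
    show "\<forall>p\<in>?X. (case p of (l, i, j) \<Rightarrow> d l i j) \<in> lin_maps K ?F (scal K)"
    proof clarify
      fix l :: nat and i j assume "l \<in> {1..3}" "i \<in> I" "j \<in> I"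
      then show "d l i j \<in> lin_maps K ?F (scal K)" by (rule d)
    qed
    show "\<forall>p\<in>?X. \<forall>q\<in>?X. (case p of (l, i, j) \<Rightarrow> d l i j) (?T q) = (if p = q then \<one>\<^bsub>K\<^esub> else \<zero>\<^bsub>K\<^esub>)"
    proof (clarify)
      fix l l' :: nat and i j i' j'
      assume "l \<in> {1..3}" "i \<in> I" "j \<in> I" "l' \<in> {1..3}" "i' \<in> I" "j' \<in> I"
      then show "d l i j (T3 K V l' (e i') (e j')) = (if (l, i, j) = (l', i', j') then \<one>\<^bsub>K\<^esub> else \<zero>\<^bsub>K\<^esub>)"
        using dT[of l i j] e by (simp add: ce del: atLeastAtMost_iff)
    qed
    note sub = mod_span_submodule[OF mF S]
    show "mod_span K ?F (?T ` ?X) = carrier ?F"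
    proof
      show "mod_span K ?F (?T ` ?X) \<subseteq> carrier ?F" by (rule mod_span_carrier[OF mF S])
      have eS: "e ` I \<subseteq> carrier ?M" using e by auto
      have "T3 K V l u v \<in> mod_span K ?F (?T ` ?X)" if "l \<in> {1..3}" "u \<in> carrier ?M" "v \<in> carrier ?M" for l u v
      proof (rule bilinear_on_span[OF T3_bilinear[OF pV that(1)] mM mM mF sub eS eS])
        fix x y assume "x \<in> e ` I" "y \<in> e ` I"
        then obtain i j where ij: "i \<in> I" "x = e i" "j \<in> I" "y = e j" by blast
        have "?T (l, i, j) \<in> ?T ` ?X" by (rule imageI) (use ij that(1) in blast)
        then show "T3 K V l x y \<in> mod_span K ?F (?T ` ?X)" unfolding ij by (intro mod_span_incl) simp
      qed (use that sp in auto)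
      then have "mod_span K ?F {T3 K V l u v | l u v. l \<in> {1..3} \<and> u \<in> carrier ?M \<and> v \<in> carrier ?M} \<subseteq> mod_span K ?F (?T ` ?X)"
        by (intro mod_span_least[OF sub]) blast
      then show "carrier ?F \<subseteq> mod_span K ?F (?T ` ?X)" unfolding T3_span[OF pV bin] .
    qed
  qed
  then show ?thesis using that by blast
qed

section \<open>The generators of the white product with two compatible commutative algebras\<close>

lemma s_module_double: assumes "s_module K V" shows "s_module K (double_smod V)"
proof -
  note m = pre_smodD(1)[OF s_module_pre_smod[OF assms]]
  have U: "module K (part (double_smod V) n)" for n unfolding double_part by (rule module_dsum[OF m m])
  have s: "sact (double_smod V) n u \<sigma> = (sact V n (fst u) \<sigma>, sact V n (snd u) \<sigma>)" for n u \<sigma>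
    by (simp add: double_smod_def smod_dsum_def)
  have "(\<lambda>v. sact (double_smod V) n v \<sigma>) \<in> lin_maps K (part (double_smod V) n) (part (double_smod V) n)"
    if "\<sigma> permutes {1..n}" for n \<sigma>
    using lin_mapsD[OF s_module_sact_linear[OF assms that]]
    unfolding s by (intro lin_mapsI) (auto simp: double_part dsum_def)
  moreover have "sact (double_smod V) n u id = u" if "u \<in> carrier (part (double_smod V) n)" for n u
    using that s_moduleD(1)[OF assms] unfolding s by (auto simp: double_part dsum_def)
  moreover have "sact (double_smod V) n u (\<sigma> \<circ> \<tau>) = sact (double_smod V) n (sact (double_smod V) n u \<sigma>) \<tau>"
    if "u \<in> carrier (part (double_smod V) n)" "\<sigma> permutes {1..n}" "\<tau> permutes {1..n}" for n u \<sigma> \<tau>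
    using that s_moduleD(2)[OF assms] unfolding s by (auto simp: double_part dsum_def)
  ultimately show ?thesis unfolding s_module_def using U by blast
qed

lemma binary_double: "binary_smod V \<Longrightarrow> binary_smod (double_smod V)"
  by (auto simp: binary_smod_def double_part dsum_def)

lemma s_module_com: assumes "cring K" shows "s_module K (com_smod K)"
proof -
  interpret cring K by fact
  have ag: "abelian_group (part (com_smod K) n)" for n
  proof (rule abelian_groupI)
    fix x assume "x \<in> carrier (part (com_smod K) n)"
    then show "\<exists>y\<in>carrier (part (com_smod K) n). y \<oplus>\<^bsub>part (com_smod K) n\<^esub> x = \<zero>\<^bsub>part (com_smod K) n\<^esub>"
      by (intro bexI[of _ "\<ominus>\<^bsub>K\<^esub> x"]) (auto simp: com_smod_def l_neg split: if_splits)
  qed (auto simp: com_smod_def a_ac split: if_splits)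
  have "module K (part (com_smod K) n)" for n
    by (rule moduleI[OF assms ag]) (auto simp: com_smod_def l_distr r_distr m_assoc split: if_splits)
  then show ?thesis
    unfolding s_module_def using lin_maps_id by (auto simp: com_smod_def)
qed

lemma binary_com: "binary_smod (com_smod K)"
  by (auto simp: binary_smod_def com_smod_def)

lemma dual_basis_com:
  assumes "cring K" shows "dual_basis K (part (com_smod K) 2) {1..1::nat} (\<lambda>i. \<one>\<^bsub>K\<^esub>) (\<lambda>i x. x)"
proof -
  interpret cring K by fact
  have m: "module K (scal K)" by (rule module_scal[OF assms])
  have S: "{\<one>\<^bsub>K\<^esub>} \<subseteq> carrier (scal K)" by simp
  note sub = mod_span_submodule[OF m S]
  have "x \<in> mod_span K (scal K) {\<one>\<^bsub>K\<^esub>}" if "x \<in> carrier K" for x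
    using submoduleD(4)[OF sub that mod_span_incl[of "\<one>\<^bsub>K\<^esub>"]] that by simp
  then have "mod_span K (scal K) {\<one>\<^bsub>K\<^esub>} = carrier (scal K)"
    using mod_span_carrier[OF m S] by auto
  then show ?thesis
    unfolding dual_basis_def scal_def[symmetric] using lin_maps_id[of K "scal K"] by auto
qed

text \<open>The generators w and b as the two copies of 1, indexed by the same Booleans as the two
  copies of V.\<close>

definition colour :: "('k, 'm) ring_scheme \<Rightarrow> bool \<Rightarrow> 'k \<times> 'k" where
  "colour K x = copy (com_smod K) x \<one>\<^bsub>K\<^esub>"

lemma colour_simps: "colour K False = com2_w K" "colour K True = com2_b K"
  by (simp_all add: colour_def copy_def com2_w_def com2_b_def)

lemma colour_pair: "colour K False = (\<one>\<^bsub>K\<^esub>, \<zero>\<^bsub>K\<^esub>)" "colour K True = (\<zero>\<^bsub>K\<^esub>, \<one>\<^bsub>K\<^esub>)"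
  by (simp_all add: colour_def copy_def white_copy_def black_copy_def com_smod_def)

lemma s_module_com2: "cring K \<Longrightarrow> s_module K (com2_smod K)"
  unfolding com2_smod_def by (rule s_module_double[OF s_module_com])

lemma com2_carrier: "carrier (part (com2_smod K) 2) = carrier K \<times> carrier K"
  by (simp add: com2_smod_def double_part dsum_def com_smod_def)

lemma com2_ops:
  "(a, b) \<oplus>\<^bsub>part (com2_smod K) 2\<^esub> (c, d) = (a \<oplus>\<^bsub>K\<^esub> c, b \<oplus>\<^bsub>K\<^esub> d)"
  "k \<odot>\<^bsub>part (com2_smod K) 2\<^esub> (a, b) = (k \<otimes>\<^bsub>K\<^esub> a, k \<otimes>\<^bsub>K\<^esub> b)"
  by (simp_all add: com2_smod_def double_part dsum_def com_smod_def)

lemma com2_sact: "sact (com2_smod K) n u \<sigma> = u"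
  by (simp add: com2_smod_def double_smod_def smod_dsum_def com_smod_def)

lemma colour_closed: "cring K \<Longrightarrow> colour K x \<in> carrier (part (com2_smod K) 2)"
  by (cases x) (simp_all add: colour_pair com2_carrier cring.cring_simprules)

lemma colour_span:
  assumes "cring K"
  shows "mod_span K (part (com2_smod K) 2) (range (colour K)) = carrier (part (com2_smod K) 2)"
proof -
  have m: "module K (part (com_smod K) 2)" by (rule pre_smodD(1)[OF s_module_pre_smod[OF s_module_com[OF assms]]])
  have "(\<lambda>(i, x). copy (com_smod K) x \<one>\<^bsub>K\<^esub>) ` ({1..1::nat} \<times> UNIV) = range (colour K)"
    by (auto simp: colour_def image_def)
  then show ?thesis
    using dual_basis_double[OF dual_basis_com[OF assms] m] by (simp add: dual_basis_def com2_smod_def)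
qed

text \<open>The action is defined through representatives in the free module. It is compared with
  the map supplied by the universal property, both being determined by their values on the pairs (v,
  w).\<close>

lemma tensor_sact:
  assumes V: "s_module K V" and W: "s_module K W" and \<sigma>: "\<sigma> permutes {1..n}"
  shows "(\<lambda>x. sact (smod_tensor K V W) n x \<sigma>) \<in>
      lin_maps K (part (smod_tensor K V W) n) (part (smod_tensor K V W) n)"
    and "v \<in> carrier (part V n) \<Longrightarrow> w \<in> carrier (part W n) \<Longrightarrow>
      sact (smod_tensor K V W) n (tens K (part V n) (part W n) v w) \<sigma> =
      tens K (part V n) (part W n) (sact V n v \<sigma>) (sact W n w \<sigma>)"
proof -
  let ?M = "part V n" and ?N = "part W n"
  let ?F = "tensor_pre K ?M ?N" and ?T = "tensor K ?M ?N" and ?I = "tensor_ker K ?M ?N"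
  note mM = pre_smodD(1)[OF s_module_pre_smod[OF V], of n] and mN = pre_smodD(1)[OF s_module_pre_smod[OF W], of n]
  note cr = module_cring[OF mM]
  note lV = s_module_sact_linear[OF V \<sigma>] and lW = s_module_sact_linear[OF W \<sigma>]
  note mT = module_tensor[OF mM mN] and mF = module_tensor_pre[OF cr, of ?M ?N]
  note sub = submodule_tensor_ker[OF mM mN]
  note B = bilinear_onD[OF tens_bilinear[OF mM mN]]
  have "bilinear_on K ?M ?N ?T (\<lambda>v w. tens K ?M ?N (sact V n v \<sigma>) (sact W n w \<sigma>))"
    unfolding bilinear_on_def
    using lin_maps_compose[OF lW B(1)[OF lin_mapsD(1)[OF lV]]] lin_maps_compose[OF lV B(2)[OF lin_mapsD(1)[OF lW]]]
    by blast
  then obtain g where g: "g \<in> lin_maps K ?T ?T"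
    and gt: "\<And>v w. v \<in> carrier ?M \<Longrightarrow> w \<in> carrier ?N \<Longrightarrow> g (tens K ?M ?N v w) = tens K ?M ?N (sact V n v \<sigma>) (sact W n w \<sigma>)"
    using tensor_lift[OF mM mN mT] by blast
  define S where "S = lin_ext K ?F (\<lambda>(v, w). single K (sact V n v \<sigma>, sact W n w \<sigma>))"
  have sc: "single K (sact V n v \<sigma>, sact W n w \<sigma>) \<in> carrier ?F" if "v \<in> carrier ?M" "w \<in> carrier ?N" for v w
    by (rule tensor_pre_single[OF cr]) (use lin_mapsD(1)[OF lV] lin_mapsD(1)[OF lW] that in auto)
  have S: "S \<in> lin_maps K ?F ?F"
    unfolding S_def using lin_ext_linear[OF mF, of "carrier ?M \<times> carrier ?N"] sc by (auto simp: tensor_pre_def[of K ?M ?N])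
  have Ss: "S (single K (v, w)) = single K (sact V n v \<sigma>, sact W n w \<sigma>)" if "v \<in> carrier ?M" "w \<in> carrier ?N" for v w
    unfolding S_def using lin_ext_single[OF mF, of "\<lambda>(v, w). single K (sact V n v \<sigma>, sact W n w \<sigma>)" "(v, w)"] sc[OF that] by simp
  note q = proj_linear[OF mF sub, folded tensor_def]
  have qS: "?I +>\<^bsub>?F\<^esub> S f = g (?I +>\<^bsub>?F\<^esub> f)" if "f \<in> carrier ?F" for f
  proof (rule free_mod_lin_maps_eq[where f = "\<lambda>f. ?I +>\<^bsub>?F\<^esub> S f" and g = "\<lambda>f. g (?I +>\<^bsub>?F\<^esub> f)", OF _ _ mT])
    show "(\<lambda>f. ?I +>\<^bsub>?F\<^esub> S f) \<in> lin_maps K (free_mod K (carrier ?M \<times> carrier ?N)) ?T"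
      using lin_maps_compose[OF S q] by (simp add: tensor_pre_def[of K ?M ?N])
    show "(\<lambda>f. g (?I +>\<^bsub>?F\<^esub> f)) \<in> lin_maps K (free_mod K (carrier ?M \<times> carrier ?N)) ?T"
      using lin_maps_compose[OF q g] by (simp add: tensor_pre_def[of K ?M ?N])
    show "f \<in> carrier (free_mod K (carrier ?M \<times> carrier ?N))" using that by (simp add: tensor_pre_def)
    fix p assume "p \<in> carrier ?M \<times> carrier ?N"
    then obtain v w where "p = (v, w)" "v \<in> carrier ?M" "w \<in> carrier ?N" by auto
    then show "?I +>\<^bsub>?F\<^esub> S (single K p) = g (?I +>\<^bsub>?F\<^esub> single K p)"
      using gt[of v w] Ss[of v w] by (simp add: tens_def)
  qed
  have eq: "sact (smod_tensor K V W) n x \<sigma> = g x" if x: "x \<in> carrier ?T" for x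
  proof -
    obtain f where f: "f \<in> carrier ?F" "x = ?I +>\<^bsub>?F\<^esub> f" using x by (auto simp: tensor_def quot_mod_simps)
    have "(\<Union>y\<in>?I +>\<^bsub>?F\<^esub> f. ?I +>\<^bsub>?F\<^esub> S y) = ?I +>\<^bsub>?F\<^esub> S f"
      by (rule UN_coset[OF mF sub f(1)]) (simp add: qS f(1))
    then show ?thesis using qS[OF f(1)] f(2) by (simp add: smod_tensor_def S_def)
  qed
  have part: "part (smod_tensor K V W) n = ?T" by (simp add: smod_tensor_def)
  show "(\<lambda>x. sact (smod_tensor K V W) n x \<sigma>) \<in> lin_maps K (part (smod_tensor K V W) n) (part (smod_tensor K V W) n)"
    unfolding part by (rule lin_maps_cong[OF g mT]) (rule eq)
  show "sact (smod_tensor K V W) n (tens K ?M ?N v w) \<sigma> = tens K ?M ?N (sact V n v \<sigma>) (sact W n w \<sigma>)"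
    if "v \<in> carrier ?M" "w \<in> carrier ?N"
    using eq[OF tens_closed[OF mM mN that]] gt[OF that] by simp
qed

lemma pre_smod_tensor:
  assumes "s_module K V" "s_module K W" shows "pre_smod K (smod_tensor K V W)"
proof -
  have "module K (part (smod_tensor K V W) n)" for n
    using module_tensor[OF pre_smodD(1)[OF s_module_pre_smod[OF assms(1)]] pre_smodD(1)[OF s_module_pre_smod[OF assms(2)]]]
    by (simp add: smod_tensor_def)
  then show ?thesis
    using lin_mapsD(1)[OF tensor_sact(1)[OF assms]] unfolding pre_smod_def by blast
qed

section \<open>The identification of V \<oplus> V with V \<otimes> (w, b)\<close>

lemma lin_maps_inv:
  assumes f: "f \<in> lin_maps K M N" and b: "bij_betw f (carrier M) (carrier N)" and M: "module K M"
  shows "inv_into (carrier M) f \<in> lin_maps K N M"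
proof (rule lin_maps_quotientI[OF f _ _ M])
  show "f ` carrier M = carrier N" using b by (simp add: bij_betw_def)
  show "(\<lambda>x. inv_into (carrier M) f (f x)) \<in> lin_maps K M M"
    by (rule lin_maps_cong[OF lin_maps_id M]) (use b in \<open>simp add: bij_betw_def\<close>)
qed

text \<open>The isomorphism (v, v') to v \<otimes> w + v' \<otimes> b. The default value zero covers
  the arities other than 2, where both modules vanish for binary V.\<close>

definition theta :: "('k, 'm) ring_scheme \<Rightarrow> ('k, 'v) smod \<Rightarrow> nat \<Rightarrow> 'v \<times> 'v \<Rightarrow> ('v \<times> 'k \<times> 'k \<Rightarrow> 'k) set" where
  "theta K V n u = (let t = tens K (part V n) (part (com2_smod K) n); T = tensor K (part V n) (part (com2_smod K) n) in
     if n = 2 then t (fst u) (colour K False) \<oplus>\<^bsub>T\<^esub> t (snd u) (colour K True) else \<zero>\<^bsub>T\<^esub>)"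

lemma theta_two:
  "theta K V 2 u = tens K (part V 2) (part (com2_smod K) 2) (fst u) (colour K False)
     \<oplus>\<^bsub>tensor K (part V 2) (part (com2_smod K) 2)\<^esub> tens K (part V 2) (part (com2_smod K) 2) (snd u) (colour K True)"
  by (simp add: theta_def Let_def)

lemma theta_other: "n \<noteq> 2 \<Longrightarrow> theta K V n u = \<zero>\<^bsub>tensor K (part V n) (part (com2_smod K) n)\<^esub>"
  by (simp add: theta_def Let_def)

text \<open>The inverse of \<open>theta\<close> on elementary tensors: v \<otimes> (a w + b b'),
  with b' the black generator, goes to (a v, b v).\<close>

definition scale_pair :: "('k, 'v) smod \<Rightarrow> 'v \<Rightarrow> 'k \<times> 'k \<Rightarrow> 'v \<times> 'v" where
  "scale_pair V v w = (fst w \<odot>\<^bsub>part V 2\<^esub> v, snd w \<odot>\<^bsub>part V 2\<^esub> v)"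

context
  fixes K :: "('k, 'm) ring_scheme" and V :: "('k, 'v) smod"
  assumes V: "s_module K V"
begin

private lemmas mV = s_module_module[OF V]
private lemmas cr = s_module_cring[OF V]
private lemmas W = s_module_com2[OF cr]
private lemmas mW = pre_smodD(1)[OF s_module_pre_smod[OF W]]

lemma double_carrier: "carrier (part (double_smod V) n) = carrier (part V n) \<times> carrier (part V n)"
  by (simp add: double_part dsum_def)

lemma scale_pair_bilinear:
  "bilinear_on K (part V 2) (part (com2_smod K) 2) (part (double_smod V) 2) (scale_pair V)"
proof -
  interpret M: module K "part V 2" by (rule mV)
  have "a \<odot>\<^bsub>part V 2\<^esub> (k \<odot>\<^bsub>part V 2\<^esub> v) = k \<odot>\<^bsub>part V 2\<^esub> (a \<odot>\<^bsub>part V 2\<^esub> v)"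
    if "a \<in> carrier K" "k \<in> carrier K" "v \<in> carrier (part V 2)" for a k v
    using that by (metis M.smult_assoc1 M.R.m_comm)
  then show ?thesis
    unfolding bilinear_on_def
    by (intro conjI ballI lin_mapsI)
      (auto simp: scale_pair_def double_part dsum_def com2_carrier com2_ops M.smult_l_distr M.smult_r_distr
        M.smult_assoc1)
qed

lemma scale_pair_colour:
  assumes "v \<in> carrier (part V 2)" shows "scale_pair V v (colour K x) = copy V x v"
proof -
  interpret M: module K "part V 2" by (rule mV)
  show ?thesis using assms
    by (cases x) (simp_all add: scale_pair_def colour_pair copy_def white_copy_def black_copy_def)
qed

lemma theta_linear:
  "theta K V n \<in> lin_maps K (part (double_smod V) n) (part (smod_tensor K V (com2_smod K)) n)"
proof -
  have p: "part (smod_tensor K V (com2_smod K)) n = tensor K (part V n) (part (com2_smod K) n)" by (simp add: smod_tensor_def)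
  note mT = module_tensor[OF mV mW, of n n]
  show ?thesis
  proof (cases "n = 2")
    case True
    note B = bilinear_onD(2)[OF tens_bilinear[OF mV mW] colour_closed[OF cr], of 2]
    have "theta K V 2 = (\<lambda>u. tens K (part V 2) (part (com2_smod K) 2) (fst u) (colour K False)
        \<oplus>\<^bsub>tensor K (part V 2) (part (com2_smod K) 2)\<^esub> tens K (part V 2) (part (com2_smod K) 2) (snd u) (colour K True))"
      by (rule ext) (rule theta_two)
    then show ?thesis unfolding p[unfolded True] True double_part
      using lin_maps_add[OF lin_maps_compose[OF dsum_fst B] lin_maps_compose[OF dsum_snd B] mT[unfolded True]] by simp
  next
    case False
    have "theta K V n = (\<lambda>u. \<zero>\<^bsub>tensor K (part V n) (part (com2_smod K) n)\<^esub>)"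
      by (rule ext) (rule theta_other[OF False])
    then show ?thesis unfolding p using lin_maps_const_zero[OF mT] by simp
  qed
qed

lemma theta_scale_pair:
  assumes v: "v \<in> carrier (part V 2)" and w: "w \<in> carrier (part (com2_smod K) 2)"
  shows "theta K V 2 (scale_pair V v w) = tens K (part V 2) (part (com2_smod K) 2) v w"
proof -
  let ?M = "part V 2" and ?N = "part (com2_smod K) 2"
  interpret M: module K ?M by (rule mV)
  obtain a b where ab: "w = (a, b)" "a \<in> carrier K" "b \<in> carrier K" using w by (auto simp: com2_carrier)
  note B1 = lin_mapsD[OF bilinear_onD(1)[OF tens_bilinear[OF mV mW] v]]
  note B2 = lin_mapsD[OF bilinear_onD(2)[OF tens_bilinear[OF mV mW]]]
  note cc = colour_closed[OF cr]
  interpret N: module K ?N by (rule mW)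
  have "theta K V 2 (scale_pair V v w) =
      tens K ?M ?N v (a \<odot>\<^bsub>?N\<^esub> colour K False) \<oplus>\<^bsub>tensor K ?M ?N\<^esub> tens K ?M ?N v (b \<odot>\<^bsub>?N\<^esub> colour K True)"
    using ab v by (simp add: theta_two scale_pair_def B1(3) B2(3) cc)
  also have "\<dots> = tens K ?M ?N v (a \<odot>\<^bsub>?N\<^esub> colour K False \<oplus>\<^bsub>?N\<^esub> b \<odot>\<^bsub>?N\<^esub> colour K True)"
    using ab by (simp add: B1(2) cc)
  also have "a \<odot>\<^bsub>?N\<^esub> colour K False \<oplus>\<^bsub>?N\<^esub> b \<odot>\<^bsub>?N\<^esub> colour K True = w"
    using ab by (simp add: colour_pair com2_ops)
  finally show ?thesis .
qed

text \<open>In arity two the inverse is induced by \<open>scale_pair\<close> through the universal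
  property. In every other arity V is zero, and elementary tensors with a zero factor span the zero
  module.\<close>

lemma theta_bij:
  assumes bin: "binary_smod V"
  shows "bij_betw (theta K V n) (carrier (part (double_smod V) n)) (carrier (part (smod_tensor K V (com2_smod K)) n))"
proof -
  let ?M = "part V n" and ?N = "part (com2_smod K) n"
  let ?T = "tensor K ?M ?N" and ?U = "part (double_smod V) n"
  have p: "part (smod_tensor K V (com2_smod K)) n = ?T" by (simp add: smod_tensor_def)
  note mT = module_tensor[OF mV mW, of n n]
  note mU = pre_smodD(1)[OF s_module_pre_smod[OF s_module_double[OF V]]]
  note th = theta_linear[of n, unfolded p]
  show ?thesis
  proof (cases "n = 2")
    case True
    obtain g where g: "g \<in> lin_maps K ?T ?U"
      and gt: "\<And>v w. v \<in> carrier ?M \<Longrightarrow> w \<in> carrier ?N \<Longrightarrow> g (tens K ?M ?N v w) = scale_pair V v w"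
      using tensor_lift[OF mV mW mU scale_pair_bilinear] unfolding True by blast
    have 1: "g (theta K V n u) = u" if "u \<in> carrier ?U" for u
    proof -
      interpret M: module K ?M by (rule mV)
      note cc = colour_closed[OF cr]
      have u: "fst u \<in> carrier ?M" "snd u \<in> carrier ?M" using that by (auto simp: double_carrier)
      have "g (theta K V n u) = scale_pair V (fst u) (colour K False) \<oplus>\<^bsub>?U\<^esub> scale_pair V (snd u) (colour K True)"
        using u cc gt lin_mapsD(2)[OF g tens_closed[OF mV mW] tens_closed[OF mV mW]]
        unfolding True by (simp add: theta_two)
      also have "\<dots> = u" using u[unfolded True] by (simp add: scale_pair_colour copy_def white_copy_def black_copy_def
            double_part dsum_def True M.r_zero[unfolded True] M.l_zero[unfolded True])
      finally show ?thesis .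
    qed
    have 2: "theta K V n (g x) = x" if "x \<in> carrier ?T" for x
    proof (rule lin_maps_eq_on_span[OF lin_maps_compose[OF g th] lin_maps_id mT mT])
      show "x \<in> mod_span K ?T {tens K ?M ?N x y | x y. x \<in> carrier ?M \<and> y \<in> carrier ?N}"
        unfolding tensor_span[OF mV mW] by (rule that)
      show "{tens K ?M ?N x y | x y. x \<in> carrier ?M \<and> y \<in> carrier ?N} \<subseteq> carrier ?T"
        using tens_closed[OF mV mW] by blast
      fix y assume "y \<in> {tens K ?M ?N x y | x y. x \<in> carrier ?M \<and> y \<in> carrier ?N}"
      then obtain v w where vw: "y = tens K ?M ?N v w" "v \<in> carrier ?M" "w \<in> carrier ?N" by blast
      then show "theta K V n (g y) = y" using gt theta_scale_pair unfolding True by simp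
    qed
    show ?thesis unfolding p
      by (rule bij_betw_byWitness[where f' = g]) (use 1 2 lin_mapsD(1)[OF g] lin_mapsD(1)[OF th] in auto)
  next
    case False
    interpret T: module K ?T by (rule mT)
    have cM: "carrier ?M = {\<zero>\<^bsub>?M\<^esub>}" using bin False by (simp add: binary_smod_def)
    have cU: "carrier ?U = {(\<zero>\<^bsub>?M\<^esub>, \<zero>\<^bsub>?M\<^esub>)}" unfolding double_carrier cM by auto
    have "tens K ?M ?N v w = \<zero>\<^bsub>?T\<^esub>" if "v \<in> carrier ?M" "w \<in> carrier ?N" for v w
      using lin_maps_zero[OF bilinear_onD(2)[OF tens_bilinear[OF mV mW] that(2)] mV mT] that(1) cM by simp
    then have "{tens K ?M ?N x y | x y. x \<in> carrier ?M \<and> y \<in> carrier ?N} \<subseteq> {\<zero>\<^bsub>?T\<^esub>}" by blast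
    then have "carrier ?T \<subseteq> {\<zero>\<^bsub>?T\<^esub>}"
      unfolding tensor_span[OF mV mW, symmetric] by (rule mod_span_least[OF submodule_zero[OF mT]])
    then have "carrier ?T = {\<zero>\<^bsub>?T\<^esub>}" by auto
    then show ?thesis unfolding p cU by (simp add: bij_betw_def theta_other[OF False])
  qed
qed

lemma theta_sact:
  assumes u: "u \<in> carrier (part (double_smod V) n)" and \<sigma>: "\<sigma> permutes {1..n}"
  shows "theta K V n (sact (double_smod V) n u \<sigma>) = sact (smod_tensor K V (com2_smod K)) n (theta K V n u) \<sigma>"
proof -
  let ?X = "smod_tensor K V (com2_smod K)"
  have p: "part ?X n = tensor K (part V n) (part (com2_smod K) n)" by (simp add: smod_tensor_def)
  note mT = module_tensor[OF mV mW, of n n]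
  note lX = tensor_sact(1)[OF V W \<sigma>, unfolded p] and tX = tensor_sact(2)[OF V W \<sigma>]
  show ?thesis
  proof (cases "n = 2")
    case True
    note cc = colour_closed[OF cr]
    have "fst u \<in> carrier (part V 2)" "snd u \<in> carrier (part V 2)" using u True by (auto simp: double_carrier)
    then show ?thesis
      using lin_mapsD(2)[OF lX tens_closed[OF mV mW] tens_closed[OF mV mW]] tX cc
      unfolding True by (simp add: theta_two com2_sact double_smod_def smod_dsum_def)
  next
    case False
    then show ?thesis using lin_maps_zero[OF lX mT mT] by (simp add: theta_other)
  qed
qed

end

section \<open>Sums of submodules, S-submodule spans, and sums of trees with coefficients\<close>

lemma bilinear_on_compose_left:
  assumes f: "bilinear_on K M N L f" and g: "g \<in> lin_maps K L L'"
  shows "bilinear_on K M N L' (\<lambda>x y. g (f x y))"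
  unfolding bilinear_on_def
  using lin_maps_compose[OF bilinear_onD(1)[OF f] g] lin_maps_compose[OF bilinear_onD(2)[OF f] g] by blast

lemma bilinear_on_compose_right:
  assumes f: "bilinear_on K M N L f" and g: "g \<in> lin_maps K M' M" and h: "h \<in> lin_maps K N' N"
  shows "bilinear_on K M' N' L (\<lambda>x y. f (g x) (h y))"
  unfolding bilinear_on_def
  using lin_maps_compose[OF h bilinear_onD(1)[OF f lin_mapsD(1)[OF g]]]
    lin_maps_compose[OF g bilinear_onD(2)[OF f lin_mapsD(1)[OF h]]] by blast

lemma smod_span_incl: "x \<in> S \<Longrightarrow> x \<in> smod_span K V n S"
  by (auto simp: smod_span_def)

lemma smod_span_least:
  assumes "submodule H K (part V n)" "\<And>x \<sigma>. x \<in> H \<Longrightarrow> \<sigma> permutes {1..n} \<Longrightarrow> sact V n x \<sigma> \<in> H" "S \<subseteq> H"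
  shows "smod_span K V n S \<subseteq> H"
  unfolding smod_span_def by (rule Inter_lower) (use assms in blast)

lemma smod_span_submodule:
  assumes P: "lin_operad K P" and S: "S \<subseteq> carrier (part P n)"
  shows "submodule (smod_span K P n S) K (part P n)"
  unfolding smod_span_def
proof (rule submodule_Int[OF lin_operadD(1)[OF P]])
  show "{H. submodule H K (part P n) \<and> (\<forall>x\<in>H. \<forall>\<sigma>. \<sigma> permutes {1..n} \<longrightarrow> sact P n x \<sigma> \<in> H) \<and> S \<subseteq> H} \<noteq> {}"
    using submodule_carrier[OF lin_operadD(1)[OF P, of n]] operad_closed(1)[OF P] S by blast
qed blast

lemma set_add_submodule:
  assumes M: "module K M" and A: "submodule A K M" and B: "submodule B K M"
  shows "submodule (set_add M A B) K M"
proof -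
  interpret M: module K M by fact
  have sA: "A \<subseteq> carrier M" and sB: "B \<subseteq> carrier M" using submoduleD(1)[OF A] submoduleD(1)[OF B] by auto
  have mem: "x \<in> set_add M A B \<longleftrightarrow> (\<exists>a\<in>A. \<exists>b\<in>B. x = a \<oplus>\<^bsub>M\<^esub> b)" for x by (auto simp: set_add_def')
  show ?thesis
  proof (rule mod_submoduleI[OF M])
    show "set_add M A B \<subseteq> carrier M" using sA sB by (auto simp: mem intro!: M.a_closed)
    show "\<zero>\<^bsub>M\<^esub> \<in> set_add M A B" unfolding mem
      using submoduleD(2)[OF A] submoduleD(2)[OF B] M.l_zero[OF M.zero_closed] by metis
  next
    fix x y assume "x \<in> set_add M A B" "y \<in> set_add M A B"
    then obtain a b a' b' where ab: "a \<in> A" "b \<in> B" "x = a \<oplus>\<^bsub>M\<^esub> b" "a' \<in> A" "b' \<in> B" "y = a' \<oplus>\<^bsub>M\<^esub> b'"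
      unfolding mem by blast
    have "a \<in> carrier M" "b \<in> carrier M" "a' \<in> carrier M" "b' \<in> carrier M" using ab sA sB by auto
    then have "x \<oplus>\<^bsub>M\<^esub> y = (a \<oplus>\<^bsub>M\<^esub> a') \<oplus>\<^bsub>M\<^esub> (b \<oplus>\<^bsub>M\<^esub> b')" using ab by (simp add: M.a_ac)
    then show "x \<oplus>\<^bsub>M\<^esub> y \<in> set_add M A B" unfolding mem
      using submoduleD(3)[OF A ab(1,4)] submoduleD(3)[OF B ab(2,5)] by blast
  next
    fix k x assume k: "k \<in> carrier K" and "x \<in> set_add M A B"
    then obtain a b where ab: "a \<in> A" "b \<in> B" "x = a \<oplus>\<^bsub>M\<^esub> b" unfolding mem by blast
    have "a \<in> carrier M" "b \<in> carrier M" using ab sA sB by auto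
    then have "k \<odot>\<^bsub>M\<^esub> x = k \<odot>\<^bsub>M\<^esub> a \<oplus>\<^bsub>M\<^esub> k \<odot>\<^bsub>M\<^esub> b" using ab k by (simp add: M.smult_r_distr)
    then show "k \<odot>\<^bsub>M\<^esub> x \<in> set_add M A B" unfolding mem
      using submoduleD(4)[OF A k ab(1)] submoduleD(4)[OF B k ab(2)] by blast
  qed
qed

lemma set_add_incl:
  assumes M: "module K M" and A: "submodule A K M" and B: "submodule B K M"
  shows "A \<subseteq> set_add M A B" "B \<subseteq> set_add M A B"
proof -
  interpret M: module K M by fact
  have mem: "x \<in> set_add M A B \<longleftrightarrow> (\<exists>a\<in>A. \<exists>b\<in>B. x = a \<oplus>\<^bsub>M\<^esub> b)" for x by (auto simp: set_add_def')
  show "A \<subseteq> set_add M A B"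
  proof
    fix a assume a: "a \<in> A"
    then have "a = a \<oplus>\<^bsub>M\<^esub> \<zero>\<^bsub>M\<^esub>" using submoduleD(1)[OF A] by simp
    then show "a \<in> set_add M A B" unfolding mem using a submoduleD(2)[OF B] by blast
  qed
  show "B \<subseteq> set_add M A B"
  proof
    fix b assume b: "b \<in> B"
    then have "b = \<zero>\<^bsub>M\<^esub> \<oplus>\<^bsub>M\<^esub> b" using submoduleD(1)[OF B] by simp
    then show "b \<in> set_add M A B" unfolding mem using b submoduleD(2)[OF A] by blast
  qed
qed

lemma copy_sact:
  assumes V: "s_module K V" and v: "v \<in> carrier (part V 2)"
  shows "sact (double_smod V) 2 (copy V x v) flip = copy V x (sact V 2 v flip)"
proof -
  note m = pre_smodD(1)[OF s_module_pre_smod[OF V], of 2]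
  have "sact V 2 \<zero>\<^bsub>part V 2\<^esub> flip = \<zero>\<^bsub>part V 2\<^esub>"
    by (rule lin_maps_zero[OF s_module_sact_linear[OF V flip_permutes] m m])
  then show ?thesis
    by (simp add: copy_def white_copy_def black_copy_def double_smod_def smod_dsum_def)
qed

text \<open>The implication from x to y admits the colour pairs white-white, black-black and
  white-black but not black-white. The three copies of R can so be treated as one case.\<close>

lemma double_rels_cases:
  assumes "r \<in> double_rels K V s e t \<gamma>"
  obtains k x y where "k \<in> {1..t}" "x \<longrightarrow> y"
      "r = rel3 K (double_smod V) s (\<lambda>i. copy V x (e i)) (\<lambda>i. copy V y (e i)) (\<gamma> k)"
  | l i j where "l \<in> {1..3}" "i \<in> {1..s}" "j \<in> {1..s}"
      "r = T3 K (double_smod V) l (copy V False (e i)) (copy V True (e j)) \<ominus>\<^bsub>part (free_operad K (double_smod V)) 3\<^esub>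
         T3 K (double_smod V) l (copy V True (e i)) (copy V False (e j))"
proof -
  have c: "white_copy V = copy V False" "black_copy V = copy V True" by (auto simp: copy_def)
  show ?thesis using assms that(1)[of _ False False] that(1)[of _ True True] that(1)[of _ False True] that(2)
    unfolding double_rels_def Let_def c by blast
qed

lemma double_relsI:
  "k \<in> {1..t} \<Longrightarrow> x \<longrightarrow> y \<Longrightarrow>
     rel3 K (double_smod V) s (\<lambda>i. copy V x (e i)) (\<lambda>i. copy V y (e i)) (\<gamma> k) \<in> double_rels K V s e t \<gamma>"
  "l \<in> {1..3} \<Longrightarrow> i \<in> {1..s} \<Longrightarrow> j \<in> {1..s} \<Longrightarrow>
     T3 K (double_smod V) l (copy V False (e i)) (copy V True (e j)) \<ominus>\<^bsub>part (free_operad K (double_smod V)) 3\<^esub>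
         T3 K (double_smod V) l (copy V True (e i)) (copy V False (e j)) \<in> double_rels K V s e t \<gamma>"
proof -
  have c: "white_copy V = copy V False" "black_copy V = copy V True" by (auto simp: copy_def)
  show "k \<in> {1..t} \<Longrightarrow> x \<longrightarrow> y \<Longrightarrow>
     rel3 K (double_smod V) s (\<lambda>i. copy V x (e i)) (\<lambda>i. copy V y (e i)) (\<gamma> k) \<in> double_rels K V s e t \<gamma>"
  proof -
    assume k: "k \<in> {1..t}" and xy: "x \<longrightarrow> y"
    have "rel3 K (double_smod V) s (\<lambda>i. copy V False (e i)) (\<lambda>i. copy V False (e i)) (\<gamma> k) \<in> double_rels K V s e t \<gamma>"
      "rel3 K (double_smod V) s (\<lambda>i. copy V True (e i)) (\<lambda>i. copy V True (e i)) (\<gamma> k) \<in> double_rels K V s e t \<gamma>"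
      "rel3 K (double_smod V) s (\<lambda>i. copy V False (e i)) (\<lambda>i. copy V True (e i)) (\<gamma> k) \<in> double_rels K V s e t \<gamma>"
      unfolding double_rels_def Let_def c using k by blast+
    then show ?thesis using xy by (cases x; cases y) simp_all
  qed
  show "l \<in> {1..3} \<Longrightarrow> i \<in> {1..s} \<Longrightarrow> j \<in> {1..s} \<Longrightarrow>
     T3 K (double_smod V) l (copy V False (e i)) (copy V True (e j)) \<ominus>\<^bsub>part (free_operad K (double_smod V)) 3\<^esub>
         T3 K (double_smod V) l (copy V True (e i)) (copy V False (e j)) \<in> double_rels K V s e t \<gamma>"
    unfolding double_rels_def Let_def c by blast
qed

lemma rel3_closed:
  assumes V: "pre_smod K V" and a: "\<And>i. i \<in> {1..s} \<Longrightarrow> a i \<in> carrier (part V 2)"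
    and b: "\<And>i. i \<in> {1..s} \<Longrightarrow> b i \<in> carrier (part V 2)"
    and g: "\<And>l i j. l \<in> {1..3} \<Longrightarrow> i \<in> {1..s} \<Longrightarrow> j \<in> {1..s} \<Longrightarrow> g l i j \<in> carrier K"
  shows "rel3 K V s a b g \<in> carrier (part (free_operad K V) 3)"
proof -
  note m = module_free_operad[OF V, of 3]
  show ?thesis unfolding rel3_def Let_def
  proof (rule submodule_finsum[OF submodule_carrier[OF m] m], rule funcsetI, clarify)
    fix l i j :: nat assume l: "l \<in> {1..3}" and i: "i \<in> {1..s}" and j: "j \<in> {1..s}"
    show "g l i j \<odot>\<^bsub>part (free_operad K V) 3\<^esub> T3 K V l (a i) (b j) \<in> carrier (part (free_operad K V) 3)"
      by (rule submoduleD(4)[OF submodule_carrier[OF m] g[OF l i j] T3_closed[OF V a[OF i] b[OF j] l]])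
  qed
qed

text \<open>Used for the recolouring maps, which turn a relation of R into its coloured
  copies.\<close>

lemma lin_maps_rel3:
  assumes V: "pre_smod K V" and V': "pre_smod K V'"
    and f: "f \<in> lin_maps K (part (free_operad K V) 3) (part (free_operad K V') 3)"
    and a: "\<And>i. i \<in> {1..s} \<Longrightarrow> a i \<in> carrier (part V 2)" "\<And>i. i \<in> {1..s} \<Longrightarrow> b i \<in> carrier (part V 2)"
    and g: "\<And>l i j. l \<in> {1..3} \<Longrightarrow> i \<in> {1..s} \<Longrightarrow> j \<in> {1..s} \<Longrightarrow> g l i j \<in> carrier K"
    and fT: "\<And>l i j. l \<in> {1..3} \<Longrightarrow> i \<in> {1..s} \<Longrightarrow> j \<in> {1..s} \<Longrightarrow>
       f (T3 K V l (a i) (b j)) = T3 K V' l (a' i) (b' j)"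
  shows "f (rel3 K V s a b g) = rel3 K V' s a' b' g"
proof -
  let ?F = "part (free_operad K V) 3" and ?F' = "part (free_operad K V') 3"
  note m = module_free_operad[OF V, of 3] and m' = module_free_operad[OF V', of 3]
  interpret N: module K ?F' by (rule m')
  let ?X = "{1..3::nat} \<times> {1..s} \<times> {1..s}"
  have cl: "g l i j \<odot>\<^bsub>?F\<^esub> T3 K V l (a i) (b j) \<in> carrier ?F"
    if "l \<in> {1..3}" "i \<in> {1..s}" "j \<in> {1..s}" for l i j
    by (rule submoduleD(4)[OF submodule_carrier[OF m] g[OF that] T3_closed[OF V a(1)[OF that(2)] a(2)[OF that(3)] that(1)]])
  have eq: "f (g l i j \<odot>\<^bsub>?F\<^esub> T3 K V l (a i) (b j)) = g l i j \<odot>\<^bsub>?F'\<^esub> T3 K V' l (a' i) (b' j)"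
    if "l \<in> {1..3}" "i \<in> {1..s}" "j \<in> {1..s}" for l i j
    using lin_mapsD(3)[OF f g[OF that] T3_closed[OF V a(1)[OF that(2)] a(2)[OF that(3)] that(1)]] fT[OF that] by simp
  have cl': "g l i j \<odot>\<^bsub>?F'\<^esub> T3 K V' l (a' i) (b' j) \<in> carrier ?F'"
    if "l \<in> {1..3}" "i \<in> {1..s}" "j \<in> {1..s}" for l i j
    using lin_mapsD(1)[OF f cl[OF that]] eq[OF that] by simp
  have "f (rel3 K V s a b g) = finsum ?F' (\<lambda>p. f ((\<lambda>(l, i, j). g l i j \<odot>\<^bsub>?F\<^esub> T3 K V l (a i) (b j)) p)) ?X"
    unfolding rel3_def Let_def
  proof (rule lin_maps_finsum[OF f m m'], rule funcsetI, clarify)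
    fix l i j :: nat assume "l \<in> {1..3}" "i \<in> {1..s}" "j \<in> {1..s}"
    then show "g l i j \<odot>\<^bsub>?F\<^esub> T3 K V l (a i) (b j) \<in> carrier ?F" by (rule cl)
  qed
  also have "\<dots> = finsum ?F' (\<lambda>(l, i, j). g l i j \<odot>\<^bsub>?F'\<^esub> T3 K V' l (a' i) (b' j)) ?X"
  proof (rule N.finsum_cong'[OF refl])
    show "(\<lambda>(l, i, j). g l i j \<odot>\<^bsub>?F'\<^esub> T3 K V' l (a' i) (b' j)) \<in> ?X \<rightarrow> carrier ?F'"
    proof (rule funcsetI, clarify)
      fix l i j :: nat assume "l \<in> {1..3}" "i \<in> {1..s}" "j \<in> {1..s}"
      then show "g l i j \<odot>\<^bsub>?F'\<^esub> T3 K V' l (a' i) (b' j) \<in> carrier ?F'" by (rule cl')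
    qed
    fix p assume "p \<in> ?X"
    then obtain l i j where p: "p = (l, i, j)" "l \<in> {1..3}" "i \<in> {1..s}" "j \<in> {1..s}" by blast
    show "f ((\<lambda>(l, i, j). g l i j \<odot>\<^bsub>?F\<^esub> T3 K V l (a i) (b j)) p) =
        (\<lambda>(l, i, j). g l i j \<odot>\<^bsub>?F'\<^esub> T3 K V' l (a' i) (b' j)) p"
      using eq[OF p(2-4)] by (simp add: p(1))
  qed
  finally show ?thesis unfolding rel3_def Let_def .
qed

section \<open>Linear maps out of F(V)(3) and F(V \<oplus> V)(3) prescribed on basis trees\<close>

locale binary_base =
  fixes K :: "('k, 'm) ring_scheme" and V :: "('k, 'v) smod" and e :: "nat \<Rightarrow> 'v" and s :: nat
    and c :: "nat \<Rightarrow> 'v \<Rightarrow> 'k"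
  assumes V: "s_module K V" and bin: "binary_smod V" and base: "dual_basis K (part V 2) {1..s} e c"
begin

abbreviation "W \<equiv> com2_smod K"
abbreviation "U \<equiv> double_smod V"
abbreviation "X \<equiv> smod_tensor K V W"
abbreviation "A \<equiv> part (free_operad K V) 3"
abbreviation "B \<equiv> part (free_operad K W) 3"
abbreviation "C \<equiv> part (free_operad K U) 3"
abbreviation "T \<equiv> tensor3 K V W"

lemmas pV = s_module_pre_smod[OF V]
lemmas cr = s_module_cring[OF V]
lemmas mV = s_module_module[OF V]
lemmas sU = s_module_double[OF V]
lemmas pU = s_module_pre_smod[OF sU]
lemmas sW = s_module_com2[OF cr]
lemmas pW = s_module_pre_smod[OF sW]
lemmas mW = s_module_module[OF sW]
lemmas mA = module_free_operad[OF pV, of 3]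
lemmas mB = module_free_operad[OF pW, of 3]
lemmas mC = module_free_operad[OF pU, of 3]
lemmas mT = module_tensor[OF mA mB, folded tensor3_def]
lemmas tens3_bilinear = tens_bilinear[OF mA mB, folded tensor3_def tens3_def]
lemmas tens3_closed = tens_closed[OF mA mB, folded tensor3_def tens3_def]

lemma basis_closed: "i \<in> {1..s} \<Longrightarrow> e i \<in> carrier (part V 2)"
  using base by (auto simp: dual_basis_def)

lemma copy_basis_closed: "i \<in> {1..s} \<Longrightarrow> copy V x (e i) \<in> carrier (part U 2)"
  by (rule lin_mapsD(1)[OF copy_linear[OF mV] basis_closed])

lemma free_ext:
  assumes N: "module K N" and g: "\<And>l i j. l \<in> {1..3} \<Longrightarrow> i \<in> {1..s} \<Longrightarrow> j \<in> {1..s} \<Longrightarrow> g l i j \<in> carrier N"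
  shows "\<exists>f\<in>lin_maps K A N.
    \<forall>l\<in>{1..3}. \<forall>i\<in>{1..s}. \<forall>j\<in>{1..s}. f (T3 K V l (e i) (e j)) = g l i j"
proof -
  obtain d where d: "dual_basis K A ({1..3} \<times> {1..s} \<times> {1..s}) (\<lambda>(l, i, j). T3 K V l (e i) (e j)) d"
    using dual_basis_T3[OF V bin base] by blast
  have gc: "(\<lambda>(l, i, j). g l i j) p \<in> carrier N" if p: "p \<in> {1..3} \<times> {1..s} \<times> {1..s}" for p
  proof -
    obtain l i j where "p = (l, i, j)" "l \<in> {1..3}" "i \<in> {1..s}" "j \<in> {1..s}" using p by blast
    then show ?thesis using g by simp
  qed
  from dual_basis_extend[OF d N gc]
  obtain f where f: "f \<in> lin_maps K A N"
    and fp: "\<forall>p\<in>{1..3} \<times> {1..s} \<times> {1..s}. f ((\<lambda>(l, i, j). T3 K V l (e i) (e j)) p) = (\<lambda>(l, i, j). g l i j) p"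
    by (rule bexE)
  show ?thesis
  proof (intro bexI[OF _ f] ballI)
    fix l i j :: nat assume "l \<in> {1..3}" "i \<in> {1..s}" "j \<in> {1..s}"
    then show "f (T3 K V l (e i) (e j)) = g l i j" using bspec[OF fp, of "(l, i, j)"] by simp
  qed
qed

lemma free_memI:
  assumes N: "module K N" and H: "submodule H K N" and f: "f \<in> lin_maps K A N"
    and fT: "\<And>l i j. l \<in> {1..3} \<Longrightarrow> i \<in> {1..s} \<Longrightarrow> j \<in> {1..s} \<Longrightarrow> f (T3 K V l (e i) (e j)) \<in> H"
    and z: "z \<in> carrier A"
  shows "f z \<in> H"
proof -
  obtain d where d: "dual_basis K A ({1..3} \<times> {1..s} \<times> {1..s}) (\<lambda>(l, i, j). T3 K V l (e i) (e j)) d"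
    using dual_basis_T3[OF V bin base] by blast
  show ?thesis
  proof (rule dual_basis_memI[OF d mA N H f _ z])
    fix p assume "p \<in> {1..3::nat} \<times> {1..s} \<times> {1..s}"
    then obtain l i j where p: "p = (l, i, j)" "l \<in> {1..3}" "i \<in> {1..s}" "j \<in> {1..s}" by blast
    show "f ((\<lambda>(l, i, j). T3 K V l (e i) (e j)) p) \<in> H" using fT[OF p(2-4)] p(1) by simp
  qed
qed

lemma free_eqI:
  assumes N: "module K N" and f: "f \<in> lin_maps K A N"
    and g: "g \<in> lin_maps K A N"
    and fT: "\<And>l i j. l \<in> {1..3} \<Longrightarrow> i \<in> {1..s} \<Longrightarrow> j \<in> {1..s} \<Longrightarrow> f (T3 K V l (e i) (e j)) = g (T3 K V l (e i) (e j))"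
    and z: "z \<in> carrier A"
  shows "f z = g z"
proof -
  interpret N: module K N by (rule N)
  have "f z \<ominus>\<^bsub>N\<^esub> g z \<in> {\<zero>\<^bsub>N\<^esub>}"
  proof (rule free_memI[OF N submodule_zero[OF N] lin_maps_diff[OF f g N] _ z])
    fix l i j :: nat assume lij: "l \<in> {1..3}" "i \<in> {1..s}" "j \<in> {1..s}"
    have "g (T3 K V l (e i) (e j)) \<in> carrier N"
      by (rule lin_mapsD(1)[OF g T3_closed[OF pV basis_closed[OF lij(2)] basis_closed[OF lij(3)] lij(1)]])
    then show "f (T3 K V l (e i) (e j)) \<ominus>\<^bsub>N\<^esub> g (T3 K V l (e i) (e j)) \<in> {\<zero>\<^bsub>N\<^esub>}"
      using fT[OF lij] by (simp add: a_minus_def N.r_neg)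
  qed
  then show ?thesis
    using diff_zero_imp_eq[OF N.abelian_group_axioms] lin_mapsD(1)[OF f z] lin_mapsD(1)[OF g z] by blast
qed

lemma double_basis:
  obtains d where "dual_basis K C
    ({1..3} \<times> ({1..s} \<times> UNIV) \<times> ({1..s} \<times> UNIV))
    (\<lambda>(l, p, q). T3 K U l ((\<lambda>(i, x). copy V x (e i)) p) ((\<lambda>(i, x). copy V x (e i)) q)) d"
  using dual_basis_T3[OF sU binary_double[OF bin] dual_basis_double[OF base mV]] by blast

lemma double_ext:
  assumes N: "module K N" and g: "\<And>l i j x y. l \<in> {1..3} \<Longrightarrow> i \<in> {1..s} \<Longrightarrow> j \<in> {1..s} \<Longrightarrow> g l i j x y \<in> carrier N"
  shows "\<exists>f\<in>lin_maps K C N.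
    \<forall>l\<in>{1..3}. \<forall>i\<in>{1..s}. \<forall>j\<in>{1..s}. \<forall>x y.
       f (T3 K U l (copy V x (e i)) (copy V y (e j))) = g l i j x y"
proof -
  obtain d where d: "dual_basis K C
    ({1..3} \<times> ({1..s} \<times> UNIV) \<times> ({1..s} \<times> UNIV))
    (\<lambda>(l, p, q). T3 K U l ((\<lambda>(i, x). copy V x (e i)) p) ((\<lambda>(i, x). copy V x (e i)) q)) d"
    by (rule double_basis)
  let ?X = "{1..3::nat} \<times> ({1..s} \<times> (UNIV :: bool set)) \<times> ({1..s} \<times> (UNIV :: bool set))"
  have gc: "(\<lambda>(l, (i, x), (j, y)). g l i j x y) p \<in> carrier N" if p: "p \<in> ?X" for p
  proof -
    obtain l i x j y where "p = (l, (i, x), (j, y))" "l \<in> {1..3}" "i \<in> {1..s}" "j \<in> {1..s}" using p by blast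
    then show ?thesis using g by simp
  qed
  from dual_basis_extend[OF d N gc]
  obtain f where f: "f \<in> lin_maps K C N"
    and fp: "\<forall>p\<in>?X. f ((\<lambda>(l, p, q). T3 K U l ((\<lambda>(i, x). copy V x (e i)) p) ((\<lambda>(i, x). copy V x (e i)) q)) p)
        = (\<lambda>(l, (i, x), (j, y)). g l i j x y) p"
    by (rule bexE)
  show ?thesis
  proof (intro bexI[OF _ f] ballI allI)
    fix l i j :: nat and x y assume "l \<in> {1..3}" "i \<in> {1..s}" "j \<in> {1..s}"
    then show "f (T3 K U l (copy V x (e i)) (copy V y (e j))) = g l i j x y"
      using bspec[OF fp, of "(l, (i, x), (j, y))"] by simp
  qed
qed

lemma double_memI:
  assumes N: "module K N" and H: "submodule H K N" and f: "f \<in> lin_maps K C N"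
    and fT: "\<And>l i j x y. l \<in> {1..3} \<Longrightarrow> i \<in> {1..s} \<Longrightarrow> j \<in> {1..s} \<Longrightarrow>
       f (T3 K U l (copy V x (e i)) (copy V y (e j))) \<in> H"
    and z: "z \<in> carrier C"
  shows "f z \<in> H"
proof -
  obtain d where d: "dual_basis K C
    ({1..3} \<times> ({1..s} \<times> UNIV) \<times> ({1..s} \<times> UNIV))
    (\<lambda>(l, p, q). T3 K U l ((\<lambda>(i, x). copy V x (e i)) p) ((\<lambda>(i, x). copy V x (e i)) q)) d"
    by (rule double_basis)
  show ?thesis
  proof (rule dual_basis_memI[OF d mC N H f _ z])
    fix p assume "p \<in> {1..3::nat} \<times> ({1..s} \<times> (UNIV :: bool set)) \<times> ({1..s} \<times> (UNIV :: bool set))"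
    then obtain l i x j y where p: "p = (l, (i, x), (j, y))" "l \<in> {1..3}" "i \<in> {1..s}" "j \<in> {1..s}" by blast
    show "f ((\<lambda>(l, p, q). T3 K U l ((\<lambda>(i, x). copy V x (e i)) p) ((\<lambda>(i, x). copy V x (e i)) q)) p) \<in> H"
      using fT[OF p(2-4)] p(1) by simp
  qed
qed

text \<open>Recolouring with x at the inner vertex and y at the root. It is prescribed on basis
  trees, but the formula is extended to all decorations by bilinearity before equivariance is
  attacked: the action may put the flip of e_i in place of e_i.\<close>

lemma dup_exists:
  "\<exists>G\<in>lin_maps K A C.
    (\<forall>l\<in>{1..3}. \<forall>v\<in>carrier (part V 2). \<forall>v'\<in>carrier (part V 2).
       G (T3 K V l v v') = T3 K U l (copy V x v) (copy V y v')) \<and>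
    (\<forall>z\<in>carrier A. \<forall>\<sigma>. \<sigma> permutes {1..3} \<longrightarrow>
       G (sact (free_operad K V) 3 z \<sigma>) = sact (free_operad K U) 3 (G z) \<sigma>)"
proof -
    note cl = lin_mapsD(1)[OF copy_linear[OF mV]]
  have "\<exists>G\<in>lin_maps K A C. \<forall>l\<in>{1..3}. \<forall>i\<in>{1..s}. \<forall>j\<in>{1..s}.
      G (T3 K V l (e i) (e j)) = T3 K U l (copy V x (e i)) (copy V y (e j))"
  proof (rule free_ext[OF mC])
    fix l i j :: nat assume l: "l \<in> {1..3}" and i: "i \<in> {1..s}" and j: "j \<in> {1..s}"
    show "T3 K U l (copy V x (e i)) (copy V y (e j)) \<in> carrier C"
      by (rule T3_closed[OF pU copy_basis_closed[OF i] copy_basis_closed[OF j] l])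
  qed
  then obtain G where G: "G \<in> lin_maps K A C"
    and Gb: "\<forall>l\<in>{1..3}. \<forall>i\<in>{1..s}. \<forall>j\<in>{1..s}.
      G (T3 K V l (e i) (e j)) = T3 K U l (copy V x (e i)) (copy V y (e j))"
    by (rule bexE)
  have GT: "G (T3 K V l v v') = T3 K U l (copy V x v) (copy V y v')"
    if l: "l \<in> {1..3}" and v: "v \<in> carrier (part V 2)" "v' \<in> carrier (part V 2)" for l v v'
  proof (rule bilinear_on_eq_on_span[OF bilinear_on_compose_left[OF T3_bilinear[OF pV l] G]
        bilinear_on_compose_right[OF T3_bilinear[OF pU l] copy_linear[OF mV] copy_linear[OF mV]] mV mV mC])
    show "e ` {1..s} \<subseteq> carrier (part V 2)" using basis_closed by blast
    then show "e ` {1..s} \<subseteq> carrier (part V 2)" .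
    show "v \<in> mod_span K (part V 2) (e ` {1..s})" "v' \<in> mod_span K (part V 2) (e ` {1..s})"
      using v base by (simp_all add: dual_basis_def)
    fix a b assume "a \<in> e ` {1..s}" "b \<in> e ` {1..s}"
    then obtain i j where "a = e i" "i \<in> {1..s}" "b = e j" "j \<in> {1..s}" by blast
    then show "G (T3 K V l a b) = T3 K U l (copy V x a) (copy V y b)" using Gb l by blast
  qed
  have Gs: "G (sact (free_operad K V) 3 z \<sigma>) = sact (free_operad K U) 3 (G z) \<sigma>"
    if z: "z \<in> carrier A" and \<sigma>: "\<sigma> permutes {1..3}" for z \<sigma>
  proof (rule free_eqI[OF mC lin_maps_compose[OF lin_operadD(2)[OF lin_operad_free[OF pV] \<sigma>] G]
        lin_maps_compose[OF G lin_operadD(2)[OF lin_operad_free[OF pU] \<sigma>]] _ z])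
    fix l i j :: nat assume l: "l \<in> {1..3}" and "i \<in> {1..s}" "j \<in> {1..s}"
    then have ij: "e i \<in> carrier (part V 2)" "e j \<in> carrier (part V 2)" by (simp_all only: basis_closed)
    note T = T3_sact[OF pV ij l \<sigma>] and T' = T3_sact[OF pU cl[OF ij(1)] cl[OF ij(2)] l \<sigma>]
    let ?b = "ccl (inv_into UNIV \<sigma> l) (inv_into UNIV \<sigma> (second l))"
    have "(if ?b then e i else sact V 2 (e i) flip) \<in> carrier (part V 2)"
      using ij(1) two_closed[OF pV ij(1)] by simp
    from GT[OF T(2) this ij(2)]
    show "G (sact (free_operad K V) 3 (T3 K V l (e i) (e j)) \<sigma>) =
        sact (free_operad K U) 3 (G (T3 K V l (e i) (e j))) \<sigma>"
      unfolding GT[OF l ij] T(1) T'(1) copy_sact[OF V ij(1)] by (simp split: if_splits)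
  qed
  show ?thesis by (intro bexI[OF _ G] conjI ballI allI impI GT Gs)
qed

end

lemma double_rels_carrier:
  assumes V: "s_module K V" and e: "\<And>i. i \<in> {1..s} \<Longrightarrow> e i \<in> carrier (part V 2)"
    and g: "\<And>k l i j. k \<in> {1..t} \<Longrightarrow> l \<in> {1..3} \<Longrightarrow> i \<in> {1..s} \<Longrightarrow> j \<in> {1..s} \<Longrightarrow> \<gamma> k l i j \<in> carrier K"
  shows "double_rels K V s e t \<gamma> \<subseteq> carrier (part (free_operad K (double_smod V)) 3)"
proof
  note pU = s_module_pre_smod[OF s_module_double[OF V]]
  note m = module_free_operad[OF pU, of 3]
  have c: "copy V x (e i) \<in> carrier (part (double_smod V) 2)" if "i \<in> {1..s}" for x i
    by (rule lin_mapsD(1)[OF copy_linear[OF pre_smodD(1)[OF s_module_pre_smod[OF V]]] e[OF that]])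
  fix r assume "r \<in> double_rels K V s e t \<gamma>"
  then show "r \<in> carrier (part (free_operad K (double_smod V)) 3)"
  proof (cases rule: double_rels_cases)
    case (1 k x y)
    show ?thesis unfolding 1(3) by (rule rel3_closed[OF pU c c g[OF 1(1)]])
  next
    case (2 l i j)
    show ?thesis unfolding 2(4)
      by (rule submodule_minus[OF submodule_carrier[OF m] m T3_closed[OF pU c[OF 2(2)] c[OF 2(3)] 2(1)]
            T3_closed[OF pU c[OF 2(2)] c[OF 2(3)] 2(1)]])
  qed
qed

section \<open>The relations and the coordinates of 2Com in arity three\<close>

context
  fixes K :: "('k, 'm) ring_scheme"
  assumes K: "cring K"
begin

private abbreviation (input) "W \<equiv> com2_smod K"
private abbreviation (input) "B \<equiv> part (free_operad K W) 3"
private lemmas sW = s_module_com2[OF K]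
private lemmas pW = s_module_pre_smod[OF sW]
private lemmas mB = module_free_operad[OF pW, of 3]
private lemmas cc = colour_closed[OF K]

lemma colour_T3_closed: "l \<in> {1..3} \<Longrightarrow> T3 K W l (colour K x) (colour K y) \<in> carrier B"
  by (rule T3_closed[OF pW cc cc])

text \<open>With a single generator the sum has three terms, and one of the three coefficients is
  zero.\<close>

lemma rel3_com:
  assumes k: "k \<in> {1..2}"
  shows "rel3 K W 1 (\<lambda>i. colour K x) (\<lambda>i. colour K y) (com_coeff K k) =
    T3 K W k (colour K x) (colour K y) \<ominus>\<^bsub>B\<^esub> T3 K W (k + 1) (colour K x) (colour K y)"
proof -
  interpret B: module K B by (rule mB)
  have X: "{1..3::nat} \<times> {1..1::nat} \<times> {1..1::nat} = {(1, 1, 1), (2, 1, 1), (3, 1, 1)}" by auto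
  define T where "T l = T3 K W l (colour K x) (colour K y)" for l
  have T: "T 1 \<in> carrier B" "T 2 \<in> carrier B" "T 3 \<in> carrier B"
    unfolding T_def by (rule colour_T3_closed; simp)+
  have "rel3 K W 1 (\<lambda>i. colour K x) (\<lambda>i. colour K y) (com_coeff K k) =
      com_coeff K k 1 1 1 \<odot>\<^bsub>B\<^esub> T 1 \<oplus>\<^bsub>B\<^esub> (com_coeff K k 2 1 1 \<odot>\<^bsub>B\<^esub> T 2 \<oplus>\<^bsub>B\<^esub> com_coeff K k 3 1 1 \<odot>\<^bsub>B\<^esub> T 3)"
    unfolding rel3_def Let_def X T_def[symmetric]
    using T by (simp add: com_coeff_def Pi_def)
  also have "\<dots> = T k \<ominus>\<^bsub>B\<^esub> T (k + 1)"
  proof -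
    have "k = 1 \<or> k = 2" using k by auto
    then show ?thesis using T
      by (elim disjE) (simp_all add: com_coeff_def a_minus_def B.smult_l_minus)
  qed
  finally show ?thesis unfolding T_def .
qed

lemma com2_rels_eq: "com2_rels K = double_rels K (com_smod K) 1 (\<lambda>i. \<one>\<^bsub>K\<^esub>) 2 (com_coeff K)"
  by (simp add: com2_rels_def)

lemma com2_rels_carrier: "com2_rels K \<subseteq> carrier B"
proof -
  interpret cring K by (rule K)
  show ?thesis unfolding com2_rels_eq com2_smod_def
    by (rule double_rels_carrier[OF s_module_com[OF K]]) (auto simp: com_smod_def com_coeff_def)
qed

text \<open>The coordinate belonging to the unordered pair of colours x, y. Ignoring the shape l, it
  kills the associativity relations; ignoring which colour sits at the root, it kills the exchange
  relations.\<close>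

lemma com2_functional:
  "\<exists>p\<in>lin_maps K B (scal K).
    (\<forall>l\<in>{1..3}. \<forall>x' y'. p (T3 K W l (colour K x') (colour K y')) =
       (if (x', y') = (x, y) \<or> (x', y') = (y, x) then \<one>\<^bsub>K\<^esub> else \<zero>\<^bsub>K\<^esub>)) \<and>
    (\<forall>z\<in>smod_span K (free_operad K W) 3 (com2_rels K). p z = \<zero>\<^bsub>K\<^esub>)"
proof -
  interpret cring K by (rule K)
  note ms = module_scal[OF K]
  interpret S: module K "scal K" by (rule ms)
  let ?g = "\<lambda>x' y'. if (x', y') = (x, y) \<or> (x', y') = (y, x) then \<one>\<^bsub>K\<^esub> else \<zero>\<^bsub>K\<^esub>"
  \<comment> \<open>The results for V apply to Com with its one-element basis, because 2Com is
    generated by the double of \<open>com_smod\<close>.\<close>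
  note com = binary_base.intro[OF s_module_com[OF K] binary_com dual_basis_com[OF K]]
  have "\<exists>p\<in>lin_maps K (part (free_operad K (double_smod (com_smod K))) 3) (scal K).
    \<forall>l\<in>{1..3}. \<forall>i\<in>{1..1::nat}. \<forall>j\<in>{1..1::nat}. \<forall>x' y'.
       p (T3 K (double_smod (com_smod K)) l (copy (com_smod K) x' \<one>\<^bsub>K\<^esub>) (copy (com_smod K) y' \<one>\<^bsub>K\<^esub>)) = ?g x' y'"
    by (rule binary_base.double_ext[OF com ms]) simp
  then obtain p where p: "p \<in> lin_maps K (part (free_operad K (double_smod (com_smod K))) 3) (scal K)"
    and pa: "\<forall>l\<in>{1..3}. \<forall>i\<in>{1..1::nat}. \<forall>j\<in>{1..1::nat}. \<forall>x' y'.
       p (T3 K (double_smod (com_smod K)) l (copy (com_smod K) x' \<one>\<^bsub>K\<^esub>) (copy (com_smod K) y' \<one>\<^bsub>K\<^esub>)) = ?g x' y'"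
    by (rule bexE)
  note p = p[folded com2_smod_def]
  have pT: "p (T3 K W l (colour K x') (colour K y')) = ?g x' y'" if "l \<in> {1..3}" for l x' y'
    using pa that unfolding com2_smod_def colour_def by simp
  note pd = lin_mapsD[OF p]
  \<comment> \<open>The relations are closed up under the symmetric group, so p has to be invariant.
    The generators being symmetric, a permutation changes only the shape, which p does not
    see.\<close>
  have inv: "p (sact (free_operad K W) 3 z \<sigma>) = p z" if z: "z \<in> carrier B" and \<sigma>: "\<sigma> permutes {1..3}" for z \<sigma>
  proof -
    let ?f = "\<lambda>z. p (sact (free_operad K W) 3 z \<sigma>) \<ominus>\<^bsub>scal K\<^esub> p z"
    have lin: "?f \<in> lin_maps K B (scal K)"
      by (rule lin_maps_diff[OF lin_maps_compose[OF lin_operadD(2)[OF lin_operad_free[OF pW] \<sigma>] p] p ms])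
    have "?f z \<in> {\<zero>\<^bsub>scal K\<^esub>}"
    proof (rule binary_base.double_memI[OF com ms submodule_zero[OF ms] lin[unfolded com2_smod_def] _ z[unfolded com2_smod_def], folded com2_smod_def])
      fix l i j :: nat and x' y' assume l: "l \<in> {1..3}"
      have "sact (free_operad K W) 3 (T3 K W l (colour K x') (colour K y')) \<sigma> =
          T3 K W (index (inv_into UNIV \<sigma> (third l))) (colour K x') (colour K y')"
        using T3_sact(1)[OF pW cc cc l \<sigma>] by (simp add: com2_sact)
      then have "p (sact (free_operad K W) 3 (T3 K W l (colour K x') (colour K y')) \<sigma>) = p (T3 K W l (colour K x') (colour K y'))"
        using pT[OF T3_sact(2)[OF pW cc cc l \<sigma>]] pT[OF l] by simp
      moreover have "p (T3 K W l (colour K x') (colour K y')) \<in> carrier (scal K)" using pT[OF l] by simp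
      ultimately show "p (sact (free_operad K W) 3 (T3 K W l (copy (com_smod K) x' \<one>\<^bsub>K\<^esub>) (copy (com_smod K) y' \<one>\<^bsub>K\<^esub>)) \<sigma>)
          \<ominus>\<^bsub>scal K\<^esub> p (T3 K W l (copy (com_smod K) x' \<one>\<^bsub>K\<^esub>) (copy (com_smod K) y' \<one>\<^bsub>K\<^esub>)) \<in> {\<zero>\<^bsub>scal K\<^esub>}"
        unfolding colour_def[symmetric] using S.r_neg by (simp add: a_minus_def)
    qed
    then show ?thesis
      using diff_zero_imp_eq[OF S.abelian_group_axioms pd(1) pd(1)] z operad_closed(1)[OF lin_operad_free[OF pW] z \<sigma>] by simp
  qed
  have "smod_span K (free_operad K W) 3 (com2_rels K) \<subseteq> {z \<in> carrier B. p z \<in> {\<zero>\<^bsub>scal K\<^esub>}}"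
  proof (rule smod_span_least[OF submodule_preimage[OF p mB ms submodule_zero[OF ms]]])
    show "sact (free_operad K W) 3 z \<sigma> \<in> {z \<in> carrier B. p z \<in> {\<zero>\<^bsub>scal K\<^esub>}}"
      if "z \<in> {z \<in> carrier B. p z \<in> {\<zero>\<^bsub>scal K\<^esub>}}" "\<sigma> permutes {1..3}" for z \<sigma>
      using that inv[OF _ that(2)] operad_closed(1)[OF lin_operad_free[OF pW] _ that(2)] by simp
    have diff: "p (a \<ominus>\<^bsub>B\<^esub> b) = \<zero>\<^bsub>K\<^esub>" if "a \<in> carrier B" "b \<in> carrier B" "p a = p b" for a b
      using lin_maps_minus[OF p mB ms that(1,2)] that(3) pd(1)[OF that(2)] S.r_neg[of "p b"] by (simp add: a_minus_def)
    show "com2_rels K \<subseteq> {z \<in> carrier B. p z \<in> {\<zero>\<^bsub>scal K\<^esub>}}"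
    proof
      fix r assume r: "r \<in> com2_rels K"
      have "p r = \<zero>\<^bsub>K\<^esub>"
        using r unfolding com2_rels_eq
      proof (cases rule: double_rels_cases)
        case (1 k u v)
        then have "k \<in> {1..3}" "k + 1 \<in> {1..3}" by auto
        then show ?thesis
          using diff[OF colour_T3_closed[of k u v] colour_T3_closed[of "k + 1" u v]] pT rel3_com[OF 1(1), of u v] 1(3)
          by (simp add: com2_smod_def[symmetric] colour_def[symmetric])
      next
        case (2 l i j)
        then show ?thesis
          using diff[OF colour_T3_closed[of l False True] colour_T3_closed[of l True False]] pT[OF 2(1)]
          by (auto simp: com2_smod_def[symmetric] colour_def[symmetric])
      qed
      then show "r \<in> {z \<in> carrier B. p z \<in> {\<zero>\<^bsub>scal K\<^esub>}}" using r com2_rels_carrier by auto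
    qed
  qed
  then have pz: "\<And>z. z \<in> smod_span K (free_operad K W) 3 (com2_rels K) \<Longrightarrow> p z = \<zero>\<^bsub>K\<^esub>" by auto
  show ?thesis by (intro bexI[OF _ p] conjI ballI allI pT pz)
qed

text \<open>The two associativity relations chain the three shapes together; passing to cosets turns
  the chain into transitivity of equality. The first shape serves as reference.\<close>

lemma com2_span_diff:
  assumes l: "l \<in> {1..3}" and xy: "x \<longrightarrow> y"
  shows "T3 K W l (colour K x) (colour K y) \<ominus>\<^bsub>B\<^esub> T3 K W 1 (colour K x) (colour K y)
    \<in> smod_span K (free_operad K W) 3 (com2_rels K)"
proof -
  let ?S = "smod_span K (free_operad K W) 3 (com2_rels K)"
  define T where "T l = T3 K W l (colour K x) (colour K y)" for l
  have T: "T l \<in> carrier B" if "l \<in> {1..3}" for l unfolding T_def by (rule colour_T3_closed[OF that])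
  note sub = smod_span_submodule[OF lin_operad_free[OF pW] com2_rels_carrier]
  have step: "?S +>\<^bsub>B\<^esub> T k = ?S +>\<^bsub>B\<^esub> T (k + 1)" if k: "k \<in> {1..2}" for k
  proof -
    have "rel3 K W 1 (\<lambda>i. colour K x) (\<lambda>i. colour K y) (com_coeff K k) \<in> com2_rels K"
      unfolding com2_rels_eq colour_def com2_smod_def by (rule double_relsI(1)[OF k xy])
    then have "T k \<ominus>\<^bsub>B\<^esub> T (k + 1) \<in> ?S" unfolding rel3_com[OF k] T_def by (rule smod_span_incl)
    moreover have "k \<in> {1..3}" "k + 1 \<in> {1..3}" using k by auto
    ultimately show ?thesis using coset_eq_iff[OF mB sub T T] by blast
  qed
  have "?S +>\<^bsub>B\<^esub> T l = ?S +>\<^bsub>B\<^esub> T 1"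
    using three_cases[OF l] step[of 1] step[of 2] by auto
  then show ?thesis using coset_eq_iff[OF mB sub T[OF l] T[of 1]] by (simp add: T_def)
qed

lemma com2_span_swap:
  assumes l: "l \<in> {1..3}"
  shows "T3 K W l (colour K False) (colour K True) \<ominus>\<^bsub>B\<^esub> T3 K W l (colour K True) (colour K False)
    \<in> smod_span K (free_operad K W) 3 (com2_rels K)"
proof -
  have "T3 K W l (colour K False) (colour K True) \<ominus>\<^bsub>B\<^esub> T3 K W l (colour K True) (colour K False) \<in> com2_rels K"
    unfolding com2_rels_eq colour_def com2_smod_def using double_relsI(2)[OF l, of 1 1 1] by simp
  then show ?thesis by (rule smod_span_incl)
qed

end

section \<open>Comparison of the two spaces of relations\<close>

locale compatible_relations = binary_base K V e s c
  for K :: "('k, 'm) ring_scheme" and V :: "('k, 'v) smod" and e :: "nat \<Rightarrow> 'v" and s :: nat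
    and c :: "nat \<Rightarrow> 'v \<Rightarrow> 'k" +
  fixes t :: nat and \<gamma> :: "nat \<Rightarrow> nat \<Rightarrow> nat \<Rightarrow> nat \<Rightarrow> 'k"
    and \<Psi> :: "(('v \<times> 'v) ptree \<Rightarrow> 'k) set \<Rightarrow>
      (('v ptree \<Rightarrow> 'k) set \<times> (('k \<times> 'k) ptree \<Rightarrow> 'k) set \<Rightarrow> 'k) set"
  assumes \<gamma>: "\<And>k l i j. k \<in> {1..t} \<Longrightarrow> l \<in> {1..3} \<Longrightarrow> i \<in> {1..s} \<Longrightarrow> j \<in> {1..s} \<Longrightarrow> \<gamma> k l i j \<in> carrier K"
    and \<Psi>: "\<Psi> \<in> lin_maps K C T"
    and \<Psi>T: "\<And>l i j x y. l \<in> {1..3} \<Longrightarrow> i \<in> {1..s} \<Longrightarrow> j \<in> {1..s} \<Longrightarrow>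
      \<Psi> (T3 K U l (copy V x (e i)) (copy V y (e j))) =
      tens3 K V W (T3 K V l (e i) (e j)) (T3 K W l (colour K x) (colour K y))"
begin

text \<open>\<open>H\<close> is the subspace whose preimage defines the white product, and
  \<open>J\<close> the ideal of the doubled operad. \<Psi> stands for \<Phi> read on F(V \<oplus>
  V)(3); as a parameter it keeps the comparison of \<open>H\<close> with \<open>J\<close> clear of
  the choice by \<open>SOME\<close>.\<close>

abbreviation "RS \<equiv> smod_span K (free_operad K V) 3 {rel3 K V s e e (\<gamma> k) | k. k \<in> {1..t}}"
abbreviation "SS \<equiv> smod_span K (free_operad K W) 3 (com2_rels K)"
abbreviation "H1 \<equiv> mod_span K T {tens3 K V W r y | r y. r \<in> RS \<and> y \<in> carrier B}"
abbreviation "H2 \<equiv> mod_span K T {tens3 K V W x s | x s. x \<in> carrier A \<and> s \<in> SS}"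
abbreviation "H \<equiv> set_add T H1 H2"
abbreviation "J \<equiv> gen_ideal K (free_operad K U) (\<lambda>n. if n = 3 then double_rels K V s e t \<gamma> else {})"

lemma T3e: "l \<in> {1..3} \<Longrightarrow> i \<in> {1..s} \<Longrightarrow> j \<in> {1..s} \<Longrightarrow> T3 K V l (e i) (e j) \<in> carrier A"
  by (rule T3_closed[OF pV basis_closed basis_closed])

lemma T3u: "l \<in> {1..3} \<Longrightarrow> i \<in> {1..s} \<Longrightarrow> j \<in> {1..s} \<Longrightarrow> T3 K U l (copy V x (e i)) (copy V y (e j)) \<in> carrier C"
  by (rule T3_closed[OF pU copy_basis_closed copy_basis_closed])

lemma rels_carrier: "{rel3 K V s e e (\<gamma> k) | k. k \<in> {1..t}} \<subseteq> carrier A"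
proof clarify
  fix k assume k: "k \<in> {1..t}"
  show "rel3 K V s e e (\<gamma> k) \<in> carrier A" by (rule rel3_closed[OF pV basis_closed basis_closed \<gamma>[OF k]])
qed

lemmas RS_sub = smod_span_submodule[OF lin_operad_free[OF pV] rels_carrier]
lemmas SS_sub = smod_span_submodule[OF lin_operad_free[OF pW] com2_rels_carrier[OF cr]]

lemma H1_gens: "{tens3 K V W r y | r y. r \<in> RS \<and> y \<in> carrier B} \<subseteq> carrier T"
proof clarify
  fix r y assume "r \<in> RS" "y \<in> carrier B"
  then show "tens3 K V W r y \<in> carrier T" by (intro tens3_closed submoduleD(1)[OF RS_sub])
qed

lemma H2_gens: "{tens3 K V W x s | x s. x \<in> carrier A \<and> s \<in> SS} \<subseteq> carrier T"
proof clarify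
  fix x s assume "x \<in> carrier A" "s \<in> SS"
  then show "tens3 K V W x s \<in> carrier T" by (intro tens3_closed submoduleD(1)[OF SS_sub])
qed

lemmas H1_sub = mod_span_submodule[OF mT H1_gens]
lemmas H2_sub = mod_span_submodule[OF mT H2_gens]
lemmas H_sub = set_add_submodule[OF mT H1_sub H2_sub]

lemma H1I: "r \<in> RS \<Longrightarrow> y \<in> carrier B \<Longrightarrow> tens3 K V W r y \<in> H"
  by (rule subsetD[OF set_add_incl(1)[OF mT H1_sub H2_sub]], rule mod_span_incl) blast

lemma H2I: "x \<in> carrier A \<Longrightarrow> z \<in> SS \<Longrightarrow> tens3 K V W x z \<in> H"
  by (rule subsetD[OF set_add_incl(2)[OF mT H1_sub H2_sub]], rule mod_span_incl) blast

lemma tens_diff_H: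
  assumes x: "x \<in> carrier A" and yz: "y \<in> carrier B" "z \<in> carrier B" "y \<ominus>\<^bsub>B\<^esub> z \<in> SS"
  shows "tens3 K V W x y \<ominus>\<^bsub>T\<^esub> tens3 K V W x z \<in> H"
  using lin_maps_minus[OF bilinear_onD(1)[OF tens3_bilinear x] mB mT yz(1,2)] H2I[OF x yz(3)] by simp

text \<open>A coloured copy of a relation r is congruent to r \<otimes> b modulo \<open>H2\<close>,
  for one fixed tree b of 2Com, because all shapes with these colours agree there; and r \<otimes> b
  lies in \<open>H1\<close>. An exchange relation gives a tree tensored with a relation of
  2Com.\<close>

lemma double_rels_white:
  assumes r: "r \<in> double_rels K V s e t \<gamma>"
  shows "\<Psi> r \<in> H"
  using r
proof (cases rule: double_rels_cases)
  case (1 k x y)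
  from dup_exists[of x y]
  obtain G where G: "G \<in> lin_maps K A C" and Ga: "(\<forall>l\<in>{1..3}. \<forall>v\<in>carrier (part V 2). \<forall>v'\<in>carrier (part V 2).
       G (T3 K V l v v') = T3 K U l (copy V x v) (copy V y v')) \<and>
    (\<forall>z\<in>carrier A. \<forall>\<sigma>. \<sigma> permutes {1..3} \<longrightarrow>
       G (sact (free_operad K V) 3 z \<sigma>) = sact (free_operad K U) 3 (G z) \<sigma>)"
    by (rule bexE)
  have GT: "G (T3 K V l v v') = T3 K U l (copy V x v) (copy V y v')"
    if "l \<in> {1..3}" "v \<in> carrier (part V 2)" "v' \<in> carrier (part V 2)" for l v v'
    using Ga that by blast
  \<comment> \<open>The reference tree for the colours x and y; any of the three shapes could
    represent the class in 2Com.\<close>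
  define b where "b = T3 K W 1 (colour K x) (colour K y)"
  have b: "b \<in> carrier B" unfolding b_def by (rule colour_T3_closed[OF cr]) simp
  \<comment> \<open>Recolouring followed by \<Psi> and tensoring with b differ by an element of
    \<open>H\<close> on every basis tree, hence everywhere; the relation r then needs no expansion
    into its terms.\<close>
  let ?D = "\<lambda>z. \<Psi> (G z) \<ominus>\<^bsub>T\<^esub> tens3 K V W z b"
  have D: "?D \<in> lin_maps K A T"
    by (rule lin_maps_diff[OF lin_maps_compose[OF G \<Psi>] bilinear_onD(2)[OF tens3_bilinear b] mT])
  have DH: "?D z \<in> H" if z: "z \<in> carrier A" for z
  proof (rule free_memI[OF mT H_sub D _ z])
    fix l i j :: nat assume l: "l \<in> {1..3}" and i: "i \<in> {1..s}" and j: "j \<in> {1..s}"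
    show "?D (T3 K V l (e i) (e j)) \<in> H"
      unfolding GT[OF l basis_closed[OF i] basis_closed[OF j]] \<Psi>T[OF l i j]
      by (rule tens_diff_H[OF T3e[OF l i j] colour_T3_closed[OF cr, OF l] b]) (unfold b_def, rule com2_span_diff[OF cr l 1(2)])
  qed
  let ?r = "rel3 K V s e e (\<gamma> k)"
  have rRS: "?r \<in> RS" by (rule smod_span_incl) (use 1(1) in blast)
  then have rA: "?r \<in> carrier A" by (rule submoduleD(1)[OF RS_sub])
  have "G ?r = r" unfolding 1(3) by (rule lin_maps_rel3[OF pV pU G basis_closed basis_closed \<gamma>[OF 1(1)] GT[OF _ basis_closed basis_closed]])
  then have d: "\<Psi> r \<ominus>\<^bsub>T\<^esub> tens3 K V W ?r b \<in> H" using DH[OF rA] by simp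
  have tH: "tens3 K V W ?r b \<in> H" by (rule H1I[OF rRS b])
  interpret T: module K T by (rule mT)
  have rc: "\<Psi> r \<in> carrier T" using lin_mapsD(1)[OF lin_maps_compose[OF G \<Psi>] rA] \<open>G ?r = r\<close> by simp
  have "\<Psi> r = (\<Psi> r \<ominus>\<^bsub>T\<^esub> tens3 K V W ?r b) \<oplus>\<^bsub>T\<^esub> tens3 K V W ?r b"
    using rc submoduleD(1)[OF H_sub tH] by (simp add: a_minus_def T.a_assoc T.l_neg)
  then show ?thesis using submoduleD(3)[OF H_sub d tH] by simp
next
  case (2 l i j)
  have "\<Psi> r = tens3 K V W (T3 K V l (e i) (e j)) (T3 K W l (colour K False) (colour K True)) \<ominus>\<^bsub>T\<^esub>
      tens3 K V W (T3 K V l (e i) (e j)) (T3 K W l (colour K True) (colour K False))"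
    unfolding 2(4) \<Psi>T[OF 2(1-3), symmetric] by (rule lin_maps_minus[OF \<Psi> mC mT T3u[OF 2(1-3)] T3u[OF 2(1-3)]])
  also have "\<dots> \<in> H"
    by (rule tens_diff_H[OF T3e[OF 2(1-3)] colour_T3_closed[OF cr, OF 2(1)] colour_T3_closed[OF cr, OF 2(1)] com2_span_swap[OF cr 2(1)]])
  finally show ?thesis .
qed

lemmas J_ideal = gen_ideal_ideal[OF lin_operad_free[OF pU], of "\<lambda>n. if n = 3 then double_rels K V s e t \<gamma> else {}"]

lemma dr_carrier: "(if n = 3 then double_rels K V s e t \<gamma> else {}) \<subseteq> carrier (part (free_operad K U) n)"
  using double_rels_carrier[OF V, of s e t \<gamma>, OF basis_closed \<gamma>] by simp

lemmas Ji = J_ideal[OF dr_carrier]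
lemmas J_sub = operad_idealD(1)[OF Ji, of 3]

lemma J_incl: "r \<in> double_rels K V s e t \<gamma> \<Longrightarrow> r \<in> J 3"
  by (rule gen_ideal_incl) simp

lemma colour_part:
  assumes xy: "x \<longrightarrow> y"
  shows "\<exists>E\<in>lin_maps K C C.
    (\<forall>l\<in>{1..3}. \<forall>i\<in>{1..s}. \<forall>j\<in>{1..s}. \<forall>x' y'.
       E (T3 K U l (copy V x' (e i)) (copy V y' (e j))) =
       (if (x', y') = (x, y) \<or> (x', y') = (y, x) then T3 K U l (copy V x (e i)) (copy V y (e j)) else \<zero>\<^bsub>C\<^esub>)) \<and>
    (\<forall>z\<in>carrier C. \<Psi> z \<in> H \<longrightarrow> E z \<in> J 3)"
proof -
  interpret A: module K A by (rule mA)
  interpret C: module K C by (rule mC)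
  from dup_exists[of x y]
  obtain G where G: "G \<in> lin_maps K A C" and Ga: "(\<forall>l\<in>{1..3}. \<forall>v\<in>carrier (part V 2). \<forall>v'\<in>carrier (part V 2).
       G (T3 K V l v v') = T3 K U l (copy V x v) (copy V y v')) \<and>
    (\<forall>z\<in>carrier A. \<forall>\<sigma>. \<sigma> permutes {1..3} \<longrightarrow>
       G (sact (free_operad K V) 3 z \<sigma>) = sact (free_operad K U) 3 (G z) \<sigma>)"
    by (rule bexE)
  have GT: "G (T3 K V l v v') = T3 K U l (copy V x v) (copy V y v')"
    if "l \<in> {1..3}" "v \<in> carrier (part V 2)" "v' \<in> carrier (part V 2)" for l v v'
    using Ga that by blast
  have Gs: "G (sact (free_operad K V) 3 z \<sigma>) = sact (free_operad K U) 3 (G z) \<sigma>"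
    if "z \<in> carrier A" "\<sigma> permutes {1..3}" for z \<sigma> using Ga that by blast
  from com2_functional[OF cr, of x y]
  obtain p where p: "p \<in> lin_maps K B (scal K)"
    and pa: "(\<forall>l\<in>{1..3}. \<forall>x' y'. p (T3 K W l (colour K x') (colour K y')) =
       (if (x', y') = (x, y) \<or> (x', y') = (y, x) then \<one>\<^bsub>K\<^esub> else \<zero>\<^bsub>K\<^esub>)) \<and> (\<forall>z\<in>SS. p z = \<zero>\<^bsub>K\<^esub>)"
    by (rule bexE)
  have pT: "p (T3 K W l (colour K x') (colour K y')) =
       (if (x', y') = (x, y) \<or> (x', y') = (y, x) then \<one>\<^bsub>K\<^esub> else \<zero>\<^bsub>K\<^esub>)" if "l \<in> {1..3}" for l x' y'
    using conjunct1[OF pa] that by blast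
  have pz: "p z = \<zero>\<^bsub>K\<^esub>" if "z \<in> SS" for z using conjunct2[OF pa] that by blast
  have pc: "p y \<in> carrier K" if "y \<in> carrier B" for y using lin_mapsD(1)[OF p that] by simp
  \<comment> \<open>The identity tensored with the coordinate p: it contracts the second factor of
    the tensor product to a scalar.\<close>
  have "bilinear_on K A B A (\<lambda>z y. p y \<odot>\<^bsub>A\<^esub> z)"
    unfolding bilinear_on_def
    using lin_maps_scale[OF p mA] lin_maps_smult[OF lin_maps_id mA pc] by blast
  then obtain q where q: "q \<in> lin_maps K (tensor K A B) A"
    and qt: "\<And>z y. z \<in> carrier A \<Longrightarrow> y \<in> carrier B \<Longrightarrow> q (tens K A B z y) = p y \<odot>\<^bsub>A\<^esub> z"
    using tensor_lift[OF mA mB mA] by blast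
  note q = q[folded tensor3_def] and qt = qt[folded tens3_def]
  have qH1: "q h \<in> RS" if h: "h \<in> H1" for h
  proof (rule lin_maps_mod_span[OF q mT mA RS_sub H1_gens _ h])
    fix h assume "h \<in> {tens3 K V W r y | r y. r \<in> RS \<and> y \<in> carrier B}"
    then obtain r y where ry: "h = tens3 K V W r y" "r \<in> RS" "y \<in> carrier B" by blast
    show "q h \<in> RS" unfolding ry(1) qt[OF submoduleD(1)[OF RS_sub ry(2)] ry(3)]
      by (rule submoduleD(4)[OF RS_sub pc[OF ry(3)] ry(2)])
  qed
  \<comment> \<open>The second summand of \<open>H\<close> is annihilated, as p kills the relations
    of 2Com.\<close>
  have qH2: "q h \<in> RS" if h: "h \<in> H2" for h
  proof (rule lin_maps_mod_span[OF q mT mA RS_sub H2_gens _ h])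
    fix h assume "h \<in> {tens3 K V W x s | x s. x \<in> carrier A \<and> s \<in> SS}"
    then obtain z y where zy: "h = tens3 K V W z y" "z \<in> carrier A" "y \<in> SS" by blast
    have "q h = \<zero>\<^bsub>A\<^esub>" unfolding zy(1) qt[OF zy(2) submoduleD(1)[OF SS_sub zy(3)]] pz[OF zy(3)]
      by (rule A.smult_l_null[OF zy(2)])
    then show "q h \<in> RS" using submoduleD(2)[OF RS_sub] by simp
  qed
  have qH: "q h \<in> RS" if h: "h \<in> H" for h
  proof -
    obtain h1 h2 where hh: "h1 \<in> H1" "h2 \<in> H2" "h = h1 \<oplus>\<^bsub>T\<^esub> h2" using h by (auto simp: set_add_def')
    show ?thesis unfolding hh(3) lin_mapsD(2)[OF q submoduleD(1)[OF H1_sub hh(1)] submoduleD(1)[OF H2_sub hh(2)]]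
      by (rule submoduleD(3)[OF RS_sub qH1[OF hh(1)] qH2[OF hh(2)]])
  qed
  \<comment> \<open>\<open>RS\<close> is generated under the symmetric group, so equivariance of G
    and closure of the ideal under the action are both needed to go beyond the given
    relations.\<close>
  have GRS: "RS \<subseteq> {z \<in> carrier A. G z \<in> J 3}"
  proof (rule smod_span_least[OF submodule_preimage[OF G mA mC J_sub]])
    show "sact (free_operad K V) 3 z \<sigma> \<in> {z \<in> carrier A. G z \<in> J 3}"
      if z: "z \<in> {z \<in> carrier A. G z \<in> J 3}" and \<sigma>: "\<sigma> permutes {1..3}" for z \<sigma>
      using z operad_closed(1)[OF lin_operad_free[OF pV] _ \<sigma>] Gs[OF _ \<sigma>] operad_idealD(2)[OF Ji _ \<sigma>] by simp
    show "{rel3 K V s e e (\<gamma> k) | k. k \<in> {1..t}} \<subseteq> {z \<in> carrier A. G z \<in> J 3}"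
    proof clarify
      fix k assume k: "k \<in> {1..t}"
      have "G (rel3 K V s e e (\<gamma> k)) = rel3 K U s (\<lambda>i. copy V x (e i)) (\<lambda>i. copy V y (e i)) (\<gamma> k)"
        by (rule lin_maps_rel3[OF pV pU G basis_closed basis_closed \<gamma>[OF k] GT[OF _ basis_closed basis_closed]])
      then have "G (rel3 K V s e e (\<gamma> k)) \<in> J 3" using J_incl[OF double_relsI(1)[OF k xy]] by simp
      then show "rel3 K V s e e (\<gamma> k) \<in> carrier A \<and> G (rel3 K V s e e (\<gamma> k)) \<in> J 3" using rels_carrier k by blast
    qed
  qed
  \<comment> \<open>Contraction by the coordinate forgets the colours, and G paints them back in the
    order x, y. A tree coloured in the opposite order thus comes back exchanged.\<close>
  let ?E = "\<lambda>z. G (q (\<Psi> z))"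
  show ?thesis
  proof (intro bexI[OF _ lin_maps_compose[OF lin_maps_compose[OF \<Psi> q] G]] conjI ballI allI impI)
    show "?E z \<in> J 3" if "\<Psi> z \<in> H" for z using GRS qH[OF that] by blast
    fix l i j :: nat and x' y' assume l: "l \<in> {1..3}" and i: "i \<in> {1..s}" and j: "j \<in> {1..s}"
    note t = T3e[OF l i j]
    have "q (\<Psi> (T3 K U l (copy V x' (e i)) (copy V y' (e j)))) =
        (if (x', y') = (x, y) \<or> (x', y') = (y, x) then \<one>\<^bsub>K\<^esub> else \<zero>\<^bsub>K\<^esub>) \<odot>\<^bsub>A\<^esub> T3 K V l (e i) (e j)"
      unfolding \<Psi>T[OF l i j] qt[OF t colour_T3_closed[OF cr, OF l]] pT[OF l] ..
    also have "\<dots> = (if (x', y') = (x, y) \<or> (x', y') = (y, x) then T3 K V l (e i) (e j) else \<zero>\<^bsub>A\<^esub>)"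
      using t by simp
    finally show "?E (T3 K U l (copy V x' (e i)) (copy V y' (e j))) =
       (if (x', y') = (x, y) \<or> (x', y') = (y, x) then T3 K U l (copy V x (e i)) (copy V y (e j)) else \<zero>\<^bsub>C\<^esub>)"
      using GT[OF l basis_closed[OF i] basis_closed[OF j]] lin_maps_zero[OF G mA mC] by simp
  qed
qed

lemma white_double_ideal:
  assumes z: "z \<in> carrier C" and zH: "\<Psi> z \<in> H"
  shows "z \<in> J 3"
proof -
  interpret C: module K C by (rule mC)
  have "False \<longrightarrow> False" by simp
  from colour_part[OF this]
  obtain E1 where E1: "E1 \<in> lin_maps K C C"
    and E1a: "(\<forall>l\<in>{1..3}. \<forall>i\<in>{1..s}. \<forall>j\<in>{1..s}. \<forall>x' y'.
       E1 (T3 K U l (copy V x' (e i)) (copy V y' (e j))) =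
       (if (x', y') = (False, False) \<or> (x', y') = (False, False) then T3 K U l (copy V False (e i)) (copy V False (e j)) else \<zero>\<^bsub>C\<^esub>)) \<and>
    (\<forall>z\<in>carrier C. \<Psi> z \<in> H \<longrightarrow> E1 z \<in> J 3)"
    by (rule bexE)
  have E1T: "E1 (T3 K U l (copy V x' (e i)) (copy V y' (e j))) =
       (if (x', y') = (False, False) \<or> (x', y') = (False, False) then T3 K U l (copy V False (e i)) (copy V False (e j)) else \<zero>\<^bsub>C\<^esub>)"
    if "l \<in> {1..3}" "i \<in> {1..s}" "j \<in> {1..s}" for l i j x' y'
    using conjunct1[OF E1a] that by blast
  note E1J = mp[OF bspec[OF conjunct2[OF E1a] z] zH]
  have "True \<longrightarrow> True" by simp
  from colour_part[OF this]
  obtain E2 where E2: "E2 \<in> lin_maps K C C"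
    and E2a: "(\<forall>l\<in>{1..3}. \<forall>i\<in>{1..s}. \<forall>j\<in>{1..s}. \<forall>x' y'.
       E2 (T3 K U l (copy V x' (e i)) (copy V y' (e j))) =
       (if (x', y') = (True, True) \<or> (x', y') = (True, True) then T3 K U l (copy V True (e i)) (copy V True (e j)) else \<zero>\<^bsub>C\<^esub>)) \<and>
    (\<forall>z\<in>carrier C. \<Psi> z \<in> H \<longrightarrow> E2 z \<in> J 3)"
    by (rule bexE)
  have E2T: "E2 (T3 K U l (copy V x' (e i)) (copy V y' (e j))) =
       (if (x', y') = (True, True) \<or> (x', y') = (True, True) then T3 K U l (copy V True (e i)) (copy V True (e j)) else \<zero>\<^bsub>C\<^esub>)"
    if "l \<in> {1..3}" "i \<in> {1..s}" "j \<in> {1..s}" for l i j x' y'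
    using conjunct1[OF E2a] that by blast
  note E2J = mp[OF bspec[OF conjunct2[OF E2a] z] zH]
  have "False \<longrightarrow> True" by simp
  from colour_part[OF this]
  obtain E3 where E3: "E3 \<in> lin_maps K C C"
    and E3a: "(\<forall>l\<in>{1..3}. \<forall>i\<in>{1..s}. \<forall>j\<in>{1..s}. \<forall>x' y'.
       E3 (T3 K U l (copy V x' (e i)) (copy V y' (e j))) =
       (if (x', y') = (False, True) \<or> (x', y') = (True, False) then T3 K U l (copy V False (e i)) (copy V True (e j)) else \<zero>\<^bsub>C\<^esub>)) \<and>
    (\<forall>z\<in>carrier C. \<Psi> z \<in> H \<longrightarrow> E3 z \<in> J 3)"
    by (rule bexE)
  have E3T: "E3 (T3 K U l (copy V x' (e i)) (copy V y' (e j))) =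
       (if (x', y') = (False, True) \<or> (x', y') = (True, False) then T3 K U l (copy V False (e i)) (copy V True (e j)) else \<zero>\<^bsub>C\<^esub>)"
    if "l \<in> {1..3}" "i \<in> {1..s}" "j \<in> {1..s}" for l i j x' y'
    using conjunct1[OF E3a] that by blast
  note E3J = mp[OF bspec[OF conjunct2[OF E3a] z] zH]
  \<comment> \<open>The three parts together fix every basis tree except those with black inner
    vertex and white root, whose two colours they exchange. So z differs from the sum by exchange
    relations only.\<close>
  let ?E = "\<lambda>z. E1 z \<oplus>\<^bsub>C\<^esub> (E2 z \<oplus>\<^bsub>C\<^esub> E3 z)"
  have E: "?E \<in> lin_maps K C C" by (intro lin_maps_add E1 E2 E3 mC)
  have "z \<ominus>\<^bsub>C\<^esub> ?E z \<in> J 3"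
  proof (rule double_memI[OF mC J_sub lin_maps_diff[OF lin_maps_id E mC] _ z])
    fix l i j :: nat and x y assume lij: "l \<in> {1..3}" "i \<in> {1..s}" "j \<in> {1..s}"
    let ?T = "\<lambda>x y. T3 K U l (copy V x (e i)) (copy V y (e j))"
    note t = T3u[OF lij]
    note simps = E1T[OF lij] E2T[OF lij] E3T[OF lij]
    have z0: "a \<ominus>\<^bsub>C\<^esub> a = \<zero>\<^bsub>C\<^esub>" if "a \<in> carrier C" for a using that C.r_neg by (simp add: a_minus_def)
    note J0 = submoduleD(2)[OF J_sub]
    consider "\<not> x" "\<not> y" | "x" "y" | "\<not> x" "y" | "x" "\<not> y" by blast
    then show "?T x y \<ominus>\<^bsub>C\<^esub> ?E (?T x y) \<in> J 3"
    proof cases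
      case 1 then show ?thesis using t J0 by (simp add: simps z0)
    next
      case 2 then show ?thesis using t J0 by (simp add: simps z0)
    next
      case 3 then show ?thesis using t J0 by (simp add: simps z0)
    next
      \<comment> \<open>The exchange relation is listed with the opposite sign; equality of cosets
        provides the symmetry.\<close>
      case 4
      have "?T False True \<ominus>\<^bsub>C\<^esub> ?T True False \<in> J 3" by (rule J_incl[OF double_relsI(2)[OF lij]])
      then have "J 3 +>\<^bsub>C\<^esub> ?T False True = J 3 +>\<^bsub>C\<^esub> ?T True False"
        using coset_eq_iff[OF mC J_sub t t] by blast
      then have "?T True False \<ominus>\<^bsub>C\<^esub> ?T False True \<in> J 3"
        using coset_eq_iff[OF mC J_sub t t] by metis
      then show ?thesis using 4 t by (simp add: simps)
    qed
  qed
  moreover have Ez: "?E z \<in> J 3"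
    by (intro submoduleD(3)[OF J_sub] E1J E2J E3J)
  moreover have "z = (z \<ominus>\<^bsub>C\<^esub> ?E z) \<oplus>\<^bsub>C\<^esub> ?E z"
    using z lin_mapsD(1)[OF E z] by (simp add: a_minus_def C.a_assoc C.l_neg)
  ultimately show ?thesis using submoduleD(3)[OF J_sub] by metis
qed

end

section \<open>Existence of \<Phi> and its values on coloured trees\<close>

definition white_spec ::
    "('k, 'm) ring_scheme \<Rightarrow> ('k, 'v) smod \<Rightarrow> ('k, 'w) smod \<Rightarrow>
     ((('v \<times> 'w \<Rightarrow> 'k) set ptree \<Rightarrow> 'k) set \<Rightarrow>
      (('v ptree \<Rightarrow> 'k) set \<times> ('w ptree \<Rightarrow> 'k) set \<Rightarrow> 'k) set) \<Rightarrow> bool" where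
  "white_spec K V W \<Phi> \<longleftrightarrow> \<Phi> \<in> lin_maps K (part (free_operad K (smod_tensor K V W)) 3) (tensor3 K V W) \<and>
     (\<forall>l\<in>{1..3}. \<forall>v\<in>carrier (part V 2). \<forall>v'\<in>carrier (part V 2).
        \<forall>w\<in>carrier (part W 2). \<forall>w'\<in>carrier (part W 2).
          \<Phi> (T3 K (smod_tensor K V W) l (tens K (part V 2) (part W 2) v w) (tens K (part V 2) (part W 2) v' w')) =
          tens3 K V W (T3 K V l v v') (T3 K W l w w'))"

text \<open>The choice in \<open>white_Phi\<close> inherits the defining property only from an
  existence proof, which is supplied by \<open>white_Phi_white_spec\<close>.\<close>

lemma white_Phi_spec: assumes "\<exists>\<Phi>. white_spec K V W \<Phi>" shows "white_spec K V W (white_Phi K V W)"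
proof -
  have "white_Phi K V W = (SOME \<Phi>. white_spec K V W \<Phi>)"
    unfolding white_Phi_def Let_def white_spec_def ..
  then show ?thesis using someI_ex[OF assms] by simp
qed

lemma white_iso:
  assumes V: "s_module K V" and bin: "binary_smod V"
  shows "\<exists>\<phi>\<in>operad_iso K (free_operad K (double_smod V)) (free_operad K (smod_tensor K V (com2_smod K))).
    \<forall>n. \<forall>t\<in>vtrees (double_smod V) n.
      \<phi> n (free_tree K (double_smod V) n t) = free_tree K (smod_tensor K V (com2_smod K)) n (tmap (theta K V) t)"
proof -
  note cr = pre_smodD(2)[OF s_module_pre_smod[OF V]]
  note pU = s_module_pre_smod[OF s_module_double[OF V]] and pX = pre_smod_tensor[OF V s_module_com2[OF cr]]
  show ?thesis
  proof (rule free_operad_iso[OF pU pX theta_linear[OF V] theta_bij[OF V bin] theta_sact[OF V]])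
    fix f assume "f \<in> operad_iso K (free_operad K (double_smod V)) (free_operad K (smod_tensor K V (com2_smod K)))"
      "\<And>n t. t \<in> vtrees (double_smod V) n \<Longrightarrow>
        f n (free_tree K (double_smod V) n t) = free_tree K (smod_tensor K V (com2_smod K)) n (tmap (theta K V) t)"
    then show ?thesis by blast
  qed
qed

lemma tmap_tree3: "tmap \<phi> (tree3 l u v) = tree3 l (\<phi> 2 u) (\<phi> 2 v)"
  by (simp add: tree3_def numeral_2_eq_2)

locale white_comparison = binary_base K V e s c
  for K :: "('k, 'm) ring_scheme" and V :: "('k, 'v) smod" and e :: "nat \<Rightarrow> 'v" and s :: nat
    and c :: "nat \<Rightarrow> 'v \<Rightarrow> 'k" +
  fixes \<phi> :: "nat \<Rightarrow> (('v \<times> 'v) ptree \<Rightarrow> 'k) set \<Rightarrow> (('v \<times> 'k \<times> 'k \<Rightarrow> 'k) set ptree \<Rightarrow> 'k) set"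
  assumes \<phi>: "\<phi> \<in> operad_iso K (free_operad K U) (free_operad K X)"
    and \<phi>t: "\<forall>n. \<forall>t\<in>vtrees U n. \<phi> n (free_tree K U n t) = free_tree K X n (tmap (theta K V) t)"
begin

lemmas sp = scale_pair_bilinear[OF V]

lemma sp_closed:
  "v \<in> carrier (part V 2) \<Longrightarrow> w \<in> carrier (part W 2) \<Longrightarrow> scale_pair V v w \<in> carrier (part U 2)"
  by (rule lin_mapsD(1)[OF bilinear_onD(1)[OF sp]])

lemma phi_T3:
  assumes "l \<in> {1..3}" "u \<in> carrier (part U 2)" "v \<in> carrier (part U 2)"
  shows "\<phi> 3 (T3 K U l u v) = T3 K X l (theta K V 2 u) (theta K V 2 v)"
  using \<phi>t tree3_vtrees[OF pU assms(2,3,1)] by (simp add: T3_def tmap_tree3)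

text \<open>A candidate for \<Phi> is prescribed on the coloured basis trees of F(V \<oplus> V)(3)
  and transported by the inverse of \<open>\<phi> 3\<close>. Its values on arbitrary elementary
  tensors follow by bilinearity, one vertex at a time.\<close>

lemma white_Phi_white_spec: "white_spec K V W (white_Phi K V W)"
proof (rule white_Phi_spec)
  have "\<exists>\<Psi>\<in>lin_maps K C T. \<forall>l\<in>{1..3}. \<forall>i\<in>{1..s}. \<forall>j\<in>{1..s}. \<forall>x y.
      \<Psi> (T3 K U l (copy V x (e i)) (copy V y (e j))) =
      tens3 K V W (T3 K V l (e i) (e j)) (T3 K W l (colour K x) (colour K y))"
  proof (rule double_ext[OF mT])
    fix l i j :: nat and x y assume l: "l \<in> {1..3}" and i: "i \<in> {1..s}" and j: "j \<in> {1..s}"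
    show "tens3 K V W (T3 K V l (e i) (e j)) (T3 K W l (colour K x) (colour K y)) \<in> carrier T"
      by (rule tens3_closed[OF T3_closed[OF pV basis_closed[OF i] basis_closed[OF j] l] colour_T3_closed[OF cr l]])
  qed
  then obtain \<Psi> where \<Psi>: "\<Psi> \<in> lin_maps K C T"
    and \<Psi>T: "\<forall>l\<in>{1..3}. \<forall>i\<in>{1..s}. \<forall>j\<in>{1..s}. \<forall>x y.
      \<Psi> (T3 K U l (copy V x (e i)) (copy V y (e j))) =
      tens3 K V W (T3 K V l (e i) (e j)) (T3 K W l (colour K x) (colour K y))"
    by (rule bexE)
  have eS: "e ` {1..s} \<subseteq> carrier (part V 2)" using basis_closed by blast
  have cS: "range (colour K) \<subseteq> carrier (part W 2)" using colour_closed[OF cr] by blast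
  have eV: "v \<in> mod_span K (part V 2) (e ` {1..s})" if "v \<in> carrier (part V 2)" for v
    using base that by (simp add: dual_basis_def)
  have cW: "w \<in> mod_span K (part W 2) (range (colour K))" if "w \<in> carrier (part W 2)" for w
    using colour_span[OF cr] that by simp
  \<comment> \<open>First the inner vertex is freed from the basis while the root keeps a basis
    decoration; the next step frees the root. In each step the formula is bilinear in the pair (v,
    w) at that vertex.\<close>
  have 1: "\<Psi> (T3 K U l (scale_pair V v w) (copy V y (e j))) = tens3 K V W (T3 K V l v (e j)) (T3 K W l w (colour K y))"
    if l: "l \<in> {1..3}" and j: "j \<in> {1..s}" and v: "v \<in> carrier (part V 2)" and w: "w \<in> carrier (part W 2)" for l j y v w
  proof (rule bilinear_on_eq_on_span[OF
        bilinear_on_compose_left[OF sp lin_maps_compose[OF bilinear_onD(2)[OF T3_bilinear[OF pU l] copy_basis_closed[OF j]] \<Psi>]]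
        bilinear_on_compose_right[OF tens3_bilinear bilinear_onD(2)[OF T3_bilinear[OF pV l] basis_closed[OF j]] bilinear_onD(2)[OF T3_bilinear[OF pW l] colour_closed[OF cr]]]
        mV mW mT eS cS _ eV[OF v] cW[OF w]])
    fix a b assume "a \<in> e ` {1..s}" "b \<in> range (colour K)"
    then obtain i x where ab: "a = e i" "i \<in> {1..s}" "b = colour K x" by blast
    show "\<Psi> (T3 K U l (scale_pair V a b) (copy V y (e j))) = tens3 K V W (T3 K V l a (e j)) (T3 K W l b (colour K y))"
      unfolding ab(1,3) scale_pair_colour[OF V basis_closed[OF ab(2)]] using \<Psi>T l j ab(2) by blast
  qed
  have 2: "\<Psi> (T3 K U l (scale_pair V v w) (scale_pair V v' w')) = tens3 K V W (T3 K V l v v') (T3 K W l w w')"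
    if l: "l \<in> {1..3}" and v: "v \<in> carrier (part V 2)" and w: "w \<in> carrier (part W 2)"
      and v': "v' \<in> carrier (part V 2)" and w': "w' \<in> carrier (part W 2)" for l v w v' w'
  proof (rule bilinear_on_eq_on_span[OF
        bilinear_on_compose_left[OF sp lin_maps_compose[OF bilinear_onD(1)[OF T3_bilinear[OF pU l] sp_closed[OF v w]] \<Psi>]]
        bilinear_on_compose_right[OF tens3_bilinear bilinear_onD(1)[OF T3_bilinear[OF pV l] v] bilinear_onD(1)[OF T3_bilinear[OF pW l] w]]
        mV mW mT eS cS _ eV[OF v'] cW[OF w']])
    fix a b assume "a \<in> e ` {1..s}" "b \<in> range (colour K)"
    then obtain j y where ab: "a = e j" "j \<in> {1..s}" "b = colour K y" by blast
    show "\<Psi> (T3 K U l (scale_pair V v w) (scale_pair V a b)) = tens3 K V W (T3 K V l v a) (T3 K W l w b)"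
      unfolding ab(1,3) scale_pair_colour[OF V basis_closed[OF ab(2)]] by (rule 1[OF l ab(2) v w])
  qed
  let ?inv = "inv_into (carrier C) (\<phi> 3)"
  \<comment> \<open>The candidate has to be defined on the free operad on the tensor product, where
    no basis of trees has been exhibited; the isomorphism brings it to the side of the doubled
    basis.\<close>
  have inv: "?inv \<in> lin_maps K (part (free_operad K X) 3) C"
    by (rule lin_maps_inv[OF operad_isoD(1)[OF \<phi>] operad_isoD(2)[OF \<phi>] mC])
  have "white_spec K V W (\<lambda>z. \<Psi> (?inv z))"
    unfolding white_spec_def
  proof (intro conjI ballI)
    show "(\<lambda>z. \<Psi> (?inv z)) \<in> lin_maps K (part (free_operad K X) 3) T" by (rule lin_maps_compose[OF inv \<Psi>])
    fix l :: nat and v v' w w' assume l: "l \<in> {1..3}" and v: "v \<in> carrier (part V 2)" "v' \<in> carrier (part V 2)"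
      and w: "w \<in> carrier (part W 2)" "w' \<in> carrier (part W 2)"
    let ?z = "T3 K U l (scale_pair V v w) (scale_pair V v' w')"
    have z: "?z \<in> carrier C"
      by (rule T3_closed[OF pU sp_closed[OF v(1) w(1)] sp_closed[OF v(2) w(2)] l])
    have "T3 K X l (tens K (part V 2) (part W 2) v w) (tens K (part V 2) (part W 2) v' w') = \<phi> 3 ?z"
      unfolding phi_T3[OF l sp_closed[OF v(1) w(1)] sp_closed[OF v(2) w(2)]]
        theta_scale_pair[OF V v(1) w(1)] theta_scale_pair[OF V v(2) w(2)] ..
    moreover have "?inv (\<phi> 3 ?z) = ?z"
      using operad_isoD(2)[OF \<phi>, of 3] z by (simp add: bij_betw_def)
    ultimately show "\<Psi> (?inv (T3 K X l (tens K (part V 2) (part W 2) v w) (tens K (part V 2) (part W 2) v' w'))) = tens3 K V W (T3 K V l v v') (T3 K W l w w')"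
      using 2[OF l v(1) w(1) v(2) w(2)] by simp
  qed
  then show "\<exists>\<Phi>. white_spec K V W \<Phi>" by blast
qed

lemma white_Psi:
  "(\<lambda>z. white_Phi K V W (\<phi> 3 z)) \<in> lin_maps K C T"
  "l \<in> {1..3} \<Longrightarrow> i \<in> {1..s} \<Longrightarrow> j \<in> {1..s} \<Longrightarrow>
    white_Phi K V W (\<phi> 3 (T3 K U l (copy V x (e i)) (copy V y (e j)))) =
    tens3 K V W (T3 K V l (e i) (e j)) (T3 K W l (colour K x) (colour K y))"
proof -
  note spec = white_Phi_white_spec[unfolded white_spec_def]
  show "(\<lambda>z. white_Phi K V W (\<phi> 3 z)) \<in> lin_maps K C T"
    by (rule lin_maps_compose[OF operad_isoD(1)[OF \<phi>] conjunct1[OF spec]])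
  assume l: "l \<in> {1..3}" and i: "i \<in> {1..s}" and j: "j \<in> {1..s}"
  note cb = copy_basis_closed
  have th: "theta K V 2 (copy V x (e i)) = tens K (part V 2) (part W 2) (e i) (colour K x)" if "i \<in> {1..s}" for i x
    using theta_scale_pair[OF V basis_closed[OF that] colour_closed[OF cr]] scale_pair_colour[OF V basis_closed[OF that]] by simp
  show "white_Phi K V W (\<phi> 3 (T3 K U l (copy V x (e i)) (copy V y (e j)))) =
    tens3 K V W (T3 K V l (e i) (e j)) (T3 K W l (colour K x) (colour K y))"
    unfolding phi_T3[OF l cb[OF i] cb[OF j]] th[OF i] th[OF j]
    using conjunct2[OF spec] l basis_closed[OF i] basis_closed[OF j] colour_closed[OF cr] by blast
qed

end

section \<open>The isomorphism of the two presented operads and its effect on generators\<close>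

theorem corollary1p22:
  fixes K :: "('k, 'm) ring_scheme"
    and V :: "('k, 'v) smod"
    and R :: "('v ptree \<Rightarrow> 'k) set set"
    and e :: "nat \<Rightarrow> 'v"
    and s t :: nat
    and \<gamma> :: "nat \<Rightarrow> nat \<Rightarrow> nat \<Rightarrow> nat \<Rightarrow> 'k"
  assumes "field K"
    and "s_module K V"
    and "binary_smod V"
    and "is_basis K (part V 2) s e"
    and "R \<subseteq> carrier (part (free_operad K V) 3)"
    and "\<forall>k\<in>{1..t}. \<forall>l\<in>{1..3}. \<forall>i\<in>{1..s}. \<forall>j\<in>{1..s}. \<gamma> k l i j \<in> carrier K"
    and "smod_span K (free_operad K V) 3 R =
         smod_span K (free_operad K V) 3 {rel3 K V s e e (\<gamma> k) | k. k \<in> {1..t}}"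
  shows "\<exists>f \<in> operad_iso K (double_operad K V s e t \<gamma>)
                (white_product K V R (com2_smod K) (com2_rels K)).
           \<forall>i\<in>{1..s}.
             f 2 (bq_gen K (double_smod V) (double_rels K V s e t \<gamma>) (white_copy V (e i))) =
               white_gen K V R (com2_smod K) (com2_rels K) (e i) (com2_w K) \<and>
             f 2 (bq_gen K (double_smod V) (double_rels K V s e t \<gamma>) (black_copy V (e i))) =
               white_gen K V R (com2_smod K) (com2_rels K) (e i) (com2_b K)"
proof -
  note V = assms(2) and bin = assms(3)
  let ?U = "double_smod V" and ?W = "com2_smod K"
  let ?X = "smod_tensor K V ?W"
  note pV = s_module_pre_smod[OF V]
  note cr = pre_smodD(2)[OF pV]
  note pU = s_module_pre_smod[OF s_module_double[OF V]] and pX = pre_smod_tensor[OF V s_module_com2[OF cr]]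
  note lU = lin_operad_free[OF pU] and lX = lin_operad_free[OF pX]
  obtain c where base: "dual_basis K (part V 2) {1..s} e c"
    by (rule is_basis_dual[OF assms(4) pre_smodD(1)[OF pV]])
  have \<gamma>: "\<And>k l i j. k \<in> {1..t} \<Longrightarrow> l \<in> {1..3} \<Longrightarrow> i \<in> {1..s} \<Longrightarrow> j \<in> {1..s} \<Longrightarrow> \<gamma> k l i j \<in> carrier K"
    using assms(6) by blast
  from white_iso[OF V bin] obtain \<phi> where \<phi>: "\<phi> \<in> operad_iso K (free_operad K ?U) (free_operad K ?X)"
    and \<phi>t: "\<forall>n. \<forall>t\<in>vtrees ?U n. \<phi> n (free_tree K ?U n t) = free_tree K ?X n (tmap (theta K V) t)"
    by (rule bexE)
  interpret binary_base K V e s c by (rule binary_base.intro[OF V bin base])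
  interpret white_comparison K V e s c \<phi> by unfold_locales (rule \<phi>, rule \<phi>t)
  \<comment> \<open>Here \<Psi> becomes \<Phi> after the isomorphism of free operads, so that
    \<open>\<phi> 3 x\<close> is a white relation exactly when \<Psi> sends x into
    \<open>H\<close>.\<close>
  interpret compatible_relations K V e s c t \<gamma> "\<lambda>z. white_Phi K V ?W (\<phi> 3 z)"
    by unfold_locales (rule \<gamma> white_Psi; assumption)+
  let ?D = "double_rels K V s e t \<gamma>" and ?R = "white_rels K V R ?W (com2_rels K)"
  let ?I = "bq_ideal K ?U ?D" and ?J = "bq_ideal K ?X ?R"
  have Dc: "(if n = 3 then ?D else {}) \<subseteq> carrier (part (free_operad K ?U) n)" for n
    using double_rels_carrier[OF V, of s e t \<gamma>, OF basis_closed \<gamma>] by simp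
  have Rc: "(if n = 3 then ?R else {}) \<subseteq> carrier (part (free_operad K ?X) n)" for n
    by (auto simp: white_rels_def)
  note I = gen_ideal_ideal[where R = "\<lambda>n. if n = 3 then ?D else {}", OF lU Dc, folded bq_ideal_def]
    and J = gen_ideal_ideal[where R = "\<lambda>n. if n = 3 then ?R else {}", OF lX Rc, folded bq_ideal_def]
  \<comment> \<open>Both ideals are generated in arity three, so they correspond under \<phi> once
    the relations of each are found in the other.\<close>
  have im: "\<phi> n ` ?I n = ?J n" for n
    unfolding bq_ideal_def
  proof (rule operad_iso_gen_ideal[OF lU lX \<phi> Dc Rc])
    fix n :: nat and x assume "x \<in> (if n = 3 then ?D else {})"
    then have n: "n = 3" and x: "x \<in> ?D" by (simp_all split: if_splits)
    have "\<phi> 3 x \<in> ?R"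
      \<comment> \<open>\<open>white_rels\<close> involves R only through the S-submodule it
        generates, which the hypothesis describes by the coefficients \<gamma>.\<close>
      unfolding white_rels_def assms(7)
    proof (intro CollectI conjI)
      show "\<phi> 3 x \<in> carrier (part (free_operad K ?X) 3)"
        by (rule lin_mapsD(1)[OF operad_isoD(1)[OF \<phi>]]) (use Dc[of 3] x in auto)
    qed (rule double_rels_white[OF x])
    then show "\<phi> n x \<in> gen_ideal K (free_operad K ?X) (\<lambda>n. if n = 3 then ?R else {}) n"
      unfolding n by (intro gen_ideal_incl) simp
  next
    fix n :: nat and y assume "y \<in> (if n = 3 then ?R else {})"
    then have n: "n = 3" and y: "y \<in> ?R" by (simp_all split: if_splits)
    have "y \<in> carrier (part (free_operad K ?X) 3)" using y by (simp add: white_rels_def)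
    then obtain x where x: "x \<in> carrier (part (free_operad K ?U) 3)" "y = \<phi> 3 x"
      using operad_isoD(2)[OF \<phi>, of 3] by (auto simp: bij_betw_def)
    have "x \<in> gen_ideal K (free_operad K ?U) (\<lambda>n. if n = 3 then ?D else {}) 3"
    proof (rule white_double_ideal[OF x(1)])
      show "white_Phi K V ?W (\<phi> 3 x) \<in> set_add (tensor3 K V ?W)
        (mod_span K (tensor3 K V ?W) {tens3 K V ?W r y | r y.
          r \<in> smod_span K (free_operad K V) 3 {rel3 K V s e e (\<gamma> k) | k. k \<in> {1..t}} \<and> y \<in> carrier (part (free_operad K ?W) 3)})
        (mod_span K (tensor3 K V ?W) {tens3 K V ?W x s | x s.
          x \<in> carrier (part (free_operad K V) 3) \<and> s \<in> smod_span K (free_operad K ?W) 3 (com2_rels K)})"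
        using y unfolding x(2) white_rels_def assms(7) by blast
    qed
    then show "\<exists>x\<in>gen_ideal K (free_operad K ?U) (\<lambda>n. if n = 3 then ?D else {}) n. y = \<phi> n x"
      unfolding n using x(2) by blast
  qed
  have "\<exists>f\<in>operad_iso K (quot_operad (free_operad K ?U) ?I) (quot_operad (free_operad K ?X) ?J).
      \<forall>n. \<forall>x\<in>carrier (part (free_operad K ?U) n).
        f n (oproj (free_operad K ?U) ?I n x) = oproj (free_operad K ?X) ?J n (\<phi> n x)"
  proof (rule operad_iso_quot[OF lU lX \<phi> I J im])
    fix g assume "g \<in> operad_iso K (quot_operad (free_operad K ?U) ?I) (quot_operad (free_operad K ?X) ?J)"
      "\<And>n x. x \<in> carrier (part (free_operad K ?U) n) \<Longrightarrow>
        g n (oproj (free_operad K ?U) ?I n x) = oproj (free_operad K ?X) ?J n (\<phi> n x)"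
    then show ?thesis by blast
  qed
  then obtain f where f: "f \<in> operad_iso K (quot_operad (free_operad K ?U) ?I) (quot_operad (free_operad K ?X) ?J)"
    and fx: "\<forall>n. \<forall>x\<in>carrier (part (free_operad K ?U) n).
        f n (oproj (free_operad K ?U) ?I n x) = oproj (free_operad K ?X) ?J n (\<phi> n x)"
    by (rule bexE)
  have gen: "f 2 (bq_gen K ?U ?D (copy V x (e i))) = white_gen K V R ?W (com2_rels K) (e i) (colour K x)"
    if i: "i \<in> {1..s}" for i x
  proof -
    note cv = corolla_vtrees[OF pU copy_basis_closed[OF i, of x]]
    note ei = basis_closed[OF i]
    \<comment> \<open>The induced isomorphism acts on a corolla by \<open>theta\<close> on its
      decoration, and \<open>theta\<close> takes a copy of e_i to e_i tensored with the matching
      generator of 2Com.\<close>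
    have "theta K V 2 (copy V x (e i)) = tens K (part V 2) (part ?W 2) (e i) (colour K x)"
      using theta_scale_pair[OF V ei colour_closed[OF cr]] scale_pair_colour[OF V ei] by simp
    then have "\<phi> 2 (free_tree K ?U 2 (corolla 2 (copy V x (e i)))) =
        free_tree K ?X 2 (corolla 2 (tens K (part V 2) (part ?W 2) (e i) (colour K x)))"
      using \<phi>t cv by (simp add: tmap_corolla)
    then show ?thesis
      using fx free_tree_closed[OF pU cv] by (simp add: bq_gen_def white_gen_def oproj_def)
  qed
  show ?thesis
  proof (intro bexI[of _ f] ballI conjI)
    show "f \<in> operad_iso K (double_operad K V s e t \<gamma>) (white_product K V R ?W (com2_rels K))"
      using f by (simp add: double_operad_def white_product_def bq_operad_def)
    fix i assume i: "i \<in> {1..s}"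
    show "f 2 (bq_gen K ?U ?D (white_copy V (e i))) = white_gen K V R ?W (com2_rels K) (e i) (com2_w K)"
      using gen[OF i, of False] by (simp add: colour_simps copy_def)
    show "f 2 (bq_gen K ?U ?D (black_copy V (e i))) = white_gen K V R ?W (com2_rels K) (e i) (com2_b K)"
      using gen[OF i, of True] by (simp add: colour_simps copy_def)
  qed
qed

end
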